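(* Let $\mathcal M_k$ denote the monodromy group of the quantum cohomology of $\mathbf{CP}^{k-1}$ (defined in the context). Then: (a) The monodromy group $\mathcal M_3$ of the quantum cohomology of $\mathbf{CP}^2$ is isomorphic to $$\langle X,Y\mid X^2=Y^3=1\rangle\times C_2\;\cong\;PSL(2,\mathbf Z)\times C_2,$$ where $C_2$ is the cyclic group of order $2$. (b) The monodromy group $\mathcal M_4$ of the quantum cohomology of $\mathbf{CP}^3$ is isomorphic to $$\langle X,Y\mid X^2=Y^4=1\rangle,$$ which is isomorphic to the subgroup of orientation-preserving transformations of the hyperbolic triangular group $[2,4,\infty]$.
   Context: **Linear system, Stokes matrix $S$.** For an integer $k\ge2$ put $u_n=k\,e^{2\pi i(n-1)/k}$, $U=\mathrm{diag}(u_1,\dots,u_k)$, $\hat\mu=\mathrm{diag}\left(\frac{k-1}{2},\frac{k-3}{2},\dots,-\frac{k-1}{2}\right)$, $X=(X_{jn})$ with $X_{jn}=\frac1{\sqrt k}e^{(2j-1)i\pi(n-1)/k}$, and $V=X^{-1}\hat\mu X$ (skew-symmetric). Let $\tilde Y_L,\tilde Y_R$ be the unique fundamental matrix solutions of $d\tilde Y/dz=(U+V/z)\tilde Y$ with $\tilde Y_{L/R}(z)=(I+O(1/z))e^{zU}$ as $z\to\infty$ in $\mathcal S_L=\{0<\arg z<\pi+\frac\pi k\}$, respectively $\mathcal S_R=\{-\pi<\arg z<\frac\pi k\}$. The Stokes matrix $S$ is defined by $\tilde Y_L=\tilde Y_RS$ on $0<\arg z<\frac\pi k$. **The matrix $T$.**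 The first row of $X\tilde Y_L(z)$ is $z^{(k-1)/2}\Phi_L(z)$, where $\Phi_L$ is a row vector whose entries form a basis of solutions of $(z\frac{d}{dz})^k\varphi=(kz)^k\varphi$. This equation is invariant under $z\mapsto ze^{2\pi i/k}$, and $T$ is the constant matrix with $\Phi_L(ze^{2\pi i/k})=\Phi_L(z)T$ (analytic continuation). **Monodromy group.** The monodromy group of a Frobenius manifold is the group of transformations undergone by the flat coordinates $x^1(t,\lambda),\dots,x^k(t,\lambda)$ of the pencil $(\,,\,)-\lambda\langle\,,\,\rangle$ (intersection form minus $\lambda$ times the flat metric) when $t$ moves along loops avoiding the discriminant of the pencil. For the quantum cohomology of $\mathbf{CP}^{k-1}$ it is described concretely as follows; take this as the definition. Let $G=\frac12(S+S^T)$ and let $\phi^{(1)},\dots,\phi^{(k)}$ be the images of the standard basis vectors in $W_k:=\mathbf C^k/\ker G$. (They represent the solutions $\phi^{(j)}(\lambda)\sim(\lambda-u_j)^{-1/2}e_j$ of the Fuchsian system $(U-\lambda)\frac{d\phi}{d\lambda}=(\frac12+V)\phi$. For $k$ odd $\ker G=0$, for $k$ even $\dim\ker G=1$.) Define linear maps on $W_k$ by $$R_j\phi^{(i)}=\phi^{(i)}-2G_{ij}\phi^{(j)},\qquad T\phi^{(i)}=\sum_{j=1}^kT_{ji}\phi^{(j)} .$$ ($R_j$ is the monodromy of the Fuchsian system around $u_j$, and $T$ is the effect of $t^2\mapsto t^2+2\pi i$.) Then $\mathcal M_k\subset GL(W_k)$ is the group generated by $R_1,\dots,R_k,T$. **Triangular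 group.** $[2,4,\infty]$ is the group of isometries of the hyperbolic plane generated by the reflections in the sides of a hyperbolic triangle with angles $\frac\pi2,\frac\pi4,0$. *)

theory Defs
  imports
    Complex_Main
    "HOL-Library.Landau_Symbols"
    "HOL-Algebra.Coset"
    "HOL-Algebra.Bij"
    "HOL-Algebra.Generated_Groups"
    "HOL-Algebra.Elementary_Groups"
    "Jordan_Normal_Form.Determinant"
    "Jordan_Normal_Form.Gauss_Jordan_Elimination"
    "Jordan_Normal_Form.Matrix_Kernel"
begin

text \<open>
  Matrices are indexed from 0, so row \<open>j\<close> and column \<open>n\<close> below are row \<open>j + 1\<close> and column \<open>n + 1\<close>
  in the usual numbering \<open>1, ..., k\<close>.
\<close>

definition canonical_coord :: "nat \<Rightarrow> nat \<Rightarrow> complex" where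
  "canonical_coord k n = of_nat k * exp (2 * of_real pi * \<i> * of_nat n / of_nat k)"

definition U_mat :: "nat \<Rightarrow> complex mat" where
  "U_mat k = mat_diag k (canonical_coord k)"

definition mu_mat :: "nat \<Rightarrow> complex mat" where
  "mu_mat k = mat_diag k (\<lambda>j. (of_nat k - 1) / 2 - of_nat j)"

definition X_mat :: "nat \<Rightarrow> complex mat" where
  "X_mat k = mat k k (\<lambda>(j, n).
     exp ((2 * of_nat j + 1) * \<i> * of_real pi * of_nat n / of_nat k) / of_real (sqrt (real k)))"

definition V_mat :: "nat \<Rightarrow> complex mat" where
  "V_mat k = the (mat_inverse (X_mat k)) * mu_mat k * X_mat k"

text \<open>
  Multivalued functions of \<open>z\<close> are functions on the universal cover of the punctured plane,
  parametrised by \<open>w = log z\<close>: thus \<open>z = exp w\<close>, \<open>arg z = Im w\<close>, multiplication of \<open>z\<close> by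
  \<open>e\<^sup>i\<^sup>a\<close> (with analytic continuation) is \<open>w \<mapsto> w + i a\<close>, and \<open>d/dw = z d/dz\<close>, which is the reason
  for the factor \<open>exp w\<close> in front of the right-hand side of the system.
\<close>

definition fundamental_solution :: "nat \<Rightarrow> (complex \<Rightarrow> complex mat) \<Rightarrow> bool" where
  "fundamental_solution k Y \<longleftrightarrow>
     (\<forall>w. Y w \<in> carrier_mat k k \<and> invertible_mat (Y w)) \<and>
     (\<forall>w. \<forall>i<k. \<forall>j<k.
        ((\<lambda>w. Y w $$ (i, j)) has_field_derivative
          exp w * ((U_mat k + (1 / exp w) \<cdot>\<^sub>m V_mat k) * Y w) $$ (i, j)) (at w))"

text \<open>The filter of \<open>z \<rightarrow> \<infinity>\<close> in the closed sector \<open>a \<le> arg z \<le> b\<close>.\<close>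

definition sector_at_infinity :: "real \<Rightarrow> real \<Rightarrow> complex filter" where
  "sector_at_infinity a b = inf (filtercomap Re at_top) (principal {w. a \<le> Im w \<and> Im w \<le> b})"

text \<open>
  \<open>Y(z) = (I + O(1/z)) e\<^sup>z\<^sup>U\<close> in the open sector \<open>\<alpha> < arg z < \<beta>\<close>. As usual for asymptotics in an
  open sector, the estimate is uniform on every closed subsector; it would fail up to the
  boundary, because the boundary rays of the sectors used below are Stokes rays.
\<close>

definition sector_asymptotics ::
    "nat \<Rightarrow> real \<Rightarrow> real \<Rightarrow> (complex \<Rightarrow> complex mat) \<Rightarrow> bool" where
  "sector_asymptotics k \<alpha> \<beta> Y \<longleftrightarrow>
     (\<exists>E. (\<forall>w. E w \<in> carrier_mat k k \<and>
               Y w = (1\<^sub>m k + E w) * mat_diag k (\<lambda>n. exp (exp w * canonical_coord k n))) \<and>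
          (\<forall>a b. \<alpha> < a \<and> a \<le> b \<and> b < \<beta> \<longrightarrow>
             (\<forall>i<k. \<forall>j<k. (\<lambda>w. E w $$ (i, j)) \<in> O[sector_at_infinity a b](\<lambda>w. 1 / exp w))))"

definition Y_L :: "nat \<Rightarrow> complex \<Rightarrow> complex mat" where
  "Y_L k = (THE Y. fundamental_solution k Y \<and> sector_asymptotics k 0 (pi + pi / real k) Y)"

definition Y_R :: "nat \<Rightarrow> complex \<Rightarrow> complex mat" where
  "Y_R k = (THE Y. fundamental_solution k Y \<and> sector_asymptotics k (- pi) (pi / real k) Y)"

definition Stokes_mat :: "nat \<Rightarrow> complex mat" where
  "Stokes_mat k = (THE S. S \<in> carrier_mat k k \<and>
     (\<forall>w. 0 < Im w \<and> Im w < pi / real k \<longrightarrow> Y_L k w = Y_R k w * S))"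

text \<open>The row vector \<open>\<Phi>\<^sub>L\<close>, as a matrix with one row; \<open>exp (- (k - 1) / 2 * w)\<close> is
  \<open>z\<close> to the power \<open>- (k - 1) / 2\<close>.\<close>

definition Phi_L :: "nat \<Rightarrow> complex \<Rightarrow> complex mat" where
  "Phi_L k w = mat 1 k (\<lambda>(_, n).
     exp (- ((of_nat k - 1) / 2) * w) * (X_mat k * Y_L k w) $$ (0, n))"

definition T_mat :: "nat \<Rightarrow> complex mat" where
  "T_mat k = (THE T. T \<in> carrier_mat k k \<and>
     (\<forall>w. Phi_L k (w + 2 * of_real pi * \<i> / of_nat k) = Phi_L k w * T))"

definition G_mat :: "nat \<Rightarrow> complex mat" where
  "G_mat k = (1 / 2) \<cdot>\<^sub>m (Stokes_mat k + transpose_mat (Stokes_mat k))"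

definition W_space :: "nat \<Rightarrow> complex vec set set" where
  "W_space k = carrier (monoid_vec TYPE(complex) k Mod mat_kernel (G_mat k))"

definition W_class :: "nat \<Rightarrow> complex vec \<Rightarrow> complex vec set" where
  "W_class k v = mat_kernel (G_mat k) #>\<^bsub>monoid_vec TYPE(complex) k\<^esub> v"

text \<open>The map on \<open>\<complex>\<^sup>k / ker G\<close> induced by a matrix which maps \<open>ker G\<close> to itself. For such a matrix
  all the sets in the union are equal.\<close>

definition induced_map :: "nat \<Rightarrow> complex mat \<Rightarrow> complex vec set \<Rightarrow> complex vec set" where
  "induced_map k A = (\<lambda>c \<in> W_space k. \<Union>v\<in>c. W_class k (A *\<^sub>v v))"

text \<open>Column \<open>i\<close> of this matrix is \<open>e\<^sub>i - 2 G\<^sub>i\<^sub>j e\<^sub>j\<close>.\<close>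

definition reflection_mat :: "nat \<Rightarrow> nat \<Rightarrow> complex mat" where
  "reflection_mat k j = mat k k (\<lambda>(l, i).
     (if l = i then 1 else 0) - (if l = j then 2 * G_mat k $$ (i, j) else 0))"

text \<open>The generators are linear bijections, so the subgroup of the group of all bijections
  of \<open>\<complex>\<^sup>k / ker G\<close> that they generate is the subgroup of its general linear group.\<close>

definition monodromy_group :: "nat \<Rightarrow> (complex vec set \<Rightarrow> complex vec set) monoid" where
  "monodromy_group k = (BijGroup (W_space k))
     \<lparr>carrier := generate (BijGroup (W_space k))
        (insert (induced_map k (T_mat k)) ((\<lambda>j. induced_map k (reflection_mat k j)) ` {..<k}))\<rparr>"

text \<open>A letter \<open>(True, x)\<close> is the generator \<open>x\<close> and \<open>(False, x)\<close> is its inverse.\<close>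

type_synonym 'g word = "(bool \<times> 'g) list"

inductive word_cong :: "'g word set \<Rightarrow> 'g word \<Rightarrow> 'g word \<Rightarrow> bool" for R where
  word_refl: "word_cong R u u"
| word_sym: "word_cong R u v \<Longrightarrow> word_cong R v u"
| word_trans: "word_cong R u v \<Longrightarrow> word_cong R v w \<Longrightarrow> word_cong R u w"
| word_cancel: "word_cong R (u @ [(b, x), (\<not> b, x)] @ v) (u @ v)"
| word_relator: "r \<in> R \<Longrightarrow> word_cong R (u @ r @ v) (u @ v)"

definition presented_group :: "'g word set \<Rightarrow> 'g word set monoid" where
  "presented_group R =
     \<lparr>carrier = UNIV // {(u, v). word_cong R u v},
      mult = (\<lambda>A B. \<Union>a\<in>A. \<Union>b\<in>B. {w. word_cong R (a @ b) w}),
      one = {w. word_cong R [] w}\<rparr>"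

datatype two_gens = Gen_X | Gen_Y

text \<open>The group with generators \<open>X\<close>, \<open>Y\<close> and relations \<open>X\<^sup>m = Y\<^sup>n = 1\<close>.\<close>

definition power_relators_group :: "nat \<Rightarrow> nat \<Rightarrow> two_gens word set monoid" where
  "power_relators_group m n =
     presented_group {replicate m (True, Gen_X), replicate n (True, Gen_Y)}"

definition SL2Z :: "int mat monoid" where
  "SL2Z = \<lparr>carrier = {A \<in> carrier_mat 2 2. det A = 1}, mult = (*), one = 1\<^sub>m 2\<rparr>"

definition PSL2Z :: "int mat set monoid" where
  "PSL2Z = SL2Z Mod {1\<^sub>m 2, - 1\<^sub>m 2}"

text \<open>
  The hyperboloid model: the distance \<open>d\<close> of two points is given by
  \<open>cosh (d x y) = - lorentz x y\<close>. Ideal points are represented by nonzero vectors on the future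
  light cone (up to positive scaling).
\<close>

definition lorentz :: "real vec \<Rightarrow> real vec \<Rightarrow> real" where
  "lorentz x y = x $ 0 * y $ 0 + x $ 1 * y $ 1 - x $ 2 * y $ 2"

definition hyp_plane :: "real vec set" where
  "hyp_plane = {x \<in> carrier_vec 3. lorentz x x = - 1 \<and> 0 < x $ 2}"

definition ideal_points :: "real vec set" where
  "ideal_points = {x \<in> carrier_vec 3. lorentz x x = 0 \<and> 0 < x $ 2}"

text \<open>A vector Lorentz-orthogonal to \<open>p\<close> and \<open>q\<close>.\<close>

definition line_normal :: "real vec \<Rightarrow> real vec \<Rightarrow> real vec" where
  "line_normal p q = vec_of_list
     [p $ 1 * q $ 2 - p $ 2 * q $ 1, p $ 2 * q $ 0 - p $ 0 * q $ 2, p $ 1 * q $ 0 - p $ 0 * q $ 1]"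

text \<open>Reflection in the geodesic through \<open>p\<close> and \<open>q\<close> (points of the plane or ideal points).\<close>

definition hyp_reflection :: "real vec \<Rightarrow> real vec \<Rightarrow> real vec \<Rightarrow> real vec" where
  "hyp_reflection p q = (\<lambda>x \<in> hyp_plane.
     let n = line_normal p q in x - (2 * lorentz x n / lorentz n n) \<cdot>\<^sub>v n)"

definition hyp_triangle :: "real vec \<Rightarrow> real vec \<Rightarrow> real vec \<Rightarrow> bool" where
  "hyp_triangle A B C \<longleftrightarrow>
     A \<in> hyp_plane \<union> ideal_points \<and> B \<in> hyp_plane \<union> ideal_points \<and>
     C \<in> hyp_plane \<union> ideal_points \<and> det (mat_of_cols 3 [A, B, C]) \<noteq> 0"

text \<open>The angle at \<open>v\<close> between the geodesics towards \<open>p\<close> and \<open>q\<close>. The vectors \<open>a\<close> and \<open>b\<close> are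
  tangent at \<open>v\<close> to these geodesics. The angle at an ideal vertex is 0.\<close>

definition hyp_angle :: "real vec \<Rightarrow> real vec \<Rightarrow> real vec \<Rightarrow> real" where
  "hyp_angle v p q =
     (if v \<in> ideal_points then 0
      else let a = p + lorentz p v \<cdot>\<^sub>v v; b = q + lorentz q v \<cdot>\<^sub>v v
           in arccos (lorentz a b / (sqrt (lorentz a a) * sqrt (lorentz b b))))"

definition hyp_triangle_with_angles ::
    "real vec \<Rightarrow> real vec \<Rightarrow> real vec \<Rightarrow> real \<Rightarrow> real \<Rightarrow> real \<Rightarrow> bool" where
  "hyp_triangle_with_angles A B C \<alpha> \<beta> \<gamma> \<longleftrightarrow>
     hyp_triangle A B C \<and>
     hyp_angle A B C = \<alpha> \<and> hyp_angle B C A = \<beta> \<and> hyp_angle C A B = \<gamma>"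

definition triangle_group ::
    "real vec \<Rightarrow> real vec \<Rightarrow> real vec \<Rightarrow> (real vec \<Rightarrow> real vec) monoid" where
  "triangle_group A B C = (BijGroup hyp_plane)
     \<lparr>carrier := generate (BijGroup hyp_plane)
        {hyp_reflection A B, hyp_reflection B C, hyp_reflection C A}\<rparr>"

text \<open>\<open>f\<close> preserves the orientation of every triple of points. (The determinant is positive,
  negative or zero according to whether the triple is positively oriented, negatively oriented or
  collinear.)\<close>

definition orientation_preserving :: "(real vec \<Rightarrow> real vec) \<Rightarrow> bool" where
  "orientation_preserving f \<longleftrightarrow>
     (\<forall>x\<in>hyp_plane. \<forall>y\<in>hyp_plane. \<forall>z\<in>hyp_plane.
        sgn (det (mat_of_cols 3 [f x, f y, f z])) = sgn (det (mat_of_cols 3 [x, y, z])))"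

definition oriented_triangle_group ::
    "real vec \<Rightarrow> real vec \<Rightarrow> real vec \<Rightarrow> (real vec \<Rightarrow> real vec) monoid" where
  "oriented_triangle_group A B C = (triangle_group A B C)
     \<lparr>carrier := {f \<in> carrier (triangle_group A B C). orientation_preserving f}\<rparr>"

text \<open>All triangles with given angles are congruent; the angles \<open>\<pi>/2\<close>, \<open>\<pi>/4\<close>, \<open>0\<close> do occur.\<close>

lemma hyp_triangle_2_4_infinity_exists:
  "\<exists>A B C. hyp_triangle_with_angles A B C (pi / 2) (pi / 4) 0"
proof -
  define A B C :: "real vec"
    where "A = vec_of_list [1, 0, sqrt 2]" and "B = vec_of_list [0, 0, 1]"
      and "C = vec_of_list [1, 1, sqrt 2]"
  have ix: "A $ 0 = 1" "A $ 1 = 0" "A $ 2 = sqrt 2" "B $ 0 = 0" "B $ 1 = 0" "B $ 2 = 1"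
    "C $ 0 = 1" "C $ 1 = 1" "C $ 2 = sqrt 2"
    by (auto simp: A_def B_def C_def numeral_2_eq_2)
  have car: "A \<in> carrier_vec 3" "B \<in> carrier_vec 3" "C \<in> carrier_vec 3"
    unfolding A_def B_def C_def by (rule carrier_vecI, simp)+
  have dims: "dim_vec A = 3" "dim_vec B = 3" "dim_vec C = 3" using car by auto
  have memA: "A \<in> hyp_plane" "A \<notin> ideal_points" and memB: "B \<in> hyp_plane" "B \<notin> ideal_points"
    and memC: "C \<in> ideal_points"
    using car ix by (auto simp: hyp_plane_def ideal_points_def lorentz_def)
  let ?M = "mat_of_cols 3 [A, B, C]"
  let ?D = "mat_delete ?M 2 1"
  have M: "?M \<in> carrier_mat 3 3"
    using mat_of_cols_carrier(1)[of 3 "[A, B, C]"] by (simp add: numeral_3_eq_3)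
  have D: "?D \<in> carrier_mat 2 2"
    using mat_delete_carrier[OF M, of 2 1] by simp
  have D_entries: "?D $$ (0, 0) = 1" "?D $$ (Suc 0, 0) = 0" "?D $$ (Suc 0, Suc 0) = 1"
    using ix M by (simp_all add: mat_delete_def mat_of_cols_index)
  have entries: "?M $$ (0, 1) = 0" "?M $$ (1, 1) = 0" "?M $$ (2, 1) = 1"
    using ix by (simp_all add: mat_of_cols_index)
  have "det ?M = (\<Sum>i<3. ?M $$ (i, 1) * cofactor ?M i 1)"
    by (rule laplace_expansion_column[OF M]) simp
  also have "\<dots> = cofactor ?M 2 1"
    using entries by (simp add: eval_nat_numeral)
  also have "\<dots> = - det ?D"
    by (simp add: cofactor_def)
  also have "det ?D = prod_list (diag_mat ?D)"
  proof (rule det_upper_triangular)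
    show "?D \<in> carrier_mat 2 2" by (rule D)
    show "upper_triangular ?D"
      using D D_entries by (auto simp: upper_triangular_def less_Suc_eq numeral_2_eq_2)
  qed
  also have "diag_mat ?D = [1, 1]"
    using D D_entries by (simp add: diag_mat_def numeral_2_eq_2)
  finally have "det ?M \<noteq> 0" by simp
  then have tri: "hyp_triangle A B C"
    using memA memB memC by (auto simp: hyp_triangle_def)
  have "hyp_angle A B C = arccos 0"
    using memA ix dims by (simp add: hyp_angle_def Let_def lorentz_def)
  moreover have "1 / sqrt 2 = cos (pi / 4)"
    by (simp add: cos_45 real_div_sqrt field_simps)
  then have "hyp_angle B C A = arccos (cos (pi / 4))"
    using memB ix dims by (simp add: hyp_angle_def Let_def lorentz_def)
  then have "hyp_angle B C A = pi / 4"
    by (simp add: arccos_cos)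
  moreover have "hyp_angle C A B = 0"
    using memC by (simp add: hyp_angle_def)
  ultimately show ?thesis
    using tri unfolding hyp_triangle_with_angles_def by (metis arccos_0)
qed

end

theory Submission
  imports Defs "HOL-Complex_Analysis.Complex_Analysis"
begin

text \<open>
  In the coordinate \<open>w = log z\<close> the linear system is the scalar equation
  \<open>\<phi>\<^sup>(\<^sup>k\<^sup>) = k\<^sup>k e\<^sup>k\<^sup>w \<phi>\<close>. Its Frobenius basis at \<open>z = 0\<close> shows that the shift \<open>w \<mapsto> w + 2\<pi>i/k\<close> is
  unipotent, so \<open>\<Sum>m. (k choose m) h\<^sub>m = 0\<close> for the rotations \<open>h\<^sub>m(w) = (- 1)\<^sup>m h(w + 2\<pi>im/k)\<close> of a
  solution \<open>h\<close>. For \<open>h\<close> take the solution with asymptotics \<open>e\<^sup>k\<^sup>z\<close> which is recessive on the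
  negative axis; integrating backwards along rays from infinity, its asymptotics hold for
  \<open>- \<pi>/k < arg z < 2\<pi> + \<pi>/k\<close>. Hence \<open>h\<^sub>m\<close> has exponent \<open>u\<^sub>m\<^sub>+\<^sub>1\<close> in the sector rotated by
  \<open>- 2\<pi>m/k\<close>. The columns of \<open>Y\<^sub>L\<close> and \<open>Y\<^sub>R\<close> are these rotations, corrected by dominated ones, and
  the binomial relation gives \<open>S\<close> and \<open>T\<close> explicitly for \<open>k = 3, 4\<close>.

  The monodromy group is then generated by \<open>R\<^sub>1\<close> and \<open>T R\<^sub>1\<close>; one has \<open>(T R\<^sub>1)\<^sup>3 = - 1\<close> for
  \<open>k = 3\<close> and \<open>(T R\<^sub>1)\<^sup>4 = 1\<close> for \<open>k = 4\<close>. That there are no further relations, in this group as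
  well as in \<open>PSL(2, \<int>)\<close> and in the triangular group, is one and the same ping-pong argument with
  triples of real numbers attached to the group elements.
\<close>

hide_const (open) Finite_Cartesian_Product.mat Finite_Cartesian_Product.vec Determinants.det

section \<open>The hypergeometric equation of quantum cohomology\<close>

text \<open>No integral representation of \<open>h\<close> is used; one estimate does the work. In
  directions where no exponential is smaller than \<open>exp (k z)\<close>, no component of a
  solution divided by \<open>exp (k z)\<close> can grow backwards along a ray, up to an integrable
  error. So closeness to the limit at the far end is carried back with a constant independent of the
  solution and of the end point. Prescribing the limit value at farther and farther points gives a
  Cauchy sequence, whose limit is \<open>h\<close>. The extreme directions are
  \<open>pi - pi/k\<close> and \<open>pi + pi/k\<close>, and rays carry the estimate through angles
  less than \<open>pi\<close> to both sides; hence the width of the sector.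

  A rotation whose sector does not cover the one prescribed for its column is corrected by dominated
  rotations with the coefficients of the binomial relation: solved the other way, the relation
  writes the same column through rotations valid on the rest. Both prescribed sectors are wider than
  \<open>pi\<close>, which makes the columns unique.

  The quotient by \<open>ker G\<close> is handled through \<open>v \<mapsto> G v\<close>, whose
  fibres are its elements; the function behind the monodromy triples is an entry of
  \<open>G v\<close>.\<close>

definition fps_weight :: "nat \<Rightarrow> complex fps \<Rightarrow> real" where
  "fps_weight i f = (\<Sum>l\<le>i. norm (fps_nth f l))"

lemma fps_weight_nonneg: "0 \<le> fps_weight i f"
  by (simp add: fps_weight_def sum_nonneg)

lemma norm_fps_nth_le_weight: "norm (fps_nth f i) \<le> fps_weight i f"
  unfolding fps_weight_def by (rule member_le_sum) auto

text \<open>The truncated l1 norm replaces a single coefficient because it is submultiplicative: the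
  index pairs with sum at most \<open>i\<close> all lie in the square of pairs with both indices at
  most \<open>i\<close>.\<close>

lemma fps_weight_mult: "fps_weight i (f * g) \<le> fps_weight i f * fps_weight i g"
proof -
  have "fps_weight i (f * g) \<le> (\<Sum>l\<le>i. \<Sum>m\<le>l. norm (fps_nth f m) * norm (fps_nth g (l - m)))"
    unfolding fps_weight_def fps_mult_nth
    by (intro sum_mono order_trans[OF norm_sum]) (simp add: norm_mult atLeast0AtMost)
  also have "\<dots> = (\<Sum>(m, n)\<in>{(m, n). m + n \<le> i}. norm (fps_nth f m) * norm (fps_nth g n))"
    by (simp add: sum.triangle_reindex_eq)
  also have "\<dots> \<le> (\<Sum>(m, n)\<in>{..i} \<times> {..i}. norm (fps_nth f m) * norm (fps_nth g n))"
    by (rule sum_mono2) auto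
  also have "\<dots> = fps_weight i f * fps_weight i g"
    by (simp add: fps_weight_def sum_product sum.cartesian_product)
  finally show ?thesis .
qed

lemma fps_weight_one: "fps_weight i 1 = 1"
  by (simp add: fps_weight_def fps_one_nth sum.If_cases if_distrib[of norm] cong: if_cong)

lemma fps_weight_power: "fps_weight i (f ^ n) \<le> fps_weight i f ^ n"
  by (induction n)
    (auto simp: fps_weight_one intro!: order_trans[OF fps_weight_mult] mult_left_mono fps_weight_nonneg)

lemma fps_weight_of_nat: "fps_weight i (of_nat n) \<le> real n"
  by (simp add: fps_weight_def fps_nth_of_nat if_distrib[of norm] sum.If_cases cong: if_cong)

lemma fps_weight_X_add_of_nat: "fps_weight i (fps_X + of_nat d) \<le> 1 + real d"
proof -
  have "fps_weight i (fps_X + of_nat d) \<le> (\<Sum>l\<le>i. norm (fps_nth (fps_X :: complex fps) l)) + fps_weight i (of_nat d)"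
    unfolding fps_weight_def sum.distrib[symmetric]
    by (rule sum_mono) (simp add: norm_triangle_ineq)
  also have "(\<Sum>l\<le>i. norm (fps_nth (fps_X :: complex fps) l)) \<le> 1"
    by (simp add: fps_X_def if_distrib[of norm] sum.If_cases cong: if_cong)
  finally show ?thesis using fps_weight_of_nat[of i d] by simp
qed

lemma fps_weight_exp: "fps_weight i (fps_exp c) \<le> exp (norm c)"
proof -
  have "fps_weight i (fps_exp c) = (\<Sum>l\<le>i. norm c ^ l /\<^sub>R fact l)"
    by (simp add: fps_weight_def norm_mult norm_inverse norm_power divide_inverse mult.commute)
  also have "\<dots> \<le> exp (norm c)"
    unfolding exp_def by (intro sum_le_suminf summable_exp_generic) auto
  finally show ?thesis .
qed

text \<open>
  The formal variable is the parameter \<open>\<epsilon>\<close> of Frobenius' method: modulo \<open>\<epsilon>\<^sup>k\<close> the series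
  \<open>\<Sum>d. frob_coeff k d e\<^sup>k\<^sup>(\<^sup>d\<^sup>+\<^sup>\<epsilon>\<^sup>)\<^sup>w\<close> solves the scalar equation. Taking the coefficient of \<open>\<epsilon>\<^sup>i\<close> gives
  \<open>frob_sol k i\<close>, whose second index counts the derivatives in \<open>w\<close>.
\<close>

definition frob_coeff :: "nat \<Rightarrow> nat \<Rightarrow> complex fps" where
  "frob_coeff k d = inverse ((\<Prod>l=1..d. fps_X + of_nat l) ^ k)"

lemma inverse_X_add_of_nat:
  assumes "0 < l" shows "inverse (fps_X + of_nat l :: complex fps) = Abs_fps (\<lambda>n. (-1) ^ n / of_nat l ^ Suc n)"
proof -
  have "(fps_X + of_nat l) * Abs_fps (\<lambda>n. (-1) ^ n / of_nat l ^ Suc n) = (1 :: complex fps)"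
  proof (rule fps_ext)
    fix n
    show "fps_nth ((fps_X + of_nat l) * Abs_fps (\<lambda>n. (-1) ^ n / of_nat l ^ Suc n)) n = fps_nth (1 :: complex fps) n"
      using assms by (cases n) (auto simp: distrib_right fps_of_nat[symmetric] field_simps)
  qed
  then show ?thesis by (metis fps_inverse_unique mult.commute)
qed

text \<open>Each of the \<open>i + 1\<close> coefficients has modulus at most \<open>1 / l\<close>.
  The factor \<open>1 / l\<close> is what later accumulates to \<open>1 / d!\<close> in the
  Frobenius coefficients.\<close>

lemma fps_weight_inverse_X_add_of_nat:
  assumes "0 < l" shows "fps_weight i (inverse (fps_X + of_nat l)) \<le> real (Suc i) / real l"
proof -
  have "fps_weight i (inverse (fps_X + of_nat l)) = (\<Sum>n\<le>i. 1 / real l ^ Suc n)"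
    by (simp add: inverse_X_add_of_nat[OF assms] fps_weight_def norm_divide norm_power norm_mult)
  also have "\<dots> \<le> (\<Sum>n\<le>i. 1 / real l)"
  proof (rule sum_mono)
    fix n show "1 / real l ^ Suc n \<le> 1 / real l"
      using assms by (intro divide_left_mono self_le_power) (auto simp del: power_Suc)
  qed
  finally show ?thesis by simp
qed

text \<open>This recursion is the scalar equation for the coefficients: \<open>d/dw\<close>
  multiplies \<open>exp (k (d + \<epsilon>) w)\<close> by \<open>k (d + \<epsilon>)\<close>, and
  multiplication by \<open>exp (k w)\<close> raises \<open>d\<close> by one.\<close>

lemma frob_coeff_Suc:
  "(fps_X + of_nat (Suc d)) ^ k * frob_coeff k (Suc d) = frob_coeff k d"
proof -
  have nz: "fps_nth ((fps_X + of_nat (Suc d)) ^ k :: complex fps) 0 \<noteq> 0"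
    by (simp add: fps_power_zeroth) (metis of_nat_Suc of_nat_neq_0)
  have "frob_coeff k (Suc d) = frob_coeff k d * inverse ((fps_X + of_nat (Suc d)) ^ k)"
    by (simp add: frob_coeff_def power_mult_distrib fps_inverse_mult del: of_nat_Suc)
  then show ?thesis
    using inverse_mult_eq_1[OF nz] by (simp add: mult_ac del: of_nat_Suc)
qed

lemma frob_coeff_0 [simp]: "frob_coeff k 0 = 1"
  by (simp add: frob_coeff_def)

lemma fps_weight_frob_coeff: "fps_weight i (frob_coeff k d) \<le> (real (Suc i) ^ d / fact d) ^ k"
proof (induction d)
  case 0 show ?case by (simp add: fps_weight_one)
next
  case (Suc d)
  have "frob_coeff k (Suc d) = frob_coeff k d * inverse (fps_X + of_nat (Suc d)) ^ k"
    by (simp add: frob_coeff_def power_mult_distrib fps_inverse_mult fps_inverse_power del: of_nat_Suc)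
  then have "fps_weight i (frob_coeff k (Suc d)) \<le>
      fps_weight i (frob_coeff k d) * fps_weight i (inverse (fps_X + of_nat (Suc d)) ^ k)"
    by (metis fps_weight_mult)
  also have "\<dots> \<le> (real (Suc i) ^ d / fact d) ^ k * (real (Suc i) / real (Suc d)) ^ k"
    by (intro mult_mono Suc fps_weight_nonneg order_trans[OF fps_weight_power] power_mono
      fps_weight_inverse_X_add_of_nat) auto
  also have "\<dots> = (real (Suc i) ^ Suc d / fact (Suc d)) ^ k"
    by (simp add: power_mult_distrib[symmetric] mult_ac del: of_nat_Suc)
  finally show ?case .
qed

definition frob_term :: "nat \<Rightarrow> nat \<Rightarrow> nat \<Rightarrow> nat \<Rightarrow> complex \<Rightarrow> complex" where
  "frob_term k i j d w = exp (of_nat (k * d) * w) *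
     (of_nat k ^ j * fps_nth ((fps_X + of_nat d) ^ j * frob_coeff k d * fps_exp (of_nat k * w)) i)"

definition frob_sol :: "nat \<Rightarrow> nat \<Rightarrow> nat \<Rightarrow> complex \<Rightarrow> complex" where
  "frob_sol k i j w = (\<Sum>d. frob_term k i j d w)"

lemma DERIV_fps_exp_nth:
  "((\<lambda>w. fps_nth (fps_exp (c * w)) n) has_field_derivative c * fps_nth (fps_X * fps_exp (c * w)) n) (at (w :: complex))"
proof (cases n)
  case (Suc m)
  have "((\<lambda>w. (c * w) ^ Suc m) has_field_derivative of_nat (Suc m) * (c * (c * w) ^ m)) (at w)"
    using DERIV_power[of "\<lambda>w. c * w" c w UNIV "Suc m"] by (simp add: DERIV_cmult_Id del: of_nat_Suc power_Suc)
  then have "((\<lambda>w. (c * w) ^ Suc m / fact (Suc m)) has_field_derivative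
      c * ((c * w) ^ m / fact m)) (at w)"
    by (rule DERIV_cdivide[THEN DERIV_cong]) (simp add: divide_simps del: of_nat_Suc)
  then show ?thesis using Suc by (simp add: fps_X_mult_nth del: of_nat_Suc power_Suc fact_Suc)
qed auto

lemma DERIV_fps_mult_exp_nth:
  fixes B :: "complex fps"
  shows "((\<lambda>w. fps_nth (B * fps_exp (c * w)) i) has_field_derivative
    c * fps_nth (fps_X * B * fps_exp (c * w)) i) (at w)"
proof -
  have "((\<lambda>w. fps_nth (B * fps_exp (c * w)) i) has_field_derivative
    (\<Sum>l=0..i. fps_nth B l * (c * fps_nth (fps_X * fps_exp (c * w)) (i - l)))) (at w)"
    unfolding fps_mult_nth[of B] by (intro DERIV_sum DERIV_cmult DERIV_fps_exp_nth)
  also have "(\<Sum>l=0..i. fps_nth B l * (c * fps_nth (fps_X * fps_exp (c * w)) (i - l)))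
      = c * fps_nth (B * (fps_X * fps_exp (c * w))) i"
    by (simp add: fps_mult_nth[of B] sum_distrib_left mult_ac)
  finally show ?thesis by (simp add: mult_ac)
qed

lemma DERIV_frob_term:
  "(frob_term k i j d has_field_derivative frob_term k i (Suc j) d w) (at w)"
proof -
  let ?B = "(fps_X + of_nat d) ^ j * frob_coeff k d"
  have "((\<lambda>w. exp (of_nat (k * d) * w) * (of_nat k ^ j * fps_nth (?B * fps_exp (of_nat k * w)) i))
     has_field_derivative
      exp (of_nat (k * d) * w) * (of_nat k ^ j * (of_nat k * fps_nth (fps_X * ?B * fps_exp (of_nat k * w)) i)) +
      of_nat (k * d) * exp (of_nat (k * d) * w) * (of_nat k ^ j * fps_nth (?B * fps_exp (of_nat k * w)) i)) (at w)"
    by (rule DERIV_mult'[OF _ DERIV_cmult[OF DERIV_fps_mult_exp_nth]])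
      (auto intro!: derivative_eq_intros)
  moreover have "fps_nth ((fps_X + of_nat d) ^ Suc j * frob_coeff k d * fps_exp (of_nat k * w)) i =
      fps_nth (fps_X * ?B * fps_exp (of_nat k * w)) i + of_nat d * fps_nth (?B * fps_exp (of_nat k * w)) i"
  proof -
    have "(fps_X + of_nat d) ^ Suc j * frob_coeff k d * fps_exp (of_nat k * w) =
      fps_X * ?B * fps_exp (of_nat k * w) + fps_const (of_nat d) * (?B * fps_exp (of_nat k * w))"
      by (simp add: algebra_simps fps_of_nat)
    then show ?thesis by simp
  qed
  ultimately show ?thesis
    by (simp add: frob_term_def[abs_def] algebra_simps del: power_Suc)
qed

definition frob_bound :: "nat \<Rightarrow> nat \<Rightarrow> nat \<Rightarrow> real \<Rightarrow> nat \<Rightarrow> real" where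
  "frob_bound k i j r d = exp (real k * r) ^ d * (real k ^ j * ((1 + real d) ^ j * (real (Suc i) ^ d / fact d) ^ k * exp (real k * r)))"

lemma norm_frob_term_le:
  assumes "norm w \<le> r" shows "norm (frob_term k i j d w) \<le> frob_bound k i j r d"
proof -
  have kw: "norm (of_nat k * w) \<le> real k * r"
    using assms by (simp add: norm_mult mult_left_mono)
  have "norm (exp (of_nat (k * d) * w)) \<le> exp (real d * (real k * r))"
  proof -
    have "Re (of_nat (k * d) * w) \<le> norm (of_nat (k * d) * w)" by (rule complex_Re_le_cmod)
    also have "\<dots> \<le> real d * (real k * r)"
      using mult_left_mono[OF kw, of "real d"] by (simp add: norm_mult mult_ac)
    finally show ?thesis by (simp add: norm_exp_eq_Re)
  qed
  then have 1: "norm (exp (of_nat (k * d) * w)) \<le> exp (real k * r) ^ d"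
    by (simp add: exp_of_nat_mult)
  have "norm (fps_nth ((fps_X + of_nat d) ^ j * frob_coeff k d * fps_exp (of_nat k * w)) i)
     \<le> fps_weight i ((fps_X + of_nat d) ^ j * frob_coeff k d * fps_exp (of_nat k * w))"
    by (rule norm_fps_nth_le_weight)
  also have "\<dots> \<le> fps_weight i ((fps_X + of_nat d) ^ j) * fps_weight i (frob_coeff k d)
      * fps_weight i (fps_exp (of_nat k * w))"
    by (intro order_trans[OF fps_weight_mult] mult_right_mono fps_weight_mult fps_weight_nonneg)
  also have "\<dots> \<le> (1 + real d) ^ j * (real (Suc i) ^ d / fact d) ^ k * exp (real k * r)"
    using kw by (intro mult_mono fps_weight_frob_coeff order_trans[OF fps_weight_exp]
      order_trans[OF fps_weight_power] power_mono fps_weight_X_add_of_nat fps_weight_nonneg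
      mult_nonneg_nonneg) auto
  finally show ?thesis
    unfolding frob_term_def frob_bound_def norm_mult norm_power norm_of_nat
    using 1 by (intro mult_mono mult_left_mono) auto
qed

lemma frob_bound_nonneg: "0 \<le> frob_bound k i j r d"
  by (simp add: frob_bound_def)

text \<open>An exponential series is a majorant: \<open>(1 + d) ^ j\<close> is at most
  \<open>j! * exp (1 + d)\<close>, and because \<open>k > 0\<close> one factorial of
  \<open>(d!) ^ k\<close> may be kept and the others dropped.\<close>

lemma summable_frob_bound:
  assumes "0 < k" shows "summable (frob_bound k i j r)"
proof -
  define c where "c = exp (real k * r) * real (Suc i) ^ k"
  define c2 where "c2 = real k ^ j * exp (real k * r) * (fact j * exp 1)"
  have "summable (\<lambda>d. c2 * ((c * exp 1) ^ d /\<^sub>R fact d))"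
    by (intro summable_mult summable_exp_generic)
  moreover have "norm (frob_bound k i j r d) \<le> c2 * ((c * exp 1) ^ d /\<^sub>R fact d)" for d
  proof -
    have "(1 + real d) ^ j \<le> fact j * exp (1 + real d)"
    proof -
      have "(1 + real d) ^ j /\<^sub>R fact j = (\<Sum>l\<in>{j}. (1 + real d) ^ l /\<^sub>R fact l)" by simp
      also have "\<dots> \<le> exp (1 + real d)"
        unfolding exp_def by (rule sum_le_suminf) (use summable_exp_generic[of "1 + real d"] in auto)
      finally show ?thesis by (simp add: field_simps)
    qed
    then have 1: "(1 + real d) ^ j \<le> fact j * (exp 1 * exp 1 ^ d)"
      by (simp add: exp_add exp_of_nat_mult[symmetric])
    have 2: "(real (Suc i) ^ d / fact d) ^ k \<le> (real (Suc i) ^ k) ^ d / fact d"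
    proof -
      have "(real (Suc i) ^ d / fact d) ^ k = (real (Suc i) ^ k) ^ d / fact d ^ k"
        by (simp add: power_divide power_mult[symmetric] mult.commute)
      also have "\<dots> \<le> (real (Suc i) ^ k) ^ d / fact d"
        using assms by (intro divide_left_mono self_le_power) auto
      finally show ?thesis .
    qed
    have "frob_bound k i j r d \<le> exp (real k * r) ^ d * (real k ^ j * ((fact j * (exp 1 * exp 1 ^ d)) *
        ((real (Suc i) ^ k) ^ d / fact d) * exp (real k * r)))"
      unfolding frob_bound_def by (intro mult_left_mono mult_right_mono mult_mono 1 2) auto
    also have "\<dots> = c2 * ((c * exp 1) ^ d /\<^sub>R fact d)"
      by (simp add: c_def c2_def power_mult_distrib field_simps)
    finally show ?thesis using frob_bound_nonneg by simp
  qed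
  ultimately show ?thesis by (rule summable_comparison_test'[where N = 0])
qed

lemma summable_frob_term: "0 < k \<Longrightarrow> summable (\<lambda>d. frob_term k i j d w)"
  by (rule summable_comparison_test'[OF summable_frob_bound[of k i j "norm w"], of 0])
    (auto intro: norm_frob_term_le)

lemma DERIV_frob_sol:
  assumes k: "0 < k"
  shows "(frob_sol k i j has_field_derivative frob_sol k i (Suc j) w) (at w)"
proof -
  have "\<exists>g g'. \<forall>x\<in>UNIV. (\<lambda>d. frob_term k i j d x) sums g x \<and> (\<lambda>d. frob_term k i (Suc j) d x) sums g' x \<and>
      (g has_field_derivative g' x) (at x)"
  proof (rule series_and_derivative_comparison_complex)
    fix x :: complex
    show "\<exists>e h. 0 < e \<and> summable h \<and> range h \<subseteq> \<real>\<^sub>\<ge>\<^sub>0 \<and>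
      (\<forall>\<^sub>F n in sequentially. \<forall>y\<in>ball x e \<inter> UNIV. cmod (frob_term k i j n y) \<le> cmod (h n))"
    proof (intro exI conjI)
      let ?h = "\<lambda>d. of_real (frob_bound k i j (norm x + 1) d) :: complex"
      show "summable ?h" by (intro summable_of_real summable_frob_bound k)
      show "range ?h \<subseteq> \<real>\<^sub>\<ge>\<^sub>0" by (auto simp: frob_bound_nonneg)
      have "norm y \<le> norm x + 1" if "y \<in> ball x 1" for y
        using that norm_triangle_ineq2[of y x] by (auto simp: dist_norm norm_minus_commute)
      then show "\<forall>\<^sub>F n in sequentially. \<forall>y\<in>ball x 1 \<inter> UNIV. cmod (frob_term k i j n y) \<le> cmod (?h n)"
        by (auto intro!: always_eventually norm_frob_term_le simp: frob_bound_nonneg)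
    qed simp
  qed (auto intro: DERIV_frob_term)
  then obtain g g' where g: "\<And>x. (\<lambda>d. frob_term k i j d x) sums g x"
    "\<And>x. (\<lambda>d. frob_term k i (Suc j) d x) sums g' x" "\<And>x. (g has_field_derivative g' x) (at x)"
    by blast
  have "g = frob_sol k i j" "g' = frob_sol k i (Suc j)"
    using g(1,2) by (auto simp: frob_sol_def fun_eq_iff sums_unique)
  with g(3) show ?thesis by simp
qed

text \<open>At \<open>d = 0\<close> the derivative of order \<open>k\<close> carries the factor
  \<open>\<epsilon> ^ k\<close>, which has no coefficient of order \<open>i < k\<close>; this is why
  exactly the first \<open>k\<close> coefficients give solutions. All other terms move down by one
  through \<open>frob_coeff_Suc\<close>.\<close>

lemma frob_sol_top:
  assumes k: "0 < k" and i: "i < k"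
  shows "frob_sol k i k w = of_nat k ^ k * exp (of_nat k * w) * frob_sol k i 0 w"
proof -
  have 0: "frob_term k i k 0 w = 0"
    using i by (simp add: frob_term_def fps_X_power_mult_nth)
  have S: "frob_term k i k (Suc d) w = of_nat k ^ k * exp (of_nat k * w) * frob_term k i 0 d w" for d
    unfolding frob_term_def frob_coeff_Suc
    by (simp add: exp_add algebra_simps del: of_nat_Suc)
  have "frob_sol k i k w = (\<Sum>d. frob_term k i k (Suc d) w) + frob_term k i k 0 w"
    using suminf_split_head[OF summable_frob_term[OF k, of i k w]] by (simp add: frob_sol_def)
  then show ?thesis
    unfolding 0 S using suminf_mult[OF summable_frob_term[OF k, of i 0 w]] by (simp add: frob_sol_def)
qed

text \<open>Since \<open>d\<close> is an integer, the shift leaves \<open>exp (k d w)\<close> alone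
  and multiplies only the formal factor \<open>exp (k \<epsilon> w)\<close>, by a power of
  \<open>exp (2 pi i \<epsilon>)\<close>.\<close>

lemma frob_term_shift:
  assumes "0 < k"
  shows "frob_term k i j d (w + 2 * of_real pi * \<i> * of_nat m / of_nat k) = exp (of_nat (k * d) * w) *
     (of_nat k ^ j * fps_nth ((fps_X + of_nat d) ^ j * frob_coeff k d * fps_exp (of_nat k * w) *
       fps_exp (2 * of_real pi * \<i>) ^ m) i)"
proof -
  have 1: "of_nat k * (w + 2 * of_real pi * \<i> * of_nat m / of_nat k) = of_nat k * w + of_nat m * (2 * of_real pi * \<i>)"
    using assms by (simp add: field_simps)
  have "of_nat (k * d) * (w + 2 * of_real pi * \<i> * of_nat m / of_nat k) =
      of_nat (k * d) * w + of_nat (d * m) * (2 * of_real pi * \<i>)"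
    using assms by (simp add: field_simps)
  then have "exp (of_nat (k * d) * (w + 2 * of_real pi * \<i> * of_nat m / of_nat k)) =
      exp (of_nat (k * d) * w + of_nat (d * m) * (2 * of_real pi * \<i>))"
    by (rule arg_cong)
  also have "\<dots> = exp (of_nat (k * d) * w)"
    by (simp only: exp_add exp_of_nat_mult exp_two_pi_i) simp
  finally have 2: "exp (of_nat (k * d) * (w + 2 * of_real pi * \<i> * of_nat m / of_nat k)) =
      exp (of_nat (k * d) * w)" .
  show ?thesis
    unfolding frob_term_def 1 2 fps_exp_add_mult fps_exp_power_mult by (simp add: mult_ac)
qed

lemma frob_sol_shift_sums:
  assumes k: "0 < k"
  shows "(\<lambda>d. exp (of_nat (k * d) * w) * (of_nat k ^ j * fps_nth ((fps_X + of_nat d) ^ j *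
      frob_coeff k d * fps_exp (of_nat k * w) * (1 - fps_exp (2 * of_real pi * \<i>)) ^ n) i))
    sums (\<Sum>m\<le>n. of_nat (n choose m) * (-1) ^ m * frob_sol k i j (w + 2 * of_real pi * \<i> * of_nat m / of_nat k))"
proof -
  have "(\<lambda>d. \<Sum>m\<le>n. of_nat (n choose m) * (-1) ^ m * frob_term k i j d (w + 2 * of_real pi * \<i> * of_nat m / of_nat k))
    sums (\<Sum>m\<le>n. of_nat (n choose m) * (-1) ^ m * frob_sol k i j (w + 2 * of_real pi * \<i> * of_nat m / of_nat k))"
    unfolding frob_sol_def by (intro sums_sum sums_mult summable_sums summable_frob_term k)
  moreover have "(\<Sum>m\<le>n. of_nat (n choose m) * (-1) ^ m * frob_term k i j d (w + 2 * of_real pi * \<i> * of_nat m / of_nat k))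
    = exp (of_nat (k * d) * w) * (of_nat k ^ j * fps_nth ((fps_X + of_nat d) ^ j *
      frob_coeff k d * fps_exp (of_nat k * w) * (1 - fps_exp (2 * of_real pi * \<i>)) ^ n) i)" for d
  proof -
    let ?e = "fps_exp (2 * of_real pi * \<i>) :: complex fps"
    let ?B = "(fps_X + of_nat d) ^ j * frob_coeff k d * fps_exp (of_nat k * w)"
    have "(1 - ?e) ^ n = (\<Sum>m\<le>n. of_nat (n choose m) * (- ?e) ^ m)"
      using binomial_ring[of "- ?e" 1 n] by simp
    also have "\<dots> = (\<Sum>m\<le>n. fps_const (of_nat (n choose m) * (-1) ^ m) * ?e ^ m)"
    proof (rule sum.cong[OF refl])
      fix m
      have "fps_const (of_nat (n choose m) * (-1) ^ m :: complex) = of_nat (n choose m) * (-1) ^ m"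
        by (cases "even m") (simp_all add: fps_of_nat flip: fps_const_neg)
      then show "of_nat (n choose m) * (- ?e) ^ m = fps_const (of_nat (n choose m) * (-1) ^ m) * ?e ^ m"
        by (metis (no_types) mult.assoc power_minus)
    qed
    finally have "fps_nth (?B * (1 - ?e) ^ n) i =
        (\<Sum>m\<le>n. of_nat (n choose m) * (-1) ^ m * fps_nth (?B * ?e ^ m) i)"
      by (simp add: sum_distrib_left fps_sum_nth mult.left_commute[of ?B])
    then show ?thesis
      unfolding frob_term_shift[OF k] by (simp add: sum_distrib_left mult_ac)
  qed
  ultimately show ?thesis by simp
qed

lemma one_minus_fps_exp_power:
  "\<exists>q. (1 - fps_exp c) ^ n = fps_X ^ n * q \<and> fps_nth q 0 = (- c :: complex) ^ n"
proof -
  have "1 - fps_exp c = fps_X * fps_shift 1 (1 - fps_exp c)"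
    by (rule fps_ext) (auto simp: fps_X_mult_nth)
  then have "(1 - fps_exp c) ^ n = fps_X ^ n * fps_shift 1 (1 - fps_exp c) ^ n"
    by (metis power_mult_distrib)
  then show ?thesis by (intro exI conjI) (auto simp: fps_power_zeroth)
qed

text \<open>The alternating binomial sum of the shifts amounts to the factor
  \<open>(1 - exp (2 pi i \<epsilon>)) ^ n\<close>, which is divisible by
  \<open>\<epsilon> ^ n\<close> and so contributes nothing in order \<open>i < n\<close>.\<close>

lemma frob_sol_shift_relation:
  assumes k: "0 < k" and i: "i < n"
  shows "(\<Sum>m\<le>n. of_nat (n choose m) * (-1) ^ m * frob_sol k i j (w + 2 * of_real pi * \<i> * of_nat m / of_nat k)) = 0"
proof -
  obtain q where q: "(1 - fps_exp (2 * of_real pi * \<i>)) ^ n = fps_X ^ n * q"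
    using one_minus_fps_exp_power by blast
  have "fps_nth (B * (fps_X ^ n * q)) i = 0" for B
    using i by (simp add: mult.left_commute[of B] fps_X_power_mult_nth)
  then show ?thesis
    using frob_sol_shift_sums[OF k, of w j n i] by (simp add: q sums_unique[symmetric] sums_0 sums_iff)
qed

text \<open>In the borderline order \<open>n = i\<close> only the lowest coefficient survives: at
  \<open>w = 0\<close> it is \<open>(- 2 pi i) ^ i\<close> times the positive sum of
  \<open>1 / (d!) ^ k\<close>. Together with the vanishing for larger \<open>n\<close> this
  triangularity proves that the Frobenius basis is independent.\<close>

lemma frob_sol_shift_top:
  assumes k: "0 < k"
  shows "(\<Sum>m\<le>i. of_nat (i choose m) * (-1) ^ m * frob_sol k i 0 (2 * of_real pi * \<i> * of_nat m / of_nat k)) \<noteq> 0"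
proof -
  let ?c = "2 * of_real pi * \<i>"
  obtain q where q: "(1 - fps_exp ?c) ^ i = fps_X ^ i * q" "fps_nth q 0 = (- ?c) ^ i"
    using one_minus_fps_exp_power by blast
  have A: "fps_nth (frob_coeff k d) 0 = of_real (1 / fact d ^ k)" for d
  proof (induction d)
    case (Suc d)
    have "of_nat (Suc d) ^ k * fps_nth (frob_coeff k (Suc d)) 0 = fps_nth (frob_coeff k d) 0"
      by (subst frob_coeff_Suc[symmetric]) (simp add: fps_power_zeroth)
    then show ?case
      using Suc by (simp add: power_mult_distrib divide_simps mult_ac del: of_nat_Suc)
  qed simp
  have "fps_nth (frob_coeff k d * (fps_X ^ i * q)) i = of_real (1 / fact d ^ k) * (- ?c) ^ i" for d
    by (simp add: mult.left_commute[of "frob_coeff k d"] fps_X_power_mult_nth A q)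
  then have s: "(\<lambda>d. of_real (1 / fact d ^ k) * (- ?c) ^ i) sums
     (\<Sum>m\<le>i. of_nat (i choose m) * (-1) ^ m * frob_sol k i 0 (?c * of_nat m / of_nat k))"
    using frob_sol_shift_sums[OF k, of 0 0 i i] by (simp add: q)
  have sm: "summable (\<lambda>d. 1 / fact d ^ k :: real)"
  proof (rule summable_comparison_test'[where N = 0])
    show "summable (\<lambda>d. 1 ^ d /\<^sub>R fact d :: real)" by (rule summable_exp_generic)
    show "norm (1 / fact d ^ k :: real) \<le> 1 ^ d /\<^sub>R fact d" for d
      using k by (auto simp: field_simps intro!: self_le_power)
  qed
  then have "0 < (\<Sum>d. 1 / fact d ^ k :: real)" by (rule suminf_pos) auto
  moreover have "(\<lambda>d. of_real (1 / fact d ^ k) * (- ?c) ^ i) sums (of_real (\<Sum>d. 1 / fact d ^ k) * (- ?c) ^ i)"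
    by (intro sums_mult2 sums_of_real summable_sums sm)
  ultimately show ?thesis using sums_unique2[OF s] by auto
qed

text \<open>\<open>F j\<close> is the derivative of order \<open>j\<close> of the scalar solution \<open>F 0\<close> in \<open>w = log z\<close>.\<close>

definition qde_solution :: "nat \<Rightarrow> (nat \<Rightarrow> complex \<Rightarrow> complex) \<Rightarrow> bool" where
  "qde_solution k F \<longleftrightarrow> (\<forall>j<k. \<forall>w. (F j has_field_derivative
     (if Suc j < k then F (Suc j) w else of_nat k ^ k * exp (of_nat k * w) * F 0 w)) (at w))"

lemma qde_solutionD:
  "qde_solution k F \<Longrightarrow> j < k \<Longrightarrow> (F j has_field_derivative
     (if Suc j < k then F (Suc j) w else of_nat k ^ k * exp (of_nat k * w) * F 0 w)) (at w)"
  by (simp add: qde_solution_def)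

lemma qde_solution_frob:
  assumes "i < k" shows "qde_solution k (frob_sol k i)"
  unfolding qde_solution_def
proof (intro allI impI)
  fix j w assume "j < k"
  have "(frob_sol k i j has_field_derivative frob_sol k i (Suc j) w) (at w)"
    using assms by (intro DERIV_frob_sol) auto
  moreover have "frob_sol k i (Suc j) w = of_nat k ^ k * exp (of_nat k * w) * frob_sol k i 0 w"
    if "\<not> Suc j < k"
    using that \<open>j < k\<close> assms frob_sol_top[of k i w] by (metis Suc_lessI less_nat_zero_code neq0_conv)
  ultimately show "(frob_sol k i j has_field_derivative (if Suc j < k then frob_sol k i (Suc j) w
      else of_nat k ^ k * exp (of_nat k * w) * frob_sol k i 0 w)) (at w)"
    by (cases "Suc j < k") simp_all
qed

section \<open>Closure properties, uniqueness and a basis of the solution space\<close>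

lemma qde_solution_sum:
  assumes "\<And>i. i \<in> I \<Longrightarrow> qde_solution k (F i)"
  shows "qde_solution k (\<lambda>j w. \<Sum>i\<in>I. c i * F i j w)"
  unfolding qde_solution_def
proof (intro allI impI)
  fix j w assume j: "j < k"
  have "((\<lambda>w. \<Sum>i\<in>I. c i * F i j w) has_field_derivative (\<Sum>i\<in>I. c i *
      (if Suc j < k then F i (Suc j) w else of_nat k ^ k * exp (of_nat k * w) * F i 0 w))) (at w)"
    using assms j by (intro DERIV_sum DERIV_cmult qde_solutionD)
  then show "((\<lambda>w. \<Sum>i\<in>I. c i * F i j w) has_field_derivative (if Suc j < k then \<Sum>i\<in>I. c i * F i (Suc j) w
      else of_nat k ^ k * exp (of_nat k * w) * (\<Sum>i\<in>I. c i * F i 0 w))) (at w)"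
    by (auto simp: sum_distrib_left mult_ac)
qed

lemma qde_solution_cmult: "qde_solution k F \<Longrightarrow> qde_solution k (\<lambda>j w. c * F j w)"
  using qde_solution_sum[of "{()}" k "\<lambda>_. F" "\<lambda>_. c"] by simp

lemma qde_solution_add: "qde_solution k F \<Longrightarrow> qde_solution k G \<Longrightarrow> qde_solution k (\<lambda>j w. F j w + G j w)"
  using qde_solution_sum[of "{True, False}" k "\<lambda>b. if b then F else G" "\<lambda>_. 1"] by simp

lemma qde_solution_diff: "qde_solution k F \<Longrightarrow> qde_solution k G \<Longrightarrow> qde_solution k (\<lambda>j w. F j w - G j w)"
  using qde_solution_add[OF _ qde_solution_cmult[of k G "-1"], of F] by simp

lemma qde_solution_shift:
  assumes "qde_solution k F" "0 < k"
  shows "qde_solution k (\<lambda>j w. c * F j (w + 2 * of_real pi * \<i> * of_int m / of_nat k))"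
proof (rule qde_solution_cmult, unfold qde_solution_def, intro allI impI)
  fix j w assume j: "j < k"
  let ?s = "2 * of_real pi * \<i> * of_int m / of_nat k :: complex"
  have "exp (of_nat k * (w + ?s)) = exp (of_nat k * w + 2 * of_int m * of_real pi * \<i>)"
    using assms(2) by (intro arg_cong[where f = exp]) (simp add: field_simps)
  also have "\<dots> = exp (of_nat k * w)"
    using exp_integer_2pi[of "of_int m"] by (simp add: exp_add mult_ac)
  finally have e: "exp (of_nat k * (w + ?s)) = exp (of_nat k * w)" .
  have "((\<lambda>w. w + ?s) has_field_derivative 1) (at w)"
    by (auto intro!: derivative_eq_intros)
  from DERIV_chain2[OF qde_solutionD[OF assms(1) j, of "w + ?s"] this]
  show "((\<lambda>w. F j (w + ?s)) has_field_derivative (if Suc j < k then F (Suc j) (w + ?s)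
      else of_nat k ^ k * exp (of_nat k * w) * F 0 (w + ?s))) (at w)"
    unfolding e by simp
qed

lemma qde_solution_holomorphic:
  assumes "qde_solution k F" "j < k" shows "F j holomorphic_on UNIV"
  using qde_solutionD[OF assms] unfolding holomorphic_on_def field_differentiable_def
  by (metis has_field_derivative_at_within)

lemma qde_solution_higher_deriv:
  assumes "qde_solution k F" "0 < k"
  shows "n < k \<Longrightarrow> (deriv ^^ n) (F 0) = F n"
proof (induction n)
  case (Suc n)
  then have "(deriv ^^ Suc n) (F 0) = deriv (F n)" by simp
  also have "\<dots> = F (Suc n)"
    using qde_solutionD[OF assms(1), of n] Suc.prems by (auto intro: DERIV_imp_deriv)
  finally show ?case .
qed simp

text \<open>Leibniz' rule applied to the derivative of order \<open>k\<close> propagates the zero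
  initial values to derivatives of all orders at \<open>p\<close>; the identity theorem then kills
  the entire function \<open>F 0\<close>.\<close>

lemma qde_solution_unique:
  assumes F: "qde_solution k F" and k: "0 < k" and z: "\<And>j. j < k \<Longrightarrow> F j p = 0" and j: "j < k"
  shows "F j w = 0"
proof -
  define q where "q = (\<lambda>w::complex. of_nat k ^ k * exp (of_nat k * w))"
  have qh: "q holomorphic_on UNIV" unfolding q_def by (intro holomorphic_intros)
  have dk: "(deriv ^^ k) (F 0) = (\<lambda>w. q w * F 0 w)"
  proof -
    obtain k' where k': "k = Suc k'" using k by (cases k) auto
    have "(deriv ^^ k) (F 0) = deriv (F k')"
      using qde_solution_higher_deriv[OF F k, of k'] k' by simp
    also have "deriv (F k') w = q w * F 0 w" for w
      using qde_solutionD[OF F, of k' w] k' by (auto intro: DERIV_imp_deriv simp: q_def)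
    then have "deriv (F k') = (\<lambda>w. q w * F 0 w)" by blast
    finally show ?thesis .
  qed
  have d0: "(deriv ^^ n) (F 0) p = 0" for n
  proof (induction n rule: less_induct)
    case (less n)
    show ?case
    proof (cases "n < k")
      case True
      then show ?thesis using qde_solution_higher_deriv[OF F k] z by simp
    next
      case False
      then have "(deriv ^^ n) (F 0) p = (deriv ^^ (n - k)) (\<lambda>w. q w * F 0 w) p"
        unfolding dk[symmetric] by (metis funpow_add comp_apply le_add_diff_inverse2 not_less)
      also have "\<dots> = (\<Sum>i=0..n - k. of_nat ((n - k) choose i) * (deriv ^^ i) q p * (deriv ^^ (n - k - i)) (F 0) p)"
        using qde_solution_holomorphic[OF F k] by (intro higher_deriv_mult[OF qh]) auto
      also have "\<dots> = 0"
        using False k by (intro sum.neutral ballI) (simp add: less)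
      finally show ?thesis .
    qed
  qed
  have "F 0 w = 0" for w
    by (rule holomorphic_fun_eq_0_on_connected[OF qde_solution_holomorphic[OF F k], where z = p]) (auto simp: d0)
  then have "F 0 = (\<lambda>_. 0)" by blast
  moreover have "(deriv ^^ j) (\<lambda>_. 0 :: complex) = (\<lambda>_. 0)" by (induction j) auto
  ultimately show ?thesis
    using qde_solution_higher_deriv[OF F k j] by metis
qed

lemma qde_solution_zero_of_scalar_zero:
  assumes F: "qde_solution k F" and k: "0 < k" and z: "\<And>w. F 0 w = 0" and j: "j < k"
  shows "F j w = 0"
proof -
  have "F 0 = (\<lambda>_. 0)" using z by blast
  moreover have "(deriv ^^ j) (\<lambda>_. 0 :: complex) = (\<lambda>_. 0)" by (induction j) auto
  ultimately show ?thesis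
    using qde_solution_higher_deriv[OF F k j] by metis
qed

text \<open>Let \<open>n\<close> be the largest index with a nonzero coefficient. The
  \<open>n\<close>-th power of (1 - shift) annihilates all earlier members of the basis and leaves a
  nonzero multiple of \<open>c n\<close>.\<close>

lemma frob_sol_independent:
  assumes k: "0 < k" and z: "\<And>w. (\<Sum>i<k. c i * frob_sol k i 0 w) = 0" and i: "i < k"
  shows "c i = 0"
proof (rule ccontr)
  assume "c i \<noteq> 0"
  define n where "n = (GREATEST i. i < k \<and> c i \<noteq> 0)"
  have n: "n < k" "c n \<noteq> 0"
    using GreatestI_nat[of "\<lambda>i. i < k \<and> c i \<noteq> 0" i k] i \<open>c i \<noteq> 0\<close> by (auto simp: n_def)
  have max: "c l = 0" if "n < l" "l < k" for l
    using Greatest_le_nat[of "\<lambda>i. i < k \<and> c i \<noteq> 0" l k] that by (auto simp: n_def)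
  let ?s = "\<lambda>m. 2 * of_real pi * \<i> * of_nat m / of_nat k :: complex"
  have "0 = (\<Sum>m\<le>n. of_nat (n choose m) * (-1) ^ m * (\<Sum>i<k. c i * frob_sol k i 0 (?s m)))"
    by (simp add: z)
  also have "\<dots> = (\<Sum>i<k. c i * (\<Sum>m\<le>n. of_nat (n choose m) * (-1) ^ m * frob_sol k i 0 (?s m)))"
    by (simp add: sum_distrib_left sum.swap[of _ _ "{..<k}"] mult_ac)
  also have "\<dots> = (\<Sum>i<k. if i = n then c n * (\<Sum>m\<le>n. of_nat (n choose m) * (-1) ^ m * frob_sol k n 0 (?s m)) else 0)"
  proof (rule sum.cong[OF refl])
    fix i assume "i \<in> {..<k}"
    then show "c i * (\<Sum>m\<le>n. of_nat (n choose m) * (-1) ^ m * frob_sol k i 0 (?s m)) =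
        (if i = n then c n * (\<Sum>m\<le>n. of_nat (n choose m) * (-1) ^ m * frob_sol k n 0 (?s m)) else 0)"
      using max[of i] frob_sol_shift_relation[OF k, of i n 0 0] by (cases i n rule: linorder_cases) auto
  qed
  also have "\<dots> = c n * (\<Sum>m\<le>n. of_nat (n choose m) * (-1) ^ m * frob_sol k n 0 (?s m))"
    using n by simp
  finally show False
    using n frob_sol_shift_top[OF k, of n] by simp
qed

definition frob_wronskian :: "nat \<Rightarrow> complex \<Rightarrow> complex mat" where
  "frob_wronskian k w = mat k k (\<lambda>(j, i). frob_sol k i j w)"

lemma frob_wronskian_carrier [simp]: "frob_wronskian k w \<in> carrier_mat k k"
  by (simp add: frob_wronskian_def)

lemma sum_atLeast0_lessThan: "sum f {0..<n::nat} = sum f {..<n}"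
  by (simp add: lessThan_atLeast0)

lemma det_frob_wronskian:
  assumes k: "0 < k" shows "det (frob_wronskian k w) \<noteq> 0"
proof
  assume "det (frob_wronskian k w) = 0"
  then obtain v where v: "v \<in> carrier_vec k" "v \<noteq> 0\<^sub>v k" "frob_wronskian k w *\<^sub>v v = 0\<^sub>v k"
    using det_0_iff_vec_prod_zero[OF frob_wronskian_carrier] by blast
  let ?F = "\<lambda>j w. \<Sum>i<k. v $ i * frob_sol k i j w"
  have "?F j w = 0" if "j < k" for j
  proof -
    have "(frob_wronskian k w *\<^sub>v v) $ j = ?F j w"
      using that v(1) by (simp add: frob_wronskian_def scalar_prod_def sum_atLeast0_lessThan mult.commute)
    then show ?thesis using v(3) that by simp
  qed
  then have "?F 0 x = 0" for x
    using k by (intro qde_solution_unique[of k ?F w 0] qde_solution_sum qde_solution_frob) auto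
  then have "v $ i = 0" if "i < k" for i
    using frob_sol_independent[OF k _ that, of "\<lambda>i. v $ i"] by blast
  then have "v = 0\<^sub>v k" using v(1) by (intro eq_vecI) auto
  with v(2) show False by contradiction
qed

lemma frob_sol_initial_values:
  assumes k: "0 < k"
  shows "\<exists>c. \<forall>j<k. (\<Sum>i<k. c i * frob_sol k i j p) = x j"
proof -
  obtain B where B: "B \<in> carrier_mat k k" "frob_wronskian k p * B = 1\<^sub>m k"
    using det_non_zero_imp_unit[OF frob_wronskian_carrier det_frob_wronskian[OF k], of p]
    by (auto simp: Units_def ring_mat_simps)
  define v where "v = B *\<^sub>v vec k x"
  have v: "v \<in> carrier_vec k" using B by (simp add: v_def)
  have "frob_wronskian k p *\<^sub>v v = vec k x"
    using B assoc_mult_mat_vec[of "frob_wronskian k p" k k B k "vec k x"]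
    by (simp add: v_def)
  then have "(frob_wronskian k p *\<^sub>v v) $ j = x j" if "j < k" for j using that by simp
  moreover have "(frob_wronskian k p *\<^sub>v v) $ j = (\<Sum>i<k. v $ i * frob_sol k i j p)" if "j < k" for j
    using that v by (simp add: frob_wronskian_def scalar_prod_def sum_atLeast0_lessThan mult.commute)
  ultimately show ?thesis by auto
qed

lemma qde_solution_frob_combination:
  assumes F: "qde_solution k F" and k: "0 < k"
  shows "\<exists>c. \<forall>j<k. \<forall>w. F j w = (\<Sum>i<k. c i * frob_sol k i j w)"
proof -
  obtain c where c: "\<And>j. j < k \<Longrightarrow> (\<Sum>i<k. c i * frob_sol k i j 0) = F j 0"
    using frob_sol_initial_values[OF k, of 0 "\<lambda>j. F j 0"] by blast
  have "qde_solution k (\<lambda>j w. F j w - (\<Sum>i<k. c i * frob_sol k i j w))"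
    by (intro qde_solution_diff F qde_solution_sum qde_solution_frob) auto
  then have "F j w - (\<Sum>i<k. c i * frob_sol k i j w) = 0" if "j < k" for j w
    by (rule qde_solution_unique[OF _ k, of _ 0]) (auto simp: c that)
  then show ?thesis by (intro exI[of _ c]) simp
qed

text \<open>Inherited from the Frobenius basis, every member of which is annihilated by the
  \<open>k\<close>-th power of (1 - shift). Together with the sectors of validity this relation
  determines the Stokes matrix.\<close>

lemma qde_solution_shift_relation:
  assumes F: "qde_solution k F" and k: "0 < k" and j: "j < k"
  shows "(\<Sum>m\<le>k. of_nat (k choose m) * (-1) ^ m * F j (w + 2 * of_real pi * \<i> * of_nat m / of_nat k)) = 0"
proof -
  obtain c where c: "\<And>j w. j < k \<Longrightarrow> F j w = (\<Sum>i<k. c i * frob_sol k i j w)"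
    using qde_solution_frob_combination[OF F k] by blast
  let ?s = "\<lambda>m. w + 2 * of_real pi * \<i> * of_nat m / of_nat k"
  have "(\<Sum>m\<le>k. of_nat (k choose m) * (-1) ^ m * F j (?s m)) =
    (\<Sum>i<k. c i * (\<Sum>m\<le>k. of_nat (k choose m) * (-1) ^ m * frob_sol k i j (?s m)))"
    by (simp add: c[OF j] sum_distrib_left sum.swap[of _ _ "{..<k}"] mult_ac)
  also have "\<dots> = 0"
    using k by (intro sum.neutral ballI) (simp add: frob_sol_shift_relation)
  finally show ?thesis .
qed

section \<open>The linear system\<close>

lemma roots_of_unity_sum:
  assumes k: "0 < k" and d: "\<bar>d\<bar> < int k"
  shows "(\<Sum>n<k. exp (2 * of_real pi * \<i> * of_int d * of_nat n / of_nat k)) = (if d = 0 then of_nat k else (0::complex))"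
proof (cases "d = 0")
  case False
  let ?x = "exp (2 * of_real pi * \<i> * of_int d / of_nat k) :: complex"
  have "?x ^ k = exp (of_int d * (of_real (2 * pi) * \<i>))"
    using k by (simp add: exp_of_nat_mult[symmetric] field_simps)
  also have "\<dots> = 1" using exp_integer_2pi[of "of_int d"] by (simp add: mult_ac)
  finally have xk: "?x ^ k = 1" .
  have x1: "?x \<noteq> 1"
  proof
    assume "?x = 1"
    then obtain n :: int where n: "2 * of_real pi * \<i> * of_int d / of_nat k = of_int (2 * n) * pi * \<i>"
      unfolding exp_eq_1 by (auto simp: complex_eq_iff)
    then have "2 * of_real pi * \<i> * (of_int d / of_nat k) = 2 * of_real pi * \<i> * (of_int n :: complex)"
      by (simp add: mult_ac)
    then have "of_int d / of_nat k = (of_int n :: complex)"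
      by (subst (asm) mult_cancel_left) simp
    then have "(of_int d :: complex) = of_int (n * int k)" using k by (simp add: field_simps)
    then have "d = n * int k" by (simp only: of_int_eq_iff)
    with d False show False
      by (metis abs_mult abs_of_nat dvd_imp_le_int dvd_triv_right not_less)
  qed
  have "(\<Sum>n<k. exp (2 * of_real pi * \<i> * of_int d * of_nat n / of_nat k)) = (\<Sum>n<k. ?x ^ n)"
    by (intro sum.cong refl) (simp add: exp_of_nat_mult[symmetric] mult_ac)
  also have "\<dots> = 0" using x1 xk by (simp add: geometric_sum)
  finally show ?thesis using False by simp
qed simp

text \<open>The column index is an integer, so that rotations of a solution can be counted beyond
  \<open>k\<close> and below 0; the entry is antiperiodic in it with period
  \<open>k\<close>.\<close>

definition X_entry :: "nat \<Rightarrow> nat \<Rightarrow> int \<Rightarrow> complex" where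
  "X_entry k j n = exp ((2 * of_nat j + 1) * \<i> * of_real pi * of_int n / of_nat k) / of_real (sqrt (real k))"

definition can :: "nat \<Rightarrow> int \<Rightarrow> complex" where
  "can k n = of_nat k * exp (2 * of_real pi * \<i> * of_int n / of_nat k)"

definition mu :: "nat \<Rightarrow> nat \<Rightarrow> complex" where
  "mu k j = (of_nat k - 1) / 2 - of_nat j"

definition V_entry :: "nat \<Rightarrow> nat \<Rightarrow> nat \<Rightarrow> complex" where
  "V_entry k n m = (\<Sum>j<k. cnj (X_entry k j (int n)) * mu k j * X_entry k j (int m))"

text \<open>
  If \<open>y\<close> is the solution of the system which corresponds to \<open>F\<close>, then \<open>gauged k F\<close> is \<open>X y\<close> and
  \<open>ycol k F\<close> is \<open>y\<close>.
\<close>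

definition gauged :: "nat \<Rightarrow> (nat \<Rightarrow> complex \<Rightarrow> complex) \<Rightarrow> nat \<Rightarrow> complex \<Rightarrow> complex" where
  "gauged k F j w = exp (w * mu k j) * F j w / of_nat k ^ j"

definition ycol :: "nat \<Rightarrow> (nat \<Rightarrow> complex \<Rightarrow> complex) \<Rightarrow> nat \<Rightarrow> complex \<Rightarrow> complex" where
  "ycol k F n w = (\<Sum>j<k. cnj (X_entry k j (int n)) * gauged k F j w)"

lemma norm_X_entry: "0 < k \<Longrightarrow> norm (X_entry k j n) = 1 / sqrt (real k)"
  by (simp add: X_entry_def norm_divide norm_exp_eq_Re)

lemma cnj_X_entry: "cnj (X_entry k j n) = X_entry k j (- n)"
  by (simp add: X_entry_def exp_cnj)

lemma X_entry_mult: "0 < k \<Longrightarrow> X_entry k j m * X_entry k l n =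
  exp (((2 * of_nat j + 1) * of_int m + (2 * of_nat l + 1) * of_int n) * \<i> * of_real pi / of_nat k) / of_nat k"
proof -
  assume "0 < k"
  have "(of_real (sqrt (real k)) * of_real (sqrt (real k)) :: complex) = of_nat k"
    by (simp flip: of_real_mult)
  then show ?thesis
    by (simp add: X_entry_def exp_add[symmetric] add_divide_distrib algebra_simps)
qed

lemma X_unitary_columns:
  assumes "n < k" "m < k"
  shows "(\<Sum>j<k. cnj (X_entry k j (int n)) * X_entry k j (int m)) = (if n = m then 1 else 0)"
proof -
  have k: "0 < k" using assms by simp
  let ?d = "int m - int n"
  have "cnj (X_entry k j (int n)) * X_entry k j (int m) =
     exp (of_int ?d * \<i> * of_real pi / of_nat k) / of_nat k * exp (2 * of_real pi * \<i> * of_int ?d * of_nat j / of_nat k)" for j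
    by (simp add: cnj_X_entry X_entry_mult[OF k] exp_add[symmetric] add_divide_distrib algebra_simps diff_divide_distrib)
  then have "(\<Sum>j<k. cnj (X_entry k j (int n)) * X_entry k j (int m)) =
      exp (of_int ?d * \<i> * of_real pi / of_nat k) / of_nat k * (\<Sum>j<k. exp (2 * of_real pi * \<i> * of_int ?d * of_nat j / of_nat k))"
    by (simp add: sum_distrib_left)
  also have "\<dots> = (if n = m then 1 else 0)"
    using assms k by (subst roots_of_unity_sum) auto
  finally show ?thesis .
qed

lemma X_unitary_rows:
  assumes "j < k" "l < k"
  shows "(\<Sum>n<k. X_entry k j (int n) * cnj (X_entry k l (int n))) = (if j = l then 1 else 0)"
proof -
  have k: "0 < k" using assms by simp
  let ?d = "int j - int l"
  have "X_entry k j (int n) * cnj (X_entry k l (int n)) =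
     exp (2 * of_real pi * \<i> * of_int ?d * of_nat n / of_nat k) / of_nat k" for n
    by (simp add: cnj_X_entry X_entry_mult[OF k] algebra_simps)
  then have "(\<Sum>n<k. X_entry k j (int n) * cnj (X_entry k l (int n))) =
      (\<Sum>n<k. exp (2 * of_real pi * \<i> * of_int ?d * of_nat n / of_nat k)) / of_nat k"
    by (simp add: sum_divide_distrib)
  also have "\<dots> = (if j = l then 1 else 0)"
    using assms k by (subst roots_of_unity_sum) auto
  finally show ?thesis .
qed

lemma gauged_eq_sum_ycol:
  assumes "j < k" shows "gauged k F j w = (\<Sum>n<k. X_entry k j (int n) * ycol k F n w)"
proof -
  have "(\<Sum>n<k. X_entry k j (int n) * ycol k F n w) =
     (\<Sum>l<k. gauged k F l w * (\<Sum>n<k. X_entry k j (int n) * cnj (X_entry k l (int n))))"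
    unfolding ycol_def sum_distrib_left by (subst sum.swap) (simp add: mult_ac)
  also have "\<dots> = (\<Sum>l<k. if l = j then gauged k F l w else 0)"
    using assms by (intro sum.cong refl) (auto simp: X_unitary_rows)
  also have "\<dots> = gauged k F j w" using assms by simp
  finally show ?thesis by simp
qed

text \<open>The weights \<open>mu k j\<close> drop by one at each step, so
  \<open>exp (w * mu k j)\<close> provides the factor \<open>exp w = z\<close> in front of the next
  component. At the step from \<open>k - 1\<close> back to \<open>0\<close> the factor
  \<open>exp (k w)\<close> of the scalar equation makes up for the jump of the weights.\<close>

lemma gauged_deriv:
  assumes F: "qde_solution k F" and j: "j < k"
  shows "(gauged k F j has_field_derivative
    mu k j * gauged k F j w + of_nat k * exp w * gauged k F (if Suc j < k then Suc j else 0) w) (at w)"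
proof -
  have k: "of_nat k \<noteq> (0 :: complex)" using j by auto
  let ?D = "if Suc j < k then F (Suc j) w else of_nat k ^ k * exp (of_nat k * w) * F 0 w"
  have "(gauged k F j has_field_derivative
     (exp (w * mu k j) * ?D + exp (w * mu k j) * mu k j * F j w) / of_nat k ^ j) (at w)"
    unfolding gauged_def
    by (intro DERIV_cdivide DERIV_mult' qde_solutionD[OF F j]) (auto intro!: derivative_eq_intros)
  moreover have "exp (w * mu k j) * ?D / of_nat k ^ j = of_nat k * exp w * gauged k F (if Suc j < k then Suc j else 0) w"
  proof (cases "Suc j < k")
    case True
    have "exp (w * mu k j) = exp w * exp (w * mu k (Suc j))"
      by (simp add: exp_add[symmetric] mu_def algebra_simps)
    with True k show ?thesis by (simp add: gauged_def field_simps)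
  next
    case False
    then have kj: "k = Suc j" using j by simp
    have "exp (w * mu k j) * exp (of_nat k * w) = exp w * exp (w * mu k 0)"
      by (simp add: exp_add[symmetric] mu_def algebra_simps kj)
    moreover have "exp (w * mu k j) * (of_nat k ^ k * exp (of_nat k * w) * F 0 w) / of_nat k ^ j =
        (exp (w * mu k j) * exp (of_nat k * w)) * F 0 w * (of_nat k ^ k / of_nat k ^ j)"
      by simp
    moreover have "of_nat k ^ k / of_nat k ^ j = (of_nat k :: complex)"
      using k by (subst (2) kj) simp
    ultimately show ?thesis using False by (simp add: gauged_def mult_ac)
  qed
  ultimately show ?thesis by (simp add: add_divide_distrib gauged_def algebra_simps)
qed

text \<open>For fixed \<open>n\<close> the conjugated entries form an eigenvector of the cyclic
  shift of \<open>j\<close>; they close up at \<open>j = k\<close> because \<open>n\<close> is an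
  integer. This is what makes the leading matrix of the system diagonal with entries
  \<open>can k n\<close>.\<close>

lemma X_entry_cyclic:
  assumes "j < k"
  shows "of_nat k * cnj (X_entry k j n) = can k n * cnj (X_entry k (if Suc j < k then Suc j else 0) n)"
proof -
  have k: "of_nat k \<noteq> (0::complex)" using assms by auto
  have 1: "of_nat k * cnj (X_entry k j n) = can k n * cnj (X_entry k (Suc j) n)"
    using k unfolding cnj_X_entry by (simp add: X_entry_def can_def exp_add[symmetric] field_simps)
  have "X_entry k k (- n) = X_entry k 0 (- n)"
  proof -
    have "(2 * of_nat k + 1) * \<i> * of_real pi * of_int (- n) / of_nat k =
       (2 * of_nat 0 + 1) * \<i> * of_real pi * of_int (- n) / of_nat k + 2 * of_int (- n) * of_real pi * \<i>"
      using k by (simp add: field_simps)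
    then show ?thesis
      using exp_integer_2pi[of "of_int (- n)"] unfolding X_entry_def by (simp only: exp_add) (simp add: mult_ac)
  qed
  moreover have "k = Suc j" if "\<not> Suc j < k" using that assms by simp
  ultimately show ?thesis
    using 1 by (cases "Suc j < k") (auto simp: cnj_X_entry)
qed

lemma ycol_deriv:
  assumes F: "qde_solution k F" and n: "n < k"
  shows "(ycol k F n has_field_derivative
    exp w * can k (int n) * ycol k F n w + (\<Sum>m<k. V_entry k n m * ycol k F m w)) (at w)"
proof -
  let ?s = "\<lambda>j. if Suc j < k then Suc j else 0"
  have "(ycol k F n has_field_derivative
     (\<Sum>j<k. cnj (X_entry k j (int n)) * (mu k j * gauged k F j w + of_nat k * exp w * gauged k F (?s j) w))) (at w)"
    unfolding ycol_def by (intro DERIV_sum DERIV_cmult gauged_deriv F) auto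
  moreover have "(\<Sum>j<k. cnj (X_entry k j (int n)) * (mu k j * gauged k F j w + of_nat k * exp w * gauged k F (?s j) w))
     = (\<Sum>j<k. cnj (X_entry k j (int n)) * mu k j * gauged k F j w)
       + exp w * (\<Sum>j<k. of_nat k * cnj (X_entry k j (int n)) * gauged k F (?s j) w)"
    by (simp add: sum.distrib sum_distrib_left algebra_simps)
  moreover have "(\<Sum>j<k. of_nat k * cnj (X_entry k j (int n)) * gauged k F (?s j) w) = can k (int n) * ycol k F n w"
  proof -
    have "(\<Sum>j<k. of_nat k * cnj (X_entry k j (int n)) * gauged k F (?s j) w) =
       (\<Sum>j<k. (\<lambda>l. can k (int n) * cnj (X_entry k l (int n)) * gauged k F l w) (?s j))"
      by (intro sum.cong refl) (simp add: X_entry_cyclic)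
    also have "\<dots> = (\<Sum>l<k. can k (int n) * cnj (X_entry k l (int n)) * gauged k F l w)"
    proof (rule sum.reindex_bij_betw)
      show "bij_betw ?s {..<k} {..<k}"
        using n by (intro bij_betw_byWitness[where f' = "\<lambda>l. if l = 0 then k - 1 else l - 1"]) auto
    qed
    also have "\<dots> = can k (int n) * ycol k F n w"
      by (simp add: ycol_def sum_distrib_left mult_ac)
    finally show ?thesis .
  qed
  moreover have "(\<Sum>j<k. cnj (X_entry k j (int n)) * mu k j * gauged k F j w) = (\<Sum>m<k. V_entry k n m * ycol k F m w)"
  proof -
    have "(\<Sum>j<k. cnj (X_entry k j (int n)) * mu k j * gauged k F j w) =
       (\<Sum>j<k. \<Sum>m<k. cnj (X_entry k j (int n)) * mu k j * X_entry k j (int m) * ycol k F m w)"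
      by (intro sum.cong refl) (simp add: gauged_eq_sum_ycol sum_distrib_left mult_ac)
    also have "\<dots> = (\<Sum>m<k. V_entry k n m * ycol k F m w)"
      by (subst sum.swap) (simp add: V_entry_def sum_distrib_right)
    finally show ?thesis .
  qed
  ultimately show ?thesis by (simp add: algebra_simps)
qed

text \<open>All entries of \<open>X\<close> have the same modulus, so a diagonal entry of
  \<open>V\<close> is the mean of the numbers \<open>mu k j\<close>, whose sum is 0. A nonzero
  diagonal could not be removed by \<open>gauge1\<close>.\<close>

lemma V_entry_diag: assumes "0 < k" shows "V_entry k n n = 0"
proof -
  have "V_entry k n n = (\<Sum>j<k. mu k j * (X_entry k j (int n) * cnj (X_entry k j (int n))))"
    by (simp add: V_entry_def mult_ac)
  also have "\<dots> = (\<Sum>j<k. mu k j) / of_nat k"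
    using assms by (simp add: complex_norm_square[symmetric] norm_X_entry power_divide sum_divide_distrib)
  also have "(\<Sum>j<k. mu k j) = 0"
  proof -
    have "(\<Sum>j<k. of_nat j :: complex) = of_nat k * (of_nat k - 1) / 2" by (induction k) (auto simp: field_simps)
    then show ?thesis by (simp add: mu_def sum_subtractf)
  qed
  finally show ?thesis by simp
qed

lemma can_inj:
  assumes "n < k" "m < k" "can k (int n) = can k (int m)" shows "n = m"
proof (rule ccontr)
  assume "n \<noteq> m"
  have k: "0 < k" using assms by simp
  have "exp (2 * of_real pi * \<i> * of_int (int n - int m) / of_nat k) = (1::complex)"
    using assms(3) k by (simp add: can_def exp_diff right_diff_distrib diff_divide_distrib)
  then have "(\<Sum>j<k. exp (2 * of_real pi * \<i> * of_int (int n - int m) / of_nat k) ^ j) = (of_nat k :: complex)"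
    by simp
  also have "(\<Sum>j<k. exp (2 * of_real pi * \<i> * of_int (int n - int m) / of_nat k) ^ j) =
     (\<Sum>j<k. exp (2 * of_real pi * \<i> * of_int (int n - int m) * of_nat j / of_nat k) :: complex)"
    by (intro sum.cong refl) (simp add: exp_of_nat_mult[symmetric] mult_ac)
  also have "\<dots> = 0"
    using assms k \<open>n \<noteq> m\<close> by (subst roots_of_unity_sum) auto
  finally show False using k by simp
qed

text \<open>
  The first term of the formal solution: the transformation \<open>1 - gauge1/z\<close> removes the term \<open>V/z\<close>
  of the system, so that what remains besides the diagonal part is integrable along rays.
\<close>

definition gauge1 :: "nat \<Rightarrow> nat \<Rightarrow> nat \<Rightarrow> complex" where
  "gauge1 k n m = (if n = m then 0 else V_entry k n m / (can k (int m) - can k (int n)))"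

lemma gauge1: "n < k \<Longrightarrow> m < k \<Longrightarrow> gauge1 k n m * (can k (int m) - can k (int n)) = V_entry k n m"
  using can_inj[of m k n] by (auto simp: gauge1_def V_entry_diag)

text \<open>The solution after the transformation \<open>1 - gauge1/z\<close> and division by the
  exponential of index 0; for the recessive solution its limit is the vector
  \<open>(1, 0, ..., 0)\<close>.\<close>

definition normalized :: "nat \<Rightarrow> (nat \<Rightarrow> complex \<Rightarrow> complex) \<Rightarrow> nat \<Rightarrow> complex \<Rightarrow> complex" where
  "normalized k F n w = exp (- of_nat k * exp w) *
     (ycol k F n w - exp (- w) * (\<Sum>m<k. gauge1 k n m * ycol k F m w))"

lemma can_0 [simp]: "can k 0 = of_nat k" by (simp add: can_def)

text \<open>The commutator of \<open>gauge1\<close> with the diagonal matrix is \<open>V\<close>, so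
  the terms of order 1 cancel. The remainder has order \<open>1/z\<close> with respect to
  \<open>d/dw\<close>, that is \<open>1/z^2\<close> with respect to \<open>d/dz\<close>, which is
  integrable along rays.\<close>

lemma normalized_deriv:
  assumes F: "qde_solution k F" and n: "n < k"
  shows "(normalized k F n has_field_derivative
    exp w * (can k (int n) - of_nat k) * normalized k F n w +
    exp (- w) * (\<Sum>m<k. (gauge1 k n m - (\<Sum>l<k. gauge1 k n l * V_entry k l m)) *
       (exp (- of_nat k * exp w) * ycol k F m w))) (at w)"
proof -
  let ?v = "\<lambda>n. ycol k F n w"
  let ?D = "\<lambda>n. exp w * can k (int n) * ?v n + (\<Sum>m<k. V_entry k n m * ?v m)"
  let ?S = "\<Sum>m<k. gauge1 k n m * ?v m"
  have "(normalized k F n has_field_derivative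
     exp (- of_nat k * exp w) * (?D n - (exp (- w) * (\<Sum>m<k. gauge1 k n m * ?D m) + - exp (- w) * ?S)) +
     - of_nat k * exp w * exp (- of_nat k * exp w) * (?v n - exp (- w) * ?S)) (at w)"
    unfolding normalized_def
    by (intro DERIV_mult' DERIV_diff DERIV_sum DERIV_cmult ycol_deriv F n)
      (auto intro!: derivative_eq_intros)
  moreover have "(\<Sum>m<k. gauge1 k n m * ?D m) = exp w * can k (int n) * ?S + exp w * (\<Sum>m<k. V_entry k n m * ?v m)
       + (\<Sum>m<k. (\<Sum>l<k. gauge1 k n l * V_entry k l m) * ?v m)"
  proof -
    have "(\<Sum>m<k. gauge1 k n m * ?D m) = exp w * (\<Sum>m<k. gauge1 k n m * can k (int m) * ?v m) +
        (\<Sum>l<k. \<Sum>m<k. gauge1 k n l * V_entry k l m * ?v m)"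
      by (simp add: distrib_left sum.distrib sum_distrib_left mult_ac)
    also have "(\<Sum>m<k. gauge1 k n m * can k (int m) * ?v m) =
        can k (int n) * ?S + (\<Sum>m<k. V_entry k n m * ?v m)"
      using n by (simp add: gauge1[symmetric] sum.distrib[symmetric] sum_distrib_left algebra_simps)
    finally show ?thesis
      by (subst (asm) sum.swap) (simp add: sum_distrib_right algebra_simps, simp add: sum_distrib_left mult_ac)
  qed
  moreover have "exp (- w) * exp w = 1" by (simp flip: exp_add)
  ultimately show ?thesis
    by (elim DERIV_cong)
      (simp add: normalized_def left_diff_distrib sum_subtractf sum_distrib_left[symmetric] mult.left_commute[of _ "exp (- (of_nat k * exp w))"],
       simp add: algebra_simps, algebra)
qed

section \<open>Estimates along rays\<close>

text \<open>A maximum argument in place of Gronwall's inequality. If \<open>M\<close> is the largest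
  deviation over all components and all times, integration from \<open>T\<close> back to
  \<open>t\<close> gives \<open>M \<le> \<eta> + A (K + k M) / r\<close>, where \<open>K\<close> is
  the sum of the norms of the \<open>\<delta> m\<close>. As \<open>2 k A \<le> r\<close>, the term
  with \<open>M\<close> on the right is at most \<open>M / 2\<close> and can be absorbed.\<close>

lemma backward_estimate:
  fixes g :: "nat \<Rightarrow> real \<Rightarrow> complex" and \<alpha> \<delta> :: "nat \<Rightarrow> complex"
  assumes k: "0 < k" and T: "0 \<le> T" and r: "0 < r" and A: "0 \<le> A" "2 * real k * A \<le> r"
    and deriv: "\<And>n t. n < k \<Longrightarrow> t \<in> {0..T} \<Longrightarrow> (g n has_vector_derivative \<alpha> n * g n t + err n t) (at t)"
    and \<alpha>: "\<And>n. n < k \<Longrightarrow> 0 \<le> Re (\<alpha> n)" and \<delta>: "\<And>n. n < k \<Longrightarrow> \<alpha> n * \<delta> n = 0"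
    and err: "\<And>n t. n < k \<Longrightarrow> t \<in> {0..T} \<Longrightarrow> norm (err n t) \<le> A / (r + t)\<^sup>2 * (\<Sum>m<k. norm (g m t))"
    and \<eta>: "\<And>n. n < k \<Longrightarrow> norm (g n T - \<delta> n) \<le> \<eta>"
    and n: "n < k"
  shows "norm (g n 0 - \<delta> n) \<le> 2 * \<eta> + 2 * A * (\<Sum>m<k. norm (\<delta> m)) / r"
proof -
  have cont: "continuous_on {0..T} (\<lambda>t. norm (g n t - \<delta> n))" if "n < k" for n
    using deriv[OF that]
    by (intro continuous_intros continuous_at_imp_continuous_on ballI has_vector_derivative_continuous) auto
  have "\<exists>s\<in>{0..T}. \<forall>t\<in>{0..T}. norm (g n t - \<delta> n) \<le> norm (g n s - \<delta> n)" if "n < k" for n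
    using T by (intro continuous_attains_sup cont that) auto
  then obtain s where s: "\<And>n. n < k \<Longrightarrow> s n \<in> {0..T}"
    "\<And>n t. n < k \<Longrightarrow> t \<in> {0..T} \<Longrightarrow> norm (g n t - \<delta> n) \<le> norm (g n (s n) - \<delta> n)"
    by metis
  define M where "M = Max ((\<lambda>n. norm (g n (s n) - \<delta> n)) ` {..<k})"
  define K where "K = (\<Sum>m<k. norm (\<delta> m))"
  have M_in: "M \<in> (\<lambda>n. norm (g n (s n) - \<delta> n)) ` {..<k}"
    unfolding M_def using k by (intro Max_in) auto
  then have M0: "0 \<le> M" by auto
  have K0: "0 \<le> K" by (simp add: K_def sum_nonneg)
  have M_ge: "norm (g n t - \<delta> n) \<le> M" if "n < k" "t \<in> {0..T}" for n t
    using s(2)[OF that] that(1) unfolding M_def by (intro order_trans[OF _ Max_ge]) auto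
  have \<eta>0: "0 \<le> \<eta>" using order_trans[OF norm_ge_zero \<eta>[OF n]] .
  have err': "norm (err n t) \<le> A / (r + t)\<^sup>2 * (K + real k * M)" if "n < k" "t \<in> {0..T}" for n t
  proof -
    have "(\<Sum>m<k. norm (g m t)) \<le> (\<Sum>m<k. norm (\<delta> m) + M)"
    proof (rule sum_mono)
      fix m assume "m \<in> {..<k}"
      then show "norm (g m t) \<le> norm (\<delta> m) + M"
        using M_ge[of m t] that norm_triangle_sub[of "g m t" "\<delta> m"] by auto
    qed
    then have "(\<Sum>m<k. norm (g m t)) \<le> K + real k * M"
      by (simp add: sum.distrib K_def)
    then show ?thesis
      using A(1) by (intro order_trans[OF err[OF that]] mult_left_mono) auto
  qed
  have step: "norm (g n t - \<delta> n) \<le> \<eta> + A * (K + real k * M) / r" if n: "n < k" and t: "t \<in> {0..T}" for n t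
  proof (cases "t = T")
    case True
    moreover have "0 \<le> A * (K + real k * M) / r" using A r K0 M0 by simp
    ultimately show ?thesis using \<eta>[OF n] by simp
  next
    case False
    \<comment> \<open>The integrating factor is normalized to 1 at \<open>t\<close>; for later
      \<open>x\<close> its modulus is at most 1 because \<open>Re (\<alpha> n) \<ge> 0\<close>.
      Subtracting \<open>\<delta> n\<close> is compatible with the equation since
      \<open>\<alpha> n * \<delta> n = 0\<close>.\<close>
    define f where "f = (\<lambda>x::real. exp (- \<alpha> n * of_real (x - t)) * (g n x - \<delta> n))"
    define C where "C = A * (K + real k * M)"
    have f': "(f has_vector_derivative exp (- \<alpha> n * of_real (x - t)) * err n x) (at x)" if "x \<in> {0..T}" for x
    proof -
      have "((\<lambda>x::real. exp (- \<alpha> n * of_real (x - t))) has_vector_derivative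
          - \<alpha> n * exp (- \<alpha> n * of_real (x - t))) (at x)"
        unfolding of_real_diff
        by (rule has_vector_derivative_real_field) (auto intro!: derivative_eq_intros)
      moreover have "((\<lambda>x. g n x - \<delta> n) has_vector_derivative \<alpha> n * g n x + err n x) (at x)"
        using has_vector_derivative_diff[OF deriv[OF n that] has_vector_derivative_const[of "\<delta> n"]] by simp
      ultimately have "(f has_vector_derivative exp (- \<alpha> n * of_real (x - t)) * (\<alpha> n * g n x + err n x)
         + - \<alpha> n * exp (- \<alpha> n * of_real (x - t)) * (g n x - \<delta> n)) (at x)"
        unfolding f_def by (rule has_vector_derivative_mult)
      then show ?thesis
        using \<delta>[OF n] by (auto simp: algebra_simps)
    qed
    \<comment> \<open>The mean value inequality against \<open>- C / (r + x)\<close>, a primitive of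
      the bound for the derivative.\<close>
    have "norm (f T - f t) \<le> - C / (r + T) - (- C / (r + t))"
    proof (rule differentiable_bound_general[where f' = "\<lambda>x. exp (- \<alpha> n * of_real (x - t)) * err n x"
          and \<phi>' = "\<lambda>x. C / (r + x)\<^sup>2" and \<phi> = "\<lambda>x. - C / (r + x)"])
      show "t < T" using t False by auto
      show "continuous_on {t..T} f"
        using t by (intro continuous_at_imp_continuous_on ballI has_vector_derivative_continuous[OF f']) auto
      show "continuous_on {t..T} (\<lambda>x. - C / (r + x))"
        using r t by (intro continuous_intros) auto
      fix x assume x: "t < x" "x < T"
      show "(f has_vector_derivative exp (- \<alpha> n * of_real (x - t)) * err n x) (at x)"
        using f'[of x] x t by auto
      show "((\<lambda>x. - C / (r + x)) has_vector_derivative C / (r + x)\<^sup>2) (at x)"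
        unfolding has_real_derivative_iff_has_vector_derivative[symmetric]
        using r t x by (auto intro!: derivative_eq_intros simp: power2_eq_square)
      have "norm (exp (- \<alpha> n * of_real (x - t))) \<le> 1"
        using \<alpha>[OF n] x by (simp add: norm_exp_eq_Re)
      then have "norm (exp (- \<alpha> n * of_real (x - t)) * err n x) \<le> norm (err n x)"
        by (simp add: norm_mult mult_left_le_one_le)
      also have "\<dots> \<le> A / (r + x)\<^sup>2 * (K + real k * M)"
        using err'[OF n, of x] x t by auto
      finally show "norm (exp (- \<alpha> n * of_real (x - t)) * err n x) \<le> C / (r + x)\<^sup>2"
        by (simp add: C_def)
    qed
    moreover have "0 \<le> C / (r + T)" "C / (r + t) \<le> C / r"
      using A K0 M0 r t T by (auto simp: C_def intro!: divide_left_mono)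
    ultimately have "norm (f T - f t) \<le> C / r" by (simp add: field_simps)
    moreover have "norm (f T) \<le> \<eta>"
    proof -
      have "norm (exp (- \<alpha> n * of_real (T - t))) \<le> 1"
        using \<alpha>[OF n] t by (simp add: norm_exp_eq_Re)
      then have "norm (f T) \<le> norm (g n T - \<delta> n)"
        by (simp add: f_def norm_mult mult_left_le_one_le)
      then show ?thesis using \<eta>[OF n] by simp
    qed
    moreover have "norm (f t) \<le> norm (f T) + norm (f T - f t)"
      by (metis norm_minus_commute norm_triangle_sub)
    ultimately show ?thesis by (simp add: f_def C_def)
  qed
  have "M \<le> \<eta> + A * (K + real k * M) / r"
    using M_in step s(1) by auto
  also have "\<dots> = \<eta> + A * K / r + (real k * A / r) * M"
    by (simp add: algebra_simps add_divide_distrib)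
  also have "\<dots> \<le> \<eta> + A * K / r + 1 / 2 * M"
    using A r M0 by (intro add_left_mono mult_right_mono) (auto simp: field_simps)
  finally have "M \<le> 2 * \<eta> + 2 * A * K / r" by simp
  with M_ge[OF n, of 0] T show ?thesis by (simp add: K_def)
qed

text \<open>The bound follows from the identity with remainder
  \<open>(1 + c) / 2 * (r - t)^2\<close>. Geometrically, a ray whose start stays away from the
  direction opposite to it keeps a distance from 0 comparable with \<open>r + t\<close>.\<close>

lemma norm_add_of_real_ge:
  fixes \<zeta> :: complex
  assumes \<zeta>: "\<zeta> = of_real r * cis \<beta>" and r: "0 \<le> r" and t: "0 \<le> t" and c: "- c \<le> cos \<beta>" "\<bar>c\<bar> \<le> 1"
  shows "sqrt ((1 - c) / 2) * (r + t) \<le> norm (\<zeta> + of_real t)"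
proof -
  have "(norm (\<zeta> + of_real t))\<^sup>2 = (r * cos \<beta> + t)\<^sup>2 + (r * sin \<beta>)\<^sup>2"
    by (simp add: cmod_power2 \<zeta>)
  also have "\<dots> = r\<^sup>2 * ((sin \<beta>)\<^sup>2 + (cos \<beta>)\<^sup>2) + t\<^sup>2 + 2 * (r * t) * cos \<beta>"
    by (simp add: power2_eq_square algebra_simps del: sin_cos_squared_add sin_cos_squared_add2 sin_cos_squared_add3)
  also have "\<dots> \<ge> r\<^sup>2 + t\<^sup>2 + 2 * (r * t) * (- c)"
    using r t c by (simp only: sin_cos_squared_add) (intro add_mono mult_left_mono, auto)
  moreover have "r\<^sup>2 + t\<^sup>2 + 2 * (r * t) * (- c) - (1 - c) / 2 * (r + t)\<^sup>2 = (1 + c) / 2 * (r - t)\<^sup>2"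
    by (simp add: power2_eq_square field_simps)
  moreover have "0 \<le> (1 + c) / 2 * (r - t)\<^sup>2" using c by simp
  ultimately have "(1 - c) / 2 * (r + t)\<^sup>2 \<le> (norm (\<zeta> + of_real t))\<^sup>2" by linarith
  then have "sqrt ((1 - c) / 2 * (r + t)\<^sup>2) \<le> norm (\<zeta> + of_real t)"
    by (rule real_le_lsqrt[OF norm_ge_zero, rotated]) 
  moreover have "sqrt ((1 - c) / 2 * (r + t)\<^sup>2) = sqrt ((1 - c) / 2) * (r + t)"
    using r t by (simp only: real_sqrt_mult real_sqrt_abs)
  ultimately show ?thesis by simp
qed

text \<open>The half-line \<open>exp w + t e\<^sup>i\<^sup>\<theta>\<close>, \<open>t \<ge> 0\<close>, in the coordinate \<open>w\<close>.\<close>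

definition ray :: "real \<Rightarrow> complex \<Rightarrow> real \<Rightarrow> complex" where
  "ray \<theta> w t = \<i> * of_real \<theta> + Ln (exp (w - \<i> * of_real \<theta>) + of_real t)"

section \<open>Rays in the logarithmic coordinate and the estimate along them\<close>

lemma exp_shift_polar: "exp (w - \<i> * of_real \<theta>) = of_real (exp (Re w)) * cis (Im w - \<theta>)"
  by (simp add: exp_eq_polar)

lemma ray_slit_plane:
  assumes "\<bar>Im w - \<theta>\<bar> < pi" "0 \<le> t"
  shows "exp (w - \<i> * of_real \<theta>) + of_real t \<notin> \<real>\<^sub>\<le>\<^sub>0"
proof
  let ?\<beta> = "Im w - \<theta>"
  assume "exp (w - \<i> * of_real \<theta>) + of_real t \<in> \<real>\<^sub>\<le>\<^sub>0"
  then have "exp (Re w) * sin ?\<beta> = 0" "exp (Re w) * cos ?\<beta> + t \<le> 0"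
    by (auto simp: complex_nonpos_Reals_iff exp_shift_polar)
  then have s: "sin ?\<beta> = 0" and c: "exp (Re w) * cos ?\<beta> + t \<le> 0" by auto
  have "?\<beta> = 0"
    using s assms(1) sin_gt_zero[of ?\<beta>] sin_gt_zero[of "- ?\<beta>"] sin_minus[of ?\<beta>] by (cases "?\<beta>" "0::real" rule: linorder_cases) auto
  with c assms(2) show False using exp_gt_zero[of "Re w"] by (auto simp: not_le[symmetric])
qed

lemma ray_0: "\<bar>Im w - \<theta>\<bar> < pi \<Longrightarrow> ray \<theta> w 0 = w"
  by (simp add: ray_def abs_less_iff)

lemma exp_ray:
  assumes "\<bar>Im w - \<theta>\<bar> < pi" "0 \<le> t"
  shows "exp (ray \<theta> w t) = exp (\<i> * of_real \<theta>) * (exp (w - \<i> * of_real \<theta>) + of_real t)"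
proof -
  have "exp (w - \<i> * of_real \<theta>) + of_real t \<noteq> 0" using ray_slit_plane[OF assms] by auto
  then show ?thesis by (simp add: ray_def exp_add)
qed

lemma ray_deriv:
  assumes "\<bar>Im w - \<theta>\<bar> < pi" "0 \<le> t"
  shows "(ray \<theta> w has_vector_derivative exp (\<i> * of_real \<theta>) * exp (- ray \<theta> w t)) (at t)"
proof -
  have "((\<lambda>z. \<i> * of_real \<theta> + Ln (exp (w - \<i> * of_real \<theta>) + z)) has_field_derivative
      inverse (exp (w - \<i> * of_real \<theta>) + of_real t)) (at (of_real t))"
    using ray_slit_plane[OF assms] by (auto intro!: derivative_eq_intros)
  then have "(ray \<theta> w has_vector_derivative inverse (exp (w - \<i> * of_real \<theta>) + of_real t)) (at t)"
    unfolding ray_def[abs_def] by (rule has_vector_derivative_real_field)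
  also have "inverse (exp (w - \<i> * of_real \<theta>) + of_real t) = exp (\<i> * of_real \<theta>) * exp (- ray \<theta> w t)"
    by (simp add: exp_minus exp_ray[OF assms])
  finally show ?thesis .
qed

lemma exists_norm_bound:
  fixes f :: "nat \<Rightarrow> nat \<Rightarrow> complex"
  shows "\<exists>B>0. \<forall>n<k. \<forall>m<k. norm (f n m) \<le> B"
proof (intro exI conjI allI impI)
  let ?B = "(\<Sum>n<k. \<Sum>m<k. norm (f n m)) + 1"
  have "0 \<le> (\<Sum>n<k. \<Sum>m<k. norm (f n m))" by (intro sum_nonneg) auto
  then show "0 < ?B" by simp
  fix n m assume nm: "n < k" "m < k"
  have "norm (f n m) \<le> (\<Sum>m<k. norm (f n m))" using nm by (intro member_le_sum) auto
  also have "\<dots> \<le> (\<Sum>n<k. \<Sum>m<k. norm (f n m))"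
    using nm by (intro member_le_sum[of n "{..<k}" "\<lambda>n. \<Sum>m<k. norm (f n m)"]) (auto intro: sum_nonneg)
  finally show "norm (f n m) \<le> ?B" by simp
qed

definition scaled :: "nat \<Rightarrow> (nat \<Rightarrow> complex \<Rightarrow> complex) \<Rightarrow> nat \<Rightarrow> complex \<Rightarrow> complex" where
  "scaled k F n w = exp (- of_nat k * exp w) * ycol k F n w"

lemma normalized_scaled:
  "normalized k F n w = scaled k F n w - exp (- w) * (\<Sum>m<k. gauge1 k n m * scaled k F m w)"
  by (simp add: normalized_def scaled_def sum_distrib_left algebra_simps)

text \<open>The two vectors differ by the matrix \<open>1 - gauge1/z\<close>, which is close to the
  identity for large \<open>z\<close>; the condition with \<open>1 / 2\<close> makes its inverse
  bounded by 2 in the sum norm.\<close>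

lemma scaled_normalized_bound:
  "\<exists>B>0. \<forall>F w. real k * B * exp (- Re w) \<le> 1 / 2 \<longrightarrow>
     (\<forall>n<k. norm (normalized k F n w - scaled k F n w) \<le> B * exp (- Re w) * (\<Sum>m<k. norm (scaled k F m w))) \<and>
     (\<Sum>m<k. norm (scaled k F m w)) \<le> 2 * (\<Sum>m<k. norm (normalized k F m w))"
proof -
  obtain B where B: "B > 0" "\<And>n m. n < k \<Longrightarrow> m < k \<Longrightarrow> norm (gauge1 k n m) \<le> B"
    using exists_norm_bound[of k "gauge1 k"] by blast
  show ?thesis
  proof (intro exI[of _ B] conjI allI impI)
    show "B > 0" by fact
    fix F w assume small: "real k * B * exp (- Re w) \<le> 1 / 2"
    let ?S = "\<Sum>m<k. norm (scaled k F m w)"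
    show 1: "norm (normalized k F n w - scaled k F n w) \<le> B * exp (- Re w) * ?S" if n: "n < k" for n
    proof -
      have "norm (normalized k F n w - scaled k F n w) = exp (- Re w) * norm (\<Sum>m<k. gauge1 k n m * scaled k F m w)"
        by (simp add: normalized_scaled norm_mult norm_exp_eq_Re)
      also have "norm (\<Sum>m<k. gauge1 k n m * scaled k F m w) \<le> (\<Sum>m<k. B * norm (scaled k F m w))"
        using B n by (intro order_trans[OF norm_sum] sum_mono) (auto simp: norm_mult intro!: mult_right_mono)
      finally show ?thesis by (simp add: sum_distrib_left mult_ac)
    qed
    have "?S \<le> (\<Sum>m<k. norm (normalized k F m w) + B * exp (- Re w) * ?S)"
    proof (rule sum_mono)
      fix m assume "m \<in> {..<k}"
      then show "norm (scaled k F m w) \<le> norm (normalized k F m w) + B * exp (- Re w) * ?S"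
        using 1[of m] norm_triangle_sub[of "scaled k F m w" "normalized k F m w"]
        by (simp add: norm_minus_commute)
    qed
    also have "\<dots> = (\<Sum>m<k. norm (normalized k F m w)) + (real k * B * exp (- Re w)) * ?S"
      by (simp add: sum.distrib mult_ac)
    also have "\<dots> \<le> (\<Sum>m<k. norm (normalized k F m w)) + 1 / 2 * ?S"
      using small by (intro add_left_mono mult_right_mono sum_nonneg) auto
    finally show "?S \<le> 2 * (\<Sum>m<k. norm (normalized k F m w))" by simp
  qed
qed

text \<open>
  No solution of the system decays relative to \<open>e\<^sup>k\<^sup>z\<close> in such a direction, so that a solution is
  controlled by its values at the far end of the ray.
\<close>

definition direction_ok :: "nat \<Rightarrow> real \<Rightarrow> bool" where
  "direction_ok k \<theta> \<longleftrightarrow> (\<forall>n<k. 0 \<le> Re (exp (\<i> * of_real \<theta>) * (can k (int n) - of_nat k)))"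

text \<open>The order of the quantifiers is the point: \<open>C\<close> is fixed before the
  solution, the direction, the end of the ray and the limit \<open>\<kappa>\<close>. The value
  \<open>\<kappa> = 1\<close> serves asymptotics, the value \<open>\<kappa> = 0\<close> differences
  of approximate solutions.\<close>

lemma ray_estimate:
  assumes k: "0 < k" and \<epsilon>: "0 < \<epsilon>" "\<epsilon> < pi"
  shows "\<exists>C>0. \<forall>F \<theta> w T \<kappa> \<eta> n. qde_solution k F \<longrightarrow> direction_ok k \<theta> \<longrightarrow> \<bar>Im w - \<theta>\<bar> \<le> pi - \<epsilon> \<longrightarrow>
     0 \<le> T \<longrightarrow> C \<le> exp (Re w) \<longrightarrow>
     (\<forall>n<k. norm (normalized k F n (ray \<theta> w T) - (if n = 0 then \<kappa> else 0)) \<le> \<eta>) \<longrightarrow> n < k \<longrightarrow>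
     norm (normalized k F n w - (if n = 0 then \<kappa> else 0)) \<le> 2 * \<eta> + C * norm \<kappa> * exp (- Re w)"
proof -
  obtain B1 where B1: "B1 > 0" and B1': "\<And>F w. real k * B1 * exp (- Re w) \<le> 1 / 2 \<Longrightarrow>
     (\<Sum>m<k. norm (scaled k F m w)) \<le> 2 * (\<Sum>m<k. norm (normalized k F m w))"
    using scaled_normalized_bound[of k] by blast
  define c where "c = (\<lambda>n m. gauge1 k n m - (\<Sum>l<k. gauge1 k n l * V_entry k l m))"
  obtain B2 where B2: "B2 > 0" and B2': "\<And>n m. n < k \<Longrightarrow> m < k \<Longrightarrow> norm (c n m) \<le> B2"
    using exists_norm_bound[of k c] by blast
  \<comment> \<open>The constant of \<open>norm_add_of_real_ge\<close> for
    \<open>c = cos \<epsilon>\<close>: a start at most \<open>pi - \<epsilon>\<close> away from the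
    direction keeps the ray at distance at least \<open>s (r + t)\<close> from 0.\<close>
  define s where "s = sqrt ((1 - cos \<epsilon>) / 2)"
  have cos1: "cos \<epsilon> < 1" using \<epsilon> cos_monotone_0_pi[of 0 \<epsilon>] by simp
  then have s0: "0 < s" by (simp add: s_def)
  define A where "A = 2 * B2 / s\<^sup>2"
  have A0: "0 < A" using B2 s0 by (simp add: A_def)
  \<comment> \<open>The three entries provide the absorption in \<open>backward_estimate\<close>,
    the constant in the conclusion, and the invertibility of the gauge transformation along the
    whole ray.\<close>
  define C where "C = max (2 * real k * A) (max (2 * A) (2 * real k * B1 / s))"
  have C0: "0 < C" using A0 by (simp add: C_def)
  show ?thesis
  proof (intro exI[of _ C] conjI allI impI C0)
    fix F \<theta> w T \<kappa> \<eta> n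
    assume F: "qde_solution k F" and \<theta>: "direction_ok k \<theta>" and w: "\<bar>Im w - \<theta>\<bar> \<le> pi - \<epsilon>"
      and T: "0 \<le> T" and r: "C \<le> exp (Re w)" and n: "n < k"
      and fin: "\<forall>n<k. norm (normalized k F n (ray \<theta> w T) - (if n = 0 then \<kappa> else 0)) \<le> \<eta>"
    have w': "\<bar>Im w - \<theta>\<bar> < pi" using w \<epsilon> by simp
    let ?r = "exp (Re w)"
    let ?e = "exp (\<i> * of_real \<theta>)"
    have ne: "norm ?e = 1" by simp
    have lower: "s * (?r + t) \<le> exp (Re (ray \<theta> w t))" if t: "0 \<le> t" for t
    proof -
      have "cos (pi - \<epsilon>) \<le> cos \<bar>Im w - \<theta>\<bar>"
        using w \<epsilon> by (intro cos_monotone_0_pi_le) auto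
      then have "- cos \<epsilon> \<le> cos (Im w - \<theta>)" by simp
      then have "s * (?r + t) \<le> norm (exp (w - \<i> * of_real \<theta>) + of_real t)"
        unfolding s_def using t by (intro norm_add_of_real_ge[OF exp_shift_polar]) auto
      also have "\<dots> = norm (exp (ray \<theta> w t))"
        by (simp add: exp_ray[OF w' t] norm_mult)
      finally show ?thesis by (simp add: norm_exp_eq_Re)
    qed
    define err where "err = (\<lambda>n t. ?e * exp (- ray \<theta> w t) * (exp (- ray \<theta> w t) * (\<Sum>m<k. c n m * scaled k F m (ray \<theta> w t))))"
    have "norm (normalized k F n (ray \<theta> w 0) - (if n = 0 then \<kappa> else 0)) \<le>
       2 * \<eta> + 2 * A * (\<Sum>m<k. norm (if m = 0 then \<kappa> else 0)) / ?r"
    proof (rule backward_estimate[OF k T, where err = err and \<alpha> = "\<lambda>n. ?e * (can k (int n) - of_nat k)"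
          and g = "\<lambda>n t. normalized k F n (ray \<theta> w t)"])
      fix n t assume n: "n < k" and t: "t \<in> {0..T}"
      then have t0: "0 \<le> t" by simp
      let ?R = "ray \<theta> w t"
      have "((\<lambda>t. normalized k F n (ray \<theta> w t)) has_vector_derivative
         (?e * exp (- ?R)) * (exp ?R * (can k (int n) - of_nat k) * normalized k F n ?R +
            exp (- ?R) * (\<Sum>m<k. c n m * scaled k F m ?R))) (at t)"
        using field_vector_diff_chain_at[OF ray_deriv[OF w' t0] normalized_deriv[OF F n]]
        by (simp add: c_def scaled_def o_def)
      moreover have "(?e * exp (- ?R)) * (exp ?R * (can k (int n) - of_nat k) * normalized k F n ?R +
            exp (- ?R) * (\<Sum>m<k. c n m * scaled k F m ?R)) =
          ?e * (can k (int n) - of_nat k) * normalized k F n ?R * (exp (- ?R) * exp ?R) + err n t"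
        by (simp add: err_def algebra_simps)
      moreover have "exp (- ?R) * exp ?R = 1" by (simp flip: exp_add)
      ultimately show "((\<lambda>t. normalized k F n (ray \<theta> w t)) has_vector_derivative
         ?e * (can k (int n) - of_nat k) * normalized k F n ?R + err n t) (at t)"
        by simp
      have "2 * real k * B1 / s \<le> ?r" using r by (simp add: C_def)
      then have "2 * real k * B1 \<le> s * (?r + t)" using s0 t0 by (simp add: field_simps) (smt (verit) mult_nonneg_nonneg)
      then have "2 * real k * B1 \<le> exp (Re ?R)" using lower[OF t0] by simp
      then have small: "real k * B1 * exp (- Re ?R) \<le> 1 / 2"
        by (simp add: exp_minus field_simps)
      have "norm (err n t) = exp (- Re ?R) * (exp (- Re ?R) * norm (\<Sum>m<k. c n m * scaled k F m ?R))"
        by (simp add: err_def norm_mult norm_exp_eq_Re)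
      also have "norm (\<Sum>m<k. c n m * scaled k F m ?R) \<le> (\<Sum>m<k. B2 * norm (scaled k F m ?R))"
        using B2' n by (intro order_trans[OF norm_sum] sum_mono) (auto simp: norm_mult intro!: mult_right_mono)
      also have "\<dots> \<le> B2 * (2 * (\<Sum>m<k. norm (normalized k F m ?R)))"
        using B1'[OF small, of F] B2 by (simp flip: sum_distrib_left)
      also have "exp (- Re ?R) * (exp (- Re ?R) * (B2 * (2 * (\<Sum>m<k. norm (normalized k F m ?R)))))
         = 2 * B2 / (exp (Re ?R))\<^sup>2 * (\<Sum>m<k. norm (normalized k F m ?R))"
        by (simp add: exp_minus power2_eq_square field_simps)
      also have "\<dots> \<le> 2 * B2 / (s * (?r + t))\<^sup>2 * (\<Sum>m<k. norm (normalized k F m ?R))"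
        using B2 s0 t0 lower[OF t0] exp_gt_zero[of "Re w"]
        by (intro mult_right_mono divide_left_mono power_mono mult_pos_pos sum_nonneg zero_less_power)
          (auto intro!: add_pos_nonneg)
      also have "2 * B2 / (s * (?r + t))\<^sup>2 = A / (?r + t)\<^sup>2"
        by (simp add: A_def power_mult_distrib)
      finally show "norm (err n t) \<le> A / (?r + t)\<^sup>2 * (\<Sum>m<k. norm (normalized k F m ?R))"
        by (simp add: mult_left_mono)
    qed (use \<theta> fin A0 r n in \<open>auto simp: direction_ok_def C_def\<close>)
    also have "(\<Sum>m<k. norm (if m = 0 then \<kappa> else 0)) = norm \<kappa>"
      using k by (simp add: if_distrib[of norm] cong: if_cong)
    also have "2 * A * norm \<kappa> / ?r \<le> C * norm \<kappa> * exp (- Re w)"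
      by (simp add: exp_minus divide_inverse C_def mult_right_mono)
    finally show "norm (normalized k F n w - (if n = 0 then \<kappa> else 0)) \<le> 2 * \<eta> + C * norm \<kappa> * exp (- Re w)"
      by (simp add: ray_0[OF w'])
  qed
qed

section \<open>Linearity, and the directions in which \<open>exp (k z)\<close> is recessive\<close>

lemma gauged_sum: "gauged k (\<lambda>j w. \<Sum>i\<in>I. c i * F i j w) j w = (\<Sum>i\<in>I. c i * gauged k (F i) j w)"
  by (simp add: gauged_def sum_distrib_left sum_divide_distrib mult_ac)

lemma ycol_sum: "ycol k (\<lambda>j w. \<Sum>i\<in>I. c i * F i j w) n w = (\<Sum>i\<in>I. c i * ycol k (F i) n w)"
  unfolding ycol_def gauged_sum by (simp add: sum_distrib_left sum.swap[of _ I] mult_ac)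

lemma scaled_sum: "scaled k (\<lambda>j w. \<Sum>i\<in>I. c i * F i j w) n w = (\<Sum>i\<in>I. c i * scaled k (F i) n w)"
  unfolding scaled_def ycol_sum by (simp add: sum_distrib_left mult_ac)

lemma normalized_sum: "normalized k (\<lambda>j w. \<Sum>i\<in>I. c i * F i j w) n w = (\<Sum>i\<in>I. c i * normalized k (F i) n w)"
  unfolding normalized_scaled scaled_sum
  by (simp add: sum_distrib_left sum.swap[of _ I] sum_subtractf algebra_simps)

lemma normalized_diff: "normalized k (\<lambda>j w. F j w - G j w) n w = normalized k F n w - normalized k G n w"
  using normalized_sum[of k "\<lambda>i. if i then 1 else -1" "\<lambda>i. if i then F else G" "{True, False}" n w] by simp

lemma scaled_diff: "scaled k (\<lambda>j w. F j w - G j w) n w = scaled k F n w - scaled k G n w"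
  using scaled_sum[of k "\<lambda>i. if i then 1 else -1" "\<lambda>i. if i then F else G" "{True, False}" n w] by simp

lemma normalized_cong: "(\<And>j. j < k \<Longrightarrow> F j w = G j w) \<Longrightarrow> normalized k F n w = normalized k G n w"
  by (simp add: normalized_def ycol_def gauged_def)

lemma gauged_of_scaled:
  "j < k \<Longrightarrow> gauged k F j w = exp (of_nat k * exp w) * (\<Sum>n<k. X_entry k j (int n) * scaled k F n w)"
proof -
  assume j: "j < k"
  have e: "exp (of_nat k * exp w) * exp (- of_nat k * exp w) = 1" by (simp flip: exp_add)
  have "exp (of_nat k * exp w) * (\<Sum>n<k. X_entry k j (int n) * scaled k F n w) =
     (exp (of_nat k * exp w) * exp (- of_nat k * exp w)) * (\<Sum>n<k. X_entry k j (int n) * ycol k F n w)"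
    by (simp add: scaled_def sum_distrib_left mult_ac)
  then show ?thesis unfolding e by (simp add: gauged_eq_sum_ycol[OF j])
qed

lemma solution_of_gauged:
  "0 < k \<Longrightarrow> F j w = exp (- w * mu k j) * of_nat k ^ j * gauged k F j w"
  by (simp add: gauged_def mult.assoc[symmetric] exp_add[symmetric])

text \<open>The formula for a difference of cosines. Its sign decides which of the exponentials of
  index \<open>m\<close> and \<open>n\<close> is larger in the direction \<open>\<theta>\<close>,
  and its zeros are the rays where they balance.\<close>

lemma Re_can_diff:
  "Re (exp (\<i> * of_real \<theta>) * (can k m - can k n)) =
     - 2 * real k * sin (\<theta> + pi * (of_int m + of_int n) / k) * sin (pi * (of_int m - of_int n) / k)"
proof -
  have "exp (\<i> * of_real \<theta>) * can k m = of_nat k * cis (\<theta> + 2 * pi * of_int m / k)" for m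
    by (simp add: can_def cis_conv_exp exp_add[symmetric] distrib_left mult_ac)
  then have "Re (exp (\<i> * of_real \<theta>) * (can k m - can k n)) =
     real k * (cos (\<theta> + 2 * pi * of_int m / k) - cos (\<theta> + 2 * pi * of_int n / k))"
    by (simp add: right_diff_distrib)
  also have "cos (\<theta> + 2 * pi * of_int m / k) - cos (\<theta> + 2 * pi * of_int n / k) =
     2 * sin (\<theta> + pi * (of_int m + of_int n) / k) * sin (pi * (of_int n - of_int m) / k)"
    unfolding cos_diff_cos
    by (intro arg_cong2[where f = "(*)"] arg_cong[where f = sin] arg_cong[where f = "(*) 2"])
      (simp_all add: algebra_simps add_divide_distrib diff_divide_distrib)
  also have "pi * (of_int n - of_int m) / k = - (pi * (of_int m - of_int n) / k)"
    by (simp add: diff_divide_distrib right_diff_distrib)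
  finally show ?thesis by (simp only: sin_minus)
qed

text \<open>At the two ends of the range \<open>exp (k z)\<close> ties with a neighbouring
  exponential. Admitting these ends is what yields the full width of the sector of the recessive
  solution.\<close>

lemma direction_okI:
  assumes "0 < k" "pi - pi / k \<le> \<theta>" "\<theta> \<le> pi + pi / k"
  shows "direction_ok k \<theta>"
  unfolding direction_ok_def
proof (intro allI impI)
  fix n assume n: "n < k"
  show "0 \<le> Re (exp (\<i> * of_real \<theta>) * (can k (int n) - of_nat k))"
  proof (cases "n = 0")
    case False
    have nk: "pi * real n / k \<le> pi - pi / k" "pi / k \<le> pi * real n / k"
    proof -
      have "real n + 1 \<le> real k" using n by linarith
      then have "pi * (real n + 1) \<le> pi * real k" by (intro mult_left_mono) auto
      then have "pi * (real n + 1) / k \<le> pi" using assms(1) by (simp add: divide_le_eq)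
      then show "pi * real n / k \<le> pi - pi / k" by (simp add: distrib_left add_divide_distrib)
      show "pi / k \<le> pi * real n / k" using False by (intro divide_right_mono) auto
    qed
    have "0 \<le> sin (\<theta> + pi * real n / k - pi)"
      using nk assms by (intro sin_ge_zero) auto
    moreover have "0 \<le> sin (pi * real n / k)"
      using nk assms by (intro sin_ge_zero) (auto intro: order_trans[of _ "pi - pi / k"])
    moreover have "Re (exp (\<i> * of_real \<theta>) * (can k (int n) - can k 0)) =
        - 2 * real k * sin (\<theta> + pi * real n / k) * sin (pi * real n / k)"
      by (simp only: Re_can_diff of_int_of_nat_eq of_int_0 add_0_right diff_0_right)
    ultimately show ?thesis
      by (simp only: can_0) (intro mult_nonneg_nonneg mult_nonpos_nonpos; simp)
  qed simp
qed

lemma ray_on_axis: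
  assumes "0 < r" "0 \<le> t" shows "ray \<theta> (\<i> * of_real \<theta> + of_real (ln r)) t = \<i> * of_real \<theta> + of_real (ln (r + t))"
proof -
  have "exp (of_real (ln r) :: complex) = of_real r"
    using assms by (simp add: exp_of_real)
  then have "exp (\<i> * of_real \<theta> + of_real (ln r) - \<i> * of_real \<theta>) + of_real t = (of_real (r + t) :: complex)" by simp
  then show ?thesis
    unfolding ray_def using assms Ln_of_real[of "r + t"] by simp
qed

text \<open>Existence by a limit: \<open>F m\<close> is prescribed to be the ideal vector
  \<open>(1, 0, ..., 0)\<close> at distance \<open>R + m\<close> on the negative axis. By the
  uniform estimate the values at distance \<open>R\<close> form a Cauchy sequence, and the limit
  solution inherits the bounds.\<close>

lemma recessive_on_axis:
  assumes k: "0 < k"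
  shows "\<exists>F C. qde_solution k F \<and> 0 < C \<and> (\<forall>r\<ge>C. \<forall>n<k.
    norm (normalized k F n (\<i> * of_real pi + of_real (ln r)) - (if n = 0 then 1 else 0)) \<le> C / r)"
proof -
  obtain C1 where C1: "0 < C1" and C1': "\<forall>F \<theta> w T \<kappa> \<eta> n. qde_solution k F \<longrightarrow> direction_ok k \<theta> \<longrightarrow> \<bar>Im w - \<theta>\<bar> \<le> pi - pi / 2 \<longrightarrow>
     0 \<le> T \<longrightarrow> C1 \<le> exp (Re w) \<longrightarrow>
     (\<forall>n<k. norm (normalized k F n (ray \<theta> w T) - (if n = 0 then \<kappa> else 0)) \<le> \<eta>) \<longrightarrow> n < k \<longrightarrow>
     norm (normalized k F n w - (if n = 0 then \<kappa> else 0)) \<le> 2 * \<eta> + C1 * norm \<kappa> * exp (- Re w)"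
  proof -
    have "0 < pi / 2" "pi / 2 < pi" using pi_gt_zero by auto
    from ray_estimate[OF k this] show ?thesis using that by (elim exE conjE)
  qed
  have dpi: "direction_ok k pi" using direction_okI[OF k, of pi] by simp
  have est: "norm (normalized k F n w - (if n = 0 then \<kappa> else 0)) \<le> 2 * \<eta> + C1 * norm \<kappa> * exp (- Re w)"
    if "qde_solution k F" "\<bar>Im w - pi\<bar> \<le> pi - pi / 2" "0 \<le> T" "C1 \<le> exp (Re w)"
     "\<And>n. n < k \<Longrightarrow> norm (normalized k F n (ray pi w T) - (if n = 0 then \<kappa> else 0)) \<le> \<eta>" "n < k"
    for F w T \<kappa> \<eta> n
    using C1'[rule_format, OF that(1) dpi that(2-4) _ that(6)] that(5) by blast
  obtain B where B: "0 < B" and small: "\<And>F w. real k * B * exp (- Re w) \<le> 1 / 2 \<Longrightarrow>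
     (\<Sum>m<k. norm (scaled k F m w)) \<le> 2 * (\<Sum>m<k. norm (normalized k F m w))"
    using scaled_normalized_bound[of k] by blast
  obtain B2 where B2: "0 < B2" and B2': "\<And>n m. n < k \<Longrightarrow> m < k \<Longrightarrow> norm (gauge1 k n m) \<le> B2"
    using exists_norm_bound[of k "gauge1 k"] by blast
  define R where "R = max C1 (2 * real k * B)"
  have R: "0 < R" "C1 \<le> R" "2 * real k * B \<le> R" using C1 by (auto simp: R_def)
  define ax where "ax = (\<lambda>r::real. \<i> * of_real pi + of_real (ln r) :: complex)"
  have Re_ax: "exp (- Re (ax r)) = 1 / r" "exp (Re (ax r)) = r" if "0 < r" for r
    using that by (auto simp: ax_def exp_minus inverse_eq_divide)
  have Im_ax: "Im (ax r) = pi" for r by (simp add: ax_def)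
  define w where "w = (\<lambda>m. ax (R + real m))"
  let ?\<delta> = "\<lambda>n. (if n = 0 then 1 else 0) :: complex"
  have "\<exists>F. qde_solution k F \<and> (\<forall>n<k. scaled k F n (w m) = ?\<delta> n)" for m
  proof -
    obtain c where c: "\<And>j. j < k \<Longrightarrow> (\<Sum>i<k. c i * frob_sol k i j (w m)) =
        exp (- w m * mu k j) * of_nat k ^ j * (exp (of_nat k * exp (w m)) * X_entry k j 0)"
        using frob_sol_initial_values[OF k, of "w m" "\<lambda>j. exp (- w m * mu k j) * of_nat k ^ j * (exp (of_nat k * exp (w m)) * X_entry k j 0)"] by blast
    let ?F = "\<lambda>j w. \<Sum>i<k. c i * frob_sol k i j w"
    have "gauged k ?F j (w m) = exp (of_nat k * exp (w m)) * X_entry k j 0" if "j < k" for j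
      using k by (simp add: gauged_def c[OF that] exp_minus)
    then have "scaled k ?F n (w m) = (\<Sum>j<k. cnj (X_entry k j (int n)) * X_entry k j (int 0))" for n
      by (simp add: scaled_def ycol_def sum_distrib_left exp_minus field_simps)
    then have "scaled k ?F n (w m) = ?\<delta> n" if "n < k" for n
      using that k by (simp only: X_unitary_columns)
    then show ?thesis using qde_solution_sum[of "{..<k}" k "frob_sol k" c] qde_solution_frob by blast
  qed
  then obtain F where F: "\<And>m. qde_solution k (F m)" and Fs: "\<And>m n. n < k \<Longrightarrow> scaled k (F m) n (w m) = ?\<delta> n"
    by metis
  have start: "norm (normalized k (F m) n (w m) - ?\<delta> n) \<le> B2 / (R + real m)" if n: "n < k" for m n
  proof -
    have "(\<Sum>l<k. gauge1 k n l * scaled k (F m) l (w m)) = (\<Sum>l<k. if l = 0 then gauge1 k n 0 else 0)"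
      by (rule sum.cong) (auto simp: Fs)
    then have "normalized k (F m) n (w m) - ?\<delta> n = - exp (- w m) * gauge1 k n 0"
      using n k by (simp add: normalized_scaled Fs)
    then have "norm (normalized k (F m) n (w m) - ?\<delta> n) = norm (gauge1 k n 0) / (R + real m)"
      using R Re_ax[of "R + real m"] by (simp add: norm_mult norm_exp_eq_Re w_def)
    then show ?thesis using B2'[OF n k] R by (simp add: divide_right_mono)
  qed
  have ray_ax: "ray pi (ax r) t = ax (r + t)" if "0 < r" "0 \<le> t" for r t
    using ray_on_axis[OF that, of pi] by (simp add: ax_def)
  have bound: "norm (normalized k (F m) n (ax r) - ?\<delta> n) \<le> 2 * (B2 / (R + real m)) + C1 / r"
    if "n < k" "C1 \<le> r" "r \<le> R + real m" for m n r
  proof -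
    have r: "0 < r" using that C1 by simp
    have "norm (normalized k (F m) n (ax r) - ?\<delta> n) \<le> 2 * (B2 / (R + real m)) + C1 * norm (1::complex) * exp (- Re (ax r))"
      using that r start[of _ m] C1
      by (intro est[OF F, of _ "R + real m - r"]) (auto simp: Im_ax Re_ax ray_ax w_def)
    then show ?thesis using Re_ax[OF r] by simp
  qed
  define D where "D = 2 * (B2 + (2 * B2 + C1))"
  have D: "0 < D" using B2 C1 by (simp add: D_def)
  \<comment> \<open>A difference of two solutions is treated with \<open>\<kappa> = 0\<close>: its
    size at distance \<open>R\<close> is at most twice its size at distance \<open>R + m\<close>,
    where both solutions are close to the ideal vector.\<close>
  have diff: "norm (normalized k (F m) n (ax R) - normalized k (F m') n (ax R)) \<le> D / (R + real m)"
    if "m \<le> m'" "n < k" for m m' n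
  proof -
    have pos: "0 < R + real m" using R by simp
    have "norm (normalized k (\<lambda>j w. F m j w - F m' j w) n (ax R) - (if n = 0 then 0 else 0)) \<le>
      2 * ((B2 + (2 * B2 + C1)) / (R + real m)) + C1 * norm (0::complex) * exp (- Re (ax R))"
    proof (rule est[of _ _ "real m"])
      show "qde_solution k (\<lambda>j w. F m j w - F m' j w)" by (intro qde_solution_diff F)
      fix n assume n: "n < k"
      have "norm (normalized k (F m) n (w m) - ?\<delta> n) \<le> B2 / (R + real m)" by (rule start[OF n])
      moreover have "norm (normalized k (F m') n (w m) - ?\<delta> n) \<le> 2 * (B2 / (R + real m')) + C1 / (R + real m)"
        unfolding w_def using that(1) R by (intro bound n) auto
      moreover have "B2 / (R + real m') \<le> B2 / (R + real m)"
        using that(1) B2 R pos by (intro divide_left_mono mult_pos_pos) auto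
      moreover have "norm (normalized k (F m) n (w m) - normalized k (F m') n (w m)) \<le>
         norm (normalized k (F m) n (w m) - ?\<delta> n) + norm (normalized k (F m') n (w m) - ?\<delta> n)"
        using norm_triangle_ineq4[of "normalized k (F m) n (w m) - ?\<delta> n" "normalized k (F m') n (w m) - ?\<delta> n"] by simp
      ultimately have "norm (normalized k (F m) n (w m) - normalized k (F m') n (w m)) \<le> (B2 + (2 * B2 + C1)) / (R + real m)"
        by (simp add: add_divide_distrib)
      then show "norm (normalized k (\<lambda>j w. F m j w - F m' j w) n (ray pi (ax R) (real m)) - (if n = 0 then 0 else 0))
         \<le> (B2 + (2 * B2 + C1)) / (R + real m)"
        using R by (simp add: normalized_diff ray_ax w_def)
    qed (use R that in \<open>auto simp: Im_ax Re_ax\<close>)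
    then show ?thesis by (simp add: normalized_diff D_def)
  qed
  have scaled_diff': "norm (scaled k (F m) n (ax R) - scaled k (F m') n (ax R)) \<le> 2 * real k * D / (R + real m)"
    if "m \<le> m'" "n < k" for m m' n
  proof -
    let ?H = "\<lambda>j w. F m j w - F m' j w"
    have "norm (scaled k ?H n (ax R)) \<le> (\<Sum>l<k. norm (scaled k ?H l (ax R)))"
      using that by (intro member_le_sum[of n "{..<k}" "\<lambda>l. norm (scaled k ?H l (ax R))"]) auto
    also have "\<dots> \<le> 2 * (\<Sum>l<k. norm (normalized k ?H l (ax R)))"
      using R by (intro small) (simp add: Re_ax[OF R(1)] field_simps)
    also have "\<dots> \<le> 2 * (\<Sum>l<k. D / (R + real m))"
      using diff that by (intro mult_left_mono sum_mono) (auto simp: normalized_diff)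
    finally show ?thesis by (simp add: scaled_diff mult_ac)
  qed
  have conv: "convergent (\<lambda>m. F m j (ax R))" if j: "j < k" for j
  proof -
    have "convergent (\<lambda>m. scaled k (F m) n (ax R))" if n: "n < k" for n
    proof (rule Cauchy_convergent, rule metric_CauchyI)
      fix e :: real assume e: "0 < e"
      obtain M :: nat where M: "2 * real k * D / e < real M" using reals_Archimedean2 by blast
      have *: "dist (scaled k (F m) n (ax R)) (scaled k (F m') n (ax R)) < e" if "M \<le> m" "m \<le> m'" for m m'
      proof -
        have "2 * real k * D / e < R + real m" using M that R by linarith
        then have "2 * real k * D / (R + real m) < e" using e R by (simp add: field_simps)
        then show ?thesis using scaled_diff'[OF that(2) n] by (simp add: dist_norm)
      qed
      show "\<exists>M. \<forall>m\<ge>M. \<forall>m'\<ge>M. dist (scaled k (F m) n (ax R)) (scaled k (F m') n (ax R)) < e"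
      proof (intro exI[of _ M] allI impI)
        fix m m' assume "M \<le> m" "M \<le> m'"
        then show "dist (scaled k (F m) n (ax R)) (scaled k (F m') n (ax R)) < e"
          using *[of m m'] *[of m' m] by (cases "m \<le> m'") (auto simp: dist_commute)
      qed
    qed
    then have "convergent (\<lambda>m. exp (- ax R * mu k j) * of_nat k ^ j *
        (exp (of_nat k * exp (ax R)) * (\<Sum>n<k. X_entry k j (int n) * scaled k (F m) n (ax R))))"
      by (intro convergent_mult convergent_const convergent_sum) auto
    then show ?thesis
      unfolding gauged_of_scaled[OF j, symmetric] solution_of_gauged[OF k, symmetric] .
  qed
  then obtain x where x: "\<And>j. j < k \<Longrightarrow> (\<lambda>m. F m j (ax R)) \<longlonglongrightarrow> x j"
    unfolding convergent_def by metis
  \<comment> \<open>The basis with standard initial values at distance \<open>R\<close>; in it,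
    convergence of the initial values becomes convergence of the solutions at every point.\<close>
  have "\<forall>l. \<exists>c. \<forall>j<k. (\<Sum>i<k. c i * frob_sol k i j (ax R)) = (if j = l then 1 else 0)"
    by (intro allI frob_sol_initial_values[OF k])
  then obtain c where c: "\<And>l j. j < k \<Longrightarrow> (\<Sum>i<k. c l i * frob_sol k i j (ax R)) = (if j = l then 1 else 0)"
    by metis
  define E where "E = (\<lambda>l j w. \<Sum>i<k. c l i * frob_sol k i j w)"
  have E: "qde_solution k (E l)" for l
    unfolding E_def by (intro qde_solution_sum qde_solution_frob) auto
  have Fexp: "F m j w = (\<Sum>l<k. F m l (ax R) * E l j w)" if "j < k" for m j w
  proof -
    have "qde_solution k (\<lambda>j w. F m j w - (\<Sum>l<k. F m l (ax R) * E l j w))"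
      by (intro qde_solution_diff F qde_solution_sum E)
    then have "F m j w - (\<Sum>l<k. F m l (ax R) * E l j w) = 0"
    proof (rule qde_solution_unique[OF _ k _ that, where p = "ax R"])
      fix j assume j: "j < k"
      have "(\<Sum>l<k. F m l (ax R) * E l j (ax R)) = (\<Sum>l<k. if l = j then F m l (ax R) else 0)"
        using c[OF j] by (intro sum.cong) (auto simp: E_def)
      then show "F m j (ax R) - (\<Sum>l<k. F m l (ax R) * E l j (ax R)) = 0" using j by simp
    qed
    then show ?thesis by simp
  qed
  define G where "G = (\<lambda>j w. \<Sum>l<k. x l * E l j w)"
  have "qde_solution k G" unfolding G_def by (intro qde_solution_sum E)
  moreover have "norm (normalized k G n (ax r) - ?\<delta> n) \<le> C1 / r" if "C1 \<le> r" "n < k" for r n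
  proof -
    have "normalized k (F m) n (ax r) = normalized k (\<lambda>j w. \<Sum>l<k. F m l (ax R) * E l j w) n (ax r)" for m
      by (intro normalized_cong Fexp)
    then have "normalized k (F m) n (ax r) = (\<Sum>l<k. F m l (ax R) * normalized k (E l) n (ax r))" for m
      by (simp add: normalized_sum)
    then have "(\<lambda>m. normalized k (F m) n (ax r)) \<longlonglongrightarrow> (\<Sum>l<k. x l * normalized k (E l) n (ax r))"
      by (simp only:) (intro tendsto_sum tendsto_mult tendsto_const x, auto)
    then have "(\<lambda>m. normalized k (F m) n (ax r)) \<longlonglongrightarrow> normalized k G n (ax r)"
      by (simp add: G_def normalized_sum)
    then have "(\<lambda>m. norm (normalized k (F m) n (ax r) - ?\<delta> n)) \<longlonglongrightarrow> norm (normalized k G n (ax r) - ?\<delta> n)"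
      by (intro tendsto_intros)
    moreover have "(\<lambda>m. 2 * (B2 / (R + real m)) + C1 / r) \<longlonglongrightarrow> 2 * 0 + C1 / r"
      by (intro tendsto_intros tendsto_divide_0[OF tendsto_const] filterlim_at_top_imp_at_infinity
        filterlim_tendsto_add_at_top[OF tendsto_const filterlim_real_sequentially])
    moreover have "\<forall>\<^sub>F m in sequentially. norm (normalized k (F m) n (ax r) - ?\<delta> n) \<le> 2 * (B2 / (R + real m)) + C1 / r"
    proof -
      obtain M :: nat where "r < real M" using reals_Archimedean2 by blast
      then show ?thesis
        unfolding eventually_sequentially using bound[OF that(2,1)] R by (intro exI[of _ M] allI impI) auto
    qed
    ultimately show ?thesis
      by (intro tendsto_le[of sequentially "\<lambda>m. 2 * (B2 / (R + real m)) + C1 / r" "C1 / r"]) auto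
  qed
  ultimately show ?thesis using C1 by (intro exI[of _ G] exI[of _ C1]) (auto simp: ax_def)
qed

section \<open>The recessive solution\<close>

text \<open>The law of sines in the triangle formed by 0, the starting point and the point where the
  ray meets the half-line at angle \<open>\<gamma>\<close> to its direction.\<close>

lemma ray_to_axis:
  assumes \<gamma>: "0 < \<gamma>" "\<gamma> \<le> \<beta>" "\<beta> < pi" and s: "s = 1 \<or> s = -1"
    and w: "Im w = \<theta> + s * \<beta>"
  shows "ray \<theta> w (exp (Re w) * sin (\<beta> - \<gamma>) / sin \<gamma>) =
    \<i> * of_real (\<theta> + s * \<gamma>) + of_real (ln (exp (Re w) * sin \<beta> / sin \<gamma>))"
proof -
  let ?r = "exp (Re w)"
  have s\<gamma>: "0 < sin \<gamma>" and s\<beta>: "0 < sin \<beta>" using \<gamma> by (auto intro!: sin_gt_zero)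
  have cs: "cos (s * x) = cos x" "sin (s * x) = s * sin x" "cos (x * s) = cos x" "sin (x * s) = s * sin x" for x
    using s by auto
  have "exp (w - \<i> * of_real \<theta>) + of_real (?r * sin (\<beta> - \<gamma>) / sin \<gamma>) =
      of_real (?r * sin \<beta> / sin \<gamma>) * cis (s * \<gamma>)"
    using s\<gamma> by (simp add: complex_eq_iff exp_shift_polar w cs sin_diff field_simps)
  also have "\<dots> = exp (of_real (ln (?r * sin \<beta> / sin \<gamma>)) + \<i> * of_real (s * \<gamma>))"
    using s\<gamma> s\<beta> by (simp add: exp_add exp_of_real cis_conv_exp del: of_real_mult of_real_divide)
  also have "Ln \<dots> = of_real (ln (?r * sin \<beta> / sin \<gamma>)) + \<i> * of_real (s * \<gamma>)"
    using \<gamma> s by (intro Ln_exp) auto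
  finally show ?thesis by (simp add: ray_def algebra_simps)
qed

section \<open>Asymptotics of the recessive solution in sectors\<close>

definition sector_small :: "nat \<Rightarrow> (nat \<Rightarrow> complex \<Rightarrow> complex) \<Rightarrow> real \<Rightarrow> real \<Rightarrow> bool" where
  "sector_small k f a b \<longleftrightarrow> (\<exists>C>0. \<forall>w. C \<le> exp (Re w) \<longrightarrow> a \<le> Im w \<longrightarrow> Im w \<le> b \<longrightarrow>
     (\<forall>n<k. norm (f n w) \<le> C * exp (- Re w)))"

lemma sector_small_subset:
  "sector_small k f a b \<Longrightarrow> a \<le> a' \<Longrightarrow> b' \<le> b \<Longrightarrow> sector_small k f a' b'"
  unfolding sector_small_def by (meson order_trans)

lemma sector_small_union:
  assumes "sector_small k f a c" "sector_small k f d b" "d \<le> c"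
  shows "sector_small k f a b"
proof -
  obtain C1 where C1: "0 < C1" "\<And>w n. C1 \<le> exp (Re w) \<Longrightarrow> a \<le> Im w \<Longrightarrow> Im w \<le> c \<Longrightarrow> n < k \<Longrightarrow>
      norm (f n w) \<le> C1 * exp (- Re w)"
    using assms(1) unfolding sector_small_def by blast
  obtain C2 where C2: "0 < C2" "\<And>w n. C2 \<le> exp (Re w) \<Longrightarrow> d \<le> Im w \<Longrightarrow> Im w \<le> b \<Longrightarrow> n < k \<Longrightarrow>
      norm (f n w) \<le> C2 * exp (- Re w)"
    using assms(2) unfolding sector_small_def by blast
  show ?thesis
    unfolding sector_small_def
  proof (intro exI[of _ "max C1 C2"] conjI allI impI)
    fix w n assume w: "max C1 C2 \<le> exp (Re w)" "a \<le> Im w" "Im w \<le> b" and n: "n < k"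
    have "norm (f n w) \<le> C1 * exp (- Re w) \<or> norm (f n w) \<le> C2 * exp (- Re w)"
      using C1(2)[of w n] C2(2)[of w n] w n assms(3) by (cases "Im w \<le> c") auto
    moreover have "C1 * exp (- Re w) \<le> max C1 C2 * exp (- Re w)" "C2 * exp (- Re w) \<le> max C1 C2 * exp (- Re w)"
      by (intro mult_right_mono; simp)+
    ultimately show "norm (f n w) \<le> max C1 C2 * exp (- Re w)"
      by linarith
  qed (use C1 in simp)
qed

lemma sector_small_add:
  assumes "sector_small k f a b" "sector_small k g a b"
  shows "sector_small k (\<lambda>n w. f n w + g n w) a b"
proof -
  obtain C1 where C1: "0 < C1" "\<And>w n. C1 \<le> exp (Re w) \<Longrightarrow> a \<le> Im w \<Longrightarrow> Im w \<le> b \<Longrightarrow> n < k \<Longrightarrow>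
      norm (f n w) \<le> C1 * exp (- Re w)"
    using assms(1) unfolding sector_small_def by blast
  obtain C2 where C2: "0 < C2" "\<And>w n. C2 \<le> exp (Re w) \<Longrightarrow> a \<le> Im w \<Longrightarrow> Im w \<le> b \<Longrightarrow> n < k \<Longrightarrow>
      norm (g n w) \<le> C2 * exp (- Re w)"
    using assms(2) unfolding sector_small_def by blast
  show ?thesis
    unfolding sector_small_def
  proof (intro exI[of _ "C1 + C2"] conjI allI impI)
    fix w n assume w: "C1 + C2 \<le> exp (Re w)" "a \<le> Im w" "Im w \<le> b" and n: "n < k"
    then have "norm (f n w) \<le> C1 * exp (- Re w)" "norm (g n w) \<le> C2 * exp (- Re w)"
      using C1 C2 by auto
    then show "norm (f n w + g n w) \<le> (C1 + C2) * exp (- Re w)"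
      using norm_triangle_ineq[of "f n w" "g n w"] by (simp add: algebra_simps)
  qed (use C1 C2 in simp)
qed

abbreviation normalized_asym :: "nat \<Rightarrow> (nat \<Rightarrow> complex \<Rightarrow> complex) \<Rightarrow> real \<Rightarrow> real \<Rightarrow> bool" where
  "normalized_asym k F \<equiv> sector_small k (\<lambda>n w. normalized k F n w - (if n = 0 then 1 else 0))"

text \<open>From a point on one side of the negative axis, the ray in the extreme direction
  \<open>pi - s pi/k\<close> crosses the axis, where the asymptotics is known, and the estimate
  carries it back. The distances from 0 at the two ends stay comparable because
  \<open>sin \<beta>\<close> is bounded below.\<close>

lemma normalized_asym_from_axis:
  assumes k: "2 \<le> k" and F: "qde_solution k F" and C: "0 < C"
    and ax: "\<And>r n. C \<le> r \<Longrightarrow> n < k \<Longrightarrow>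
      norm (normalized k F n (\<i> * of_real pi + of_real (ln r)) - (if n = 0 then 1 else 0)) \<le> C / r"
    and s: "s = 1 \<or> s = -1" and \<epsilon>: "0 < \<epsilon>" "\<epsilon> < pi"
    and a: "\<And>x. a \<le> x \<Longrightarrow> x \<le> b \<Longrightarrow> pi / k \<le> s * (x - (pi - s * pi / k)) \<and> s * (x - (pi - s * pi / k)) \<le> pi - \<epsilon>"
  shows "normalized_asym k F a b"
proof -
  have k0: "0 < k" using k by simp
  let ?\<theta> = "pi - s * pi / k"
  let ?\<gamma> = "pi / k"
  have dir: "direction_ok k ?\<theta>" using k0 s by (intro direction_okI) auto
  obtain C1 where C1: "0 < C1" and est: "\<forall>F \<theta> w T \<kappa> \<eta> n. qde_solution k F \<longrightarrow> direction_ok k \<theta> \<longrightarrow> \<bar>Im w - \<theta>\<bar> \<le> pi - \<epsilon> \<longrightarrow>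
     0 \<le> T \<longrightarrow> C1 \<le> exp (Re w) \<longrightarrow>
     (\<forall>n<k. norm (normalized k F n (ray \<theta> w T) - (if n = 0 then \<kappa> else 0)) \<le> \<eta>) \<longrightarrow> n < k \<longrightarrow>
     norm (normalized k F n w - (if n = 0 then \<kappa> else 0)) \<le> 2 * \<eta> + C1 * norm \<kappa> * exp (- Re w)"
    using ray_estimate[OF k0 \<epsilon>] by (elim exE conjE)
  have \<gamma>: "0 < ?\<gamma>" "?\<gamma> < pi" using k by (auto simp: divide_less_eq)
  \<comment> \<open>A lower bound of \<open>sin\<close> between \<open>pi/k\<close> and
    \<open>pi - \<epsilon>\<close>, taken from the two ends.\<close>
  define q where "q = min (sin ?\<gamma>) (sin \<epsilon>)"
  have s\<gamma>: "0 < sin ?\<gamma>" using \<gamma> by (intro sin_gt_zero)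
  have q: "0 < q" using \<gamma> \<epsilon> by (auto simp: q_def intro!: sin_gt_zero)
  have q1: "q \<le> 1" by (auto simp: q_def min_le_iff_disj)
  define C2 where "C2 = max (C / q) (max C1 (2 * (C / q) + C1))"
  show ?thesis
    unfolding sector_small_def
  proof (intro exI[of _ C2] conjI allI impI)
    show "0 < C2" using C1 by (simp add: C2_def)
    fix w n assume w: "C2 \<le> exp (Re w)" "a \<le> Im w" "Im w \<le> b" and n: "n < k"
    let ?r = "exp (Re w)"
    define \<beta> where "\<beta> = s * (Im w - ?\<theta>)"
    have \<beta>: "?\<gamma> \<le> \<beta>" "\<beta> \<le> pi - \<epsilon>" using a[OF w(2,3)] by (auto simp: \<beta>_def)
    have Imw: "Im w = ?\<theta> + s * \<beta>" using s by (auto simp: \<beta>_def)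
    define T where "T = ?r * sin (\<beta> - ?\<gamma>) / sin ?\<gamma>"
    define \<rho> where "\<rho> = ?r * sin \<beta> / sin ?\<gamma>"
    have T0: "0 \<le> T"
      using \<beta> \<gamma> \<epsilon> s\<gamma> by (auto simp: T_def intro!: divide_nonneg_pos mult_nonneg_nonneg sin_ge_zero)
    have rayT: "ray ?\<theta> w T = \<i> * of_real pi + of_real (ln \<rho>)"
      using ray_to_axis[OF \<gamma>(1) \<beta>(1) _ s Imw] \<beta>(2) \<epsilon>(1) by (simp add: T_def \<rho>_def)
    have "q \<le> sin \<beta>"
    proof (cases "\<beta> \<le> pi / 2")
      case True
      then have "sin ?\<gamma> \<le> sin \<beta>" using \<beta> \<gamma> by (intro sin_monotone_2pi_le) auto
      then show ?thesis by (simp add: q_def)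
    next
      case False
      then have "sin \<epsilon> \<le> sin (pi - \<beta>)" using \<beta> \<epsilon> by (intro sin_monotone_2pi_le) auto
      then show ?thesis by (simp add: q_def)
    qed
    moreover have "q * ?r \<le> \<rho>"
    proof -
      have "q * ?r \<le> ?r * sin \<beta>" using \<open>q \<le> sin \<beta>\<close> by (simp add: mult.commute)
      also have "\<dots> \<le> \<rho>"
        using s\<gamma> \<open>q \<le> sin \<beta>\<close> q unfolding \<rho>_def by (simp add: le_divide_eq mult_left_le)
      finally show ?thesis .
    qed
    moreover have "C / q \<le> ?r" using w(1) by (simp add: C2_def)
    ultimately have \<rho>: "C \<le> \<rho>" "q * ?r \<le> \<rho>" using q by (auto simp: divide_le_eq mult.commute)
    have "C / \<rho> \<le> C / (q * ?r)"
      using \<rho> C q by (intro divide_left_mono) auto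
    then have ax': "norm (normalized k F n (ray ?\<theta> w T) - (if n = 0 then 1 else 0)) \<le> C / (q * ?r)" if "n < k" for n
      using ax[OF \<rho>(1) that] unfolding rayT by simp
    have "\<bar>Im w - ?\<theta>\<bar> \<le> pi - \<epsilon>" using \<beta> \<gamma> s unfolding Imw by auto
    moreover have "C1 \<le> ?r" using w(1) by (simp add: C2_def)
    ultimately have "norm (normalized k F n w - (if n = 0 then 1 else 0)) \<le> 2 * (C / (q * ?r)) + C1 * norm (1::complex) * exp (- Re w)"
      using est[rule_format, OF F dir _ T0 _ ax' n] by blast
    also have "\<dots> = (2 * (C / q) + C1) * exp (- Re w)"
      by (simp add: exp_minus field_simps)
    also have "\<dots> \<le> C2 * exp (- Re w)" by (intro mult_right_mono) (auto simp: C2_def)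
    finally show "norm (normalized k F n w - (if n = 0 then 1 else 0)) \<le> C2 * exp (- Re w)" .
  qed
qed

text \<open>Far out on a ray the starting point no longer affects the argument, so the ray enters
  every sector around its direction.\<close>

lemma ray_at_infinity:
  assumes w: "\<bar>Im w - \<theta>\<bar> < pi" and e: "0 < e"
  shows "\<exists>T\<ge>0. \<bar>Im (ray \<theta> w T) - \<theta>\<bar> \<le> e \<and> R \<le> exp (Re (ray \<theta> w T))"
proof -
  define Z where "Z = exp (w - \<i> * of_real \<theta>)"
  define e' where "e' = min e (pi / 4)"
  have "0 < e'" "e' \<le> e" "e' \<le> pi / 4" using e by (auto simp: e'_def)
  then have e': "0 < e'" "e' \<le> e" "e' < pi / 2" using pi_gt_zero by auto
  then have t0: "0 < tan e'" by (intro tan_gt_zero)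
  have N0: "0 < norm Z" by (simp add: Z_def)
  define N where "N = norm Z / tan e'"
  have N: "0 < N" using N0 t0 by (simp add: N_def)
  define T where "T = max R 0 + norm Z + N"
  have T0: "0 \<le> T" using N by (auto simp: T_def)
  have nz: "Z + of_real T \<noteq> 0" using ray_slit_plane[OF w T0] by (auto simp: Z_def)
  have "Re (Z + of_real T) = Re Z + (max R 0 + norm Z + N)" by (simp add: T_def)
  then have re: "N \<le> Re (Z + of_real T)" "R \<le> Re (Z + of_real T)"
    using abs_Re_le_cmod[of Z] N by linarith+
  have "Im (ray \<theta> w T) - \<theta> = Im (Ln (Z + of_real T))" by (simp add: ray_def Z_def)
  also have "\<dots> = arctan (Im (Z + of_real T) / Re (Z + of_real T))"
    using re N Im_Ln_eq[OF nz] by simp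
  finally have 1: "Im (ray \<theta> w T) - \<theta> = arctan (Im Z / Re (Z + of_real T))" by simp
  define x where "x = Im Z / Re (Z + of_real T)"
  have "\<bar>x\<bar> = \<bar>Im Z\<bar> / Re (Z + of_real T)"
    using re N unfolding x_def abs_divide by (metis abs_of_pos less_le_trans)
  also have "\<dots> \<le> norm Z / N"
    using re N abs_Im_le_cmod[of Z] by (intro frac_le) auto
  also have "\<dots> = tan e'" using N0 by (simp add: N_def)
  finally have "x \<le> tan e'" "- tan e' \<le> x" by auto
  then have "arctan x \<le> arctan (tan e')" "arctan (- tan e') \<le> arctan x"
    by (simp_all only: arctan_le_iff)
  then have "\<bar>arctan x\<bar> \<le> e'"
    using e' by (simp add: arctan_tan arctan_minus abs_le_iff)
  moreover have "exp (Re (ray \<theta> w T)) = norm (Z + of_real T)"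
    using nz by (simp add: ray_def Z_def)
  moreover have "R \<le> norm (Z + of_real T)"
    using re(2) complex_Re_le_cmod by (rule order_trans)
  ultimately show ?thesis using 1 e' T0 by (intro exI[of _ T]) (auto simp: x_def)
qed

text \<open>A thin sector around \<open>\<theta>\<close> suffices, because all rays of this
  direction end in it. Moving the end of the ray to infinity makes the contribution
  \<open>\<eta>\<close> arbitrarily small, and only the term of order \<open>1/z\<close>
  remains.\<close>

lemma normalized_asym_extend:
  assumes k: "0 < k" and F: "qde_solution k F" and dir: "direction_ok k \<theta>"
    and as: "normalized_asym k F (\<theta> - e) (\<theta> + e)" and e: "0 < e" and \<epsilon>: "0 < \<epsilon>" "\<epsilon> < pi"
  shows "normalized_asym k F (\<theta> - pi + \<epsilon>) (\<theta> + pi - \<epsilon>)"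
proof -
  obtain C1 where C1: "0 < C1" and est: "\<forall>F \<theta> w T \<kappa> \<eta> n. qde_solution k F \<longrightarrow> direction_ok k \<theta> \<longrightarrow> \<bar>Im w - \<theta>\<bar> \<le> pi - \<epsilon> \<longrightarrow>
     0 \<le> T \<longrightarrow> C1 \<le> exp (Re w) \<longrightarrow>
     (\<forall>n<k. norm (normalized k F n (ray \<theta> w T) - (if n = 0 then \<kappa> else 0)) \<le> \<eta>) \<longrightarrow> n < k \<longrightarrow>
     norm (normalized k F n w - (if n = 0 then \<kappa> else 0)) \<le> 2 * \<eta> + C1 * norm \<kappa> * exp (- Re w)"
    using ray_estimate[OF k \<epsilon>] by (elim exE conjE)
  obtain C where C: "0 < C" "\<And>w n. C \<le> exp (Re w) \<Longrightarrow> \<theta> - e \<le> Im w \<Longrightarrow> Im w \<le> \<theta> + e \<Longrightarrow> n < k \<Longrightarrow>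
      norm (normalized k F n w - (if n = 0 then 1 else 0)) \<le> C * exp (- Re w)"
    using as unfolding sector_small_def by blast
  show ?thesis
    unfolding sector_small_def
  proof (intro exI[of _ C1] conjI allI impI C1)
    fix w n assume w: "C1 \<le> exp (Re w)" "\<theta> - pi + \<epsilon> \<le> Im w" "Im w \<le> \<theta> + pi - \<epsilon>" and n: "n < k"
    have w': "\<bar>Im w - \<theta>\<bar> \<le> pi - \<epsilon>" using w by auto
    then have w'': "\<bar>Im w - \<theta>\<bar> < pi" using \<epsilon> by simp
    show "norm (normalized k F n w - (if n = 0 then 1 else 0)) \<le> C1 * exp (- Re w)"
    proof (rule field_le_epsilon)
      fix \<eta> :: real assume \<eta>: "0 < \<eta>"
      obtain T where T: "0 \<le> T" "\<bar>Im (ray \<theta> w T) - \<theta>\<bar> \<le> e" "max C (C / (\<eta> / 2)) \<le> exp (Re (ray \<theta> w T))"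
        using ray_at_infinity[OF w'' e] by blast
      have "norm (normalized k F n (ray \<theta> w T) - (if n = 0 then 1 else 0)) \<le> \<eta> / 2" if "n < k" for n
      proof -
        have "norm (normalized k F n (ray \<theta> w T) - (if n = 0 then 1 else 0)) \<le> C * exp (- Re (ray \<theta> w T))"
          using T that by (intro C(2)) auto
        also have "C * exp (- Re (ray \<theta> w T)) \<le> \<eta> / 2"
          using T(3) \<eta> by (simp add: exp_minus field_simps)
        finally show ?thesis .
      qed
      then have "norm (normalized k F n w - (if n = 0 then 1 else 0)) \<le> 2 * (\<eta> / 2) + C1 * norm (1::complex) * exp (- Re w)"
        using est[rule_format, OF F dir w' T(1) w(1) _ n] by blast
      then show "norm (normalized k F n w - (if n = 0 then 1 else 0)) \<le> C1 * exp (- Re w) + \<eta>" by simp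
    qed
  qed
qed

text \<open>The extension starts from thin sectors around the extreme directions
  \<open>pi - pi/k\<close> and \<open>pi + pi/k\<close>, and these must be covered beforehand by
  rays that cross the axis. Since \<open>k \<ge> 3\<close>, the angle \<open>pi/k\<close> is at most
  \<open>pi/3\<close>, which leaves room for the margin \<open>pi/12\<close>.\<close>

lemma recessive_solution_normalized:
  assumes k: "3 \<le> k"
  shows "\<exists>F. qde_solution k F \<and> (\<forall>a b. - pi / k < a \<longrightarrow> b < 2 * pi + pi / k \<longrightarrow> normalized_asym k F a b)"
proof -
  have k0: "0 < k" "2 \<le> k" using k by auto
  obtain F C where F: "qde_solution k F" and C: "0 < C" and ax': "\<forall>r\<ge>C. \<forall>n<k.
    norm (normalized k F n (\<i> * of_real pi + of_real (ln r)) - (if n = 0 then 1 else 0)) \<le> C / r"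
    using recessive_on_axis[OF k0(1)] by (elim exE conjE)
  note ax = ax'[rule_format]
  let ?g = "pi / real k"
  have "pi / real k \<le> pi / real 3" using k by (intro divide_left_mono) auto
  then have g: "0 < ?g" "?g \<le> pi / 3" using k by auto
  define e where "e = pi / 12"
  have e: "0 < e" "e < pi" "e < pi / 11" by (auto simp: e_def)
  have right: "normalized_asym k F pi (2 * pi - ?g - e)"
  proof (rule normalized_asym_from_axis[OF k0(2) F C, where s = 1 and \<epsilon> = e])
    show "norm (normalized k F n (\<i> * of_real pi + of_real (ln r)) - (if n = 0 then 1 else 0)) \<le> C / r"
      if "C \<le> r" "n < k" for r n using that by (rule ax)
    show "1 = (1::real) \<or> 1 = (-1::real)" by simp
    show "0 < e" "e < pi" by (fact e)+
    fix x assume "pi \<le> x" "x \<le> 2 * pi - ?g - e"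
    then show "?g \<le> 1 * (x - (pi - 1 * pi / real k)) \<and> 1 * (x - (pi - 1 * pi / real k)) \<le> pi - e"
      by (simp only: mult_1 minus_mult_left[symmetric] minus_minus diff_minus_eq_add minus_divide_left[symmetric]) linarith
  qed
  have left: "normalized_asym k F (?g + e) pi"
  proof (rule normalized_asym_from_axis[OF k0(2) F C, where s = "-1" and \<epsilon> = e])
    show "norm (normalized k F n (\<i> * of_real pi + of_real (ln r)) - (if n = 0 then 1 else 0)) \<le> C / r"
      if "C \<le> r" "n < k" for r n using that by (rule ax)
    show "- 1 = (1::real) \<or> - 1 = (-1::real)" by simp
    show "0 < e" "e < pi" by (fact e)+
    fix x assume "?g + e \<le> x" "x \<le> pi"
    then show "?g \<le> - 1 * (x - (pi - - 1 * pi / real k)) \<and> - 1 * (x - (pi - - 1 * pi / real k)) \<le> pi - e"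
      by (simp only: mult_1 minus_mult_left[symmetric] minus_minus diff_minus_eq_add minus_divide_left[symmetric]) linarith
  qed
  have mid: "normalized_asym k F (?g + e) (2 * pi - ?g - e)"
    by (rule sector_small_union[OF left right]) simp
  have "normalized_asym k F a b" if ab: "- pi / k < a" "b < 2 * pi + pi / k" for a b
  proof -
    define q where "q = min (a + ?g) (2 * pi + ?g - b)"
    define \<epsilon> where "\<epsilon> = min (pi / 2) q"
    have "q \<le> a + ?g" "q \<le> 2 * pi + ?g - b" "0 < q" using ab by (auto simp: q_def)
    moreover have "\<epsilon> \<le> pi / 2" "\<epsilon> \<le> q" unfolding \<epsilon>_def by (rule min.cobounded1 min.cobounded2)+
    moreover have "0 < \<epsilon>" using \<open>0 < q\<close> by (simp add: \<epsilon>_def)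
    ultimately have "0 < \<epsilon>" "\<epsilon> \<le> pi / 2" "\<epsilon> \<le> a + ?g" "\<epsilon> \<le> 2 * pi + ?g - b" by auto
    then have \<epsilon>: "0 < \<epsilon>" "\<epsilon> < pi" "\<epsilon> \<le> a + ?g" "\<epsilon> \<le> 2 * pi + ?g - b" "\<epsilon> \<le> pi / 2"
      using pi_gt_zero by auto
    have mid': "normalized_asym k F (pi - ?g - e) (pi - ?g + e)" "normalized_asym k F (pi + ?g - e) (pi + ?g + e)"
      by (rule sector_small_subset[OF mid]; use g e in linarith)+
    have dir: "direction_ok k (pi - ?g)" "direction_ok k (pi + ?g)"
      using g by (auto intro!: direction_okI k0(1))
    have "normalized_asym k F (pi - ?g - pi + \<epsilon>) (pi - ?g + pi - \<epsilon>)"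
      by (rule normalized_asym_extend[OF k0(1) F dir(1) mid'(1) e(1) \<epsilon>(1,2)])
    moreover have "normalized_asym k F (pi + ?g - pi + \<epsilon>) (pi + ?g + pi - \<epsilon>)"
      by (rule normalized_asym_extend[OF k0(1) F dir(2) mid'(2) e(1) \<epsilon>(1,2)])
    ultimately have "normalized_asym k F (pi - ?g - pi + \<epsilon>) (pi + ?g + pi - \<epsilon>)"
      by (rule sector_small_union) (use g \<epsilon> in linarith)
    then show ?thesis by (rule sector_small_subset) (use \<epsilon> in linarith)+
  qed
  with F show ?thesis by blast
qed

section \<open>Rotated solutions and corrections by dominated ones\<close>

lemma sector_small_cmult:
  assumes "sector_small k f a b" shows "sector_small k (\<lambda>n w. c * f n w) a b"
proof -
  obtain C where C: "0 < C" "\<And>w n. C \<le> exp (Re w) \<Longrightarrow> a \<le> Im w \<Longrightarrow> Im w \<le> b \<Longrightarrow> n < k \<Longrightarrow>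
      norm (f n w) \<le> C * exp (- Re w)"
    using assms unfolding sector_small_def by blast
  show ?thesis
    unfolding sector_small_def
  proof (intro exI[of _ "C + norm c * C"] conjI allI impI)
    show "0 < C + norm c * C" using C(1) by (simp add: add_pos_nonneg)
    fix w n assume w: "C + norm c * C \<le> exp (Re w)" "a \<le> Im w" "Im w \<le> b" and n: "n < k"
    have "C \<le> exp (Re w)" using w(1) C(1) by (smt (verit) mult_nonneg_nonneg norm_ge_zero)
    then have "norm c * norm (f n w) \<le> norm c * (C * exp (- Re w))"
      using C(2) w n by (intro mult_left_mono) auto
    moreover have "0 \<le> C * exp (- Re w)" using C(1) by simp
    ultimately show "norm (c * f n w) \<le> (C + norm c * C) * exp (- Re w)"
      by (simp add: norm_mult algebra_simps)
  qed
qed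

text \<open>
  The asymptotics of the solution with exponent \<open>can k n\<close>, where the index \<open>n\<close> runs through the
  integers: \<open>n + k\<close> has the same exponent as \<open>n\<close> but the opposite sign.
\<close>

definition asym :: "nat \<Rightarrow> (nat \<Rightarrow> complex \<Rightarrow> complex) \<Rightarrow> int \<Rightarrow> real \<Rightarrow> real \<Rightarrow> bool" where
  "asym k F n = sector_small k (\<lambda>j w. exp (- exp w * can k n) * gauged k F j w - X_entry k j n)"

lemma norm_X_entry_le: "0 < k \<Longrightarrow> norm (X_entry k j n) \<le> 1"
  by (simp add: norm_X_entry)

lemma asym_of_normalized:
  assumes k: "0 < k" and as: "normalized_asym k F a b" shows "asym k F 0 a b"
proof -
  obtain B where B: "0 < B" and B': "\<And>F w. real k * B * exp (- Re w) \<le> 1 / 2 \<Longrightarrow>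
     (\<forall>n<k. norm (normalized k F n w - scaled k F n w) \<le> B * exp (- Re w) * (\<Sum>m<k. norm (scaled k F m w))) \<and>
     (\<Sum>m<k. norm (scaled k F m w)) \<le> 2 * (\<Sum>m<k. norm (normalized k F m w))"
    using scaled_normalized_bound[of k] by blast
  obtain C where C: "0 < C" "\<And>w n. C \<le> exp (Re w) \<Longrightarrow> a \<le> Im w \<Longrightarrow> Im w \<le> b \<Longrightarrow> n < k \<Longrightarrow>
      norm (normalized k F n w - (if n = 0 then 1 else 0)) \<le> C * exp (- Re w)"
    using as unfolding sector_small_def by blast
  define D where "D = max (max C (2 * real k * B)) (real k * (C + B * (4 * real k)))"
  show ?thesis
    unfolding asym_def sector_small_def
  proof (intro exI[of _ D] conjI allI impI)
    show "0 < D" using C(1) by (simp add: D_def)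
    fix w j assume w: "D \<le> exp (Re w)" "a \<le> Im w" "Im w \<le> b" and j: "j < k"
    have N: "norm (normalized k F n w - (if n = 0 then 1 else 0)) \<le> C * exp (- Re w)" if "n < k" for n
      using C(2) w that by (simp add: D_def)
    have "C \<le> exp (Re w)" using w by (simp add: D_def)
    then have Ce: "C * exp (- Re w) \<le> 1" by (simp add: exp_minus field_simps)
    have "2 * real k * B \<le> exp (Re w)" using w by (simp add: D_def)
    then have sm: "real k * B * exp (- Re w) \<le> 1 / 2" by (simp add: exp_minus field_simps)
    have "(\<Sum>m<k. norm (normalized k F m w)) \<le> (\<Sum>m<k. 2)"
    proof (rule sum_mono)
      fix m assume "m \<in> {..<k}"
      then show "norm (normalized k F m w) \<le> 2"
        using N[of m] Ce norm_triangle_sub[of "normalized k F m w" "if m = 0 then 1 else 0"]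
        by (cases "m = 0") auto
    qed
    then have S: "(\<Sum>m<k. norm (scaled k F m w)) \<le> 4 * real k"
      using conjunct2[OF B'[OF sm, of F]] by simp
    have sc: "norm (scaled k F n w - (if n = 0 then 1 else 0)) \<le> (C + B * (4 * real k)) * exp (- Re w)" if n: "n < k" for n
    proof -
      have "norm (normalized k F n w - scaled k F n w) \<le> B * exp (- Re w) * (\<Sum>m<k. norm (scaled k F m w))"
        using B'[OF sm, of F] n by blast
      also have "\<dots> \<le> B * exp (- Re w) * (4 * real k)"
        using S B by (intro mult_left_mono) auto
      finally have "norm (scaled k F n w - normalized k F n w) \<le> B * (4 * real k) * exp (- Re w)"
        by (simp add: norm_minus_commute mult_ac)
      then show ?thesis
        using N[OF n] norm_triangle_ineq[of "scaled k F n w - normalized k F n w" "normalized k F n w - (if n = 0 then 1 else 0)"]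
        by (simp add: algebra_simps)
    qed
    have "exp (- exp w * can k 0) * gauged k F j w = (\<Sum>n<k. X_entry k j (int n) * scaled k F n w)"
    proof -
      have "exp (- exp w * can k 0) * exp (of_nat k * exp w) = 1" by (simp flip: exp_add)
      then show ?thesis unfolding gauged_of_scaled[OF j] by (simp flip: mult.assoc)
    qed
    moreover have "X_entry k j 0 = (\<Sum>n<k. X_entry k j (int n) * (if n = 0 then 1 else 0))"
    proof -
      have "(\<Sum>n<k. X_entry k j (int n) * (if n = 0 then 1 else 0)) = (\<Sum>n<k. if n = 0 then X_entry k j 0 else 0)"
        by (rule sum.cong) auto
      then show ?thesis using k by simp
    qed
    ultimately have "norm (exp (- exp w * can k 0) * gauged k F j w - X_entry k j 0)
        = norm (\<Sum>n<k. X_entry k j (int n) * (scaled k F n w - (if n = 0 then 1 else 0)))"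
      by (simp only: sum_subtractf[symmetric] right_diff_distrib[symmetric])
    also have "\<dots> \<le> (\<Sum>n<k. 1 * ((C + B * (4 * real k)) * exp (- Re w)))"
    proof (rule order_trans[OF norm_sum], rule sum_mono)
      fix n assume "n \<in> {..<k}"
      then show "norm (X_entry k j (int n) * (scaled k F n w - (if n = 0 then 1 else 0))) \<le> 1 * ((C + B * (4 * real k)) * exp (- Re w))"
        unfolding norm_mult by (intro mult_mono[OF norm_X_entry_le[OF k] sc]) auto
    qed
    also have "\<dots> = real k * (C + B * (4 * real k)) * exp (- Re w)" by simp
    also have "\<dots> \<le> D * exp (- Re w)" by (intro mult_right_mono) (auto simp: D_def)
    finally show "norm (exp (- exp w * can k 0) * gauged k F j w - X_entry k j 0) \<le> D * exp (- Re w)" .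
  qed
qed

text \<open>The sign cancels the factor \<open>exp (pi i m)\<close> that the shift produces in
  \<open>exp (w * mu k j)\<close>; what is left there is the phase of column \<open>m\<close> of
  \<open>X\<close>.\<close>

definition rot :: "nat \<Rightarrow> (nat \<Rightarrow> complex \<Rightarrow> complex) \<Rightarrow> int \<Rightarrow> nat \<Rightarrow> complex \<Rightarrow> complex" where
  "rot k F m j w = (if even m then 1 else -1) * F j (w + 2 * of_real pi * \<i> * of_int m / of_nat k)"

lemma qde_solution_rot: "qde_solution k F \<Longrightarrow> 0 < k \<Longrightarrow> qde_solution k (rot k F m)"
  unfolding rot_def[abs_def] by (rule qde_solution_shift)

lemma exp_half_period: "exp (- (of_real pi * \<i> * of_int m)) = (if even m then 1 else -1 :: complex)"
proof -
  have "exp (- (of_real pi * \<i> * of_int m)) = cis (- (pi * of_int m))"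
    by (simp add: cis_conv_exp mult_ac)
  then show ?thesis by (auto simp: complex_eq_iff sin_npi_int cos_npi_int)
qed

lemma gauged_rot:
  assumes k: "0 < k"
  shows "gauged k (rot k F m) j w =
    exp ((2 * of_nat j + 1) * \<i> * of_real pi * of_int m / of_nat k) * gauged k F j (w + 2 * of_real pi * \<i> * of_int m / of_nat k)"
proof -
  let ?s = "2 * of_real pi * \<i> * of_int m / of_nat k :: complex"
  have e: "w * mu k j = (w + ?s) * mu k j + (2 * of_nat j + 1) * \<i> * of_real pi * of_int m / of_nat k
      + - (of_real pi * \<i> * of_int m)"
    using k by (simp add: mu_def field_simps)
  have s: "exp (- (of_real pi * \<i> * of_int m)) * (if even m then 1 else -1) = (1 :: complex)"
    by (simp add: exp_half_period)
  have "exp (w * mu k j) * ((if even m then 1 else -1) * F j (w + ?s)) =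
    exp ((w + ?s) * mu k j) * exp ((2 * of_nat j + 1) * \<i> * of_real pi * of_int m / of_nat k) *
    (exp (- (of_real pi * \<i> * of_int m)) * (if even m then 1 else -1)) * F j (w + ?s)"
    unfolding e exp_add by (simp only: mult.assoc)
  then show ?thesis
    unfolding s gauged_def rot_def by (simp add: mult_ac)
qed

lemma X_entry_add: "X_entry k j m = exp ((2 * of_nat j + 1) * \<i> * of_real pi * of_int m / of_nat k) * X_entry k j 0"
  by (simp add: X_entry_def)

lemma asym_rot:
  assumes k: "0 < k" and as: "asym k F 0 a b"
    and ab: "a' = a - 2 * pi * of_int m / k" "b' = b - 2 * pi * of_int m / k"
  shows "asym k (rot k F m) m a' b'"
proof -
  obtain C where C: "0 < C" "\<And>w j. C \<le> exp (Re w) \<Longrightarrow> a \<le> Im w \<Longrightarrow> Im w \<le> b \<Longrightarrow> j < k \<Longrightarrow>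
      norm (exp (- exp w * can k 0) * gauged k F j w - X_entry k j 0) \<le> C * exp (- Re w)"
    using as unfolding asym_def sector_small_def by blast
  show ?thesis
    unfolding asym_def sector_small_def
  proof (intro exI[of _ C] conjI allI impI C(1))
    fix w j assume w: "C \<le> exp (Re w)" "a' \<le> Im w" "Im w \<le> b'" and j: "j < k"
    let ?w = "w + 2 * of_real pi * \<i> * of_int m / of_nat k"
    let ?e = "exp ((2 * of_nat j + 1) * \<i> * of_real pi * of_int m / of_nat k) :: complex"
    have w': "Re ?w = Re w" "Im ?w = Im w + 2 * pi * of_int m / k" by simp_all
    have "exp ?w * can k 0 = exp w * can k m" by (simp add: exp_add can_def)
    then have "exp (- exp w * can k m) * gauged k (rot k F m) j w - X_entry k j m =
      ?e * (exp (- exp ?w * can k 0) * gauged k F j ?w - X_entry k j 0)"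
      unfolding gauged_rot[OF k] by (subst X_entry_add) (simp add: algebra_simps)
    moreover have "norm ?e = 1" by (simp add: norm_exp_eq_Re)
    ultimately show "norm (exp (- exp w * can k m) * gauged k (rot k F m) j w - X_entry k j m) \<le> C * exp (- Re w)"
      using C(2)[of ?w j] w j w' ab by (simp only: norm_mult) simp
  qed
qed

lemma can_add_period: "0 < k \<Longrightarrow> can k (n + int k) = can k n"
proof -
  assume k: "0 < k"
  have "2 * of_real pi * \<i> * of_int (n + int k) / of_nat k = 2 * of_real pi * \<i> * of_int n / of_nat k + 2 * of_real pi * (\<i>::complex)"
    using k by (simp add: field_simps)
  then show ?thesis unfolding can_def by (simp only: exp_add exp_two_pi_i) simp
qed

lemma X_entry_add_period: "0 < k \<Longrightarrow> X_entry k j (n + int k) = - X_entry k j n"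
proof -
  assume k: "0 < k"
  have "(2 * of_nat j + 1) * \<i> * of_real pi * of_int (n + int k) / of_nat k =
    (2 * of_nat j + 1) * \<i> * of_real pi * of_int n / of_nat k + - (of_real pi * (\<i>::complex) * of_int (- (2 * int j + 1)))"
    using k by (simp add: field_simps)
  then show ?thesis unfolding X_entry_def by (simp only: exp_add exp_half_period) simp
qed

lemma gauged_cmult: "gauged k (\<lambda>j w. c * F j w) j w = c * gauged k F j w"
  by (simp add: gauged_def)

lemma gauged_add: "gauged k (\<lambda>j w. F j w + G j w) j w = gauged k F j w + gauged k G j w"
  by (simp add: gauged_def algebra_simps add_divide_distrib)

lemma asym_minus_period:
  assumes k: "0 < k" and as: "asym k F (n + int k) a b"
  shows "asym k (\<lambda>j w. - F j w) n a b"
proof -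
  have "sector_small k (\<lambda>j w. - 1 * (exp (- exp w * can k (n + int k)) * gauged k F j w - X_entry k j (n + int k))) a b"
    using as unfolding asym_def by (rule sector_small_cmult)
  then show ?thesis
    using gauged_cmult[of k "-1" F]
    by (simp add: asym_def can_add_period[OF k] X_entry_add_period[OF k])
qed

text \<open>On a closed sector compactness gives a uniform rate \<open>\<kappa> > 0\<close> of
  domination, and \<open>exp (- \<kappa> r)\<close> with \<open>r = exp (Re w)\<close> is at most
  \<open>1 / (\<kappa> r)\<close>, so the added solution disappears in the error term.\<close>

lemma asym_add_dominated:
  assumes k: "0 < k" and F: "asym k F n a b" and G: "asym k G m a b"
    and dom: "\<And>\<theta>. a \<le> \<theta> \<Longrightarrow> \<theta> \<le> b \<Longrightarrow> Re (exp (\<i> * of_real \<theta>) * (can k m - can k n)) < 0"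
  shows "asym k (\<lambda>j w. F j w + c * G j w) n a b"
proof (cases "a \<le> b")
  case False
  then show ?thesis by (auto simp: asym_def sector_small_def intro!: exI[of _ 1])
next
  case True
  let ?h = "\<lambda>\<theta>. Re (exp (\<i> * of_real \<theta>) * (can k m - can k n))"
  have "continuous_on {a..b} ?h" by (intro continuous_intros)
  then obtain \<theta>0 where \<theta>0: "\<theta>0 \<in> {a..b}" "\<And>\<theta>. \<theta> \<in> {a..b} \<Longrightarrow> ?h \<theta> \<le> ?h \<theta>0"
    using True continuous_attains_sup[of "{a..b}" ?h] by auto
  define \<kappa> where "\<kappa> = - ?h \<theta>0"
  have \<kappa>: "0 < \<kappa>" using dom[of \<theta>0] \<theta>0(1) by (auto simp: \<kappa>_def)
  obtain C where C: "0 < C" "\<And>w j. C \<le> exp (Re w) \<Longrightarrow> a \<le> Im w \<Longrightarrow> Im w \<le> b \<Longrightarrow> j < k \<Longrightarrow>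
      norm (exp (- exp w * can k m) * gauged k G j w - X_entry k j m) \<le> C * exp (- Re w)"
    using G unfolding asym_def sector_small_def by blast
  have "sector_small k (\<lambda>j w. exp (- exp w * can k n) * gauged k G j w) a b"
    unfolding sector_small_def
  proof (intro exI[of _ "max C (2 / \<kappa>)"] conjI allI impI)
    show "0 < max C (2 / \<kappa>)" using C(1) by simp
    fix w j assume w: "max C (2 / \<kappa>) \<le> exp (Re w)" "a \<le> Im w" "Im w \<le> b" and j: "j < k"
    have "C * exp (- Re w) \<le> 1" using w(1) by (simp add: exp_minus field_simps)
    then have G2: "norm (exp (- exp w * can k m) * gauged k G j w) \<le> 2"
      using C(2)[of w j] w j norm_X_entry_le[OF k, of j m]
        norm_triangle_sub[of "exp (- exp w * can k m) * gauged k G j w" "X_entry k j m"] by simp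
    have "exp (- exp w * can k n) * gauged k G j w =
        exp (exp w * (can k m - can k n)) * (exp (- exp w * can k m) * gauged k G j w)"
      by (simp add: mult.assoc[symmetric] exp_add[symmetric] right_diff_distrib)
    also have "norm \<dots> \<le> exp (- \<kappa> * exp (Re w)) * 2"
    proof -
      have "exp w = of_real (exp (Re w)) * exp (\<i> * of_real (Im w))"
        by (metis complex_eq exp_add exp_of_real)
      then have "Re (exp w * (can k m - can k n)) = exp (Re w) * ?h (Im w)"
        by (simp only: mult.assoc Re_complex_of_real times_complex.sel Im_complex_of_real)
      also have "\<dots> \<le> exp (Re w) * - \<kappa>"
        using \<theta>0(2)[of "Im w"] w by (intro mult_left_mono) (auto simp: \<kappa>_def)
      finally show ?thesis
        unfolding norm_mult[of "exp (exp w * (can k m - can k n))"] norm_exp_eq_Re using G2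
        by (intro mult_mono) (auto simp: mult_ac)
    qed
    also have "exp (- \<kappa> * exp (Re w)) \<le> inverse (\<kappa> * exp (Re w))"
    proof -
      have "\<kappa> * exp (Re w) \<le> exp (\<kappa> * exp (Re w))"
        using exp_ge_add_one_self[of "\<kappa> * exp (Re w)"] by linarith
      then have "inverse (exp (\<kappa> * exp (Re w))) \<le> inverse (\<kappa> * exp (Re w))"
        using \<kappa> by (intro le_imp_inverse_le) auto
      then show ?thesis by (simp only: exp_minus mult_minus_left)
    qed
    also have "inverse (\<kappa> * exp (Re w)) * 2 = 2 / \<kappa> * exp (- Re w)" by (simp add: exp_minus field_simps)
    also have "\<dots> \<le> max C (2 / \<kappa>) * exp (- Re w)" by (intro mult_right_mono) auto
    finally show "norm (exp (- exp w * can k n) * gauged k G j w) \<le> max C (2 / \<kappa>) * exp (- Re w)" by simp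
  qed
  then have "sector_small k (\<lambda>j w. c * (exp (- exp w * can k n) * gauged k G j w)) a b"
    by (rule sector_small_cmult)
  from sector_small_add[OF F[unfolded asym_def] this]
  show ?thesis
    by (simp add: asym_def gauged_add gauged_cmult algebra_simps)
qed

definition asym_open :: "nat \<Rightarrow> (nat \<Rightarrow> complex \<Rightarrow> complex) \<Rightarrow> int \<Rightarrow> real \<Rightarrow> real \<Rightarrow> bool" where
  "asym_open k F n \<alpha> \<beta> \<longleftrightarrow> (\<forall>a b. \<alpha> < a \<longrightarrow> a \<le> b \<longrightarrow> b < \<beta> \<longrightarrow> asym k F n a b)"

lemma asym_open_subset:
  "asym_open k F n \<alpha> \<beta> \<Longrightarrow> \<alpha> \<le> \<alpha>' \<Longrightarrow> \<beta>' \<le> \<beta> \<Longrightarrow> asym_open k F n \<alpha>' \<beta>'"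
  unfolding asym_open_def by (meson le_less_trans less_le_trans)

lemma asym_open_union:
  assumes 1: "asym_open k F n \<alpha> \<beta>'" and 2: "asym_open k F n \<alpha>' \<beta>" and l: "\<alpha>' < \<beta>'"
  shows "asym_open k F n \<alpha> \<beta>"
  unfolding asym_open_def
proof (intro allI impI)
  fix a b assume ab: "\<alpha> < a" "a \<le> b" "b < \<beta>"
  consider "b < \<beta>'" | "\<alpha>' < a" | "a \<le> \<alpha>'" "\<beta>' \<le> b" by linarith
  then show "asym k F n a b"
  proof cases
    case 1 then show ?thesis using assms(1) ab by (simp add: asym_open_def)
  next
    case 2 then show ?thesis using assms(2) ab by (simp add: asym_open_def)
  next
    case 3
    let ?c = "(\<alpha>' + \<beta>') / 2"
    have "asym k F n a ?c" using assms(1) 3 ab l by (simp add: asym_open_def)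
    moreover have "asym k F n ?c b" using assms(2) 3 ab l by (simp add: asym_open_def)
    ultimately show ?thesis unfolding asym_def by (rule sector_small_union) simp
  qed
qed

text \<open>By \<open>Re_can_diff\<close> a positive product of sines says that the exponential of
  index \<open>m\<close> is the smaller one; in this form every application is a question about
  signs of \<open>sin\<close>.\<close>

lemma asym_open_add_dominated:
  assumes "0 < k" "asym_open k F n \<alpha> \<beta>" "asym_open k G m \<alpha> \<beta>"
    and "\<And>\<theta>. \<alpha> < \<theta> \<Longrightarrow> \<theta> < \<beta> \<Longrightarrow> 0 < sin (\<theta> + pi * (of_int m + of_int n) / k) * sin (pi * (of_int m - of_int n) / k)"
  shows "asym_open k (\<lambda>j w. F j w + c * G j w) n \<alpha> \<beta>"
  unfolding asym_open_def
proof (intro allI impI)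
  fix a b assume ab: "\<alpha> < a" "a \<le> b" "b < \<beta>"
  show "asym k (\<lambda>j w. F j w + c * G j w) n a b"
  proof (rule asym_add_dominated[OF assms(1)])
    show "asym k F n a b" "asym k G m a b" using ab assms(2,3) by (auto simp: asym_open_def)
    fix \<theta> assume "a \<le> \<theta>" "\<theta> \<le> b"
    then have "0 < sin (\<theta> + pi * (of_int m + of_int n) / k) * sin (pi * (of_int m - of_int n) / k)"
      using ab by (intro assms(4)) auto
    then have "0 < 2 * real k * (sin (\<theta> + pi * (of_int m + of_int n) / k) * sin (pi * (of_int m - of_int n) / k))"
      by (rule mult_pos_pos[rotated]) (use assms(1) in simp)
    moreover have "Re (exp (\<i> * of_real \<theta>) * (can k m - can k n)) =
       - (2 * real k * (sin (\<theta> + pi * (of_int m + of_int n) / k) * sin (pi * (of_int m - of_int n) / k)))"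
      unfolding Re_can_diff by simp
    ultimately show "Re (exp (\<i> * of_real \<theta>) * (can k m - can k n)) < 0" by simp
  qed
qed

lemma recessive_solution_exists:
  assumes k: "3 \<le> k"
  obtains h where "qde_solution k h"
    "\<And>m. asym_open k (rot k h m) m (- pi / k - 2 * pi * of_int m / k) (2 * pi + pi / k - 2 * pi * of_int m / k)"
proof -
  have k0: "0 < k" using k by simp
  obtain h where h: "qde_solution k h" "\<And>a b. - pi / k < a \<Longrightarrow> b < 2 * pi + pi / k \<Longrightarrow> normalized_asym k h a b"
    using recessive_solution_normalized[OF k] by blast
  have "asym_open k (rot k h m) m (- pi / k - 2 * pi * of_int m / k) (2 * pi + pi / k - 2 * pi * of_int m / k)" for m
    unfolding asym_open_def
  proof (intro allI impI)
    fix a b assume ab: "- pi / k - 2 * pi * of_int m / k < a" "a \<le> b" "b < 2 * pi + pi / k - 2 * pi * of_int m / k"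
    show "asym k (rot k h m) m a b"
      by (rule asym_rot[OF k0 asym_of_normalized[OF k0 h(2)], of "a + 2 * pi * of_int m / k" "b + 2 * pi * of_int m / k"])
        (use ab in auto)
  qed
  with h(1) that show ?thesis by blast
qed

text \<open>The signs inside \<open>rot\<close> absorb the alternating signs of the shift
  relation.\<close>

lemma rot_relation:
  assumes h: "qde_solution k h" and k: "0 < k" and j: "j < k"
  shows "(\<Sum>m\<le>k. of_nat (k choose m) * rot k h (s + int m) j w) = 0"
proof -
  let ?w = "w + 2 * of_real pi * \<i> * of_int s / of_nat k"
  have "rot k h (s + int m) j w = (if even s then 1 else -1) * ((-1) ^ m * h j (?w + 2 * of_real pi * \<i> * of_nat m / of_nat k))" for m
  proof -
    have "w + 2 * of_real pi * \<i> * of_int (s + int m) / of_nat k = ?w + 2 * of_real pi * \<i> * of_nat m / of_nat k"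
      by (simp add: distrib_left add_divide_distrib)
    then show ?thesis unfolding rot_def by (cases "even m"; cases "even s") (simp_all only: even_add even_of_nat_iff if_True if_False, simp_all)
  qed
  then have "(\<Sum>m\<le>k. of_nat (k choose m) * rot k h (s + int m) j w) = (if even s then 1 else -1) *
      (\<Sum>m\<le>k. of_nat (k choose m) * (-1) ^ m * h j (?w + 2 * of_real pi * \<i> * of_nat m / of_nat k))"
    by (simp add: sum_distrib_left mult_ac sum_negf)
  then show ?thesis using qde_solution_shift_relation[OF h k j] by simp
qed

lemma rot_shift:
  "rot k h m j (w + 2 * of_real pi * \<i> / of_nat k) = - rot k h (m + 1) j w"
proof -
  have "w + 2 * of_real pi * \<i> / of_nat k + 2 * of_real pi * \<i> * of_int m / of_nat k =
    w + 2 * of_real pi * \<i> * of_int (m + 1) / of_nat k"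
    by (simp add: distrib_left add_divide_distrib)
  then show ?thesis by (simp only: rot_def) simp
qed

section \<open>Canonical solutions and their connection matrices\<close>

lemma X_mat_eq: "X_mat k = mat k k (\<lambda>(j, n). X_entry k j (int n))"
  by (simp add: X_mat_def X_entry_def)

lemma canonical_coord_eq: "canonical_coord k n = can k (int n)"
  by (simp add: canonical_coord_def can_def)

lemma X_mat_inverse: "the (mat_inverse (X_mat k)) = mat k k (\<lambda>(n, j). cnj (X_entry k j (int n)))"
proof -
  let ?X = "X_mat k" and ?Z = "mat k k (\<lambda>(n, j). cnj (X_entry k j (int n)))"
  have X: "?X \<in> carrier_mat k k" and Z: "?Z \<in> carrier_mat k k" by (simp_all add: X_mat_eq)
  have XZ: "?X * ?Z = 1\<^sub>m k"
    by (rule eq_matI) (auto simp: X_mat_eq scalar_prod_def sum_atLeast0_lessThan X_unitary_rows)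
  have ZX: "?Z * ?X = 1\<^sub>m k"
    by (rule eq_matI) (auto simp: X_mat_eq scalar_prod_def sum_atLeast0_lessThan X_unitary_columns)
  have "?X \<in> Units (ring_mat TYPE(complex) k ())"
    using X Z XZ ZX by (auto simp: Units_def ring_mat_simps)
  then obtain B where B: "mat_inverse ?X = Some B"
    using mat_inverse(1)[OF X, of "()"] by (cases "mat_inverse ?X") auto
  then have B': "B * ?X = 1\<^sub>m k" "B \<in> carrier_mat k k"
    using mat_inverse(2)[OF X B] by auto
  then have "B = B * (?X * ?Z)" by (simp add: XZ)
  also have "\<dots> = ?Z" using B' X Z by (simp add: assoc_mult_mat[symmetric, of B k k ?X k ?Z k])
  finally show ?thesis using B by simp
qed

lemma V_mat_eq: "V_mat k = mat k k (\<lambda>(i, j). V_entry k i j)"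
proof (rule eq_matI)
  fix i j assume ij: "i < dim_row (mat k k (\<lambda>(i, j). V_entry k i j))" "j < dim_col (mat k k (\<lambda>(i, j). V_entry k i j))"
  have D: "mat k k (\<lambda>(n, j). cnj (X_entry k j (int n))) * mu_mat k =
     mat k k (\<lambda>(n, j). cnj (X_entry k j (int n)) * mu k j)"
    unfolding mu_mat_def by (subst mat_diag_mult_right[of _ k k]) (auto simp: mu_def)
  show "V_mat k $$ (i, j) = mat k k (\<lambda>(i, j). V_entry k i j) $$ (i, j)"
    using ij unfolding V_mat_def X_mat_inverse D
    by (simp add: X_mat_eq scalar_prod_def sum_atLeast0_lessThan V_entry_def)
qed (simp_all only: V_mat_def X_mat_inverse, simp_all add: X_mat_eq)

lemma system_entry:
  assumes "Y \<in> carrier_mat k k" "i < k" "n < k"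
  shows "exp w * ((U_mat k + (1 / exp w) \<cdot>\<^sub>m V_mat k) * Y) $$ (i, n) =
    exp w * can k (int i) * Y $$ (i, n) + (\<Sum>m<k. V_entry k i m * Y $$ (m, n))"
proof -
  have "((U_mat k + (1 / exp w) \<cdot>\<^sub>m V_mat k) * Y) $$ (i, n) =
     (\<Sum>m<k. (U_mat k $$ (i, m) + 1 / exp w * V_entry k i m) * Y $$ (m, n))"
    using assms by (simp add: scalar_prod_def sum_atLeast0_lessThan V_mat_eq U_mat_def mat_diag_def)
  also have "\<dots> = (\<Sum>m<k. U_mat k $$ (i, m) * Y $$ (m, n)) + (\<Sum>m<k. V_entry k i m * Y $$ (m, n)) / exp w"
    by (simp add: distrib_right sum.distrib sum_divide_distrib)
  also have "(\<Sum>m<k. U_mat k $$ (i, m) * Y $$ (m, n)) = (\<Sum>m<k. if m = i then can k (int i) * Y $$ (i, n) else 0)"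
    using assms by (intro sum.cong) (auto simp: U_mat_def mat_diag_def canonical_coord_eq)
  also have "\<dots> = can k (int i) * Y $$ (i, n)" using assms by simp
  finally show ?thesis by (simp add: distrib_left mult.assoc)
qed

lemma X_entry_cyclic_cnj:
  assumes "j < k"
  shows "X_entry k j n * can k n = of_nat k * X_entry k (if Suc j < k then Suc j else 0) n"
proof -
  have "cnj (can k n) * can k n = of_nat k * of_nat k"
    by (simp add: can_def exp_cnj exp_add[symmetric])
  moreover have "of_nat k * X_entry k j n = cnj (can k n) * X_entry k (if Suc j < k then Suc j else 0) n"
    using arg_cong[OF X_entry_cyclic[OF assms, of n], of cnj] by simp
  moreover have "of_nat k * (X_entry k j n * can k n) = (of_nat k * X_entry k j n) * can k n" by simp
  ultimately have "of_nat k * (X_entry k j n * can k n) =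
      of_nat k * (of_nat k * X_entry k (if Suc j < k then Suc j else 0) n)"
    by (simp only: mult.commute[of "cnj (can k n)"] mult.assoc) (simp only: mult_ac)
  moreover have "of_nat k \<noteq> (0 :: complex)" using assms by auto
  ultimately show ?thesis by (simp only: mult_cancel_left) simp
qed

text \<open>The converse of \<open>ycol_deriv\<close>: removing the weights \<open>mu k j\<close>
  from \<open>X v\<close> gives a scalar solution with its derivatives, so that every solution of
  the system is reached from \<open>qde_solution\<close>.\<close>

lemma solution_of_system:
  assumes "\<And>i w. i < k \<Longrightarrow> (v i has_field_derivative exp w * can k (int i) * v i w + (\<Sum>m<k. V_entry k i m * v m w)) (at w)"
  obtains F where "qde_solution k F" "\<And>i w. i < k \<Longrightarrow> ycol k F i w = v i w"
proof
  define y where "y = (\<lambda>j w. \<Sum>i<k. X_entry k j (int i) * v i w)"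
  let ?F = "\<lambda>j w. exp (- w * mu k j) * of_nat k ^ j * y j w"
  let ?s = "\<lambda>j. if Suc j < k then Suc j else 0"
  have y': "(y j has_field_derivative mu k j * y j w + of_nat k * exp w * y (?s j) w) (at w)" if j: "j < k" for j w
  proof -
    have "(y j has_field_derivative (\<Sum>i<k. X_entry k j (int i) * (exp w * can k (int i) * v i w + (\<Sum>m<k. V_entry k i m * v m w)))) (at w)"
      unfolding y_def by (intro DERIV_sum DERIV_cmult assms) auto
    moreover have "(\<Sum>i<k. X_entry k j (int i) * (exp w * can k (int i) * v i w)) = of_nat k * exp w * y (?s j) w"
    proof -
      have "(\<Sum>i<k. X_entry k j (int i) * (exp w * can k (int i) * v i w)) =
        (\<Sum>i<k. exp w * (X_entry k j (int i) * can k (int i)) * v i w)" by (simp add: mult_ac)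
      then show ?thesis
        unfolding X_entry_cyclic_cnj[OF j] by (simp add: y_def sum_distrib_left mult_ac)
    qed
    moreover have "(\<Sum>i<k. X_entry k j (int i) * (\<Sum>m<k. V_entry k i m * v m w)) = mu k j * y j w"
    proof -
      have V: "(\<Sum>i<k. X_entry k j (int i) * V_entry k i m) = mu k j * X_entry k j (int m)" for m
      proof -
        have "(\<Sum>i<k. X_entry k j (int i) * V_entry k i m) =
          (\<Sum>l<k. (\<Sum>i<k. X_entry k j (int i) * cnj (X_entry k l (int i))) * (mu k l * X_entry k l (int m)))"
          unfolding V_entry_def sum_distrib_left sum_distrib_right by (subst sum.swap) (simp add: mult_ac)
        also have "\<dots> = (\<Sum>l<k. if l = j then mu k j * X_entry k j (int m) else 0)"
          using j by (intro sum.cong) (auto simp: X_unitary_rows)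
        finally show ?thesis using j by simp
      qed
      have "(\<Sum>i<k. X_entry k j (int i) * (\<Sum>m<k. V_entry k i m * v m w)) =
         (\<Sum>m<k. (\<Sum>i<k. X_entry k j (int i) * V_entry k i m) * v m w)"
        unfolding sum_distrib_left sum_distrib_right by (subst sum.swap) (simp add: mult_ac)
      then show ?thesis unfolding V by (simp add: y_def sum_distrib_left mult_ac)
    qed
    ultimately show ?thesis by (simp add: distrib_left sum.distrib add.commute)
  qed
  show "qde_solution k ?F"
    unfolding qde_solution_def
  proof (intro allI impI)
    fix j w assume j: "j < k"
    have "(?F j has_field_derivative exp (- w * mu k j) * of_nat k ^ j * (mu k j * y j w + of_nat k * exp w * y (?s j) w)
       + - mu k j * exp (- w * mu k j) * of_nat k ^ j * y j w) (at w)"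
      by (rule DERIV_mult'[OF _ y'[OF j]]) (auto intro!: derivative_eq_intros)
    then have "(?F j has_field_derivative exp (- w * mu k j) * exp w * (of_nat k ^ Suc j * y (?s j) w)) (at w)"
      by (rule DERIV_cong) (simp add: algebra_simps)
    moreover have "exp (- w * mu k j) * exp w * (of_nat k ^ Suc j * y (?s j) w) =
        (if Suc j < k then ?F (Suc j) w else of_nat k ^ k * exp (of_nat k * w) * ?F 0 w)"
    proof -
      have e: "exp (- w * mu k j) * exp w = exp (- w * mu k (Suc j))"
        by (simp add: exp_add[symmetric] mu_def algebra_simps)
      show ?thesis
      proof (cases "Suc j < k")
        case True
        then show ?thesis unfolding e by (simp add: mult_ac)
      next
        case False
        then have kj: "k = Suc j" using j by simp
        have e2: "exp (- w * mu k (Suc j)) = exp (of_nat k * w) * exp (- w * mu k 0)"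
          by (simp add: exp_add[symmetric] mu_def algebra_simps kj)
        show ?thesis unfolding e e2 using False kj[symmetric] by (simp only: if_False) simp
      qed
    qed
    ultimately show "(?F j has_field_derivative (if Suc j < k then ?F (Suc j) w
        else of_nat k ^ k * exp (of_nat k * w) * ?F 0 w)) (at w)"
      by (simp only:)
  qed
  fix i w assume i: "i < k"
  then have k: "of_nat k \<noteq> (0 :: complex)" by auto
  have g: "gauged k ?F j w = y j w" for j
    using k by (simp add: gauged_def mult.assoc[symmetric] exp_add[symmetric])
  have "ycol k ?F i w = (\<Sum>j<k. cnj (X_entry k j (int i)) * y j w)"
    by (simp only: ycol_def g)
  also have "\<dots> = (\<Sum>m<k. (\<Sum>j<k. cnj (X_entry k j (int i)) * X_entry k j (int m)) * v m w)"
    unfolding y_def sum_distrib_left sum_distrib_right by (subst sum.swap) (simp add: mult_ac)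
  also have "\<dots> = (\<Sum>m<k. if m = i then v i w else 0)"
    using i by (intro sum.cong) (auto simp: X_unitary_columns)
  finally show "ycol k ?F i w = v i w" using i by simp
qed

lemma solution_zero_of_ycol_zero:
  assumes F: "qde_solution k F" and z: "\<And>i. i < k \<Longrightarrow> ycol k F i p = 0" and j: "j < k"
  shows "F j w = 0"
proof (rule qde_solution_unique[OF F _ _ j])
  show k: "0 < k" using j by simp
  fix j assume "j < k"
  then have "gauged k F j p = 0" by (simp add: gauged_eq_sum_ycol z)
  then show "F j p = 0" using solution_of_gauged[OF k, of F j p] by simp
qed

section \<open>Bases of solutions, limits of coefficients and uniqueness\<close>

definition independent_solutions :: "nat \<Rightarrow> (nat \<Rightarrow> nat \<Rightarrow> complex \<Rightarrow> complex) \<Rightarrow> bool" where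
  "independent_solutions k Fs \<longleftrightarrow>
     (\<forall>c. (\<forall>j<k. \<forall>w. (\<Sum>l<k. c l * Fs l j w) = 0) \<longrightarrow> (\<forall>l<k. c l = 0))"

definition sol_mat :: "nat \<Rightarrow> (nat \<Rightarrow> nat \<Rightarrow> complex \<Rightarrow> complex) \<Rightarrow> complex \<Rightarrow> complex mat" where
  "sol_mat k Fs w = mat k k (\<lambda>(i, n). ycol k (Fs n) i w)"

lemma sol_mat_carrier [simp]: "sol_mat k Fs w \<in> carrier_mat k k"
  by (simp add: sol_mat_def)

lemma sol_mat_unit:
  assumes sol: "\<And>n. n < k \<Longrightarrow> qde_solution k (Fs n)" and ind: "independent_solutions k Fs"
  obtains B where "B \<in> carrier_mat k k" "sol_mat k Fs w * B = 1\<^sub>m k" "B * sol_mat k Fs w = 1\<^sub>m k"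
proof -
  have "det (sol_mat k Fs w) \<noteq> 0"
  proof
    assume "det (sol_mat k Fs w) = 0"
    then obtain v where v: "v \<in> carrier_vec k" "v \<noteq> 0\<^sub>v k" "sol_mat k Fs w *\<^sub>v v = 0\<^sub>v k"
      using det_0_iff_vec_prod_zero[OF sol_mat_carrier] by blast
    let ?F = "\<lambda>j w. \<Sum>i<k. v $ i * Fs i j w"
    have F: "qde_solution k ?F" by (intro qde_solution_sum sol) auto
    have "ycol k ?F i w = 0" if "i < k" for i
    proof -
      have "(sol_mat k Fs w *\<^sub>v v) $ i = ycol k ?F i w"
        using that v(1) by (simp add: sol_mat_def ycol_sum scalar_prod_def sum_atLeast0_lessThan mult.commute)
      then show ?thesis using v(3) that by simp
    qed
    then have "?F j x = 0" if "j < k" for j x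
      using solution_zero_of_ycol_zero[OF F] that by blast
    then have "v $ i = 0" if "i < k" for i
      using ind that unfolding independent_solutions_def by blast
    then have "v = 0\<^sub>v k" using v(1) by (intro eq_vecI) auto
    with v(2) show False by contradiction
  qed
  then show ?thesis
    using det_non_zero_imp_unit[OF sol_mat_carrier] that by (auto simp: Units_def ring_mat_simps)
qed

lemma solution_expansion:
  assumes sol: "\<And>n. n < k \<Longrightarrow> qde_solution k (Fs n)" and ind: "independent_solutions k Fs"
    and G: "qde_solution k G"
  obtains c where "\<And>j w. j < k \<Longrightarrow> G j w = (\<Sum>l<k. c l * Fs l j w)"
proof -
  obtain B where B: "B \<in> carrier_mat k k" "sol_mat k Fs 0 * B = 1\<^sub>m k"
    using sol_mat_unit[OF sol ind] by blast
  define v where "v = B *\<^sub>v vec k (\<lambda>i. ycol k G i 0)"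
  have v: "v \<in> carrier_vec k" using B by (simp add: v_def)
  have "sol_mat k Fs 0 *\<^sub>v v = vec k (\<lambda>i. ycol k G i 0)"
    using B assoc_mult_mat_vec[of "sol_mat k Fs 0" k k B k "vec k (\<lambda>i. ycol k G i 0)"]
    by (simp add: v_def)
  then have "(sol_mat k Fs 0 *\<^sub>v v) $ i = ycol k G i 0" if "i < k" for i using that by simp
  moreover have "(sol_mat k Fs 0 *\<^sub>v v) $ i = ycol k (\<lambda>j w. \<Sum>l<k. v $ l * Fs l j w) i 0" if "i < k" for i
    using that v by (simp add: sol_mat_def ycol_sum scalar_prod_def sum_atLeast0_lessThan mult.commute)
  ultimately have y: "ycol k (\<lambda>j w. G j w - (\<Sum>l<k. v $ l * Fs l j w)) i 0 = 0" if "i < k" for i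
    using that by (simp add: ycol_def gauged_def sum_subtractf right_diff_distrib diff_divide_distrib) 
  have "qde_solution k (\<lambda>j w. G j w - (\<Sum>l<k. v $ l * Fs l j w))"
    by (intro qde_solution_diff G qde_solution_sum sol) auto
  from solution_zero_of_ycol_zero[OF this y] that show ?thesis by fastforce
qed

text \<open>For a system \<open>(1 + E) x = y\<close> with \<open>E\<close> tending to 0: once the
  norms of the entries of \<open>E\<close> add up to less than \<open>1 / 2\<close>, the total norm
  of \<open>x\<close> is at most twice that of \<open>y\<close>, hence bounded, and
  \<open>E x\<close> tends to 0.\<close>

lemma perturbed_identity_limit:
  fixes x y :: "nat \<Rightarrow> real \<Rightarrow> complex" and E :: "nat \<Rightarrow> nat \<Rightarrow> real \<Rightarrow> complex"
  assumes E: "\<And>i l. i < k \<Longrightarrow> l < k \<Longrightarrow> (E i l \<longlongrightarrow> 0) at_top"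
    and eq: "\<And>i t. i < k \<Longrightarrow> y i t = x i t + (\<Sum>l<k. E i l t * x l t)"
    and y: "\<And>i. i < k \<Longrightarrow> (y i \<longlongrightarrow> L i) at_top" and i: "i < k"
  shows "(x i \<longlongrightarrow> L i) at_top"
proof -
  define \<epsilon> where "\<epsilon> = (\<lambda>t. \<Sum>i<k. \<Sum>l<k. norm (E i l t))"
  define Sy where "Sy = (\<lambda>t. \<Sum>i<k. norm (y i t))"
  have \<epsilon>: "(\<epsilon> \<longlongrightarrow> (\<Sum>i<k. \<Sum>l<k. 0)) at_top"
    unfolding \<epsilon>_def by (intro tendsto_sum tendsto_norm_zero E) auto
  then have \<epsilon>0: "(\<epsilon> \<longlongrightarrow> 0) at_top" by simp
  have Sy: "(Sy \<longlongrightarrow> (\<Sum>i<k. norm (L i))) at_top"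
    unfolding Sy_def by (intro tendsto_sum tendsto_norm y) auto
  have row: "norm (\<Sum>l<k. E i l t * x l t) \<le> (\<Sum>l<k. norm (E i l t)) * (\<Sum>l<k. norm (x l t))" for i t
  proof -
    have "norm (\<Sum>l<k. E i l t * x l t) \<le> (\<Sum>l<k. norm (E i l t) * norm (x l t))"
      by (rule order_trans[OF norm_sum]) (simp add: norm_mult)
    also have "\<dots> \<le> (\<Sum>l<k. norm (E i l t) * (\<Sum>l<k. norm (x l t)))"
      by (intro sum_mono mult_left_mono member_le_sum) auto
    finally show ?thesis by (simp add: sum_distrib_right)
  qed
  have "\<forall>\<^sub>F t in at_top. \<epsilon> t < 1 / 2" using \<epsilon>0 by (rule order_tendstoD) simp
  then have "\<forall>\<^sub>F t in at_top. norm (x i t - y i t) \<le> \<epsilon> t * (2 * Sy t)"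
  proof eventually_elim
    case (elim t)
    let ?S = "\<Sum>l<k. norm (x l t)"
    have "?S \<le> (\<Sum>i<k. norm (y i t) + (\<Sum>l<k. norm (E i l t)) * ?S)"
    proof (rule sum_mono)
      fix i assume "i \<in> {..<k}"
      then have "x i t = y i t - (\<Sum>l<k. E i l t * x l t)" using eq by simp
      then show "norm (x i t) \<le> norm (y i t) + (\<Sum>l<k. norm (E i l t)) * ?S"
        using norm_triangle_ineq4[of "y i t" "\<Sum>l<k. E i l t * x l t"] row[of i t] by simp
    qed
    also have "\<dots> = Sy t + \<epsilon> t * ?S"
      by (simp add: sum.distrib Sy_def \<epsilon>_def sum_distrib_right)
    also have "\<epsilon> t * ?S \<le> 1 / 2 * ?S" using elim by (intro mult_right_mono sum_nonneg) auto
    finally have S: "?S \<le> 2 * Sy t" by simp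
    have "norm (x i t - y i t) = norm (\<Sum>l<k. E i l t * x l t)" using eq[OF i] by simp
    also have "\<dots> \<le> (\<Sum>l<k. norm (E i l t)) * ?S" by (rule row)
    also have "\<dots> \<le> \<epsilon> t * (2 * Sy t)"
      unfolding \<epsilon>_def using i S
      by (intro mult_mono member_le_sum[of i "{..<k}" "\<lambda>i. \<Sum>l<k. norm (E i l t)"] sum_nonneg) auto
    finally show ?case .
  qed
  moreover have "((\<lambda>t. \<epsilon> t * (2 * Sy t)) \<longlongrightarrow> 0) at_top"
    using tendsto_mult[OF \<epsilon>0 tendsto_mult[OF tendsto_const[of 2] Sy]] by simp
  ultimately have "((\<lambda>t. x i t - y i t) \<longlongrightarrow> 0) at_top"
    by (rule Lim_null_comparison)
  from tendsto_add[OF this y[OF i]] show ?thesis by simp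
qed

lemma asym_ycol:
  assumes as: "asym k F (int n) a b" and n: "n < k"
  shows "sector_small k (\<lambda>i w. exp (- exp w * can k (int n)) * ycol k F i w - (if i = n then 1 else 0)) a b"
proof -
  have k: "0 < k" using n by simp
  obtain C where C: "0 < C" "\<And>w j. C \<le> exp (Re w) \<Longrightarrow> a \<le> Im w \<Longrightarrow> Im w \<le> b \<Longrightarrow> j < k \<Longrightarrow>
      norm (exp (- exp w * can k (int n)) * gauged k F j w - X_entry k j (int n)) \<le> C * exp (- Re w)"
    using as unfolding asym_def sector_small_def by blast
  show ?thesis
    unfolding sector_small_def
  proof (intro exI[of _ "real k * C"] conjI allI impI)
    show "0 < real k * C" using C k by simp
    fix w i assume w: "real k * C \<le> exp (Re w)" "a \<le> Im w" "Im w \<le> b" and i: "i < k"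
    have "1 * C \<le> real k * C" using C k by (intro mult_right_mono) auto
    then have Cw: "C \<le> exp (Re w)" using w by simp
    let ?d = "\<lambda>j. exp (- exp w * can k (int n)) * gauged k F j w - X_entry k j (int n)"
    have 1: "(\<Sum>j<k. cnj (X_entry k j (int i)) * X_entry k j (int n)) = (if i = n then 1 else 0)"
      using i n by (rule X_unitary_columns)
    have 2: "exp (- exp w * can k (int n)) * ycol k F i w =
       (\<Sum>j<k. cnj (X_entry k j (int i)) * (exp (- exp w * can k (int n)) * gauged k F j w))"
      by (simp add: ycol_def sum_distrib_left mult_ac)
    have "exp (- exp w * can k (int n)) * ycol k F i w - (if i = n then 1 else 0) =
       (\<Sum>j<k. cnj (X_entry k j (int i)) * ?d j)"
      unfolding 1[symmetric] 2 by (simp only: right_diff_distrib sum_subtractf)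
    also have "norm \<dots> \<le> (\<Sum>j<k. 1 * (C * exp (- Re w)))"
    proof (rule order_trans[OF norm_sum], rule sum_mono)
      fix j assume "j \<in> {..<k}"
      then have "norm (?d j) \<le> C * exp (- Re w)" using C(2) w Cw by simp
      moreover have "norm (cnj (X_entry k j (int i))) \<le> 1" using norm_X_entry_le[OF k] by simp
      ultimately show "norm (cnj (X_entry k j (int i)) * ?d j) \<le> 1 * (C * exp (- Re w))"
        unfolding norm_mult by (intro mult_mono) auto
    qed
    finally show "norm (exp (- exp w * can k (int n)) * ycol k F i w - (if i = n then 1 else 0)) \<le> real k * C * exp (- Re w)"
      by simp
  qed
qed

lemma tendsto_exp_minus_zero: "((\<lambda>t::real. C * exp (- t)) \<longlongrightarrow> 0) at_top"
proof -
  have "((\<lambda>t::real. exp (- t)) \<longlongrightarrow> 0) at_top"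
    by (intro filterlim_compose[OF exp_at_bot] filterlim_uminus_at_bot_at_top)
  then show ?thesis by (rule tendsto_mult_right_zero)
qed

lemma sector_small_ray_limit:
  assumes "sector_small k f a b" "a \<le> \<theta>" "\<theta> \<le> b" "i < k"
  shows "((\<lambda>t. f i (Complex t \<theta>)) \<longlongrightarrow> 0) at_top"
proof -
  obtain C where C: "0 < C" "\<And>w n. C \<le> exp (Re w) \<Longrightarrow> a \<le> Im w \<Longrightarrow> Im w \<le> b \<Longrightarrow> n < k \<Longrightarrow>
      norm (f n w) \<le> C * exp (- Re w)"
    using assms(1) unfolding sector_small_def by blast
  have "\<forall>\<^sub>F t in at_top. C \<le> exp t"
    using exp_at_top by (simp add: filterlim_at_top)
  then have "\<forall>\<^sub>F t in at_top. norm (f i (Complex t \<theta>)) \<le> C * exp (- t)"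
  proof eventually_elim
    case (elim t)
    then show ?case using C(2)[of "Complex t \<theta>" i] assms by simp
  qed
  then show ?thesis using tendsto_exp_minus_zero by (rule Lim_null_comparison)
qed

definition canonical_solutions :: "nat \<Rightarrow> real \<Rightarrow> real \<Rightarrow> (nat \<Rightarrow> nat \<Rightarrow> complex \<Rightarrow> complex) \<Rightarrow> bool" where
  "canonical_solutions k \<alpha> \<beta> Fs \<longleftrightarrow>
     (\<forall>n<k. qde_solution k (Fs n) \<and> asym_open k (Fs n) (int n) \<alpha> \<beta>)"

lemma canonical_solutions_small:
  assumes "canonical_solutions k \<alpha> \<beta> Fs" "\<alpha> < a" "a \<le> b" "b < \<beta>" "n < k"
  shows "sector_small k (\<lambda>i w. exp (- exp w * can k (int n)) * ycol k (Fs n) i w - (if i = n then 1 else 0)) a b"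
  using assms by (intro asym_ycol) (auto simp: canonical_solutions_def asym_open_def)

text \<open>Along a ray the canonical basis is a perturbation of the identity times a diagonal
  matrix of exponentials, so the limit can be read off for each coefficient separately.\<close>

lemma coefficient_limit:
  assumes Fs: "canonical_solutions k \<alpha> \<beta> Fs" and \<theta>: "\<alpha> < \<theta>" "\<theta> < \<beta>"
    and G: "\<And>j w. j < k \<Longrightarrow> G j w = (\<Sum>l<k. c l * Fs l j w)"
    and lim: "\<And>i. i < k \<Longrightarrow> ((\<lambda>t. exp (- exp (Complex t \<theta>) * can k n) * ycol k G i (Complex t \<theta>)) \<longlongrightarrow> L i) at_top"
    and i: "i < k"
  shows "((\<lambda>t. c i * exp (exp (Complex t \<theta>) * (can k (int i) - can k n))) \<longlongrightarrow> L i) at_top"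
proof (rule perturbed_identity_limit[OF _ _ lim i, where x = "\<lambda>l t. c l * exp (exp (Complex t \<theta>) * (can k (int l) - can k n))"
    and E = "\<lambda>i l t. exp (- exp (Complex t \<theta>) * can k (int l)) * ycol k (Fs l) i (Complex t \<theta>) - (if i = l then 1 else 0)"])
  let ?E = "\<lambda>i l t. exp (- exp (Complex t \<theta>) * can k (int l)) * ycol k (Fs l) i (Complex t \<theta>) - (if i = l then 1 else 0)"
  show "(?E i l \<longlongrightarrow> 0) at_top" if "i < k" "l < k" for i l
    using sector_small_ray_limit[OF canonical_solutions_small[OF Fs \<theta>(1) order_refl \<theta>(2) that(2)] order_refl order_refl that(1)] .
  fix i t assume i: "i < k"
  let ?W = "Complex t \<theta>"
  let ?x = "\<lambda>l. c l * exp (exp ?W * (can k (int l) - can k n))"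
  have e: "exp (exp ?W * (can k (int l) - can k n)) * exp (- exp ?W * can k (int l)) = exp (- exp ?W * can k n)" for l
    by (simp add: exp_add[symmetric] algebra_simps)
  have "ycol k G i ?W = (\<Sum>l<k. c l * ycol k (Fs l) i ?W)"
    unfolding ycol_sum[symmetric] by (simp add: ycol_def gauged_def G)
  then have "exp (- exp ?W * can k n) * ycol k G i ?W =
      (\<Sum>l<k. c l * exp (- exp ?W * can k n) * ycol k (Fs l) i ?W)"
    by (simp add: sum_distrib_left mult_ac)
  also have "\<dots> = (\<Sum>l<k. ?x l * (if i = l then 1 else 0) + ?E i l t * ?x l)"
  proof (rule sum.cong[OF refl])
    fix l
    have gen: "x * q * d + (p * y - d) * (x * q) = x * (q * p) * y" for x q d p y :: complex
      by (simp add: algebra_simps)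
    show "c l * exp (- exp ?W * can k n) * ycol k (Fs l) i ?W = ?x l * (if i = l then 1 else 0) + ?E i l t * ?x l"
      unfolding gen e ..
  qed
  also have "\<dots> = ?x i + (\<Sum>l<k. ?E i l t * ?x l)"
  proof -
    have "(\<Sum>l<k. ?x l * (if i = l then 1 else 0)) = (\<Sum>l<k. if l = i then ?x i else 0)"
      by (rule sum.cong) auto
    then show ?thesis using i by (simp add: sum.distrib)
  qed
  finally show "exp (- exp ?W * can k n) * ycol k G i ?W = ?x i + (\<Sum>l<k. ?E i l t * ?x l)" .
qed

lemma canonical_solutions_independent:
  assumes Fs: "canonical_solutions k \<alpha> \<beta> Fs" and "\<alpha> < \<beta>"
  shows "independent_solutions k Fs"
  unfolding independent_solutions_def
proof (intro allI impI)
  fix c l assume z: "\<forall>j<k. \<forall>w. (\<Sum>l<k. c l * Fs l j w) = 0" and l: "l < k"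
  obtain \<theta> where \<theta>: "\<alpha> < \<theta>" "\<theta> < \<beta>" using dense[OF \<open>\<alpha> < \<beta>\<close>] by blast
  have "((\<lambda>t. c l * exp (exp (Complex t \<theta>) * (can k (int l) - can k (int l)))) \<longlongrightarrow> 0) at_top"
    by (rule coefficient_limit[OF Fs \<theta>, of "\<lambda>_ _. 0"]) (use z l in \<open>auto simp: ycol_def gauged_def\<close>)
  then show "c l = 0" by (simp add: tendsto_const_iff)
qed

lemma eventually_sector_at_infinity:
  "eventually P (sector_at_infinity a b) \<longleftrightarrow> (\<exists>R. \<forall>w. R \<le> Re w \<longrightarrow> a \<le> Im w \<longrightarrow> Im w \<le> b \<longrightarrow> P w)"
  unfolding sector_at_infinity_def eventually_inf_principal eventually_filtercomap eventually_at_top_linorder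
proof safe
  fix Q N assume "\<forall>n\<ge>N. Q n" "\<forall>x. Q (Re x) \<longrightarrow> x \<in> {w. a \<le> Im w \<and> Im w \<le> b} \<longrightarrow> P x"
  then show "\<exists>R. \<forall>w. R \<le> Re w \<longrightarrow> a \<le> Im w \<longrightarrow> Im w \<le> b \<longrightarrow> P w" by auto
next
  fix R assume "\<forall>w. R \<le> Re w \<longrightarrow> a \<le> Im w \<longrightarrow> Im w \<le> b \<longrightarrow> P w"
  then show "\<exists>Q. (\<exists>N. \<forall>n\<ge>N. Q n) \<and> (\<forall>x. Q (Re x) \<longrightarrow> x \<in> {w. a \<le> Im w \<and> Im w \<le> b} \<longrightarrow> P x)"
    by (intro exI[of _ "\<lambda>x. R \<le> x"]) auto
qed

lemma mult_mat_diag_index: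
  fixes A :: "complex mat"
  assumes "A \<in> carrier_mat k k" "i < k" "n < k" shows "(A * mat_diag k d) $$ (i, n) = A $$ (i, n) * d n"
  using assms by (subst mat_diag_mult_right[OF assms(1)]) auto

lemma sol_mat_fundamental:
  assumes sol: "\<And>n. n < k \<Longrightarrow> qde_solution k (Fs n)" and ind: "independent_solutions k Fs"
  shows "fundamental_solution k (sol_mat k Fs)"
  unfolding fundamental_solution_def
proof (intro conjI allI impI)
  fix w
  show "sol_mat k Fs w \<in> carrier_mat k k" by simp
  obtain B where "B \<in> carrier_mat k k" "sol_mat k Fs w * B = 1\<^sub>m k" "B * sol_mat k Fs w = 1\<^sub>m k"
    using sol_mat_unit[OF sol ind] by blast
  then show "invertible_mat (sol_mat k Fs w)"
    unfolding invertible_mat_def inverts_mat_def square_mat.simps by (intro conjI exI[of _ B]) (auto simp: sol_mat_def)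
  fix i n assume i: "i < k" and n: "n < k"
  have "((\<lambda>w. sol_mat k Fs w $$ (i, n)) has_field_derivative
      exp w * can k (int i) * ycol k (Fs n) i w + (\<Sum>m<k. V_entry k i m * ycol k (Fs n) m w)) (at w)"
    using ycol_deriv[OF sol[OF n] i, of w] i n by (simp add: sol_mat_def)
  also have "exp w * can k (int i) * ycol k (Fs n) i w + (\<Sum>m<k. V_entry k i m * ycol k (Fs n) m w) =
      exp w * ((U_mat k + (1 / exp w) \<cdot>\<^sub>m V_mat k) * sol_mat k Fs w) $$ (i, n)"
    unfolding system_entry[OF sol_mat_carrier i n] using i n by (simp add: sol_mat_def)
  finally show "((\<lambda>w. sol_mat k Fs w $$ (i, n)) has_field_derivative
      exp w * ((U_mat k + (1 / exp w) \<cdot>\<^sub>m V_mat k) * sol_mat k Fs w) $$ (i, n)) (at w)" .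
qed

lemma sol_mat_asymptotics:
  assumes Fs: "canonical_solutions k \<alpha> \<beta> Fs"
  shows "sector_asymptotics k \<alpha> \<beta> (sol_mat k Fs)"
  unfolding sector_asymptotics_def
proof (intro exI conjI allI impI)
  let ?E = "\<lambda>w. mat k k (\<lambda>(i, n). exp (- exp w * can k (int n)) * ycol k (Fs n) i w - (if i = n then 1 else 0))"
  fix w
  show "?E w \<in> carrier_mat k k" by simp
  have "1\<^sub>m k + ?E w \<in> carrier_mat k k" by simp
  note idx = mult_mat_diag_index[OF this]
  show "sol_mat k Fs w = (1\<^sub>m k + ?E w) * mat_diag k (\<lambda>n. exp (exp w * canonical_coord k n))"
  proof (rule eq_matI)
    fix i n assume "i < dim_row ((1\<^sub>m k + ?E w) * mat_diag k (\<lambda>n. exp (exp w * canonical_coord k n)))"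
      "n < dim_col ((1\<^sub>m k + ?E w) * mat_diag k (\<lambda>n. exp (exp w * canonical_coord k n)))"
    then have i: "i < k" and n: "n < k" by (auto simp: mat_diag_def)
    have "exp (- exp w * can k (int n)) * exp (exp w * can k (int n)) = 1" by (simp flip: exp_add)
    then show "sol_mat k Fs w $$ (i, n) = ((1\<^sub>m k + ?E w) * mat_diag k (\<lambda>n. exp (exp w * canonical_coord k n))) $$ (i, n)"
      unfolding idx[OF i n] using i n by (simp add: sol_mat_def canonical_coord_eq)
  qed (simp_all add: sol_mat_def mat_diag_def)
  fix a b i n assume ab: "\<alpha> < a \<and> a \<le> b \<and> b < \<beta>" and i: "i < k" and n: "n < k"
  obtain C where C: "0 < C" "\<And>w i. C \<le> exp (Re w) \<Longrightarrow> a \<le> Im w \<Longrightarrow> Im w \<le> b \<Longrightarrow> i < k \<Longrightarrow>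
      norm (exp (- exp w * can k (int n)) * ycol k (Fs n) i w - (if i = n then 1 else 0)) \<le> C * exp (- Re w)"
    using canonical_solutions_small[OF Fs _ _ _ n, of a b] ab unfolding sector_small_def by blast
  show "(\<lambda>w. ?E w $$ (i, n)) \<in> O[sector_at_infinity a b](\<lambda>w. 1 / exp w)"
  proof (rule bigoI[where c = C], unfold eventually_sector_at_infinity, intro exI[of _ "ln C"] allI impI)
    fix w assume w: "ln C \<le> Re w" "a \<le> Im w" "Im w \<le> b"
    then have "C \<le> exp (Re w)" using C(1) by (metis exp_ln exp_le_cancel_iff)
    then have "norm (exp (- exp w * can k (int n)) * ycol k (Fs n) i w - (if i = n then 1 else 0)) \<le> C * exp (- Re w)"
      using C(2) w i by blast
    then show "norm (?E w $$ (i, n)) \<le> C * norm (1 / exp w)"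
      using i n by (simp add: norm_divide norm_exp_eq_Re exp_minus inverse_eq_divide)
  qed
qed

text \<open>An opening of more than \<open>pi\<close> contains a direction together with its
  opposite. In one of the two the exponential of index \<open>l\<close> does not decay relative to
  that of index \<open>n\<close>; there the scaled coefficient tends to 0 for
  \<open>l \<noteq> n\<close>, which forces the coefficient itself to be 0.\<close>

lemma canonical_unique:
  assumes Fs: "canonical_solutions k \<alpha> \<beta> Fs" and wide: "pi < \<beta> - \<alpha>"
    and Y: "fundamental_solution k Y" "sector_asymptotics k \<alpha> \<beta> Y"
  shows "Y = sol_mat k Fs"
proof
  fix w
  have \<alpha>\<beta>: "\<alpha> < \<beta>" using wide pi_gt_zero by linarith
  have sol: "\<And>n. n < k \<Longrightarrow> qde_solution k (Fs n)" using Fs by (auto simp: canonical_solutions_def)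
  have ind: "independent_solutions k Fs" using Fs \<alpha>\<beta> by (rule canonical_solutions_independent)
  have Yc: "Y w \<in> carrier_mat k k" for w using Y(1) by (auto simp: fundamental_solution_def)
  obtain E where E: "\<And>w. E w \<in> carrier_mat k k"
      "\<And>w. Y w = (1\<^sub>m k + E w) * mat_diag k (\<lambda>n. exp (exp w * canonical_coord k n))"
    and EO: "\<And>a b i j. \<alpha> < a \<Longrightarrow> a \<le> b \<Longrightarrow> b < \<beta> \<Longrightarrow> i < k \<Longrightarrow> j < k \<Longrightarrow>
      (\<lambda>w. E w $$ (i, j)) \<in> O[sector_at_infinity a b](\<lambda>w. 1 / exp w)"
    using Y(2) unfolding sector_asymptotics_def by metis
  have col: "Y w $$ (i, n) = ycol k (Fs n) i w" if i: "i < k" and n: "n < k" for i n w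
  proof -
    obtain G where G: "qde_solution k G" and Gy: "\<And>i w. i < k \<Longrightarrow> ycol k G i w = Y w $$ (i, n)"
    proof (rule solution_of_system[of k "\<lambda>i w. Y w $$ (i, n)"])
      fix i w assume i: "i < k"
      have "((\<lambda>w. Y w $$ (i, n)) has_field_derivative
          exp w * ((U_mat k + (1 / exp w) \<cdot>\<^sub>m V_mat k) * Y w) $$ (i, n)) (at w)"
        using Y(1) i n by (auto simp: fundamental_solution_def)
      then show "((\<lambda>w. Y w $$ (i, n)) has_field_derivative
          exp w * can k (int i) * Y w $$ (i, n) + (\<Sum>m<k. V_entry k i m * Y w $$ (m, n))) (at w)"
        unfolding system_entry[OF Yc i n] .
    qed (use that in blast)
    obtain c where c: "\<And>j w. j < k \<Longrightarrow> G j w = (\<Sum>l<k. c l * Fs l j w)"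
      using solution_expansion[OF sol ind G] by blast
    have lim: "((\<lambda>t. exp (- exp (Complex t \<theta>) * can k (int n)) * ycol k G i (Complex t \<theta>)) \<longlongrightarrow> (if i = n then 1 else 0)) at_top"
      if \<theta>: "\<alpha> < \<theta>" "\<theta> < \<beta>" and i: "i < k" for \<theta> i
    proof -
      have "exp (- exp w * can k (int n)) * ycol k G i w = (if i = n then 1 else 0) + E w $$ (i, n)" for w
      proof -
        have "1\<^sub>m k + E w \<in> carrier_mat k k" using E(1) by simp
        then have "Y w $$ (i, n) = ((if i = n then 1 else 0) + E w $$ (i, n)) * exp (exp w * can k (int n))"
          using i n E(1)[of w] by (simp add: E(2)[of w] mult_mat_diag_index canonical_coord_eq del: index_mult_mat)
        moreover have "exp (- exp w * can k (int n)) * exp (exp w * can k (int n)) = 1" by (simp flip: exp_add)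
        ultimately show ?thesis using i by (simp add: Gy mult.left_commute)
      qed
      moreover have "((\<lambda>t. E (Complex t \<theta>) $$ (i, n)) \<longlongrightarrow> 0) at_top"
      proof -
        obtain C where C: "eventually (\<lambda>w. norm (E w $$ (i, n)) \<le> C * norm (1 / exp w)) (sector_at_infinity \<theta> \<theta>)"
          using landau_o.bigE[OF EO[OF \<theta>(1) order_refl \<theta>(2) i n]] by blast
        obtain R where R: "\<And>w. R \<le> Re w \<Longrightarrow> Im w = \<theta> \<Longrightarrow> norm (E w $$ (i, n)) \<le> C * norm (1 / exp w)"
          using C unfolding eventually_sector_at_infinity by fastforce
        have "\<forall>\<^sub>F t in at_top. norm (E (Complex t \<theta>) $$ (i, n)) \<le> C * exp (- t)"
          using eventually_ge_at_top[of R]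
        proof eventually_elim
          case (elim t)
          then show ?case using R[of "Complex t \<theta>"]
            by (simp add: norm_divide norm_exp_eq_Re exp_minus inverse_eq_divide)
        qed
        then show ?thesis using tendsto_exp_minus_zero by (rule Lim_null_comparison)
      qed
      ultimately show ?thesis
        using tendsto_add[OF tendsto_const[of "if i = n then 1 else 0 :: complex"], of "\<lambda>t. E (Complex t \<theta>) $$ (i, n)" 0 at_top] by simp
    qed
    have cl: "c l = (if l = n then 1 else 0)" if l: "l < k" for l
    proof -
      let ?h = "\<lambda>\<theta>. Re (exp (\<i> * of_real \<theta>) * (can k (int l) - can k (int n)))"
      \<comment> \<open>Places \<open>\<theta>1\<close> and \<open>\<theta>1 + pi\<close>
        symmetrically inside the sector.\<close>
      define \<theta>1 where "\<theta>1 = (\<alpha> + \<beta> - pi) / 2"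
      have \<theta>1: "\<alpha> < \<theta>1" "\<theta>1 < \<beta>" "\<alpha> < \<theta>1 + pi" "\<theta>1 + pi < \<beta>"
        using wide by (simp_all add: \<theta>1_def field_simps) (use pi_gt_zero wide in linarith)+
      have "?h (\<theta>1 + pi) = - ?h \<theta>1"
        by (simp add: distrib_left exp_add del: times_complex.sel)
      then obtain \<theta> where \<theta>: "\<alpha> < \<theta>" "\<theta> < \<beta>" "0 \<le> ?h \<theta>"
        using \<theta>1 by (cases "0 \<le> ?h \<theta>1") (auto simp del: times_complex.sel)
      have lim': "((\<lambda>t. c l * exp (exp (Complex t \<theta>) * (can k (int l) - can k (int n)))) \<longlongrightarrow> (if l = n then 1 else 0)) at_top"
        using coefficient_limit[OF Fs \<theta>(1,2) c lim[OF \<theta>(1,2)] l] by simp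
      show ?thesis
      proof (cases "l = n")
        case True
        then show ?thesis using lim' by (simp add: tendsto_const_iff)
      next
        case False
        have "norm (c l) \<le> norm (c l * exp (exp (Complex t \<theta>) * (can k (int l) - can k (int n))))" for t
        proof -
          have "exp (Complex t \<theta>) = of_real (exp t) * exp (\<i> * of_real \<theta>)"
          proof -
            have "Complex t \<theta> = of_real t + \<i> * of_real \<theta>" by (simp add: complex_eq_iff)
            then show ?thesis by (simp add: exp_add exp_of_real)
          qed
          then have "Re (exp (Complex t \<theta>) * (can k (int l) - can k (int n))) = exp t * ?h \<theta>"
            by (simp only: mult.assoc Re_complex_of_real times_complex.sel Im_complex_of_real) 
          then have "0 \<le> Re (exp (Complex t \<theta>) * (can k (int l) - can k (int n)))"
            using \<theta>(3) by (simp del: times_complex.sel)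
          then have "1 \<le> norm (exp (exp (Complex t \<theta>) * (can k (int l) - can k (int n))))"
            unfolding norm_exp_eq_Re by simp
          then show ?thesis unfolding norm_mult by (simp add: mult_left_le mult_le_cancel_left1)
        qed
        moreover have "((\<lambda>t. norm (c l * exp (exp (Complex t \<theta>) * (can k (int l) - can k (int n))))) \<longlongrightarrow> 0) at_top"
          using lim' False by (simp add: tendsto_norm_zero_iff)
        ultimately have "norm (c l) \<le> 0"
          by (intro tendsto_lowerbound[where F = "at_top :: real filter"]) auto
        then show ?thesis using False by simp
      qed
    qed
    have "G j w = Fs n j w" if "j < k" for j w
    proof -
      have "(\<Sum>l<k. c l * Fs l j w) = (\<Sum>l<k. if l = n then Fs n j w else 0)"
        by (rule sum.cong) (auto simp: cl)
      then show ?thesis using c[OF that] n by simp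
    qed
    then have "ycol k G i w = ycol k (Fs n) i w" by (simp add: ycol_def gauged_def)
    then show ?thesis using Gy[OF i] by simp
  qed
  show "Y w = sol_mat k Fs w"
    using Yc[of w] by (intro eq_matI) (auto simp: sol_mat_def col)
qed

lemma the_canonical:
  assumes Fs: "canonical_solutions k \<alpha> \<beta> Fs" and wide: "pi < \<beta> - \<alpha>"
  shows "(THE Y. fundamental_solution k Y \<and> sector_asymptotics k \<alpha> \<beta> Y) = sol_mat k Fs"
proof (rule the_equality)
  have "\<alpha> < \<beta>" using wide pi_gt_zero by linarith
  then show "fundamental_solution k (sol_mat k Fs) \<and> sector_asymptotics k \<alpha> \<beta> (sol_mat k Fs)"
    using Fs by (auto intro!: sol_mat_fundamental sol_mat_asymptotics canonical_solutions_independent simp: canonical_solutions_def)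
qed (use canonical_unique[OF assms] in blast)

lemma sol_mat_mult:
  assumes S: "S \<in> carrier_mat k k"
    and rel: "\<And>n j w. n < k \<Longrightarrow> j < k \<Longrightarrow> Ls n j w = (\<Sum>m<k. S $$ (m, n) * Rs m j w)"
  shows "sol_mat k Ls w = sol_mat k Rs w * S"
proof (rule eq_matI)
  fix i n assume "i < dim_row (sol_mat k Rs w * S)" "n < dim_col (sol_mat k Rs w * S)"
  then have i: "i < k" and n: "n < k" using S by (auto simp: sol_mat_def)
  have "ycol k (Ls n) i w = (\<Sum>m<k. S $$ (m, n) * ycol k (Rs m) i w)"
    unfolding ycol_sum[symmetric] using n by (simp add: ycol_def gauged_def rel)
  then show "sol_mat k Ls w $$ (i, n) = (sol_mat k Rs w * S) $$ (i, n)"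
    using i n S by (simp add: sol_mat_def scalar_prod_def sum_atLeast0_lessThan mult.commute)
qed (use S in \<open>auto simp: sol_mat_def\<close>)

text \<open>Evaluates the definite descriptions from explicit solutions; the matrix is unique
  because \<open>sol_mat k Rs\<close> is invertible at a point of the overlap.\<close>

lemma Stokes_mat_eq:
  assumes k: "0 < k" and L: "canonical_solutions k 0 (pi + pi / k) Ls" and R: "canonical_solutions k (- pi) (pi / k) Rs"
    and S: "S \<in> carrier_mat k k"
    and rel: "\<And>n j w. n < k \<Longrightarrow> j < k \<Longrightarrow> Ls n j w = (\<Sum>m<k. S $$ (m, n) * Rs m j w)"
  shows "Stokes_mat k = S"
proof -
  have pk: "0 < pi / k" using k by simp
  have YL: "Y_L k = sol_mat k Ls" unfolding Y_L_def using L pk by (intro the_canonical) auto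
  have YR: "Y_R k = sol_mat k Rs" unfolding Y_R_def using R pk by (intro the_canonical) auto
  have SM: "sol_mat k Ls w = sol_mat k Rs w * S" for w by (rule sol_mat_mult[OF S rel])
  show ?thesis
    unfolding Stokes_mat_def YL YR
  proof (rule the_equality)
    show "S \<in> carrier_mat k k \<and> (\<forall>w. 0 < Im w \<and> Im w < pi / real k \<longrightarrow> sol_mat k Ls w = sol_mat k Rs w * S)"
      using SM S by blast
    fix S' assume S': "S' \<in> carrier_mat k k \<and> (\<forall>w. 0 < Im w \<and> Im w < pi / real k \<longrightarrow> sol_mat k Ls w = sol_mat k Rs w * S')"
    let ?w = "Complex 0 (pi / k / 2)"
    have "sol_mat k Rs ?w * S' = sol_mat k Rs ?w * S"
      using S' SM[of ?w] pk by (metis complex.sel(2) field_sum_of_halves less_add_same_cancel1 half_gt_zero)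
    moreover obtain B where B: "B \<in> carrier_mat k k" "B * sol_mat k Rs ?w = 1\<^sub>m k"
    proof (rule sol_mat_unit[of k Rs ?w])
      show "independent_solutions k Rs" using pk pi_gt_zero by (intro canonical_solutions_independent[OF R]) linarith
    qed (use R in \<open>auto simp: canonical_solutions_def\<close>)
    moreover have "A = B * (sol_mat k Rs ?w * A)" if "A \<in> carrier_mat k k" for A
      using that B by (simp add: assoc_mult_mat[symmetric, of B k k _ k A k])
    ultimately show "S' = S" using S S' by metis
  qed
qed

text \<open>\<open>Phi_L\<close> shows only the scalar components. Uniqueness of the matrix
  therefore needs that a solution with vanishing scalar component vanishes with all its
  derivatives.\<close>

lemma T_mat_eq:
  assumes k: "0 < k" and L: "canonical_solutions k 0 (pi + pi / k) Ls" and T: "T \<in> carrier_mat k k"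
    and rel: "\<And>n j w. n < k \<Longrightarrow> j < k \<Longrightarrow> Ls n j (w + 2 * of_real pi * \<i> / of_nat k) = (\<Sum>m<k. T $$ (m, n) * Ls m j w)"
  shows "T_mat k = T"
proof -
  have pk: "0 < pi / k" using k by simp
  have YL: "Y_L k = sol_mat k Ls" unfolding Y_L_def using L pk by (intro the_canonical) auto
  have Phi: "Phi_L k w = mat 1 k (\<lambda>(_, n). Ls n 0 w)" for w
  proof -
    have "exp (- ((of_nat k - 1) / 2) * w) * (X_mat k * sol_mat k Ls w) $$ (0, n) = Ls n 0 w" if n: "n < k" for n
    proof -
      have "(X_mat k * sol_mat k Ls w) $$ (0, n) = gauged k (Ls n) 0 w"
        using n k by (simp add: X_mat_eq sol_mat_def scalar_prod_def sum_atLeast0_lessThan gauged_eq_sum_ycol[OF k])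
      moreover have "exp (- ((of_nat k - 1) / 2) * w) * exp (w * mu k 0) = 1"
        by (simp add: exp_add[symmetric] mu_def)
      ultimately show ?thesis by (simp add: gauged_def mult.assoc[symmetric])
    qed
    then show ?thesis unfolding Phi_L_def YL by (intro eq_matI) auto
  qed
  have PhiT: "(Phi_L k w * A) $$ (0, n) = (\<Sum>m<k. A $$ (m, n) * Ls m 0 w)" if "A \<in> carrier_mat k k" "n < k" for A w n
    using that by (simp add: Phi scalar_prod_def sum_atLeast0_lessThan mult.commute)
  show ?thesis
    unfolding T_mat_def
  proof (rule the_equality, intro conjI allI T)
    fix w
    show "Phi_L k (w + 2 * of_real pi * \<i> / of_nat k) = Phi_L k w * T"
    proof (rule eq_matI)
      fix i n assume "i < dim_row (Phi_L k w * T)" "n < dim_col (Phi_L k w * T)"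
      then have "i = 0" "n < k" using T by (auto simp: Phi)
      then show "Phi_L k (w + 2 * of_real pi * \<i> / of_nat k) $$ (i, n) = (Phi_L k w * T) $$ (i, n)"
        using rel[of n 0 w] k by (simp add: PhiT[OF T] del: index_mult_mat) (simp add: Phi)
    qed (use T in \<open>auto simp: Phi\<close>)
  next
    fix T' assume T': "T' \<in> carrier_mat k k \<and> (\<forall>w. Phi_L k (w + 2 * of_real pi * \<i> / of_nat k) = Phi_L k w * T')"
    have sol: "\<And>n. n < k \<Longrightarrow> qde_solution k (Ls n)" using L by (auto simp: canonical_solutions_def)
    have ind: "independent_solutions k Ls" using pk pi_gt_zero by (intro canonical_solutions_independent[OF L]) linarith
    show "T' = T"
    proof (rule eq_matI)
      fix m n assume "m < dim_row T" "n < dim_col T"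
      then have m: "m < k" and n: "n < k" using T by auto
      let ?D = "\<lambda>j w. \<Sum>m<k. (T' $$ (m, n) - T $$ (m, n)) * Ls m j w"
      have D: "qde_solution k ?D" by (intro qde_solution_sum sol) auto
      have "?D 0 w = 0" for w
      proof -
        have "(\<Sum>m<k. T' $$ (m, n) * Ls m 0 w) = Phi_L k (w + 2 * of_real pi * \<i> / of_nat k) $$ (0, n)"
          using T' PhiT[of T' n w] n by simp
        also have "\<dots> = (\<Sum>m<k. T $$ (m, n) * Ls m 0 w)" using rel[OF n k, of w] n by (simp add: Phi)
        finally show ?thesis by (simp add: left_diff_distrib sum_subtractf)
      qed
      then have "?D j w = 0" if "j < k" for j w
        by (rule qde_solution_zero_of_scalar_zero[OF D k _ that])
      then have "\<forall>j<k. \<forall>w. ?D j w = 0" by blast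
      with spec[OF ind[unfolded independent_solutions_def], of "\<lambda>m. T' $$ (m, n) - T $$ (m, n)"]
      have "\<forall>m<k. T' $$ (m, n) - T $$ (m, n) = 0" by (rule mp)
      then have "T' $$ (m, n) - T $$ (m, n) = 0" using m by blast
      then show "T' $$ (m, n) = T $$ (m, n)" by simp
    qed (use T T' in auto)
  qed
qed

lemma asym_plus_period:
  assumes k: "0 < k" and as: "asym k F n a b"
  shows "asym k (\<lambda>j w. - F j w) (n + int k) a b"
proof -
  have "sector_small k (\<lambda>j w. - 1 * (exp (- exp w * can k n) * gauged k F j w - X_entry k j n)) a b"
    using as unfolding asym_def by (rule sector_small_cmult)
  then show ?thesis
    using gauged_cmult[of k "-1" F]
    by (simp add: asym_def can_add_period[OF k] X_entry_add_period[OF k])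
qed

lemma asym_open_plus_period:
  "0 < k \<Longrightarrow> asym_open k F n \<alpha> \<beta> \<Longrightarrow> m = n + int k \<Longrightarrow> asym_open k (\<lambda>j w. - F j w) m \<alpha> \<beta>"
  by (auto simp: asym_open_def intro!: asym_plus_period)

lemma asym_open_minus_period:
  "0 < k \<Longrightarrow> asym_open k F n \<alpha> \<beta> \<Longrightarrow> n = m + int k \<Longrightarrow> asym_open k (\<lambda>j w. - F j w) m \<alpha> \<beta>"
  by (auto simp: asym_open_def intro!: asym_minus_period)

lemma asym_open_cong:
  assumes "asym_open k F n \<alpha> \<beta>" "\<And>j w. j < k \<Longrightarrow> F j w = G j w"
  shows "asym_open k G n \<alpha> \<beta>"
proof -
  have "asym k G n a b" if "asym k F n a b" for a b
    using that by (simp add: asym_def sector_small_def gauged_def assms(2))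
  then show ?thesis using assms(1) by (auto simp: asym_open_def)
qed

section \<open>Stokes matrix and shift matrix for \<open>k = 3\<close> and
  \<open>k = 4\<close>\<close>

definition rows_mat :: "nat \<Rightarrow> complex list list \<Rightarrow> complex mat" where
  "rows_mat k rs = mat k k (\<lambda>(i, j). rs ! i ! j)"

lemma rows_mat_carrier [simp]: "rows_mat k rs \<in> carrier_mat k k"
  by (simp add: rows_mat_def)

lemma rows_mat_index: "i < k \<Longrightarrow> j < k \<Longrightarrow> rows_mat k rs $$ (i, j) = rs ! i ! j"
  by (simp add: rows_mat_def)

lemma sum_lessThan_3: "(\<Sum>m<3. f m) = f 0 + f 1 + f (2::nat)"
  by (simp add: eval_nat_numeral)

lemma sum_lessThan_4: "(\<Sum>m<4. f m) = f 0 + f 1 + f 2 + f (3::nat)"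
  by (simp add: eval_nat_numeral)

lemma third_order_relation: "a + 3 * b + 3 * c + d = 0 \<Longrightarrow> d = - a - 3 * b - 3 * (c :: complex)"
proof -
  assume "a + 3 * b + 3 * c + d = 0"
  moreover have "d = (a + 3 * b + 3 * c + d) - a - 3 * b - 3 * c" by simp
  ultimately show ?thesis by simp
qed

lemma fourth_order_relation: "a + 4 * b + 6 * c + 4 * d + e = 0 \<Longrightarrow> e = - a - 4 * b - 6 * c - 4 * (d :: complex)"
proof -
  assume "a + 4 * b + 6 * c + 4 * d + e = 0"
  moreover have "e = (a + 4 * b + 6 * c + 4 * d + e) - a - 4 * b - 6 * c - 4 * d" by simp
  ultimately show ?thesis by simp
qed

lemma sin_neg: "- pi < x \<Longrightarrow> x < 0 \<Longrightarrow> sin (x :: real) < 0"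
  using sin_gt_zero[of "- x"] by simp

context
  fixes h :: "nat \<Rightarrow> complex \<Rightarrow> complex"
  assumes sol: "qde_solution 3 h"
    and asym: "\<And>m. asym_open 3 (rot 3 h m) m (- pi / 3 - 2 * pi * of_int m / 3) (2 * pi + pi / 3 - 2 * pi * of_int m / 3)"
begin

text \<open>The sector of \<open>rot 3 h 2\<close> ends at \<open>pi\<close>. The multiple of
  \<open>rot 3 h 1\<close> is the one with which the cubic relation carries the asymptotics on to
  \<open>pi + pi/3\<close>.\<close>

definition left3 :: "nat \<Rightarrow> nat \<Rightarrow> complex \<Rightarrow> complex" where
  "left3 n = [rot 3 h 0, rot 3 h 1, \<lambda>j w. rot 3 h 2 j w + 3 * rot 3 h 1 j w] ! n"

text \<open>Index 3 has the exponent of index 0 with the opposite sign, and its sector covers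
  \<open>(- pi, pi/3)\<close>, whereas that of \<open>rot 3 h 0\<close> begins only at
  \<open>- pi/3\<close>.\<close>

definition right3 :: "nat \<Rightarrow> nat \<Rightarrow> complex \<Rightarrow> complex" where
  "right3 n = [\<lambda>j w. - rot 3 h 3 j w, rot 3 h 1, rot 3 h 2] ! n"

lemma relation3: "j < 3 \<Longrightarrow> rot 3 h s j w + 3 * rot 3 h (s + 1) j w + 3 * rot 3 h (s + 2) j w + rot 3 h (s + 3) j w = 0"
  using rot_relation[OF sol _ , of j s w]
  by (simp add: eval_nat_numeral binomial_Suc_Suc atMost_Suc add_ac)

lemma sol_rot3: "qde_solution 3 (rot 3 h m)"
  using qde_solution_rot[OF sol] by simp

lemma asym3: "- pi / 3 - 2 * pi * of_int m / 3 \<le> \<alpha> \<Longrightarrow> \<beta> \<le> 2 * pi + pi / 3 - 2 * pi * of_int m / 3 \<Longrightarrow>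
   asym_open 3 (rot 3 h m) m \<alpha> \<beta>"
  using asym_open_subset[OF asym] .

lemma left3_canonical: "canonical_solutions 3 0 (pi + pi / real 3) left3"
proof -
  have third: "asym_open 3 (\<lambda>j w. rot 3 h 2 j w + 3 * rot 3 h 1 j w) 2 0 (pi + pi / 3)"
  proof (rule asym_open_union)
    show "asym_open 3 (\<lambda>j w. rot 3 h 2 j w + 3 * rot 3 h 1 j w) 2 0 pi"
    proof (rule asym_open_add_dominated[where m = 1])
      fix \<theta> :: real assume \<theta>: "0 < \<theta>" "\<theta> < pi"
      have "sin (\<theta> + pi) < 0" using sin_gt_zero[OF \<theta>] by simp
      moreover have "sin (- pi / 3) < 0" by (rule sin_neg) auto
      ultimately have "0 < sin (\<theta> + pi) * sin (- pi / 3)" by (rule mult_neg_neg)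
      then show "0 < sin (\<theta> + pi * (of_int 1 + of_int 2) / real 3) * sin (pi * (of_int 1 - of_int 2) / real 3)"
        by simp
    qed (auto intro!: asym3)
    \<comment> \<open>On this part of the sector the column is rewritten as
      \<open>- rot 3 h (-1) - 3 * rot 3 h 0\<close>. Index \<open>-1\<close> becomes index 2 by the
      change of sign, and index 0 is dominated by it here.\<close>
    have m: "asym_open 3 (\<lambda>j w. - rot 3 h (-1) j w) 2 (pi / 3) (pi + pi / 3)"
      by (rule asym_open_plus_period[OF _ asym3[of "-1"]]) auto
    have "asym_open 3 (\<lambda>j w. - rot 3 h (-1) j w + (-3) * rot 3 h 0 j w) 2 (pi / 3) (pi + pi / 3)"
    proof (rule asym_open_add_dominated[OF _ m, where m = 0])
      fix \<theta> :: real assume \<theta>: "pi / 3 < \<theta>" "\<theta> < pi + pi / 3"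
      have "sin (\<theta> + pi * 2 / 3) < 0" using \<theta> by (intro sin_lt_zero) auto
      moreover have "sin (- (pi * 2) / 3) < 0" by (rule sin_neg) auto
      ultimately have "0 < sin (\<theta> + pi * 2 / 3) * sin (- (pi * 2) / 3)" by (rule mult_neg_neg)
      then show "0 < sin (\<theta> + pi * (of_int 0 + of_int 2) / real 3) * sin (pi * (of_int 0 - of_int 2) / real 3)"
        by simp
    qed (auto intro!: asym3)
    then show "asym_open 3 (\<lambda>j w. rot 3 h 2 j w + 3 * rot 3 h 1 j w) 2 (pi / 3) (pi + pi / 3)"
    proof (rule asym_open_cong)
      fix j w assume "j < (3::nat)"
      then show "- rot 3 h (-1) j w + (-3) * rot 3 h 0 j w = rot 3 h 2 j w + 3 * rot 3 h 1 j w"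
        using third_order_relation[OF relation3[of j "-1" w]] by simp
    qed
  qed auto
  have "qde_solution 3 (left3 n) \<and> asym_open 3 (left3 n) (int n) 0 (pi + pi / 3)" if "n < 3" for n
  proof -
    consider "n = 0" | "n = 1" | "n = 2" using \<open>n < 3\<close> by linarith
    then show ?thesis
      by cases (use third in \<open>auto simp: left3_def intro!: asym3 sol_rot3 qde_solution_add qde_solution_cmult\<close>)
  qed
  then show ?thesis by (simp add: canonical_solutions_def)
qed

lemma right3_canonical: "canonical_solutions 3 (- pi) (pi / real 3) right3"
proof -
  have first: "asym_open 3 (\<lambda>j w. - rot 3 h 3 j w) 0 (- pi) (pi / 3)"
    by (rule asym_open_minus_period[OF _ asym3[of 3]]) auto
  have neg: "qde_solution 3 (\<lambda>j w. - rot 3 h 3 j w)"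
    using qde_solution_cmult[OF sol_rot3, of "-1" 3] by simp
  have "qde_solution 3 (right3 n) \<and> asym_open 3 (right3 n) (int n) (- pi) (pi / 3)" if "n < 3" for n
  proof -
    consider "n = 0" | "n = 1" | "n = 2" using \<open>n < 3\<close> by linarith
    then show ?thesis
      by cases (use first neg in \<open>auto simp: right3_def intro!: asym3 sol_rot3\<close>)
  qed
  then show ?thesis by (simp add: canonical_solutions_def)
qed

text \<open>Columns 1 and 2 follow from the definitions of the two systems; column 0 is the cubic
  relation solved for \<open>rot 3 h 0\<close>.\<close>

lemma Stokes3: "Stokes_mat 3 = rows_mat 3 [[1, 0, 0], [-3, 1, 3], [-3, 0, 1]]"
proof (rule Stokes_mat_eq[OF _ left3_canonical right3_canonical])
  fix n j :: nat and w assume n: "n < 3" and j: "j < 3"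
  consider "n = 0" | "n = 1" | "n = 2" using n by linarith
  then show "left3 n j w = (\<Sum>m<3. rows_mat 3 [[1, 0, 0], [-3, 1, 3], [-3, 0, 1]] $$ (m, n) * right3 m j w)"
    using third_order_relation[OF relation3[OF j, of 0 w]]
    by cases (simp_all add: sum_lessThan_3 rows_mat_index left3_def right3_def)
qed auto

text \<open>The shift sends \<open>rot 3 h m\<close> to \<open>- rot 3 h (m + 1)\<close>; only the
  last column leaves the range of \<open>left3\<close>, and the relation eliminates the term
  \<open>rot 3 h 3\<close>.\<close>

lemma T3: "T_mat 3 = rows_mat 3 [[0, 0, 1], [-1, 3, 3], [0, -1, 0]]"
proof (rule T_mat_eq[OF _ left3_canonical])
  fix n j :: nat and w assume n: "n < 3" and j: "j < 3"
  have r: "rot 3 h m j (w + 2 * of_real pi * \<i> / of_nat 3) = - rot 3 h (m + 1) j w" for m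
    by (rule rot_shift)
  consider "n = 0" | "n = 1" | "n = 2" using n by linarith
  then show "left3 n j (w + 2 * of_real pi * \<i> / of_nat 3) =
      (\<Sum>m<3. rows_mat 3 [[0, 0, 1], [-1, 3, 3], [0, -1, 0]] $$ (m, n) * left3 m j w)"
    using third_order_relation[OF relation3[OF j, of 0 w]]
    by cases (simp_all add: r[simplified] sum_lessThan_3 rows_mat_index left3_def)
qed auto

end

context
  fixes h :: "nat \<Rightarrow> complex \<Rightarrow> complex"
  assumes sol: "qde_solution 4 h"
    and asym: "\<And>m. asym_open 4 (rot 4 h m) m (- pi / 4 - 2 * pi * of_int m / 4) (2 * pi + pi / 4 - 2 * pi * of_int m / 4)"
begin

text \<open>The sector of \<open>rot 4 h 3\<close> ends at \<open>3 pi / 4\<close>. The coefficients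
  4 and 6 are those of the quartic relation, by which the last column also equals
  \<open>- rot 4 h (-1) - 4 * rot 4 h 0\<close>.\<close>

definition left4 :: "nat \<Rightarrow> nat \<Rightarrow> complex \<Rightarrow> complex" where
  "left4 n = [rot 4 h 0, rot 4 h 1, rot 4 h 2, \<lambda>j w. (rot 4 h 3 j w + 4 * rot 4 h 2 j w) + 6 * rot 4 h 1 j w] ! n"

text \<open>Unlike for \<open>k = 3\<close>, one column needs a correction here too: the sector of
  \<open>rot 4 h 1\<close> begins at \<open>- 3 pi / 4\<close> and not at
  \<open>- pi\<close>.\<close>

definition right4 :: "nat \<Rightarrow> nat \<Rightarrow> complex \<Rightarrow> complex" where
  "right4 n = [\<lambda>j w. - rot 4 h 4 j w, \<lambda>j w. rot 4 h 1 j w + 4 * rot 4 h 2 j w, rot 4 h 2, rot 4 h 3] ! n"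

lemma relation4: "j < 4 \<Longrightarrow> rot 4 h s j w + 4 * rot 4 h (s + 1) j w + 6 * rot 4 h (s + 2) j w + 4 * rot 4 h (s + 3) j w
    + rot 4 h (s + 4) j w = 0"
  using rot_relation[OF sol _ , of j s w]
  by (simp add: eval_nat_numeral binomial_Suc_Suc atMost_Suc add_ac)

lemma sol_rot4: "qde_solution 4 (rot 4 h m)"
  using qde_solution_rot[OF sol] by simp

lemma asym4: "- pi / 4 - 2 * pi * of_int m / 4 \<le> \<alpha> \<Longrightarrow> \<beta> \<le> 2 * pi + pi / 4 - 2 * pi * of_int m / 4 \<Longrightarrow>
   asym_open 4 (rot 4 h m) m \<alpha> \<beta>"
  using asym_open_subset[OF asym] .

lemma left4_canonical: "canonical_solutions 4 0 (pi + pi / real 4) left4"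
proof -
  have fourth: "asym_open 4 (\<lambda>j w. (rot 4 h 3 j w + 4 * rot 4 h 2 j w) + 6 * rot 4 h 1 j w) 3 0 (pi + pi / 4)"
  proof (rule asym_open_union)
    have 1: "asym_open 4 (\<lambda>j w. rot 4 h 3 j w + 4 * rot 4 h 2 j w) 3 0 (3 * pi / 4)"
    proof (rule asym_open_add_dominated[where m = 2])
      fix \<theta> :: real assume \<theta>: "0 < \<theta>" "\<theta> < 3 * pi / 4"
      have "sin (\<theta> + pi * 5 / 4) < 0" using \<theta> by (intro sin_lt_zero) auto
      moreover have "sin (- pi / 4) < 0" by (rule sin_neg) auto
      ultimately have "0 < sin (\<theta> + pi * 5 / 4) * sin (- pi / 4)" by (rule mult_neg_neg)
      then show "0 < sin (\<theta> + pi * (of_int 2 + of_int 3) / real 4) * sin (pi * (of_int 2 - of_int 3) / real 4)"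
        by simp
    qed (auto intro!: asym4)
    show "asym_open 4 (\<lambda>j w. (rot 4 h 3 j w + 4 * rot 4 h 2 j w) + 6 * rot 4 h 1 j w) 3 0 (3 * pi / 4)"
    proof (rule asym_open_add_dominated[OF _ 1, where m = 1])
      fix \<theta> :: real assume \<theta>: "0 < \<theta>" "\<theta> < 3 * pi / 4"
      have "sin (\<theta> + pi) < 0" using sin_gt_zero[of \<theta>] \<theta> by simp
      moreover have "sin (- (pi * 2) / 4) < 0" by (rule sin_neg) auto
      ultimately have "0 < sin (\<theta> + pi) * sin (- (pi * 2) / 4)" by (rule mult_neg_neg)
      then show "0 < sin (\<theta> + pi * (of_int 1 + of_int 3) / real 4) * sin (pi * (of_int 1 - of_int 3) / real 4)"
        by simp
    qed (auto intro!: asym4)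
    have m: "asym_open 4 (\<lambda>j w. - rot 4 h (-1) j w) 3 (pi / 4) (pi + pi / 4)"
      by (rule asym_open_plus_period[OF _ asym4[of "-1"]]) auto
    have "asym_open 4 (\<lambda>j w. - rot 4 h (-1) j w + (-4) * rot 4 h 0 j w) 3 (pi / 4) (pi + pi / 4)"
    proof (rule asym_open_add_dominated[OF _ m, where m = 0])
      fix \<theta> :: real assume \<theta>: "pi / 4 < \<theta>" "\<theta> < pi + pi / 4"
      have "sin (\<theta> + pi * 3 / 4) < 0" using \<theta> by (intro sin_lt_zero) auto
      moreover have "sin (- (pi * 3) / 4) < 0" by (rule sin_neg) auto
      ultimately have "0 < sin (\<theta> + pi * 3 / 4) * sin (- (pi * 3) / 4)" by (rule mult_neg_neg)
      then show "0 < sin (\<theta> + pi * (of_int 0 + of_int 3) / real 4) * sin (pi * (of_int 0 - of_int 3) / real 4)"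
        by simp
    qed (auto intro!: asym4)
    then show "asym_open 4 (\<lambda>j w. (rot 4 h 3 j w + 4 * rot 4 h 2 j w) + 6 * rot 4 h 1 j w) 3 (pi / 4) (pi + pi / 4)"
    proof (rule asym_open_cong)
      fix j w assume "j < (4::nat)"
      then show "- rot 4 h (-1) j w + (-4) * rot 4 h 0 j w = (rot 4 h 3 j w + 4 * rot 4 h 2 j w) + 6 * rot 4 h 1 j w"
        using fourth_order_relation[OF relation4[of j "-1" w]] by simp
    qed
  qed auto
  have "qde_solution 4 (left4 n) \<and> asym_open 4 (left4 n) (int n) 0 (pi + pi / 4)" if "n < 4" for n
  proof -
    consider "n = 0" | "n = 1" | "n = 2" | "n = 3" using \<open>n < 4\<close> by linarith
    then show ?thesis
      by cases (use fourth in \<open>auto simp: left4_def intro!: asym4 sol_rot4 qde_solution_add qde_solution_cmult\<close>)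
  qed
  then show ?thesis by (simp add: canonical_solutions_def)
qed

lemma right4_canonical: "canonical_solutions 4 (- pi) (pi / real 4) right4"
proof -
  have first: "asym_open 4 (\<lambda>j w. - rot 4 h 4 j w) 0 (- pi) (pi / 4)"
    by (rule asym_open_minus_period[OF _ asym4[of 4]]) auto
  have neg: "qde_solution 4 (\<lambda>j w. - rot 4 h 4 j w)"
    using qde_solution_cmult[OF sol_rot4, of "-1" 4] by simp
  have second: "asym_open 4 (\<lambda>j w. rot 4 h 1 j w + 4 * rot 4 h 2 j w) 1 (- pi) (pi / 4)"
  proof (rule asym_open_union)
    show "asym_open 4 (\<lambda>j w. rot 4 h 1 j w + 4 * rot 4 h 2 j w) 1 (- (3 * pi / 4)) (pi / 4)"
    proof (rule asym_open_add_dominated[where m = 2])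
      fix \<theta> :: real assume \<theta>: "- (3 * pi / 4) < \<theta>" "\<theta> < pi / 4"
      have "0 < sin (\<theta> + pi * 3 / 4)" using \<theta> by (intro sin_gt_zero) auto
      moreover have "0 < sin (pi / 4)" by (rule sin_gt_zero) auto
      ultimately have "0 < sin (\<theta> + pi * 3 / 4) * sin (pi / 4)" by (rule mult_pos_pos)
      then show "0 < sin (\<theta> + pi * (of_int 2 + of_int 1) / real 4) * sin (pi * (of_int 2 - of_int 1) / real 4)"
        by simp
    qed (auto intro!: asym4)
    \<comment> \<open>For the lower part of the sector the quartic relation expresses the column
      through indices 3, 4 and 5. Index 5 is index 1 up to sign, and it dominates the other
      two.\<close>
    have m: "asym_open 4 (\<lambda>j w. - rot 4 h 5 j w) 1 (- pi) (- (pi / 4))"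
      by (rule asym_open_minus_period[OF _ asym4[of 5]]) auto
    have 1: "asym_open 4 (\<lambda>j w. - rot 4 h 5 j w + (-6) * rot 4 h 3 j w) 1 (- pi) (- (pi / 4))"
    proof (rule asym_open_add_dominated[OF _ m, where m = 3])
      fix \<theta> :: real assume \<theta>: "- pi < \<theta>" "\<theta> < - (pi / 4)"
      have "0 < sin (\<theta> + pi)" using \<theta> by (intro sin_gt_zero) auto
      moreover have "0 < sin (pi * 2 / 4)" by (rule sin_gt_zero) auto
      ultimately have "0 < sin (\<theta> + pi) * sin (pi * 2 / 4)" by (rule mult_pos_pos)
      then show "0 < sin (\<theta> + pi * (of_int 3 + of_int 1) / real 4) * sin (pi * (of_int 3 - of_int 1) / real 4)"
        by simp
    qed (auto intro!: asym4)
    have "asym_open 4 (\<lambda>j w. (- rot 4 h 5 j w + (-6) * rot 4 h 3 j w) + (-4) * rot 4 h 4 j w) 1 (- pi) (- (pi / 4))"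
    proof (rule asym_open_add_dominated[OF _ 1, where m = 4])
      fix \<theta> :: real assume \<theta>: "- pi < \<theta>" "\<theta> < - (pi / 4)"
      have "0 < sin (\<theta> + pi * 5 / 4)" using \<theta> by (intro sin_gt_zero) auto
      moreover have "0 < sin (pi * 3 / 4)" by (rule sin_gt_zero) auto
      ultimately have "0 < sin (\<theta> + pi * 5 / 4) * sin (pi * 3 / 4)" by (rule mult_pos_pos)
      then show "0 < sin (\<theta> + pi * (of_int 4 + of_int 1) / real 4) * sin (pi * (of_int 4 - of_int 1) / real 4)"
        by simp
    qed (auto intro!: asym4)
    then show "asym_open 4 (\<lambda>j w. rot 4 h 1 j w + 4 * rot 4 h 2 j w) 1 (- pi) (- (pi / 4))"
    proof (rule asym_open_cong)
      fix j w assume "j < (4::nat)"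
      then show "(- rot 4 h 5 j w + (-6) * rot 4 h 3 j w) + (-4) * rot 4 h 4 j w = rot 4 h 1 j w + 4 * rot 4 h 2 j w"
        using fourth_order_relation[OF relation4[of j 1 w]] by simp
    qed
  qed auto
  have "qde_solution 4 (right4 n) \<and> asym_open 4 (right4 n) (int n) (- pi) (pi / 4)" if "n < 4" for n
  proof -
    consider "n = 0" | "n = 1" | "n = 2" | "n = 3" using \<open>n < 4\<close> by linarith
    then show ?thesis
      by cases (use first second neg in \<open>auto simp: right4_def intro!: asym4 sol_rot4 qde_solution_add qde_solution_cmult\<close>)
  qed
  then show ?thesis by (simp add: canonical_solutions_def)
qed

text \<open>Replacing \<open>rot 4 h 1\<close> by \<open>right4 1 - 4 * rot 4 h 2\<close> turns the
  coefficient \<open>- 6\<close> of the relation into 10 in column 0, and the coefficient 4 into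
  \<open>- 20\<close> in column 3.\<close>

lemma Stokes4: "Stokes_mat 4 = rows_mat 4 [[1, 0, 0, 0], [-4, 1, 0, 6], [10, -4, 1, -20], [-4, 0, 0, 1]]"
proof (rule Stokes_mat_eq[OF _ left4_canonical right4_canonical])
  fix n j :: nat and w assume n: "n < 4" and j: "j < 4"
  consider "n = 0" | "n = 1" | "n = 2" | "n = 3" using n by linarith
  then show "left4 n j w = (\<Sum>m<4. rows_mat 4 [[1, 0, 0, 0], [-4, 1, 0, 6], [10, -4, 1, -20], [-4, 0, 0, 1]] $$ (m, n) * right4 m j w)"
    using fourth_order_relation[OF relation4[OF j, of 0 w]]
    by cases (simp_all add: sum_lessThan_4 rows_mat_index left4_def right4_def)
qed auto

lemma T4: "T_mat 4 = rows_mat 4 [[0, 0, 0, 1], [-1, 0, 6, 4], [0, -1, 4, 0], [0, 0, -1, 0]]"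
proof (rule T_mat_eq[OF _ left4_canonical])
  fix n j :: nat and w assume n: "n < 4" and j: "j < 4"
  have r: "rot 4 h m j (w + 2 * of_real pi * \<i> / of_nat 4) = - rot 4 h (m + 1) j w" for m
    by (rule rot_shift)
  consider "n = 0" | "n = 1" | "n = 2" | "n = 3" using n by linarith
  then show "left4 n j (w + 2 * of_real pi * \<i> / of_nat 4) =
      (\<Sum>m<4. rows_mat 4 [[0, 0, 0, 1], [-1, 0, 6, 4], [0, -1, 4, 0], [0, 0, -1, 0]] $$ (m, n) * left4 m j w)"
    using fourth_order_relation[OF relation4[OF j, of 0 w]]
    by cases (simp_all add: r[simplified] sum_lessThan_4 rows_mat_index left4_def)
qed auto

end

theorem Stokes_and_T_3:
  "Stokes_mat 3 = rows_mat 3 [[1, 0, 0], [-3, 1, 3], [-3, 0, 1]]"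
  "T_mat 3 = rows_mat 3 [[0, 0, 1], [-1, 3, 3], [0, -1, 0]]"
proof -
  obtain h where "qde_solution 3 h"
    "\<And>m. asym_open 3 (rot 3 h m) m (- pi / 3 - 2 * pi * of_int m / 3) (2 * pi + pi / 3 - 2 * pi * of_int m / 3)"
    using recessive_solution_exists[of 3] by auto
  from Stokes3[OF this] T3[OF this] show
    "Stokes_mat 3 = rows_mat 3 [[1, 0, 0], [-3, 1, 3], [-3, 0, 1]]"
    "T_mat 3 = rows_mat 3 [[0, 0, 1], [-1, 3, 3], [0, -1, 0]]" .
qed

theorem Stokes_and_T_4:
  "Stokes_mat 4 = rows_mat 4 [[1, 0, 0, 0], [-4, 1, 0, 6], [10, -4, 1, -20], [-4, 0, 0, 1]]"
  "T_mat 4 = rows_mat 4 [[0, 0, 0, 1], [-1, 0, 6, 4], [0, -1, 4, 0], [0, 0, -1, 0]]"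
proof -
  obtain h where "qde_solution 4 h"
    "\<And>m. asym_open 4 (rot 4 h m) m (- pi / 4 - 2 * pi * of_int m / 4) (2 * pi + pi / 4 - 2 * pi * of_int m / 4)"
    using recessive_solution_exists[of 4] by auto
  from Stokes4[OF this] T4[OF this] show
    "Stokes_mat 4 = rows_mat 4 [[1, 0, 0, 0], [-4, 1, 0, 6], [10, -4, 1, -20], [-4, 0, 0, 1]]"
    "T_mat 4 = rows_mat 4 [[0, 0, 0, 1], [-1, 0, 6, 4], [0, -1, 4, 0], [0, 0, -1, 0]]" .
qed

section \<open>Groups given by power relators\<close>

lemma word_cong_append_left: "word_cong R u v \<Longrightarrow> word_cong R (w @ u) (w @ v)"
proof (induction rule: word_cong.induct)
  case (word_cancel u b x v)
  show ?case using word_cong.word_cancel[of R "w @ u" b x v] by simp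
next
  case (word_relator r u v)
  then show ?case using word_cong.word_relator[of r R "w @ u" v] by simp
next
  case (word_refl u)
  show ?case by (rule word_cong.word_refl)
next
  case (word_sym u v)
  from word_sym.IH show ?case by (rule word_cong.word_sym)
next
  case (word_trans u v u')
  from word_trans.IH show ?case by (rule word_cong.word_trans)
qed

lemma word_cong_append_right: "word_cong R u v \<Longrightarrow> word_cong R (u @ w) (v @ w)"
proof (induction rule: word_cong.induct)
  case (word_cancel u b x v)
  show ?case using word_cong.word_cancel[of R u b x "v @ w"] by simp
next
  case (word_relator r u v)
  then show ?case using word_cong.word_relator[of r R u "v @ w"] by simp
next
  case (word_refl u)
  show ?case by (rule word_cong.word_refl)
next
  case (word_sym u v)
  from word_sym.IH show ?case by (rule word_cong.word_sym)
next
  case (word_trans u v u')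
  from word_trans.IH show ?case by (rule word_cong.word_trans)
qed

lemma word_cong_append: "word_cong R u u' \<Longrightarrow> word_cong R v v' \<Longrightarrow> word_cong R (u @ v) (u' @ v')"
  by (rule word_trans[OF word_cong_append_right word_cong_append_left])

definition word_inv :: "'g word \<Rightarrow> 'g word" where
  "word_inv w = rev (map (\<lambda>(b, x). (\<not> b, x)) w)"

lemma word_cong_inv_left: "word_cong R (word_inv w @ w) []"
proof (induction w)
  case (Cons l w)
  obtain b x where l: "l = (b, x)" by (cases l)
  have "word_cong R (word_inv w @ [(\<not> b, x), (\<not> (\<not> b), x)] @ w) (word_inv w @ w)"
    by (rule word_cancel)
  then show ?case using Cons by (auto simp: word_inv_def l intro: word_trans)
qed (simp add: word_inv_def word_refl)

definition word_class :: "'g word set \<Rightarrow> 'g word \<Rightarrow> 'g word set" where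
  "word_class R u = {v. word_cong R u v}"

lemma word_class_eq_iff: "word_class R u = word_class R v \<longleftrightarrow> word_cong R u v"
proof
  assume "word_class R u = word_class R v"
  then have "v \<in> word_class R u" by (simp add: word_class_def word_refl)
  then show "word_cong R u v" by (simp add: word_class_def)
next
  assume uv: "word_cong R u v"
  have "word_cong R u w \<longleftrightarrow> word_cong R v w" for w
    using word_trans[OF uv] word_trans[OF word_sym[OF uv]] by blast
  then show "word_class R u = word_class R v" by (simp add: word_class_def)
qed

lemma carrier_presented_group: "carrier (presented_group R) = range (word_class R)"
  by (auto simp: presented_group_def quotient_def word_class_def)

lemma one_presented_group: "\<one>\<^bsub>presented_group R\<^esub> = word_class R []"
  by (simp add: presented_group_def word_class_def)

lemma mult_presented_group: "word_class R u \<otimes>\<^bsub>presented_group R\<^esub> word_class R v = word_class R (u @ v)"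
proof -
  have "word_class R u \<otimes>\<^bsub>presented_group R\<^esub> word_class R v =
     (\<Union>a\<in>word_class R u. \<Union>b\<in>word_class R v. word_class R (a @ b))"
    by (simp add: presented_group_def word_class_def)
  also have "\<dots> = word_class R (u @ v)"
  proof -
    have "word_class R (a @ b) = word_class R (u @ v)" if "a \<in> word_class R u" "b \<in> word_class R v" for a b
    proof -
      have "word_cong R (a @ b) (u @ v)"
        using that by (auto simp: word_class_def intro!: word_cong_append word_sym[of R u] word_sym[of R v])
      then show ?thesis by (simp add: word_class_eq_iff)
    qed
    moreover have "u \<in> word_class R u" "v \<in> word_class R v" by (auto simp: word_class_def word_refl)
    ultimately show ?thesis by blast
  qed
  finally show ?thesis .
qed

lemma group_presented_group: "group (presented_group R)"
proof (rule groupI)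
  fix x assume "x \<in> carrier (presented_group R)"
  then obtain u where "x = word_class R u" by (auto simp: carrier_presented_group)
  then show "\<exists>y\<in>carrier (presented_group R). y \<otimes>\<^bsub>presented_group R\<^esub> x = \<one>\<^bsub>presented_group R\<^esub>"
    by (intro bexI[of _ "word_class R (word_inv u)"])
      (auto simp: mult_presented_group one_presented_group word_class_eq_iff word_cong_inv_left carrier_presented_group)
qed (auto simp: carrier_presented_group mult_presented_group one_presented_group)

section \<open>Evaluation of words and normal forms\<close>

definition letter_value :: "('a, 'b) monoid_scheme \<Rightarrow> 'a \<Rightarrow> 'a \<Rightarrow> bool \<times> two_gens \<Rightarrow> 'a" where
  "letter_value H x y l = (let e = (case snd l of Gen_X \<Rightarrow> x | Gen_Y \<Rightarrow> y) in if fst l then e else inv\<^bsub>H\<^esub> e)"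

primrec word_value :: "('a, 'b) monoid_scheme \<Rightarrow> 'a \<Rightarrow> 'a \<Rightarrow> two_gens word \<Rightarrow> 'a" where
  "word_value H x y [] = \<one>\<^bsub>H\<^esub>"
| "word_value H x y (l # w) = letter_value H x y l \<otimes>\<^bsub>H\<^esub> word_value H x y w"

abbreviation power_relators :: "nat \<Rightarrow> nat \<Rightarrow> two_gens word set" where
  "power_relators m n \<equiv> {replicate m (True, Gen_X), replicate n (True, Gen_Y)}"

text \<open>The flag tells whether the word starts with \<open>X\<close>.\<close>

inductive alternating :: "nat \<Rightarrow> bool \<Rightarrow> two_gens word \<Rightarrow> bool" for n where
  X_only: "alternating n True [(True, Gen_X)]"
| X_cons: "alternating n False w \<Longrightarrow> alternating n True ((True, Gen_X) # w)"
| Y_only: "0 < i \<Longrightarrow> i < n \<Longrightarrow> alternating n False (replicate i (True, Gen_Y))"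
| Y_cons: "0 < i \<Longrightarrow> i < n \<Longrightarrow> alternating n True w \<Longrightarrow> alternating n False (replicate i (True, Gen_Y) @ w)"

definition has_normal_form :: "nat \<Rightarrow> two_gens word \<Rightarrow> bool" where
  "has_normal_form n w \<longleftrightarrow> word_cong (power_relators 2 n) w [] \<or>
     (\<exists>b v. alternating n b v \<and> word_cong (power_relators 2 n) w v)"

lemma has_normal_form_cong:
  "word_cong (power_relators 2 n) u v \<Longrightarrow> has_normal_form n v \<Longrightarrow> has_normal_form n u"
  unfolding has_normal_form_def using word_trans[of _ u v] by blast

lemma alternating_normal_form: "alternating n b v \<Longrightarrow> has_normal_form n v"
  unfolding has_normal_form_def by (blast intro: word_refl)

lemma has_normal_form_X_cons:
  assumes "has_normal_form n w" shows "has_normal_form n ((True, Gen_X) # w)"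
proof -
  let ?R = "power_relators 2 n" and ?X = "(True, Gen_X)"
  have XX: "word_cong ?R (?X # ?X # v) v" for v
    using word_relator[of "replicate 2 ?X" ?R "[]" v] by (simp add: numeral_2_eq_2)
  have step: "word_cong ?R (?X # w) (?X # v)" if "word_cong ?R w v" for v
    using word_cong_append_left[OF that, of "[?X]"] by simp
  from assms consider "word_cong ?R w []" | b v where "alternating n b v" "word_cong ?R w v"
    by (auto simp: has_normal_form_def)
  then show ?thesis
  proof cases
    case 1
    then show ?thesis using step X_only alternating_normal_form has_normal_form_cong by blast
  next
    case 2
    have "has_normal_form n (?X # v)"
      using 2(1)
    proof cases
      case X_only
      then show ?thesis using XX[of "[]"] by (auto simp: has_normal_form_def)
    next
      case (X_cons w')
      then show ?thesis using XX[of w'] alternating_normal_form has_normal_form_cong by blast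
    next
      case (Y_only i)
      then show ?thesis using alternating.X_cons alternating.Y_only alternating_normal_form by blast
    next
      case (Y_cons i w')
      then show ?thesis using alternating.X_cons alternating.Y_cons alternating_normal_form by blast
    qed
    then show ?thesis using step[OF 2(2)] has_normal_form_cong by blast
  qed
qed

lemma has_normal_form_Y_cons:
  assumes n: "2 \<le> n" and "has_normal_form n w" shows "has_normal_form n ((True, Gen_Y) # w)"
proof -
  let ?R = "power_relators 2 n" and ?Y = "(True, Gen_Y)"
  have YY: "word_cong ?R (?Y # replicate i ?Y @ v) v" if "Suc i = n" for i v
    using word_relator[of "replicate n ?Y" ?R "[]" v] that[symmetric] by simp
  have step: "word_cong ?R (?Y # w) (?Y # v)" if "word_cong ?R w v" for v
    using word_cong_append_left[OF that, of "[?Y]"] by simp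
  have Y1: "alternating n False [?Y]" using Y_only[of 1 n] n by simp
  from assms(2) consider "word_cong ?R w []" | b v where "alternating n b v" "word_cong ?R w v"
    by (auto simp: has_normal_form_def)
  then show ?thesis
  proof cases
    case 1
    then show ?thesis using step Y1 alternating_normal_form has_normal_form_cong by blast
  next
    case 2
    have "has_normal_form n (?Y # v)"
      using 2(1)
    proof cases
      case X_only
      then show ?thesis using Y_cons[of 1 n v] 2(1) n alternating_normal_form by force
    next
      case (X_cons w')
      then show ?thesis using Y_cons[of 1 n v] 2(1) n alternating_normal_form by force
    next
      case (Y_only i)
      show ?thesis
      proof (cases "Suc i = n")
        case True
        then show ?thesis using YY[OF True, of "[]"] Y_only by (auto simp: has_normal_form_def)
      next
        case False
        then show ?thesis using alternating.Y_only[of "Suc i" n] Y_only alternating_normal_form by force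
      qed
    next
      case (Y_cons i w')
      show ?thesis
      proof (cases "Suc i = n")
        case True
        then show ?thesis using YY[OF True, of w'] Y_cons alternating_normal_form has_normal_form_cong by blast
      next
        case False
        then show ?thesis using alternating.Y_cons[of "Suc i" n w'] Y_cons alternating_normal_form by force
      qed
    qed
    then show ?thesis using step[OF 2(2)] has_normal_form_cong by blast
  qed
qed

text \<open>An inverse letter is congruent to a positive power of the same generator, so it is
  enough to know that left multiplication by \<open>X\<close> or \<open>Y\<close> preserves the
  existence of a normal form.\<close>

lemma normal_form_exists:
  assumes n: "2 \<le> n" shows "has_normal_form n w"
proof (induction w)
  case Nil show ?case by (simp add: has_normal_form_def word_refl)
next
  case (Cons l w)
  let ?R = "power_relators 2 n"
  obtain b g where l: "l = (b, g)" by (cases l)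
  have inv: "word_cong ?R ((False, g) # w) (replicate m (True, g) @ w)" if "replicate (Suc m) (True, g) \<in> ?R" for m
  proof -
    have "word_cong ?R ([(False, g)] @ replicate (Suc m) (True, g) @ w) ([(False, g)] @ w)"
      by (rule word_relator) fact
    moreover have "word_cong ?R ([] @ [(False, g), (\<not> False, g)] @ replicate m (True, g) @ w) ([] @ replicate m (True, g) @ w)"
      by (rule word_cancel)
    ultimately show ?thesis using word_trans[OF word_sym] by simp
  qed
  have repl: "has_normal_form n (replicate m (True, Gen_Y) @ w)" for m
    by (induction m) (auto intro: has_normal_form_Y_cons[OF n] Cons)
  show ?case
  proof (cases b)
    case True
    then show ?thesis using l Cons has_normal_form_X_cons has_normal_form_Y_cons[OF n] by (cases g) auto
  next
    case False
    show ?thesis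
    proof (cases g)
      case Gen_X
      have "word_cong ?R ((False, g) # w) (replicate 1 (True, g) @ w)"
        by (rule inv) (simp add: Gen_X numeral_2_eq_2)
      then show ?thesis
        using has_normal_form_cong has_normal_form_X_cons[OF Cons] l False Gen_X by simp
    next
      case Gen_Y
      have "word_cong ?R ((False, g) # w) (replicate (n - 1) (True, g) @ w)"
        by (rule inv) (use n Gen_Y in simp)
      then show ?thesis
        using has_normal_form_cong repl l False Gen_Y by simp
    qed
  qed
qed

lemma power_relators_group_alt: "power_relators_group m n = presented_group (power_relators m n)"
  by (simp add: power_relators_group_def)

context group
begin

lemma letter_value_closed: "x \<in> carrier G \<Longrightarrow> y \<in> carrier G \<Longrightarrow> letter_value G x y l \<in> carrier G"
  by (auto simp: letter_value_def Let_def split: two_gens.split)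

lemma word_value_closed: "x \<in> carrier G \<Longrightarrow> y \<in> carrier G \<Longrightarrow> word_value G x y w \<in> carrier G"
  by (induction w) (auto simp: letter_value_closed)

lemma word_value_append:
  "x \<in> carrier G \<Longrightarrow> y \<in> carrier G \<Longrightarrow> word_value G x y (u @ v) = word_value G x y u \<otimes> word_value G x y v"
  by (induction u) (auto simp: letter_value_closed word_value_closed m_assoc)

lemma word_value_replicate:
  assumes "x \<in> carrier G" "y \<in> carrier G"
  shows "word_value G x y (replicate i (True, Gen_X)) = x [^] i"
    "word_value G x y (replicate i (True, Gen_Y)) = y [^] i"
proof -
  show "word_value G x y (replicate i (True, Gen_X)) = x [^] i"
  proof (induction i)
    case (Suc i)
    then show ?case using nat_pow_Suc2[OF assms(1), of i] by (simp add: letter_value_def del: nat_pow_Suc)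
  qed simp
  show "word_value G x y (replicate i (True, Gen_Y)) = y [^] i"
  proof (induction i)
    case (Suc i)
    then show ?case using nat_pow_Suc2[OF assms(2), of i] by (simp add: letter_value_def del: nat_pow_Suc)
  qed simp
qed

lemma word_value_cong:
  assumes xy: "x \<in> carrier G" "y \<in> carrier G" and rel: "x [^] m = \<one>" "y [^] n = \<one>"
    and "word_cong (power_relators m n) u v"
  shows "word_value G x y u = word_value G x y v"
  using assms(5)
proof (induction rule: word_cong.induct)
  case (word_cancel u b g v)
  have "letter_value G x y (b, g) \<otimes> letter_value G x y (\<not> b, g) = \<one>"
    using xy by (cases b; cases g) (auto simp: letter_value_def)
  then have "letter_value G x y (b, g) \<otimes> (letter_value G x y (\<not> b, g) \<otimes> word_value G x y v) = word_value G x y v"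
    using xy by (simp add: m_assoc[symmetric] letter_value_closed word_value_closed)
  then show ?case using xy by (simp add: word_value_append)
next
  case (word_relator r u v)
  then have "word_value G x y r = \<one>" using xy rel by (auto simp: word_value_replicate)
  then show ?case using xy by (simp add: word_value_append word_value_closed)
qed auto

lemma word_value_generate:
  assumes xy: "x \<in> carrier G" "y \<in> carrier G"
  shows "range (word_value G x y) = generate G {x, y}"
proof
  show "range (word_value G x y) \<subseteq> generate G {x, y}"
  proof safe
    fix w show "word_value G x y w \<in> generate G {x, y}"
    proof (induction w)
      case (Cons l w)
      have "letter_value G x y l \<in> generate G {x, y}"
        by (auto simp: letter_value_def Let_def split: two_gens.split intro: generate.intros)
      then show ?case using Cons by (auto intro: generate.eng)
    qed (auto intro: generate.one)
  qed
  show "generate G {x, y} \<subseteq> range (word_value G x y)"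
  proof
    fix g assume "g \<in> generate G {x, y}"
    then show "g \<in> range (word_value G x y)"
    proof (induction rule: generate.induct)
      case one
      have "\<one> = word_value G x y []" by simp
      then show ?case by blast
    next
      case (incl h)
      have "x = word_value G x y [(True, Gen_X)]" "y = word_value G x y [(True, Gen_Y)]"
        using xy by (simp_all add: letter_value_def)
      then show ?case using incl by blast
    next
      case (inv h)
      have "inv x = word_value G x y [(False, Gen_X)]" "inv y = word_value G x y [(False, Gen_Y)]"
        using xy by (simp_all add: letter_value_def)
      then show ?case using inv by blast
    next
      case (eng h1 h2)
      then obtain u v where "h1 = word_value G x y u" "h2 = word_value G x y v" by blast
      then have "h1 \<otimes> h2 = word_value G x y (u @ v)" using xy by (simp add: word_value_append)
      then show ?case by blast
    qed
  qed
qed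

text \<open>The value of a nonempty alternating word lies in \<open>Q\<close> or \<open>P\<close>
  according to its first letter. Both rules also accept the identity as argument, and this is where
  the induction over the word starts.\<close>

lemma ping_pong:
  assumes xy: "x \<in> carrier G" "y \<in> carrier G" and rel: "x [^] (2::nat) = \<one>" "y [^] n = \<one>" and n: "2 \<le> n"
    and X: "\<And>h. h \<in> P \<or> h = \<one> \<Longrightarrow> x \<otimes> h \<in> Q"
    and Y: "\<And>h i. h \<in> Q \<or> h = \<one> \<Longrightarrow> 0 < i \<Longrightarrow> i < n \<Longrightarrow> y [^] i \<otimes> h \<in> P"
  shows "word_cong (power_relators 2 n) w [] \<or> word_value G x y w \<in> P \<union> Q"
proof -
  have val: "word_value G x y v \<in> (if b then Q else P)" if "alternating n b v" for b v
    using that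
  proof (induction rule: alternating.induct)
    case X_only
    then show ?case using X[of \<one>] by (simp add: letter_value_def)
  next
    case (X_cons w)
    then show ?case using X[of "word_value G x y w"] by (simp add: letter_value_def)
  next
    case (Y_only i)
    then show ?case using Y[of \<one> i] xy by (simp add: word_value_replicate)
  next
    case (Y_cons i w)
    then show ?case using Y[of "word_value G x y w" i] xy by (simp add: word_value_replicate word_value_append)
  qed
  from normal_form_exists[OF n, of w]
  consider "word_cong (power_relators 2 n) w []" | b v where "alternating n b v" "word_cong (power_relators 2 n) w v"
    by (auto simp: has_normal_form_def)
  then show ?thesis
  proof cases
    case 2
    then have "word_value G x y w \<in> (if b then Q else P)"
      using val word_value_cong[OF xy rel] by metis
    then show ?thesis by (auto split: if_splits)
  qed simp
qed

definition class_value :: "'a \<Rightarrow> 'a \<Rightarrow> two_gens word set \<Rightarrow> 'a" where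
  "class_value x y A = word_value G x y (SOME w. w \<in> A)"

lemma class_value_word_class:
  assumes xy: "x \<in> carrier G" "y \<in> carrier G" and rel: "x [^] m = \<one>" "y [^] n = \<one>"
  shows "class_value x y (word_class (power_relators m n) w) = word_value G x y w"
proof -
  have "w \<in> word_class (power_relators m n) w" by (simp add: word_class_def word_refl)
  then have "(SOME v. v \<in> word_class (power_relators m n) w) \<in> word_class (power_relators m n) w" by (rule someI)
  then show ?thesis
    using word_value_cong[OF xy rel] by (simp add: class_value_def word_class_def)
qed

lemma word_value_inj:
  assumes xy: "x \<in> carrier G" "y \<in> carrier G"
    and triv: "\<And>w. word_value G x y w = \<one> \<Longrightarrow> word_cong R w []"
    and eq: "word_value G x y u = word_value G x y v"
    and rel: "\<And>u v. word_cong R u v \<Longrightarrow> word_value G x y u = word_value G x y v"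
  shows "word_cong R u v"
proof -
  have "word_value G x y (word_inv v) \<otimes> word_value G x y v = \<one>"
    using rel[OF word_cong_inv_left[of R v]] xy by (simp add: word_value_append)
  then have "word_cong R (word_inv v @ u) []"
    using triv eq xy by (simp add: word_value_append)
  then have "word_cong R (v @ word_inv v @ u) v"
    using word_cong_append_left[of R "word_inv v @ u" "[]" v] by simp
  moreover have "word_cong R ((v @ word_inv v) @ u) u"
  proof -
    have "word_cong R (word_inv (word_inv v) @ word_inv v) []" by (rule word_cong_inv_left)
    moreover have "word_inv (word_inv v) = v" by (simp add: word_inv_def rev_map[symmetric] o_def case_prod_beta)
    ultimately show ?thesis using word_cong_append_right[of R "v @ word_inv v" "[]" u] by simp
  qed
  ultimately show ?thesis using word_trans[OF word_sym, of R "v @ word_inv v @ u" u v] word_sym[of R u v] by simp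
qed

lemma power_relators_group_iso:
  assumes xy: "x \<in> carrier G" "y \<in> carrier G" and rel: "x [^] (2::nat) = \<one>" "y [^] n = \<one>" and n: "2 \<le> n"
    and X: "\<And>h. h \<in> P \<or> h = \<one> \<Longrightarrow> x \<otimes> h \<in> Q"
    and Y: "\<And>h i. h \<in> Q \<or> h = \<one> \<Longrightarrow> 0 < i \<Longrightarrow> i < n \<Longrightarrow> y [^] i \<otimes> h \<in> P"
    and one: "\<one> \<notin> P" "\<one> \<notin> Q" and gen: "generate G {x, y} = carrier G"
  shows "power_relators_group 2 n \<cong> G"
proof -
  note cv = class_value_word_class[OF xy rel]
  have inj: "word_cong (power_relators 2 n) u v" if "word_value G x y u = word_value G x y v" for u v
  proof (rule word_value_inj[OF xy _ that word_value_cong[OF xy rel]])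
    fix w assume "word_value G x y w = \<one>"
    then show "word_cong (power_relators 2 n) w []" using ping_pong[OF xy rel n X Y, of w] one by auto
  qed
  have "class_value x y \<in> iso (power_relators_group 2 n) G"
    unfolding iso_def hom_def power_relators_group_alt carrier_presented_group bij_betw_def
  proof (intro CollectI conjI Pi_I ballI)
    show "class_value x y A \<in> carrier G" if "A \<in> range (word_class (power_relators 2 n))" for A
      using that xy by (auto simp: cv word_value_closed)
    show "class_value x y (A \<otimes>\<^bsub>presented_group (power_relators 2 n)\<^esub> B) = class_value x y A \<otimes> class_value x y B"
      if "A \<in> range (word_class (power_relators 2 n))" "B \<in> range (word_class (power_relators 2 n))" for A B
      using that xy by (auto simp: cv mult_presented_group word_value_append)
    show "inj_on (class_value x y) (range (word_class (power_relators 2 n)))"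
      by (auto simp: inj_on_def cv word_class_eq_iff inj)
    show "class_value x y ` range (word_class (power_relators 2 n)) = carrier G"
      unfolding gen[symmetric] word_value_generate[OF xy, symmetric] by (simp add: image_image cv)
  qed
  then show ?thesis by (auto simp: is_iso_def)
qed

text \<open>Keeping \<open>z\<close> out of \<open>P\<close> and \<open>Q\<close> as well ensures
  that \<open>z\<close> is not the value of a word, so the two factors meet only in the
  identity.\<close>

lemma power_relators_group_times_C2_iso:
  assumes xy: "x \<in> carrier G" "y \<in> carrier G" and rel: "x [^] (2::nat) = \<one>" "y [^] n = \<one>" and n: "2 \<le> n"
    and X: "\<And>h. h \<in> P \<or> h = \<one> \<Longrightarrow> x \<otimes> h \<in> Q"
    and Y: "\<And>h i. h \<in> Q \<or> h = \<one> \<Longrightarrow> 0 < i \<Longrightarrow> i < n \<Longrightarrow> y [^] i \<otimes> h \<in> P"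
    and z: "z \<in> carrier G" "z \<otimes> z = \<one>" "z \<noteq> \<one>" "\<And>g. g \<in> carrier G \<Longrightarrow> z \<otimes> g = g \<otimes> z"
    and one: "\<one> \<notin> P" "\<one> \<notin> Q" "z \<notin> P" "z \<notin> Q"
    and gen: "carrier G \<subseteq> (\<lambda>g. g) ` generate G {x, y} \<union> (\<lambda>g. g \<otimes> z) ` generate G {x, y}"
  shows "power_relators_group 2 n \<times>\<times> integer_mod_group 2 \<cong> G"
proof -
  note cv = class_value_word_class[OF xy rel]
  let ?R = "power_relators 2 n"
  let ?wv = "word_value G x y"
  let ?z = "\<lambda>e::int. if e = 0 then \<one> else z"
  let ?f = "\<lambda>(A, e). class_value x y A \<otimes> ?z e"
  have pp: "word_cong ?R w [] \<or> ?wv w \<in> P \<union> Q" for w by (rule ping_pong[OF xy rel n X Y])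
  have inj: "word_cong ?R u v" if "?wv u = ?wv v" for u v
  proof (rule word_value_inj[OF xy _ that word_value_cong[OF xy rel]])
    fix w assume "?wv w = \<one>"
    then show "word_cong ?R w []" using pp[of w] one by auto
  qed
  have noz: "?wv w \<noteq> z" for w
    using pp[of w] one z(3) word_value_cong[OF xy rel, of w "[]"] by auto
  have cross: "?wv u \<noteq> ?wv v \<otimes> z" for u v
  proof
    assume a: "?wv u = ?wv v \<otimes> z"
    have "?wv (word_inv v @ u) = ?wv (word_inv v @ v) \<otimes> z"
      using xy a z(1) by (simp add: word_value_append m_assoc word_value_closed)
    also have "?wv (word_inv v @ v) = \<one>"
      using word_value_cong[OF xy rel word_cong_inv_left[of ?R v]] by simp
    finally show False using noz z(1) by simp
  qed
  have car2: "carrier (integer_mod_group 2) = {0, 1}"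
    by (auto simp: carrier_integer_mod_group)
  have "?f \<in> iso (power_relators_group 2 n \<times>\<times> integer_mod_group 2) G"
    unfolding iso_def hom_def power_relators_group_alt
  proof (intro CollectI conjI Pi_I ballI)
    fix p assume "p \<in> carrier (presented_group ?R \<times>\<times> integer_mod_group 2)"
    then show "?f p \<in> carrier G"
      using z(1) xy by (auto simp: carrier_presented_group cv word_value_closed)
  next
    fix p q assume "p \<in> carrier (presented_group ?R \<times>\<times> integer_mod_group 2)"
      "q \<in> carrier (presented_group ?R \<times>\<times> integer_mod_group 2)"
    then obtain u e v e' where p: "p = (word_class ?R u, e)" "q = (word_class ?R v, e')" "e \<in> {0, 1}" "e' \<in> {0, 1}"
      by (auto simp: carrier_presented_group car2)
    have c: "?wv u \<in> carrier G" "?wv v \<in> carrier G" using xy by (auto simp: word_value_closed)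
    have zz: "?z ((e + e') mod 2) = ?z e \<otimes> ?z e'" using p(3,4) z(1,2) by auto
    have zv: "?z e \<otimes> ?wv v = ?wv v \<otimes> ?z e" using z(4)[OF c(2)] c by auto
    have "?f (p \<otimes>\<^bsub>presented_group ?R \<times>\<times> integer_mod_group 2\<^esub> q) = (?wv u \<otimes> ?wv v) \<otimes> (?z e \<otimes> ?z e')"
      using xy by (simp add: p(1,2) cv mult_presented_group mult_integer_mod_group word_value_append zz)
    also have "\<dots> = ?wv u \<otimes> ((?wv v \<otimes> ?z e) \<otimes> ?z e')"
      using c z(1) by (simp add: m_assoc)
    also have "\<dots> = (?wv u \<otimes> ?z e) \<otimes> (?wv v \<otimes> ?z e')"
      unfolding zv[symmetric] using c z(1) by (simp add: m_assoc)
    finally show "?f (p \<otimes>\<^bsub>presented_group ?R \<times>\<times> integer_mod_group 2\<^esub> q) = ?f p \<otimes> ?f q"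
      by (simp add: p(1,2) cv)
  next
    have "inj_on ?f (carrier (presented_group ?R \<times>\<times> integer_mod_group 2))"
    proof (rule inj_onI)
      fix p q assume "p \<in> carrier (presented_group ?R \<times>\<times> integer_mod_group 2)"
        "q \<in> carrier (presented_group ?R \<times>\<times> integer_mod_group 2)" and eq: "?f p = ?f q"
      then obtain u e v e' where p: "p = (word_class ?R u, e)" "q = (word_class ?R v, e')" "e \<in> {0, 1}" "e' \<in> {0, 1}"
        by (auto simp: carrier_presented_group car2)
      have c: "?wv u \<in> carrier G" "?wv v \<in> carrier G" using xy by (auto simp: word_value_closed)
      have "?wv u \<otimes> ?z e = ?wv v \<otimes> ?z e'" using eq by (simp add: p(1,2) cv)
      then have "e = e' \<and> ?wv u = ?wv v"
        using p(3,4) c z(1) cross[of u v] cross[of v u] by auto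
      then show "p = q" using p inj by (auto simp: word_class_eq_iff)
    qed
    moreover have "carrier G \<subseteq> ?f ` carrier (presented_group ?R \<times>\<times> integer_mod_group 2)"
    proof
      fix g assume "g \<in> carrier G"
      then obtain w where "g = ?wv w \<or> g = ?wv w \<otimes> z"
        using gen unfolding word_value_generate[OF xy, symmetric] by blast
      then have "g = ?f (word_class ?R w, 0) \<or> g = ?f (word_class ?R w, 1)"
        using xy by (auto simp: cv word_value_closed)
      moreover have "(word_class ?R w, 0) \<in> carrier (presented_group ?R \<times>\<times> integer_mod_group 2)"
        "(word_class ?R w, 1) \<in> carrier (presented_group ?R \<times>\<times> integer_mod_group 2)"
        by (auto simp: carrier_presented_group car2)
      ultimately show "g \<in> ?f ` carrier (presented_group ?R \<times>\<times> integer_mod_group 2)" by blast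
    qed
    moreover have "?f ` carrier (presented_group ?R \<times>\<times> integer_mod_group 2) \<subseteq> carrier G"
      using z(1) xy by (auto simp: carrier_presented_group cv word_value_closed)
    ultimately show "bij_betw ?f (carrier (presented_group ?R \<times>\<times> integer_mod_group 2)) (carrier G)"
      by (auto simp: bij_betw_def)
  qed
  then show ?thesis by (auto simp: is_iso_def)
qed

end

section \<open>Generators of the monodromy groups\<close>

lemma rows_mat_mult:
  "rows_mat k a * rows_mat k b = rows_mat k (map (\<lambda>i. map (\<lambda>j. \<Sum>m<k. a ! i ! m * b ! m ! j) [0..<k]) [0..<k])"
  by (rule eq_matI) (auto simp: rows_mat_def scalar_prod_def sum_atLeast0_lessThan)

lemma one_rows_mat: "1\<^sub>m k = rows_mat k (map (\<lambda>i. map (\<lambda>j. if i = j then 1 else 0) [0..<k]) [0..<k])"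
  by (rule eq_matI) (auto simp: rows_mat_def)

lemma rows_mat_eq_iff: "rows_mat k a = rows_mat k b \<longleftrightarrow> (\<forall>i<k. \<forall>j<k. a ! i ! j = b ! i ! j)"
proof
  assume "rows_mat k a = rows_mat k b"
  then show "\<forall>i<k. \<forall>j<k. a ! i ! j = b ! i ! j" by (metis rows_mat_index)
qed (auto intro!: eq_matI simp: rows_mat_def)

lemma rows_mat_mult_vec_index:
  "v \<in> carrier_vec k \<Longrightarrow> i < k \<Longrightarrow> (rows_mat k a *\<^sub>v v) $ i = (\<Sum>m<k. a ! i ! m * v $ m)"
  by (simp add: rows_mat_def scalar_prod_def sum_atLeast0_lessThan)

lemma all_less_3: "(\<forall>i<3::nat. P i) \<longleftrightarrow> P 0 \<and> P 1 \<and> P 2"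
  by (auto simp: less_Suc_eq eval_nat_numeral)

lemma all_less_4: "(\<forall>i<4::nat. P i) \<longleftrightarrow> P 0 \<and> P 1 \<and> P 2 \<and> P 3"
  by (auto simp: less_Suc_eq eval_nat_numeral)

lemma minus_vec_eq_zeroD:
  fixes u v :: "complex Matrix.vec"
  assumes "u - v = 0\<^sub>v k" "u \<in> carrier_vec k" "v \<in> carrier_vec k" shows "u = v"
proof (rule eq_vecI)
  fix i assume "i < dim_vec v"
  then show "u $ i = v $ i" using arg_cong[OF assms(1), of "\<lambda>x :: complex Matrix.vec. x $ i"] assms(2,3) by simp
qed (use assms in simp)

text \<open>The inverse must preserve the kernel too, so that the induced map on the quotient is a
  bijection.\<close>

definition kernel_automorphisms :: "nat \<Rightarrow> complex mat set" where
  "kernel_automorphisms k = {A \<in> carrier_mat k k. \<exists>B\<in>carrier_mat k k. A * B = 1\<^sub>m k \<and> B * A = 1\<^sub>m k \<and>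
     (\<forall>v\<in>mat_kernel (G_mat k). A *\<^sub>v v \<in> mat_kernel (G_mat k) \<and> B *\<^sub>v v \<in> mat_kernel (G_mat k))}"

section \<open>The action on the quotient by the kernel\<close>

context
  fixes k :: nat
  assumes G: "G_mat k \<in> carrier_mat k k"
begin

lemma kernel_iff: "v \<in> mat_kernel (G_mat k) \<longleftrightarrow> v \<in> carrier_vec k \<and> G_mat k *\<^sub>v v = 0\<^sub>v k"
  using G by (auto simp: mat_kernel_def)

text \<open>\<open>G A = C G\<close> carries the kernel of \<open>G\<close> into itself. For a
  matrix that preserves the form \<open>G\<close>, the matrix \<open>C\<close> is the transposed
  inverse of \<open>A\<close>; the witnesses in the applications are found in this way.\<close>

lemma kernel_automorphismI:
  assumes "A * B = 1\<^sub>m k" "B * A = 1\<^sub>m k" "G_mat k * A = C * G_mat k" "G_mat k * B = D * G_mat k"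
    "A \<in> carrier_mat k k" "B \<in> carrier_mat k k" "C \<in> carrier_mat k k" "D \<in> carrier_mat k k"
  shows "A \<in> kernel_automorphisms k"
proof -
  have "A' *\<^sub>v v \<in> mat_kernel (G_mat k)" if "G_mat k * A' = C' * G_mat k" "A' \<in> carrier_mat k k" "C' \<in> carrier_mat k k"
    "v \<in> mat_kernel (G_mat k)" for A' C' v
  proof -
    have v: "v \<in> carrier_vec k" "G_mat k *\<^sub>v v = 0\<^sub>v k" using that(4) by (auto simp: kernel_iff)
    have "G_mat k *\<^sub>v (A' *\<^sub>v v) = C' *\<^sub>v (G_mat k *\<^sub>v v)"
      using that v G by (metis assoc_mult_mat_vec)
    also have "\<dots> = 0\<^sub>v k" unfolding v(2) using that(3) by (intro eq_vecI) auto
    finally show ?thesis using that v by (simp add: kernel_iff)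
  qed
  then show ?thesis using assms by (auto simp: kernel_automorphisms_def)
qed

lemma W_class_eq: "v \<in> carrier_vec k \<Longrightarrow> W_class k v = {h + v | h. h \<in> mat_kernel (G_mat k)}"
  by (auto simp: W_class_def r_coset_def monoid_vec_simps)

lemma W_space_eq: "W_space k = W_class k ` carrier_vec k"
  by (auto simp: W_space_def FactGroup_def RCOSETS_def W_class_def monoid_vec_simps)

text \<open>The classes are the fibres of \<open>v \<mapsto> G v\<close>. Hence the entries of
  \<open>G v\<close> are well-defined functions on the quotient, and the triples are built from
  them.\<close>

lemma mem_W_class: "v \<in> carrier_vec k \<Longrightarrow> u \<in> W_class k v \<longleftrightarrow> u \<in> carrier_vec k \<and> G_mat k *\<^sub>v u = G_mat k *\<^sub>v v"
proof
  assume v: "v \<in> carrier_vec k" and u: "u \<in> W_class k v"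
  then obtain h where "u = h + v" "h \<in> carrier_vec k" "G_mat k *\<^sub>v h = 0\<^sub>v k"
    by (auto simp: W_class_eq kernel_iff)
  then show "u \<in> carrier_vec k \<and> G_mat k *\<^sub>v u = G_mat k *\<^sub>v v"
    using v G by (simp add: mult_add_distrib_mat_vec)
next
  assume v: "v \<in> carrier_vec k" and u: "u \<in> carrier_vec k \<and> G_mat k *\<^sub>v u = G_mat k *\<^sub>v v"
  then have "G_mat k *\<^sub>v (u - v) = 0\<^sub>v k"
    using G by (simp add: mult_minus_distrib_mat_vec)
  then have "u - v \<in> mat_kernel (G_mat k)" using u v by (simp add: kernel_iff)
  moreover have "u = (u - v) + v" using u v by auto
  ultimately show "u \<in> W_class k v" using v by (auto simp: W_class_eq)
qed

lemma W_class_eq_iff: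
  assumes "u \<in> carrier_vec k" "v \<in> carrier_vec k"
  shows "W_class k u = W_class k v \<longleftrightarrow> G_mat k *\<^sub>v u = G_mat k *\<^sub>v v"
proof
  assume "W_class k u = W_class k v"
  then have "u \<in> W_class k v" using mem_W_class[OF assms(1), of u] assms by simp
  then show "G_mat k *\<^sub>v u = G_mat k *\<^sub>v v" using mem_W_class[OF assms(2)] by simp
qed (auto simp: mem_W_class assms)

lemma kernel_automorphism_image:
  assumes "A \<in> kernel_automorphisms k" "u \<in> carrier_vec k" "v \<in> carrier_vec k" "G_mat k *\<^sub>v u = G_mat k *\<^sub>v v"
  shows "G_mat k *\<^sub>v (A *\<^sub>v u) = G_mat k *\<^sub>v (A *\<^sub>v v)"
proof -
  have A: "A \<in> carrier_mat k k" using assms by (auto simp: kernel_automorphisms_def)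
  have "G_mat k *\<^sub>v (u - v) = 0\<^sub>v k" using assms G by (simp add: mult_minus_distrib_mat_vec)
  then have "u - v \<in> mat_kernel (G_mat k)" using assms by (simp add: kernel_iff)
  then have "A *\<^sub>v (u - v) \<in> mat_kernel (G_mat k)" using assms(1) by (auto simp: kernel_automorphisms_def)
  then have z: "G_mat k *\<^sub>v (A *\<^sub>v u - A *\<^sub>v v) = 0\<^sub>v k"
    using A assms by (simp add: kernel_iff mult_minus_distrib_mat_vec)
  have c: "A *\<^sub>v u \<in> carrier_vec k" "A *\<^sub>v v \<in> carrier_vec k" using A assms(2,3) by simp_all
  have "G_mat k *\<^sub>v (A *\<^sub>v u) - G_mat k *\<^sub>v (A *\<^sub>v v) = 0\<^sub>v k"
    using z c G by (simp add: mult_minus_distrib_mat_vec)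
  then show ?thesis by (rule minus_vec_eq_zeroD) (use c G in simp_all)
qed

lemma induced_map_W_class:
  assumes A: "A \<in> kernel_automorphisms k" and v: "v \<in> carrier_vec k"
  shows "induced_map k A (W_class k v) = W_class k (A *\<^sub>v v)"
proof -
  have A': "A \<in> carrier_mat k k" using A by (auto simp: kernel_automorphisms_def)
  have "W_class k (A *\<^sub>v u) = W_class k (A *\<^sub>v v)" if "u \<in> W_class k v" for u
    using that v A' kernel_automorphism_image[OF A, of u v] by (simp add: W_class_eq_iff mem_W_class)
  moreover have "v \<in> W_class k v" using v by (simp add: mem_W_class)
  ultimately have "(\<Union>u\<in>W_class k v. W_class k (A *\<^sub>v u)) = W_class k (A *\<^sub>v v)" by blast
  then show ?thesis using v by (simp add: induced_map_def W_space_eq)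
qed

lemma induced_map_Bij:
  assumes A: "A \<in> kernel_automorphisms k" shows "induced_map k A \<in> Bij (W_space k)"
proof -
  obtain B where B: "B \<in> carrier_mat k k" "A * B = 1\<^sub>m k" "B * A = 1\<^sub>m k"
    and ker: "\<forall>v\<in>mat_kernel (G_mat k). A *\<^sub>v v \<in> mat_kernel (G_mat k) \<and> B *\<^sub>v v \<in> mat_kernel (G_mat k)"
    and A': "A \<in> carrier_mat k k"
    using A by (auto simp: kernel_automorphisms_def)
  have Bk: "B \<in> kernel_automorphisms k" using B ker A' by (auto simp: kernel_automorphisms_def)
  have AB: "A *\<^sub>v (B *\<^sub>v v) = v" "B *\<^sub>v (A *\<^sub>v v) = v" if "v \<in> carrier_vec k" for v
    using that A' B by (simp_all add: assoc_mult_mat_vec[symmetric, of _ k k _ k])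
  have "bij_betw (induced_map k A) (W_space k) (W_space k)"
  proof (rule bij_betw_byWitness[where f' = "induced_map k B"])
    show "\<forall>c\<in>W_space k. induced_map k B (induced_map k A c) = c"
      using A' B AB by (auto simp: W_space_eq induced_map_W_class[OF A] induced_map_W_class[OF Bk])
    show "\<forall>c\<in>W_space k. induced_map k A (induced_map k B c) = c"
      using A' B AB by (auto simp: W_space_eq induced_map_W_class[OF A] induced_map_W_class[OF Bk])
    show "induced_map k A ` W_space k \<subseteq> W_space k"
      using A' by (auto simp: W_space_eq induced_map_W_class[OF A])
    show "induced_map k B ` W_space k \<subseteq> W_space k"
      using B by (auto simp: W_space_eq induced_map_W_class[OF Bk])
  qed
  then show ?thesis by (simp add: Bij_def induced_map_def)
qed

lemma kernel_automorphisms_mult: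
  assumes "A \<in> kernel_automorphisms k" "B \<in> kernel_automorphisms k"
  shows "A * B \<in> kernel_automorphisms k"
proof -
  obtain A' where A: "A \<in> carrier_mat k k" "A' \<in> carrier_mat k k" "A * A' = 1\<^sub>m k" "A' * A = 1\<^sub>m k"
    "\<forall>v\<in>mat_kernel (G_mat k). A *\<^sub>v v \<in> mat_kernel (G_mat k) \<and> A' *\<^sub>v v \<in> mat_kernel (G_mat k)"
    using assms(1) by (auto simp: kernel_automorphisms_def)
  obtain B' where B: "B \<in> carrier_mat k k" "B' \<in> carrier_mat k k" "B * B' = 1\<^sub>m k" "B' * B = 1\<^sub>m k"
    "\<forall>v\<in>mat_kernel (G_mat k). B *\<^sub>v v \<in> mat_kernel (G_mat k) \<and> B' *\<^sub>v v \<in> mat_kernel (G_mat k)"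
    using assms(2) by (auto simp: kernel_automorphisms_def)
  have "(A * B) * (B' * A') = A * (B * B') * A'" "(B' * A') * (A * B) = B' * (A' * A) * B"
    using A(1,2) B(1,2) by (simp_all add: assoc_mult_mat[of _ k k _ k _ k])
  then have "(A * B) * (B' * A') = 1\<^sub>m k" "(B' * A') * (A * B) = 1\<^sub>m k"
    using A B by simp_all
  moreover have "(A * B) *\<^sub>v v \<in> mat_kernel (G_mat k) \<and> (B' * A') *\<^sub>v v \<in> mat_kernel (G_mat k)"
    if "v \<in> mat_kernel (G_mat k)" for v
  proof -
    have "v \<in> carrier_vec k" using that by (simp add: kernel_iff)
    then show ?thesis using that A B by (simp add: assoc_mult_mat_vec[of _ k k _ k])
  qed
  ultimately show ?thesis
    using A(1,2) B(1,2) unfolding kernel_automorphisms_def by (intro CollectI conjI bexI[of _ "B' * A'"]) auto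
qed

lemma induced_map_mult:
  assumes "A \<in> kernel_automorphisms k" "B \<in> kernel_automorphisms k"
  shows "induced_map k A \<otimes>\<^bsub>BijGroup (W_space k)\<^esub> induced_map k B = induced_map k (A * B)"
proof -
  have c: "A \<in> carrier_mat k k" "B \<in> carrier_mat k k" using assms by (auto simp: kernel_automorphisms_def)
  have "compose (W_space k) (induced_map k A) (induced_map k B) x = induced_map k (A * B) x" for x
  proof (cases "x \<in> W_space k")
    case True
    then obtain v where v: "v \<in> carrier_vec k" "x = W_class k v" by (auto simp: W_space_eq)
    then show ?thesis using True c
      by (simp add: compose_eq induced_map_W_class assms kernel_automorphisms_mult assoc_mult_mat_vec[of _ k k _ k])
  qed (simp add: compose_def induced_map_def)
  then show ?thesis
    using assms by (simp add: BijGroup_def induced_map_Bij fun_eq_iff)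
qed

lemma induced_map_one: "induced_map k (1\<^sub>m k) = \<one>\<^bsub>BijGroup (W_space k)\<^esub>"
proof -
  have o: "1\<^sub>m k \<in> kernel_automorphisms k"
    by (auto simp: kernel_automorphisms_def kernel_iff intro!: bexI[of _ "1\<^sub>m k"])
  have "induced_map k (1\<^sub>m k) x = (\<lambda>x\<in>W_space k. x) x" for x
  proof (cases "x \<in> W_space k")
    case True
    then obtain v where v: "v \<in> carrier_vec k" "x = W_class k v" by (auto simp: W_space_eq)
    then show ?thesis using True by (simp add: induced_map_W_class[OF o])
  qed (simp add: induced_map_def)
  then show ?thesis by (simp add: BijGroup_def fun_eq_iff)
qed

end



section \<open>Matrices and relations for \<open>k = 3\<close>\<close>

abbreviation g3 :: "complex mat" where "g3 \<equiv> rows_mat 3 [[1, -3/2, -3/2], [-3/2, 1, 3/2], [-3/2, 3/2, 1]]"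

abbreviation t3 :: "complex mat" where "t3 \<equiv> rows_mat 3 [[0, 0, 1], [-1, 3, 3], [0, -1, 0]]"

abbreviation ti3 :: "complex mat" where "ti3 \<equiv> rows_mat 3 [[3, -1, -3], [0, 0, -1], [1, 0, 0]]"

abbreviation r3_0 :: "complex mat" where "r3_0 \<equiv> rows_mat 3 [[-1, 3, 3], [0, 1, 0], [0, 0, 1]]"

abbreviation r3_1 :: "complex mat" where "r3_1 \<equiv> rows_mat 3 [[1, 0, 0], [3, -1, -3], [0, 0, 1]]"

abbreviation r3_2 :: "complex mat" where "r3_2 \<equiv> rows_mat 3 [[1, 0, 0], [0, 1, 0], [3, -3, -1]]"

text \<open>The matrices \<open>y3\<close> and \<open>y4\<close> are \<open>- T R\<^sub>1\<close> and \<open>T R\<^sub>1\<close>, of order 3 and 4.\<close>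

abbreviation y3 :: "complex mat" where "y3 \<equiv> rows_mat 3 [[0, 0, -1], [-1, 0, 0], [0, 1, 0]]"

abbreviation yi3 :: "complex mat" where "yi3 \<equiv> rows_mat 3 [[0, -1, 0], [0, 0, 1], [-1, 0, 0]]"

abbreviation n3 :: "complex mat" where "n3 \<equiv> rows_mat 3 [[-1, 0, 0], [0, -1, 0], [0, 0, -1]]"

lemma G_mat_3: "G_mat 3 = g3"
  unfolding G_mat_def Stokes_and_T_3(1)
  by (rule eq_matI) (auto simp: rows_mat_def less_Suc_eq eval_nat_numeral)

lemma reflection_mat_3: "reflection_mat 3 0 = r3_0" "reflection_mat 3 1 = r3_1" "reflection_mat 3 2 = r3_2"
  unfolding reflection_mat_def G_mat_3
  by (rule eq_matI; auto simp: rows_mat_def less_Suc_eq eval_nat_numeral)+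

lemma t3_automorphism: "t3 \<in> kernel_automorphisms 3"
proof (rule kernel_automorphismI)
  show "t3 * ti3 = 1\<^sub>m 3" "ti3 * t3 = 1\<^sub>m 3"
    by (simp_all add: rows_mat_mult one_rows_mat rows_mat_eq_iff all_less_3 sum_lessThan_3)
  show "G_mat 3 * t3 = rows_mat 3 [[3, 0, 1], [-1, 0, 0], [-3, -1, 0]] * G_mat 3" "G_mat 3 * ti3 = rows_mat 3 [[0, -1, 0], [0, 3, -1], [1, 3, 0]] * G_mat 3"
    unfolding G_mat_3 by (simp_all add: rows_mat_mult one_rows_mat rows_mat_eq_iff all_less_3 sum_lessThan_3)
qed (simp_all add: G_mat_3)

lemma r3_0_automorphism: "r3_0 \<in> kernel_automorphisms 3"
proof (rule kernel_automorphismI)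
  show "r3_0 * r3_0 = 1\<^sub>m 3" "r3_0 * r3_0 = 1\<^sub>m 3"
    by (simp_all add: rows_mat_mult one_rows_mat rows_mat_eq_iff all_less_3 sum_lessThan_3)
  show "G_mat 3 * r3_0 = rows_mat 3 [[-1, 0, 0], [3, 1, 0], [3, 0, 1]] * G_mat 3" "G_mat 3 * r3_0 = rows_mat 3 [[-1, 0, 0], [3, 1, 0], [3, 0, 1]] * G_mat 3"
    unfolding G_mat_3 by (simp_all add: rows_mat_mult one_rows_mat rows_mat_eq_iff all_less_3 sum_lessThan_3)
qed (simp_all add: G_mat_3)

lemma r3_1_automorphism: "r3_1 \<in> kernel_automorphisms 3"
proof (rule kernel_automorphismI)
  show "r3_1 * r3_1 = 1\<^sub>m 3" "r3_1 * r3_1 = 1\<^sub>m 3"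
    by (simp_all add: rows_mat_mult one_rows_mat rows_mat_eq_iff all_less_3 sum_lessThan_3)
  show "G_mat 3 * r3_1 = rows_mat 3 [[1, 3, 0], [0, -1, 0], [0, -3, 1]] * G_mat 3" "G_mat 3 * r3_1 = rows_mat 3 [[1, 3, 0], [0, -1, 0], [0, -3, 1]] * G_mat 3"
    unfolding G_mat_3 by (simp_all add: rows_mat_mult one_rows_mat rows_mat_eq_iff all_less_3 sum_lessThan_3)
qed (simp_all add: G_mat_3)

lemma r3_2_automorphism: "r3_2 \<in> kernel_automorphisms 3"
proof (rule kernel_automorphismI)
  show "r3_2 * r3_2 = 1\<^sub>m 3" "r3_2 * r3_2 = 1\<^sub>m 3"
    by (simp_all add: rows_mat_mult one_rows_mat rows_mat_eq_iff all_less_3 sum_lessThan_3)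
  show "G_mat 3 * r3_2 = rows_mat 3 [[1, 0, 3], [0, 1, -3], [0, 0, -1]] * G_mat 3" "G_mat 3 * r3_2 = rows_mat 3 [[1, 0, 3], [0, 1, -3], [0, 0, -1]] * G_mat 3"
    unfolding G_mat_3 by (simp_all add: rows_mat_mult one_rows_mat rows_mat_eq_iff all_less_3 sum_lessThan_3)
qed (simp_all add: G_mat_3)

lemma y3_automorphism: "y3 \<in> kernel_automorphisms 3"
proof (rule kernel_automorphismI)
  show "y3 * yi3 = 1\<^sub>m 3" "yi3 * y3 = 1\<^sub>m 3"
    by (simp_all add: rows_mat_mult one_rows_mat rows_mat_eq_iff all_less_3 sum_lessThan_3)
  show "G_mat 3 * y3 = rows_mat 3 [[0, 0, -1], [-1, 0, 0], [0, 1, 0]] * G_mat 3" "G_mat 3 * yi3 = rows_mat 3 [[0, -1, 0], [0, 0, 1], [-1, 0, 0]] * G_mat 3"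
    unfolding G_mat_3 by (simp_all add: rows_mat_mult one_rows_mat rows_mat_eq_iff all_less_3 sum_lessThan_3)
qed (simp_all add: G_mat_3)

lemma n3_automorphism: "n3 \<in> kernel_automorphisms 3"
proof (rule kernel_automorphismI)
  show "n3 * n3 = 1\<^sub>m 3" "n3 * n3 = 1\<^sub>m 3"
    by (simp_all add: rows_mat_mult one_rows_mat rows_mat_eq_iff all_less_3 sum_lessThan_3)
  show "G_mat 3 * n3 = rows_mat 3 [[-1, 0, 0], [0, -1, 0], [0, 0, -1]] * G_mat 3" "G_mat 3 * n3 = rows_mat 3 [[-1, 0, 0], [0, -1, 0], [0, 0, -1]] * G_mat 3"
    unfolding G_mat_3 by (simp_all add: rows_mat_mult one_rows_mat rows_mat_eq_iff all_less_3 sum_lessThan_3)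
qed (simp_all add: G_mat_3)

text \<open>The first two relations exhibit \<open>r3_1\<close> and \<open>r3_2\<close> as
  conjugates of earlier reflections, by \<open>t3\<close> and by \<open>r3_1 * t3\<close>. The
  others replace \<open>t3\<close> by \<open>y3\<close> of order 3 and the central
  \<open>n3\<close>.\<close>

lemma matrix_relations_3:
  "t3 * r3_0 = r3_1 * t3"
  "r3_2 * (r3_1 * t3) = (r3_1 * t3) * r3_1"
  "n3 * (y3 * r3_0) = t3"
  "r3_0 * r3_0 = 1\<^sub>m 3"
  "y3 * (y3 * y3) = 1\<^sub>m 3"
  "n3 * n3 = 1\<^sub>m 3"
  "n3 * r3_0 = r3_0 * n3"
  "n3 * y3 = y3 * n3"
  "t3 * r3_0 = n3 * y3"
  unfolding one_rows_mat rows_mat_mult by (simp_all add: rows_mat_eq_iff all_less_3 sum_lessThan_3)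

section \<open>Matrices and relations for \<open>k = 4\<close>\<close>

abbreviation g4 :: "complex mat" where "g4 \<equiv> rows_mat 4 [[1, -2, 5, -2], [-2, 1, -2, 3], [5, -2, 1, -10], [-2, 3, -10, 1]]"

abbreviation t4 :: "complex mat" where "t4 \<equiv> rows_mat 4 [[0, 0, 0, 1], [-1, 0, 6, 4], [0, -1, 4, 0], [0, 0, -1, 0]]"

abbreviation ti4 :: "complex mat" where "ti4 \<equiv> rows_mat 4 [[4, -1, 0, -6], [0, 0, -1, -4], [0, 0, 0, -1], [1, 0, 0, 0]]"

abbreviation r4_0 :: "complex mat" where "r4_0 \<equiv> rows_mat 4 [[-1, 4, -10, 4], [0, 1, 0, 0], [0, 0, 1, 0], [0, 0, 0, 1]]"

abbreviation r4_1 :: "complex mat" where "r4_1 \<equiv> rows_mat 4 [[1, 0, 0, 0], [4, -1, 4, -6], [0, 0, 1, 0], [0, 0, 0, 1]]"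

abbreviation r4_2 :: "complex mat" where "r4_2 \<equiv> rows_mat 4 [[1, 0, 0, 0], [0, 1, 0, 0], [-10, 4, -1, 20], [0, 0, 0, 1]]"

abbreviation r4_3 :: "complex mat" where "r4_3 \<equiv> rows_mat 4 [[1, 0, 0, 0], [0, 1, 0, 0], [0, 0, 1, 0], [4, -6, 20, -1]]"

abbreviation y4 :: "complex mat" where "y4 \<equiv> rows_mat 4 [[0, 0, 0, 1], [1, -4, 16, 0], [0, -1, 4, 0], [0, 0, -1, 0]]"

abbreviation yi4 :: "complex mat" where "yi4 \<equiv> rows_mat 4 [[0, 1, -4, 0], [0, 0, -1, -4], [0, 0, 0, -1], [1, 0, 0, 0]]"

lemma G_mat_4: "G_mat 4 = g4"
  unfolding G_mat_def Stokes_and_T_4(1)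
  by (rule eq_matI) (auto simp: rows_mat_def less_Suc_eq eval_nat_numeral)

lemma reflection_mat_4: "reflection_mat 4 0 = r4_0" "reflection_mat 4 1 = r4_1" "reflection_mat 4 2 = r4_2" "reflection_mat 4 3 = r4_3"
  unfolding reflection_mat_def G_mat_4
  by (rule eq_matI; auto simp: rows_mat_def less_Suc_eq eval_nat_numeral)+

lemma t4_automorphism: "t4 \<in> kernel_automorphisms 4"
proof (rule kernel_automorphismI)
  show "t4 * ti4 = 1\<^sub>m 4" "ti4 * t4 = 1\<^sub>m 4"
    by (simp_all add: rows_mat_mult one_rows_mat rows_mat_eq_iff all_less_4 sum_lessThan_4)
  show "G_mat 4 * t4 = rows_mat 4 [[4, 0, 0, 1], [-1, 0, 0, 0], [0, -1, 0, 0], [-6, -4, -1, 0]] * G_mat 4" "G_mat 4 * ti4 = rows_mat 4 [[0, -1, 0, 0], [0, 0, -1, 0], [0, 6, 4, -1], [1, 4, 0, 0]] * G_mat 4"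
    unfolding G_mat_4 by (simp_all add: rows_mat_mult one_rows_mat rows_mat_eq_iff all_less_4 sum_lessThan_4)
qed (simp_all add: G_mat_4)

lemma r4_0_automorphism: "r4_0 \<in> kernel_automorphisms 4"
proof (rule kernel_automorphismI)
  show "r4_0 * r4_0 = 1\<^sub>m 4" "r4_0 * r4_0 = 1\<^sub>m 4"
    by (simp_all add: rows_mat_mult one_rows_mat rows_mat_eq_iff all_less_4 sum_lessThan_4)
  show "G_mat 4 * r4_0 = rows_mat 4 [[-1, 0, 0, 0], [4, 1, 0, 0], [-10, 0, 1, 0], [4, 0, 0, 1]] * G_mat 4" "G_mat 4 * r4_0 = rows_mat 4 [[-1, 0, 0, 0], [4, 1, 0, 0], [-10, 0, 1, 0], [4, 0, 0, 1]] * G_mat 4"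
    unfolding G_mat_4 by (simp_all add: rows_mat_mult one_rows_mat rows_mat_eq_iff all_less_4 sum_lessThan_4)
qed (simp_all add: G_mat_4)

lemma r4_1_automorphism: "r4_1 \<in> kernel_automorphisms 4"
proof (rule kernel_automorphismI)
  show "r4_1 * r4_1 = 1\<^sub>m 4" "r4_1 * r4_1 = 1\<^sub>m 4"
    by (simp_all add: rows_mat_mult one_rows_mat rows_mat_eq_iff all_less_4 sum_lessThan_4)
  show "G_mat 4 * r4_1 = rows_mat 4 [[1, 4, 0, 0], [0, -1, 0, 0], [0, 4, 1, 0], [0, -6, 0, 1]] * G_mat 4" "G_mat 4 * r4_1 = rows_mat 4 [[1, 4, 0, 0], [0, -1, 0, 0], [0, 4, 1, 0], [0, -6, 0, 1]] * G_mat 4"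
    unfolding G_mat_4 by (simp_all add: rows_mat_mult one_rows_mat rows_mat_eq_iff all_less_4 sum_lessThan_4)
qed (simp_all add: G_mat_4)

lemma r4_2_automorphism: "r4_2 \<in> kernel_automorphisms 4"
proof (rule kernel_automorphismI)
  show "r4_2 * r4_2 = 1\<^sub>m 4" "r4_2 * r4_2 = 1\<^sub>m 4"
    by (simp_all add: rows_mat_mult one_rows_mat rows_mat_eq_iff all_less_4 sum_lessThan_4)
  show "G_mat 4 * r4_2 = rows_mat 4 [[1, 0, -10, 0], [0, 1, 4, 0], [0, 0, -1, 0], [0, 0, 20, 1]] * G_mat 4" "G_mat 4 * r4_2 = rows_mat 4 [[1, 0, -10, 0], [0, 1, 4, 0], [0, 0, -1, 0], [0, 0, 20, 1]] * G_mat 4"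
    unfolding G_mat_4 by (simp_all add: rows_mat_mult one_rows_mat rows_mat_eq_iff all_less_4 sum_lessThan_4)
qed (simp_all add: G_mat_4)

lemma r4_3_automorphism: "r4_3 \<in> kernel_automorphisms 4"
proof (rule kernel_automorphismI)
  show "r4_3 * r4_3 = 1\<^sub>m 4" "r4_3 * r4_3 = 1\<^sub>m 4"
    by (simp_all add: rows_mat_mult one_rows_mat rows_mat_eq_iff all_less_4 sum_lessThan_4)
  show "G_mat 4 * r4_3 = rows_mat 4 [[1, 0, 0, 4], [0, 1, 0, -6], [0, 0, 1, 20], [0, 0, 0, -1]] * G_mat 4" "G_mat 4 * r4_3 = rows_mat 4 [[1, 0, 0, 4], [0, 1, 0, -6], [0, 0, 1, 20], [0, 0, 0, -1]] * G_mat 4"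
    unfolding G_mat_4 by (simp_all add: rows_mat_mult one_rows_mat rows_mat_eq_iff all_less_4 sum_lessThan_4)
qed (simp_all add: G_mat_4)

lemma y4_automorphism: "y4 \<in> kernel_automorphisms 4"
proof (rule kernel_automorphismI)
  show "y4 * yi4 = 1\<^sub>m 4" "yi4 * y4 = 1\<^sub>m 4"
    by (simp_all add: rows_mat_mult one_rows_mat rows_mat_eq_iff all_less_4 sum_lessThan_4)
  show "G_mat 4 * y4 = rows_mat 4 [[0, 0, 0, 1], [1, 0, 0, 0], [-4, -1, 0, 0], [0, -4, -1, 0]] * G_mat 4" "G_mat 4 * yi4 = rows_mat 4 [[0, 1, 0, 0], [0, -4, -1, 0], [0, 16, 4, -1], [1, 0, 0, 0]] * G_mat 4"
    unfolding G_mat_4 by (simp_all add: rows_mat_mult one_rows_mat rows_mat_eq_iff all_less_4 sum_lessThan_4)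
qed (simp_all add: G_mat_4)

text \<open>Closed forms of longer products, so that each relation can be checked one multiplication
  at a time: \<open>yy4\<close> is the square of \<open>y4\<close>, \<open>p4\<close> is
  \<open>r4_2 * t4\<close>, and \<open>q4\<close>, \<open>s4\<close> arise from it by multiplication
  with \<open>r4_1\<close> and then \<open>r4_3\<close> on the left.\<close>

abbreviation yy4 :: "complex mat" where "yy4 \<equiv> rows_mat 4 [[0, 0, -1, 0], [-4, 0, 0, 1], [-1, 0, 0, 0], [0, 1, -4, 0]]"

abbreviation p4 :: "complex mat" where "p4 \<equiv> rows_mat 4 [[0, 0, 0, 1], [-1, 0, 6, 4], [-4, 1, 0, 6], [0, 0, -1, 0]]"

abbreviation q4 :: "complex mat" where "q4 \<equiv> rows_mat 4 [[0, 0, 0, 1], [-15, 4, 0, 24], [-4, 1, 0, 6], [0, 0, -1, 0]]"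

abbreviation s4 :: "complex mat" where "s4 \<equiv> rows_mat 4 [[0, 0, 0, 1], [-15, 4, 0, 24], [-4, 1, 0, 6], [10, -4, 1, -20]]"

text \<open>Conjugation by \<open>t4\<close> takes \<open>r4_0\<close> to \<open>r4_1\<close> and
  \<open>r4_1\<close> to \<open>r4_2\<close>; conjugation by \<open>q4\<close> takes
  \<open>r4_2\<close> to \<open>r4_3\<close>. So one reflection and \<open>t4\<close> generate
  everything.\<close>

lemma matrix_relations_4:
  "t4 * r4_0 = y4"
  "r4_1 * t4 = y4"
  "t4 * r4_1 = p4"
  "r4_2 * t4 = p4"
  "r4_1 * p4 = q4"
  "r4_3 * q4 = s4"
  "q4 * r4_2 = s4"
  "y4 * r4_0 = t4"
  "r4_0 * r4_0 = 1\<^sub>m 4"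
  "y4 * y4 = yy4"
  "yy4 * yy4 = 1\<^sub>m 4"
  unfolding one_rows_mat rows_mat_mult by (simp_all add: rows_mat_eq_iff all_less_4 sum_lessThan_4)

section \<open>Ping-pong with triples\<close>

type_synonym triple = "real \<times> real \<times> real"

text \<open>
  The triple of a group element \<open>h\<close> consists of the values at \<open>h\<close>, \<open>y\<^sup>-\<^sup>1 h\<close> and \<open>y h\<close> of a suitable
  function \<open>f\<close>, up to a common sign. The functions below describe how left multiplication by \<open>x\<close> and
  \<open>y\<close> acts, given that \<open>f(x h) = f(h)\<close>, \<open>f(y\<^sup>\<plusminus>\<^sup>1 x h) = n f(h) - f(y\<^sup>\<plusminus>\<^sup>1 h)\<close> and, for \<open>n = 4\<close>,
  \<open>f(h) + f(y\<^sup>2 h) = f(y h) + f(y\<^sup>-\<^sup>1 h)\<close>. The regions \<open>far\<close> and \<open>turned\<close> are the targets of \<open>x\<close> and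
  of the nontrivial powers of \<open>y\<close>; \<open>basic\<close> is the region of the identity.
\<close>

fun neg_triple :: "triple \<Rightarrow> triple" where
  "neg_triple (a, b, c) = (- a, - b, - c)"

fun x_triple :: "nat \<Rightarrow> triple \<Rightarrow> triple" where
  "x_triple n (a, b, c) = (a, real n * a - b, real n * a - c)"

fun y_triple :: "nat \<Rightarrow> triple \<Rightarrow> triple" where
  "y_triple n (a, b, c) = (c, a, if n = 3 then b else b + c - a)"

fun far :: "nat \<Rightarrow> triple \<Rightarrow> bool" where
  "far n (a, b, c) \<longleftrightarrow> \<bar>b - c\<bar> \<le> (real n - 2) * a \<and> real n * a \<le> b + c"

fun turned :: "nat \<Rightarrow> triple \<Rightarrow> bool" where
  "turned n (a, b, c) \<longleftrightarrow> \<bar>b - c\<bar> \<le> (real n - 2) * a \<and> b + c \<le> real n * a \<and> (b \<le> a \<or> c \<le> a)"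

fun basic :: "nat \<Rightarrow> triple \<Rightarrow> bool" where
  "basic n (a, b, c) \<longleftrightarrow> a < b \<and> a < c \<and> b + c < real n * a \<and> \<bar>b - c\<bar> \<le> (real n - 2) * a"

definition equal_up_to_sign :: "triple \<Rightarrow> triple \<Rightarrow> bool" where
  "equal_up_to_sign s t \<longleftrightarrow> s = t \<or> s = neg_triple t"

lemma neg_neg_triple [simp]: "neg_triple (neg_triple t) = t"
  by (cases t) simp

lemma equal_up_to_sign_trans: "equal_up_to_sign s t \<Longrightarrow> equal_up_to_sign t u \<Longrightarrow> equal_up_to_sign s u"
  by (auto simp: equal_up_to_sign_def)

lemma x_triple_neg: "x_triple n (neg_triple t) = neg_triple (x_triple n t)"
  by (cases t) simp

lemma y_triple_neg: "y_triple n (neg_triple t) = neg_triple (y_triple n t)"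
  by (cases t) simp

lemma y_triple_sign: "equal_up_to_sign s t \<Longrightarrow> equal_up_to_sign (y_triple n s) (y_triple n t)"
  by (auto simp: equal_up_to_sign_def y_triple_neg)

text \<open>\<open>x\<close> keeps \<open>|b - c|\<close> and replaces \<open>b + c\<close> by
  \<open>2 n a - (b + c)\<close>; it thus reverses the inequality that separates \<open>far\<close>
  from the other two regions.\<close>

lemma x_triple_far: "turned n t \<or> basic n t \<Longrightarrow> far n (x_triple n t)"
  by (cases t) (auto simp: algebra_simps)

text \<open>In \<open>far\<close> and in \<open>basic\<close> the first entry is a smallest value on
  the whole \<open>y\<close>-orbit, which for \<open>n = 4\<close> also contains
  \<open>b + c - a\<close>. After a nontrivial power of \<open>y\<close> this smallest value sits at
  another place.\<close>

lemma y_triple_turned: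
  assumes "n = 3 \<or> n = 4" "0 < i" "i < n" "far n t \<or> basic n t"
  shows "turned n ((y_triple n ^^ i) t)"
proof -
  obtain a b c where t: "t = (a, b, c)" by (cases t)
  have "i = 1 \<or> i = 2 \<or> n = 4 \<and> i = 3" using assms(1-3) by linarith
  then show ?thesis
    using assms(1,4) unfolding t by (elim disjE conjE; hypsubst?; simp add: numeral_2_eq_2 numeral_3_eq_3; linarith?)
qed

text \<open>\<open>far\<close> and \<open>turned\<close> require \<open>a \<ge> 0\<close>, while
  \<open>basic\<close> forces \<open>a > 0\<close>; so triples known only up to sign still separate
  the regions.\<close>

lemma basic_not_far_turned:
  assumes "n = 3 \<or> n = 4" "basic n t"
  shows "\<not> far n t" "\<not> turned n t" "\<not> far n (neg_triple t)" "\<not> turned n (neg_triple t)"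
  using assms by (cases t; auto)+

section \<open>Ping-pong in a group with a triple for every element\<close>

context group
begin

lemma pow_y_triple:
  assumes y: "y \<in> carrier G" and Ly: "\<And>h. h \<in> carrier G \<Longrightarrow> equal_up_to_sign (L (y \<otimes> h)) (y_triple n (L h))"
    and h: "h \<in> carrier G"
  shows "equal_up_to_sign (L (y [^] (i::nat) \<otimes> h)) ((y_triple n ^^ i) (L h))"
proof (induction i)
  case (Suc i)
  have "y [^] Suc i \<otimes> h = y \<otimes> (y [^] i \<otimes> h)"
    using y h by (simp only: nat_pow_Suc2 m_assoc nat_pow_closed)
  then show ?case
    using Ly[of "y [^] i \<otimes> h"] y_triple_sign[OF Suc] y h by (auto intro: equal_up_to_sign_trans)
qed (use h in \<open>simp add: equal_up_to_sign_def\<close>)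

definition pong_x :: "nat \<Rightarrow> ('a \<Rightarrow> triple) \<Rightarrow> 'a set" where
  "pong_x n L = {h \<in> carrier G. turned n (L h) \<or> turned n (neg_triple (L h))}"

definition pong_y :: "nat \<Rightarrow> ('a \<Rightarrow> triple) \<Rightarrow> 'a set" where
  "pong_y n L = {h \<in> carrier G. far n (L h) \<or> far n (neg_triple (L h))}"

lemma pong_x_pong_y:
  assumes x: "x \<in> carrier G" and Lx: "\<And>h. h \<in> carrier G \<Longrightarrow> equal_up_to_sign (L (x \<otimes> h)) (x_triple n (L h))"
    and base: "basic n (L \<one>)" and h: "h \<in> pong_x n L \<or> h = \<one>"
  shows "x \<otimes> h \<in> pong_y n L"
proof -
  have hc: "h \<in> carrier G" using h by (auto simp: pong_x_def)
  have "far n (x_triple n (L h)) \<or> far n (neg_triple (x_triple n (L h)))"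
    using h base x_triple_far[of n "L h"] x_triple_far[of n "neg_triple (L h)"] by (auto simp: pong_x_def x_triple_neg)
  then show ?thesis using Lx[OF hc] x hc by (auto simp: pong_y_def equal_up_to_sign_def)
qed

lemma pong_y_pong_x:
  assumes y: "y \<in> carrier G" and Ly: "\<And>h. h \<in> carrier G \<Longrightarrow> equal_up_to_sign (L (y \<otimes> h)) (y_triple n (L h))"
    and n: "n = 3 \<or> n = 4" and base: "basic n (L \<one>)" and h: "h \<in> pong_y n L \<or> h = \<one>" and i: "0 < i" "i < n"
  shows "y [^] i \<otimes> h \<in> pong_x n L"
proof -
  have hc: "h \<in> carrier G" using h by (auto simp: pong_y_def)
  have neg: "(y_triple n ^^ i) (neg_triple t) = neg_triple ((y_triple n ^^ i) t)" for t
    by (induction i) (auto simp: y_triple_neg)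
  have "turned n ((y_triple n ^^ i) (L h)) \<or> turned n (neg_triple ((y_triple n ^^ i) (L h)))"
    using h base y_triple_turned[OF n i, of "L h"] y_triple_turned[OF n i, of "neg_triple (L h)"] by (auto simp: pong_y_def neg)
  then show ?thesis using pow_y_triple[where L = L and n = n, OF y Ly hc, of i] y hc by (auto simp: pong_x_def equal_up_to_sign_def)
qed

lemma base_not_pong:
  assumes n: "n = 3 \<or> n = 4" and base: "basic n (L \<one>)" and h: "equal_up_to_sign (L h) (L \<one>)"
  shows "h \<notin> pong_x n L" "h \<notin> pong_y n L"
  using basic_not_far_turned[OF n base] h by (auto simp: pong_x_def pong_y_def equal_up_to_sign_def)

lemma power_relators_group_iso_triple:
  assumes xy: "x \<in> carrier G" "y \<in> carrier G" and rel: "x [^] (2::nat) = \<one>" "y [^] n = \<one>" and n: "n = 3 \<or> n = 4"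
    and Lx: "\<And>h. h \<in> carrier G \<Longrightarrow> equal_up_to_sign (L (x \<otimes> h)) (x_triple n (L h))"
    and Ly: "\<And>h. h \<in> carrier G \<Longrightarrow> equal_up_to_sign (L (y \<otimes> h)) (y_triple n (L h))"
    and base: "basic n (L \<one>)" and gen: "generate G {x, y} = carrier G"
  shows "power_relators_group 2 n \<cong> G"
  by (rule power_relators_group_iso[OF xy rel _ pong_x_pong_y[where L = L and n = n, OF xy(1) Lx base] pong_y_pong_x[where L = L and n = n, OF xy(2) Ly n base] _ _ gen])
    (use n base_not_pong[where L = L, OF n base, of \<one>] in \<open>auto simp: equal_up_to_sign_def\<close>)

text \<open>In a product every \<open>z\<close> can be moved to the right end, where its powers
  collapse to 1 or \<open>z\<close>. The induction carries the commutation with \<open>z\<close>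
  along, since the case of a product depends on it.\<close>

lemma central_generate:
  assumes xyz: "x \<in> carrier G" "y \<in> carrier G" "z \<in> carrier G" and z: "z \<otimes> z = \<one>"
    and comm: "z \<otimes> x = x \<otimes> z" "z \<otimes> y = y \<otimes> z" and g: "g \<in> generate G {x, y, z}"
  shows "z \<otimes> g = g \<otimes> z \<and> (g \<in> generate G {x, y} \<or> (\<exists>h\<in>generate G {x, y}. g = h \<otimes> z))"
proof -
  have K: "subgroup (generate G {x, y}) G" using xyz by (intro generate_is_subgroup) auto
  have Kc: "h \<in> carrier G" if "h \<in> generate G {x, y}" for h using K that by (rule subgroup.mem_carrier)
  have iz: "inv z = z" using xyz z by (simp add: inv_equality)
  have invc: "z \<otimes> inv a = inv a \<otimes> z" if "a \<in> carrier G" "z \<otimes> a = a \<otimes> z" for a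
  proof -
    have "inv a \<otimes> inv z = inv z \<otimes> inv a" using that xyz inv_mult_group[of z a] inv_mult_group[of a z] by simp
    then show ?thesis by (simp add: iz)
  qed
  show ?thesis
    using g
  proof (induction rule: generate.induct)
    case one
    then show ?case using xyz by (auto intro: generate.one)
  next
    case (incl h)
    then consider "h \<in> {x, y}" | "h = z" by auto
    then show ?case
    proof cases
      case 1
      then show ?thesis using comm generate.incl[of h "{x, y}" G] by auto
    next
      case 2
      then show ?thesis using xyz by (auto intro!: bexI[of _ \<one>] generate.one)
    qed
  next
    case (inv h)
    then consider "h \<in> {x, y}" | "h = z" by auto
    then show ?case
    proof cases
      case 1
      then show ?thesis using comm xyz invc generate.inv[of h "{x, y}" G] by auto
    next
      case 2
      then show ?thesis using xyz iz by (auto intro!: bexI[of _ \<one>] generate.one)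
    qed
  next
    case (eng a b)
    have ac: "a \<in> carrier G" "b \<in> carrier G"
      using eng(1,2) generate_in_carrier[of "{x, y, z}"] xyz by auto
    have c: "z \<otimes> (a \<otimes> b) = a \<otimes> b \<otimes> z"
      using eng ac xyz by (metis m_assoc)
    obtain a' b' s t where ab: "a' \<in> generate G {x, y}" "b' \<in> generate G {x, y}" "a = a' \<otimes> s" "b = b' \<otimes> t"
      "s = \<one> \<or> s = z" "t = \<one> \<or> t = z"
      using eng Kc by (metis r_one)
    have ca: "a' \<in> carrier G" "b' \<in> carrier G" using ab Kc by auto
    have zb: "z \<otimes> b' = b' \<otimes> z"
    proof (cases "t = \<one>")
      case True
      then show ?thesis using ab eng ca by simp
    next
      case False
      then have "t = z" using ab by auto
      then have "z \<otimes> (b' \<otimes> z) = (b' \<otimes> z) \<otimes> z" using eng ab by simp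
      then have "(z \<otimes> b') \<otimes> z = (b' \<otimes> z) \<otimes> z" using ca xyz by (simp add: m_assoc)
      then show ?thesis using ca xyz by simp
    qed
    have "a \<otimes> b = (a' \<otimes> b') \<otimes> (s \<otimes> t)"
    proof (cases "s = \<one>")
      case True
      then show ?thesis using ab ca xyz by (auto simp: m_assoc)
    next
      case False
      then have s: "s = z" using ab by auto
      have tc: "t \<in> carrier G" using ab xyz by auto
      have "a \<otimes> b = a' \<otimes> ((z \<otimes> b') \<otimes> t)" using ab s ca xyz tc by (simp add: m_assoc)
      also have "\<dots> = (a' \<otimes> b') \<otimes> (s \<otimes> t)" unfolding zb using ca xyz s tc by (simp add: m_assoc)
      finally show ?thesis .
    qed
    moreover have "s \<otimes> t = \<one> \<or> s \<otimes> t = z" using ab xyz z by auto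
    moreover have "a' \<otimes> b' \<in> generate G {x, y}" using ab by (auto intro: generate.eng)
    ultimately show ?case using c ca by auto
  qed
qed

lemma power_relators_group_times_C2_iso_triple:
  assumes xy: "x \<in> carrier G" "y \<in> carrier G" and rel: "x [^] (2::nat) = \<one>" "y [^] n = \<one>" and n: "n = 3 \<or> n = 4"
    and Lx: "\<And>h. h \<in> carrier G \<Longrightarrow> equal_up_to_sign (L (x \<otimes> h)) (x_triple n (L h))"
    and Ly: "\<And>h. h \<in> carrier G \<Longrightarrow> equal_up_to_sign (L (y \<otimes> h)) (y_triple n (L h))"
    and base: "basic n (L \<one>)"
    and z: "z \<in> carrier G" "z \<otimes> z = \<one>" "z \<noteq> \<one>" "z \<otimes> x = x \<otimes> z" "z \<otimes> y = y \<otimes> z"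
    and Lz: "equal_up_to_sign (L z) (L \<one>)" and gen: "generate G {x, y, z} = carrier G"
  shows "power_relators_group 2 n \<times>\<times> integer_mod_group 2 \<cong> G"
proof (rule power_relators_group_times_C2_iso[OF xy rel _ pong_x_pong_y[where L = L and n = n, OF xy(1) Lx base] pong_y_pong_x[where L = L and n = n, OF xy(2) Ly n base] z(1-3)])
  note cg = central_generate[OF xy z(1,2,4,5)]
  show "z \<otimes> g = g \<otimes> z" if "g \<in> carrier G" for g using cg[of g] that gen by blast
  show "carrier G \<subseteq> (\<lambda>g. g) ` generate G {x, y} \<union> (\<lambda>g. g \<otimes> z) ` generate G {x, y}"
    using cg gen by auto
qed (use n base_not_pong[where L = L, OF n base, of \<one>] base_not_pong[where L = L, OF n base Lz] in \<open>auto simp: equal_up_to_sign_def\<close>)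

lemma small_powers:
  assumes "y \<in> carrier G"
  shows "y [^] (2::nat) = y \<otimes> y" "y [^] (3::nat) = y \<otimes> (y \<otimes> y)" "y [^] (4::nat) = (y \<otimes> y) \<otimes> (y \<otimes> y)"
  using assms by (simp_all add: eval_nat_numeral m_assoc)

lemma mem_subgroup_of_mult:
  assumes "subgroup S G" "r \<in> carrier G" "t \<in> S" "r \<otimes> t \<in> S" shows "r \<in> S"
proof -
  have "t \<in> carrier G" using assms(1,3) by (rule subgroup.mem_carrier)
  then have "r = (r \<otimes> t) \<otimes> inv t" using assms(2) by (simp add: m_assoc)
  then show ?thesis using assms by (metis subgroup.m_closed subgroup.m_inv_closed)
qed

end

text \<open>The underlying function is twice the product with \<open>e_0\<close>, the vector negated
  by \<open>x\<close>; up to sign \<open>y\<close> and its inverse take \<open>e_0\<close> to the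
  basis vectors with index 1 and \<open>k - 1\<close>. With the signs chosen here \<open>y\<close>
  acts by \<open>y_triple\<close> exactly for \<open>k = 3\<close> and by its negative for
  \<open>k = 4\<close>, while \<open>x\<close> acts by the negative of \<open>x_triple\<close>;
  hence the comparison up to sign.\<close>

definition triple_at :: "nat \<Rightarrow> complex Matrix.vec set \<Rightarrow> triple" where
  "triple_at k c = (let g = G_mat k *\<^sub>v (SOME v. v \<in> c) in
     (2 * Re (vec_index g 0), - 2 * Re (vec_index g 1), - 2 * Re (vec_index g (k - 1))))"

context
  fixes k :: nat
  assumes G: "G_mat k \<in> carrier_mat k k"
begin

lemma triple_at_W_class:
  assumes "v \<in> carrier_vec k"
  shows "triple_at k (W_class k v) = (let g = G_mat k *\<^sub>v v in
     (2 * Re (vec_index g 0), - 2 * Re (vec_index g 1), - 2 * Re (vec_index g (k - 1))))"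
proof -
  have "v \<in> W_class k v" using mem_W_class[OF G] assms by simp
  then have "(SOME v'. v' \<in> W_class k v) \<in> W_class k v" by (rule someI)
  then have "G_mat k *\<^sub>v (SOME v'. v' \<in> W_class k v) = G_mat k *\<^sub>v v"
    using mem_W_class[OF G] assms by blast
  then show ?thesis by (simp add: triple_at_def)
qed

lemma induced_map_mem_carrier:
  "A \<in> kernel_automorphisms k \<Longrightarrow> induced_map k A \<in> carrier (BijGroup (W_space k))"
  using induced_map_Bij[OF G] by (simp add: BijGroup_def)

lemma triple_at_mult:
  assumes A: "A \<in> kernel_automorphisms k" and h: "h \<in> carrier (BijGroup (W_space k))" and v0: "v0 \<in> carrier_vec k"
    and step: "\<And>v. v \<in> carrier_vec k \<Longrightarrow>
      equal_up_to_sign (triple_at k (W_class k (A *\<^sub>v v))) (f (triple_at k (W_class k v)))"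
  shows "equal_up_to_sign (triple_at k ((induced_map k A \<otimes>\<^bsub>BijGroup (W_space k)\<^esub> h) (W_class k v0)))
    (f (triple_at k (h (W_class k v0))))"
proof -
  have hB: "h \<in> Bij (W_space k)" using h by (simp add: BijGroup_def)
  have v0W: "W_class k v0 \<in> W_space k" using v0 by (simp add: W_space_eq[OF G])
  then have "h (W_class k v0) \<in> W_space k" using Bij_imp_funcset[OF hB] by auto
  then obtain v where v: "v \<in> carrier_vec k" "h (W_class k v0) = W_class k v" by (auto simp: W_space_eq[OF G])
  have "(induced_map k A \<otimes>\<^bsub>BijGroup (W_space k)\<^esub> h) (W_class k v0) = induced_map k A (h (W_class k v0))"
    using hB induced_map_Bij[OF G A] v0W by (simp add: BijGroup_def compose_eq)
  then show ?thesis using step[OF v(1)] v by (simp add: induced_map_W_class[OF G A])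
qed

end

section \<open>The two monodromy groups\<close>

lemma G_mat_3_carrier: "G_mat 3 \<in> carrier_mat 3 3" by (simp add: G_mat_3)

lemma G_mat_4_carrier: "G_mat 4 \<in> carrier_mat 4 4" by (simp add: G_mat_4)

lemma lessThan_3: "{..<3::nat} = {0, 1, 2}" by auto

lemma lessThan_4: "{..<4::nat} = {0, 1, 2, 3}" by auto

lemma intertwine_vec:
  fixes v :: "complex Matrix.vec"
  assumes "g * A = C * g" "g \<in> carrier_mat k k" "A \<in> carrier_mat k k" "C \<in> carrier_mat k k" "v \<in> carrier_vec k"
  shows "g *\<^sub>v (A *\<^sub>v v) = C *\<^sub>v (g *\<^sub>v v)"
  using assms by (metis assoc_mult_mat_vec)

theorem monodromy_group_3: "monodromy_group 3 \<cong> power_relators_group 2 3 \<times>\<times> integer_mod_group 2"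
proof -
  let ?B = "BijGroup (W_space 3)"
  let ?r = "induced_map 3"
  let ?M = "monodromy_group 3"
  interpret B: group ?B by (rule group_BijGroup)
  note G = G_mat_3_carrier
  note autos = t3_automorphism r3_0_automorphism r3_1_automorphism r3_2_automorphism y3_automorphism n3_automorphism
  note mult = induced_map_mult[OF G] kernel_automorphisms_mult[OF G]
  note car = autos[THEN induced_map_mem_carrier[OF G]]
  define gens where "gens = {?r t3, ?r r3_0, ?r r3_1, ?r r3_2}"
  have M: "?M = ?B\<lparr>carrier := generate ?B gens\<rparr>"
    by (simp add: monodromy_group_def gens_def Stokes_and_T_3(2) lessThan_3 reflection_mat_3 reflection_mat_3(2)[unfolded One_nat_def])
  have gens: "gens \<subseteq> carrier ?B" using car by (simp add: gens_def)
  define x y z where "x = ?r r3_0" and "y = ?r y3" and "z = ?r n3"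
  have c: "x \<in> carrier ?B" "y \<in> carrier ?B" "z \<in> carrier ?B" "?r t3 \<in> carrier ?B" "?r r3_1 \<in> carrier ?B" "?r r3_2 \<in> carrier ?B"
    using car by (auto simp: x_def y_def z_def)
  note R = matrix_relations_3
  have rel: "?r t3 \<otimes>\<^bsub>?B\<^esub> x = ?r r3_1 \<otimes>\<^bsub>?B\<^esub> ?r t3"
    "?r r3_2 \<otimes>\<^bsub>?B\<^esub> (?r r3_1 \<otimes>\<^bsub>?B\<^esub> ?r t3) = (?r r3_1 \<otimes>\<^bsub>?B\<^esub> ?r t3) \<otimes>\<^bsub>?B\<^esub> ?r r3_1"
    "z \<otimes>\<^bsub>?B\<^esub> (y \<otimes>\<^bsub>?B\<^esub> x) = ?r t3"
    "x \<otimes>\<^bsub>?B\<^esub> x = \<one>\<^bsub>?B\<^esub>" "y \<otimes>\<^bsub>?B\<^esub> (y \<otimes>\<^bsub>?B\<^esub> y) = \<one>\<^bsub>?B\<^esub>" "z \<otimes>\<^bsub>?B\<^esub> z = \<one>\<^bsub>?B\<^esub>"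
    "z \<otimes>\<^bsub>?B\<^esub> x = x \<otimes>\<^bsub>?B\<^esub> z" "z \<otimes>\<^bsub>?B\<^esub> y = y \<otimes>\<^bsub>?B\<^esub> z"
    unfolding x_def y_def z_def by (simp_all only: mult autos R(1-8) induced_map_one[OF G])
  have tx: "?r t3 \<otimes>\<^bsub>?B\<^esub> x = z \<otimes>\<^bsub>?B\<^esub> y"
    unfolding x_def y_def z_def by (simp_all only: mult autos R(9))
  have gen_eq: "generate ?B {x, y, z} = generate ?B gens"
  proof
    have S: "subgroup (generate ?B {x, y, z}) ?B" using c by (intro B.generate_is_subgroup) auto
    have xyz: "x \<in> generate ?B {x, y, z}" "y \<in> generate ?B {x, y, z}" "z \<in> generate ?B {x, y, z}"
      by (auto intro: generate.incl)
    have t: "?r t3 \<in> generate ?B {x, y, z}" unfolding rel(3)[symmetric] using xyz by (intro generate.eng)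
    have r1: "?r r3_1 \<in> generate ?B {x, y, z}"
      by (rule B.mem_subgroup_of_mult[OF S c(5) t]) (unfold rel(1)[symmetric], intro generate.eng t xyz)
    have r1t: "?r r3_1 \<otimes>\<^bsub>?B\<^esub> ?r t3 \<in> generate ?B {x, y, z}" by (intro generate.eng t r1)
    have r2: "?r r3_2 \<in> generate ?B {x, y, z}"
      by (rule B.mem_subgroup_of_mult[OF S c(6) r1t]) (unfold rel(2), intro generate.eng r1t r1)
    have "gens \<subseteq> generate ?B {x, y, z}" using t r1 r2 xyz by (simp add: gens_def x_def)
    then show "generate ?B gens \<subseteq> generate ?B {x, y, z}" using S by (rule B.generate_subgroup_incl)
  next
    have S: "subgroup (generate ?B gens) ?B" using gens by (rule B.generate_is_subgroup)
    have g: "x \<in> generate ?B gens" "?r t3 \<in> generate ?B gens"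
      by (auto intro: generate.incl simp: gens_def x_def)
    have zy: "z \<otimes>\<^bsub>?B\<^esub> y \<in> generate ?B gens" unfolding tx[symmetric] by (intro generate.eng g)
    \<comment> \<open>\<open>z y\<close> is the product of \<open>T\<close> and the first
      reflection; its cube recovers \<open>z\<close>, and then \<open>y\<close>, from the original
      generators.\<close>
    have zy3: "(z \<otimes>\<^bsub>?B\<^esub> y) \<otimes>\<^bsub>?B\<^esub> ((z \<otimes>\<^bsub>?B\<^esub> y) \<otimes>\<^bsub>?B\<^esub> (z \<otimes>\<^bsub>?B\<^esub> y)) = z"
    proof -
      have "(z \<otimes>\<^bsub>?B\<^esub> y) \<otimes>\<^bsub>?B\<^esub> (z \<otimes>\<^bsub>?B\<^esub> y) = z \<otimes>\<^bsub>?B\<^esub> ((y \<otimes>\<^bsub>?B\<^esub> z) \<otimes>\<^bsub>?B\<^esub> y)"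
        using c by (simp add: B.m_assoc)
      also have "\<dots> = (z \<otimes>\<^bsub>?B\<^esub> z) \<otimes>\<^bsub>?B\<^esub> (y \<otimes>\<^bsub>?B\<^esub> y)"
        unfolding rel(8)[symmetric] using c by (simp add: B.m_assoc)
      finally have "(z \<otimes>\<^bsub>?B\<^esub> y) \<otimes>\<^bsub>?B\<^esub> (z \<otimes>\<^bsub>?B\<^esub> y) = y \<otimes>\<^bsub>?B\<^esub> y" using c by (simp add: rel(6))
      then show ?thesis using c by (simp add: B.m_assoc rel(5))
    qed
    have z: "z \<in> generate ?B gens" by (subst zy3[symmetric]) (intro generate.eng zy)
    have "y = z \<otimes>\<^bsub>?B\<^esub> (z \<otimes>\<^bsub>?B\<^esub> y)" using c rel(6) by (simp add: B.m_assoc[symmetric])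
    then have "y \<in> generate ?B gens" using generate.eng[OF z zy] by simp
    then have "{x, y, z} \<subseteq> generate ?B gens" using g z by simp
    then show "generate ?B {x, y, z} \<subseteq> generate ?B gens" using S by (rule B.generate_subgroup_incl)
  qed
  have sub: "subgroup (generate ?B gens) ?B" using gens by (rule B.generate_is_subgroup)
  have grpM: "group ?M" unfolding M using sub by (rule B.subgroup_imp_group)
  interpret M: group ?M by (rule grpM)
  have xyzM: "{x, y, z} \<subseteq> generate ?B gens" unfolding gen_eq[symmetric] by (auto intro: generate.incl)
  have genM: "generate ?M {x, y, z} = carrier ?M"
    unfolding M using B.generate_consistent[OF xyzM sub] by (simp add: gen_eq)
  have opM: "carrier ?M = generate ?B gens" "monoid.mult ?M = monoid.mult ?B" "monoid.one ?M = monoid.one ?B" by (simp_all add: M)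
  \<comment> \<open>The vector \<open>(2, -1, -1)\<close>, chosen so that the triple of the
    identity, \<open>(10, 11, 11)\<close>, lies in \<open>basic 3\<close>. Writing it as the first
    column of a matrix lets the rules for \<open>rows_mat\<close> evaluate it.\<close>
  let ?v = "rows_mat 3 [[2, 0, 0], [-1, 0, 0], [-1, 0, 0]] *\<^sub>v unit_vec 3 0 :: complex Matrix.vec"
  have v: "?v \<in> carrier_vec 3" by (rule mult_mat_vec_carrier[OF rows_mat_carrier unit_vec_carrier])
  let ?c = "W_class 3 ?v"
  define L where "L = (\<lambda>h. triple_at 3 (h ?c))"
  have tr: "triple_at 3 (W_class 3 u) = (2 * Re (vec_index (G_mat 3 *\<^sub>v u) 0), - 2 * Re (vec_index (G_mat 3 *\<^sub>v u) 1), - 2 * Re (vec_index (G_mat 3 *\<^sub>v u) 2))"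
    if "u \<in> carrier_vec 3" for u
    using triple_at_W_class[OF G that] by (simp add: Let_def)
  have Gv: "G_mat 3 *\<^sub>v u \<in> carrier_vec 3" if "u \<in> carrier_vec 3" for u using that G by simp
  have I: "G_mat 3 * r3_0 = rows_mat 3 [[-1, 0, 0], [3, 1, 0], [3, 0, 1]] * G_mat 3"
    "G_mat 3 * y3 = rows_mat 3 [[0, 0, -1], [-1, 0, 0], [0, 1, 0]] * G_mat 3"
    "G_mat 3 * n3 = n3 * G_mat 3"
    unfolding G_mat_3 by (simp_all add: rows_mat_mult rows_mat_eq_iff all_less_3 sum_lessThan_3)
  note I' = I[THEN intertwine_vec, OF G rows_mat_carrier rows_mat_carrier]
  have rv: "rows_mat 3 a *\<^sub>v u \<in> carrier_vec 3" if "u \<in> carrier_vec 3" for a and u :: "complex Matrix.vec"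
    using that by (rule mult_mat_vec_carrier[OF rows_mat_carrier])
  note sums = rows_mat_mult_vec_index sum_lessThan_3 Gv rv
  have Lx: "equal_up_to_sign (L (x \<otimes>\<^bsub>?M\<^esub> h)) (x_triple 3 (L h))" if "h \<in> carrier ?M" for h
    unfolding L_def x_def opM
  proof (rule triple_at_mult[OF G r3_0_automorphism _ v])
    show "h \<in> carrier ?B" using that opM subgroup.subset[OF sub] by auto
    show "equal_up_to_sign (triple_at 3 (W_class 3 (r3_0 *\<^sub>v u))) (x_triple 3 (triple_at 3 (W_class 3 u)))"
      if u: "u \<in> carrier_vec 3" for u
      by (simp add: tr u rv I'(1)[OF u] sums equal_up_to_sign_def)
  qed
  have Ly: "equal_up_to_sign (L (y \<otimes>\<^bsub>?M\<^esub> h)) (y_triple 3 (L h))" if "h \<in> carrier ?M" for h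
    unfolding L_def y_def opM
  proof (rule triple_at_mult[OF G y3_automorphism _ v])
    show "h \<in> carrier ?B" using that opM subgroup.subset[OF sub] by auto
    show "equal_up_to_sign (triple_at 3 (W_class 3 (y3 *\<^sub>v u))) (y_triple 3 (triple_at 3 (W_class 3 u)))"
      if u: "u \<in> carrier_vec 3" for u
      by (simp add: tr u rv I'(2)[OF u] sums equal_up_to_sign_def)
  qed
  have cW: "?c \<in> W_space 3" using v by (simp add: W_space_eq[OF G])
  have L1: "L \<one>\<^bsub>?M\<^esub> = (10, 11, 11)"
  proof -
    have "L \<one>\<^bsub>?M\<^esub> = triple_at 3 ?c" using cW by (simp add: L_def opM BijGroup_def)
    also have "\<dots> = (10, 11, 11)"
      unfolding tr[OF v] G_mat_3 by (simp add: sums)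
    finally show ?thesis .
  qed
  \<comment> \<open>\<open>z\<close> acts as \<open>- 1\<close>, so up to sign it has the triple of
    the identity, and it avoids both ping-pong regions for the same reason.\<close>
  have Lz: "L z = neg_triple (L \<one>\<^bsub>?M\<^esub>)"
  proof -
    have "L z = triple_at 3 (W_class 3 (n3 *\<^sub>v ?v))"
      by (simp add: L_def z_def induced_map_W_class[OF G n3_automorphism v])
    also have "\<dots> = neg_triple (triple_at 3 ?c)"
      by (simp add: tr v rv I'(3)[OF v] sums)
    also have "triple_at 3 ?c = L \<one>\<^bsub>?M\<^esub>" using cW by (simp add: L_def opM BijGroup_def)
    finally show ?thesis .
  qed
  have "power_relators_group 2 3 \<times>\<times> integer_mod_group 2 \<cong> ?M"
  proof (rule M.power_relators_group_times_C2_iso_triple[OF _ _ _ _ _ Lx Ly _ _ _ _ _ _ _ genM])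
    show cM: "x \<in> carrier ?M" "y \<in> carrier ?M" "z \<in> carrier ?M" using xyzM by (simp_all add: opM)
    show "x [^]\<^bsub>?M\<^esub> (2::nat) = \<one>\<^bsub>?M\<^esub>"
      unfolding M.small_powers(1)[OF cM(1)] using rel(4) by (simp only: opM(2,3))
    show "y [^]\<^bsub>?M\<^esub> (3::nat) = \<one>\<^bsub>?M\<^esub>"
      unfolding M.small_powers(2)[OF cM(2)] using rel(5) by (simp only: opM(2,3))
    show "z \<otimes>\<^bsub>?M\<^esub> z = \<one>\<^bsub>?M\<^esub>" "z \<otimes>\<^bsub>?M\<^esub> x = x \<otimes>\<^bsub>?M\<^esub> z" "z \<otimes>\<^bsub>?M\<^esub> y = y \<otimes>\<^bsub>?M\<^esub> z"
      using rel by (simp_all add: opM(2,3))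
    show "z \<noteq> \<one>\<^bsub>?M\<^esub>" using Lz L1 by auto
    show "equal_up_to_sign (L z) (L \<one>\<^bsub>?M\<^esub>)" using Lz by (simp add: equal_up_to_sign_def)
    show "basic 3 (L \<one>\<^bsub>?M\<^esub>)" by (simp add: L1)
  qed simp_all
  moreover have "group (power_relators_group 2 3 \<times>\<times> integer_mod_group 2)"
    by (intro DirProd_group) (simp_all add: power_relators_group_alt group_presented_group)
  ultimately show ?thesis by (rule group.iso_sym[rotated])
qed

theorem monodromy_group_4: "monodromy_group 4 \<cong> power_relators_group 2 4"
proof -
  let ?B = "BijGroup (W_space 4)"
  let ?r = "induced_map 4"
  let ?M = "monodromy_group 4"
  interpret B: group ?B by (rule group_BijGroup)
  note G = G_mat_4_carrier
  note autos = t4_automorphism r4_0_automorphism r4_1_automorphism r4_2_automorphism r4_3_automorphism y4_automorphism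
  note mult = induced_map_mult[OF G] kernel_automorphisms_mult[OF G]
  note car = autos[THEN induced_map_mem_carrier[OF G]]
  define gens where "gens = {?r t4, ?r r4_0, ?r r4_1, ?r r4_2, ?r r4_3}"
  have M: "?M = ?B\<lparr>carrier := generate ?B gens\<rparr>"
    by (simp add: monodromy_group_def gens_def Stokes_and_T_4(2) lessThan_4 reflection_mat_4 reflection_mat_4(2)[unfolded One_nat_def])
  have gens: "gens \<subseteq> carrier ?B" using car by (simp add: gens_def)
  define x y where "x = ?r r4_0" and "y = ?r y4"
  have c: "x \<in> carrier ?B" "y \<in> carrier ?B" "?r t4 \<in> carrier ?B" "?r r4_1 \<in> carrier ?B" "?r r4_2 \<in> carrier ?B" "?r r4_3 \<in> carrier ?B"
    using car by (auto simp: x_def y_def)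
  note R = matrix_relations_4
  have extra: "p4 \<in> kernel_automorphisms 4" "q4 \<in> kernel_automorphisms 4" "yy4 \<in> kernel_automorphisms 4"
    using kernel_automorphisms_mult[OF G r4_2_automorphism t4_automorphism]
      kernel_automorphisms_mult[OF G r4_1_automorphism kernel_automorphisms_mult[OF G r4_2_automorphism t4_automorphism]]
      kernel_automorphisms_mult[OF G y4_automorphism y4_automorphism] by (simp_all only: R)
  have rel: "?r t4 \<otimes>\<^bsub>?B\<^esub> x = y" "?r r4_1 \<otimes>\<^bsub>?B\<^esub> ?r t4 = y"
    "?r t4 \<otimes>\<^bsub>?B\<^esub> ?r r4_1 = ?r p4" "?r r4_2 \<otimes>\<^bsub>?B\<^esub> ?r t4 = ?r p4"
    "?r r4_1 \<otimes>\<^bsub>?B\<^esub> ?r p4 = ?r q4" "?r r4_3 \<otimes>\<^bsub>?B\<^esub> ?r q4 = ?r q4 \<otimes>\<^bsub>?B\<^esub> ?r r4_2"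
    "y \<otimes>\<^bsub>?B\<^esub> x = ?r t4" "x \<otimes>\<^bsub>?B\<^esub> x = \<one>\<^bsub>?B\<^esub>"
    "(y \<otimes>\<^bsub>?B\<^esub> y) \<otimes>\<^bsub>?B\<^esub> (y \<otimes>\<^bsub>?B\<^esub> y) = \<one>\<^bsub>?B\<^esub>"
    unfolding x_def y_def by (simp_all only: mult autos extra R induced_map_one[OF G])
  have gen_eq: "generate ?B {x, y} = generate ?B gens"
  proof
    have S: "subgroup (generate ?B {x, y}) ?B" using c by (intro B.generate_is_subgroup) auto
    have xy: "x \<in> generate ?B {x, y}" "y \<in> generate ?B {x, y}" by (auto intro: generate.incl)
    have t: "?r t4 \<in> generate ?B {x, y}" unfolding rel(7)[symmetric] using xy by (intro generate.eng)
    have r1: "?r r4_1 \<in> generate ?B {x, y}"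
      by (rule B.mem_subgroup_of_mult[OF S c(4) t]) (simp add: rel(2) xy)
    have p: "?r p4 \<in> generate ?B {x, y}" unfolding rel(3)[symmetric] by (intro generate.eng t r1)
    have r2: "?r r4_2 \<in> generate ?B {x, y}"
      by (rule B.mem_subgroup_of_mult[OF S c(5) t]) (simp add: rel(4) p)
    have q: "?r q4 \<in> generate ?B {x, y}" unfolding rel(5)[symmetric] by (intro generate.eng p r1)
    have r3: "?r r4_3 \<in> generate ?B {x, y}"
      by (rule B.mem_subgroup_of_mult[OF S c(6) q]) (unfold rel(6), intro generate.eng q r2)
    have "gens \<subseteq> generate ?B {x, y}" using t r1 r2 r3 xy by (simp add: gens_def x_def)
    then show "generate ?B gens \<subseteq> generate ?B {x, y}" using S by (rule B.generate_subgroup_incl)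
  next
    have S: "subgroup (generate ?B gens) ?B" using gens by (rule B.generate_is_subgroup)
    have g: "x \<in> generate ?B gens" "?r t4 \<in> generate ?B gens"
      by (auto intro: generate.incl simp: gens_def x_def)
    have "y \<in> generate ?B gens" unfolding rel(1)[symmetric] by (intro generate.eng g)
    then have "{x, y} \<subseteq> generate ?B gens" using g by simp
    then show "generate ?B {x, y} \<subseteq> generate ?B gens" using S by (rule B.generate_subgroup_incl)
  qed
  have sub: "subgroup (generate ?B gens) ?B" using gens by (rule B.generate_is_subgroup)
  have grpM: "group ?M" unfolding M using sub by (rule B.subgroup_imp_group)
  interpret M: group ?M by (rule grpM)
  have xyM: "{x, y} \<subseteq> generate ?B gens" unfolding gen_eq[symmetric] by (auto intro: generate.incl)
  have genM: "generate ?M {x, y} = carrier ?M"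
    unfolding M using B.generate_consistent[OF xyM sub] by (simp add: gen_eq)
  have opM: "carrier ?M = generate ?B gens" "monoid.mult ?M = monoid.mult ?B" "monoid.one ?M = monoid.one ?B" by (simp_all add: M)
  \<comment> \<open>The vector \<open>(9, -5, -1, -1)\<close>; it gives the identity the triple
    \<open>(32, 48, 48)\<close> in \<open>basic 4\<close>.\<close>
  let ?v = "rows_mat 4 [[9, 0, 0, 0], [-5, 0, 0, 0], [-1, 0, 0, 0], [-1, 0, 0, 0]] *\<^sub>v unit_vec 4 0 :: complex Matrix.vec"
  have v: "?v \<in> carrier_vec 4" by (rule mult_mat_vec_carrier[OF rows_mat_carrier unit_vec_carrier])
  let ?c = "W_class 4 ?v"
  define L where "L = (\<lambda>h. triple_at 4 (h ?c))"
  have tr: "triple_at 4 (W_class 4 u) = (2 * Re (vec_index (G_mat 4 *\<^sub>v u) 0), - 2 * Re (vec_index (G_mat 4 *\<^sub>v u) 1), - 2 * Re (vec_index (G_mat 4 *\<^sub>v u) 3))"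
    if "u \<in> carrier_vec 4" for u
    using triple_at_W_class[OF G that] by (simp add: Let_def)
  have Gv: "G_mat 4 *\<^sub>v u \<in> carrier_vec 4" if "u \<in> carrier_vec 4" for u using that G by simp
  have I: "G_mat 4 * r4_0 = rows_mat 4 [[-1, 0, 0, 0], [4, 1, 0, 0], [-10, 0, 1, 0], [4, 0, 0, 1]] * G_mat 4"
    "G_mat 4 * y4 = rows_mat 4 [[0, 0, 0, 1], [1, 0, 0, 0], [-4, -1, 0, 0], [0, -4, -1, 0]] * G_mat 4"
    unfolding G_mat_4 by (simp_all add: rows_mat_mult rows_mat_eq_iff all_less_4 sum_lessThan_4)
  note I' = I[THEN intertwine_vec, OF G rows_mat_carrier rows_mat_carrier]
  have rv: "rows_mat 4 a *\<^sub>v u \<in> carrier_vec 4" if "u \<in> carrier_vec 4" for a and u :: "complex Matrix.vec"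
    using that by (rule mult_mat_vec_carrier[OF rows_mat_carrier])
  note sums = rows_mat_mult_vec_index sum_lessThan_4 Gv rv
  \<comment> \<open>The relation between the rows of \<open>g4\<close> that corresponds to the
    kernel vector \<open>(1, -3, -1, 1)\<close>. It eliminates entry 2, which the triple does not
    record, and so produces the third entry of \<open>y_triple 4\<close>.\<close>
  have kernel_relation: "vec_index (G_mat 4 *\<^sub>v u) 2 = vec_index (G_mat 4 *\<^sub>v u) 0 - 3 * vec_index (G_mat 4 *\<^sub>v u) 1 + vec_index (G_mat 4 *\<^sub>v u) 3"
    if "u \<in> carrier_vec 4" for u
    unfolding G_mat_4 using that by (simp add: sums algebra_simps)
  have Lx: "equal_up_to_sign (L (x \<otimes>\<^bsub>?M\<^esub> h)) (x_triple 4 (L h))" if "h \<in> carrier ?M" for h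
    unfolding L_def x_def opM
  proof (rule triple_at_mult[OF G r4_0_automorphism _ v])
    show "h \<in> carrier ?B" using that opM subgroup.subset[OF sub] by auto
    show "equal_up_to_sign (triple_at 4 (W_class 4 (r4_0 *\<^sub>v u))) (x_triple 4 (triple_at 4 (W_class 4 u)))"
      if u: "u \<in> carrier_vec 4" for u
      by (simp add: tr u rv I'(1)[OF u] sums equal_up_to_sign_def)
  qed
  have Ly: "equal_up_to_sign (L (y \<otimes>\<^bsub>?M\<^esub> h)) (y_triple 4 (L h))" if "h \<in> carrier ?M" for h
    unfolding L_def y_def opM
  proof (rule triple_at_mult[OF G y4_automorphism _ v])
    show "h \<in> carrier ?B" using that opM subgroup.subset[OF sub] by auto
    show "equal_up_to_sign (triple_at 4 (W_class 4 (y4 *\<^sub>v u))) (y_triple 4 (triple_at 4 (W_class 4 u)))"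
      if u: "u \<in> carrier_vec 4" for u
      by (simp add: tr u rv I'(2)[OF u] sums kernel_relation[OF u] equal_up_to_sign_def)
  qed
  have cW: "?c \<in> W_space 4" using v by (simp add: W_space_eq[OF G])
  have L1: "L \<one>\<^bsub>?M\<^esub> = (32, 48, 48)"
  proof -
    have "L \<one>\<^bsub>?M\<^esub> = triple_at 4 ?c" using cW by (simp add: L_def opM BijGroup_def)
    also have "\<dots> = (32, 48, 48)"
      unfolding tr[OF v] G_mat_4 by (simp add: sums)
    finally show ?thesis .
  qed
  have "power_relators_group 2 4 \<cong> ?M"
  proof (rule M.power_relators_group_iso_triple[OF _ _ _ _ _ Lx Ly _ genM])
    show cM: "x \<in> carrier ?M" "y \<in> carrier ?M" using xyM by (simp_all add: opM)
    show "x [^]\<^bsub>?M\<^esub> (2::nat) = \<one>\<^bsub>?M\<^esub>"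
      unfolding M.small_powers(1)[OF cM(1)] using rel(8) by (simp only: opM(2,3))
    show "y [^]\<^bsub>?M\<^esub> (4::nat) = \<one>\<^bsub>?M\<^esub>"
      unfolding M.small_powers(3)[OF cM(2)] using rel(9) by (simp only: opM(2,3))
    show "basic 4 (L \<one>\<^bsub>?M\<^esub>)" by (simp add: L1)
  qed simp_all
  moreover have "group (power_relators_group 2 4)"
    by (simp add: power_relators_group_alt group_presented_group)
  ultimately show ?thesis by (rule group.iso_sym[rotated])
qed

section \<open>The modular group\<close>

lemma det_dim_2:
  assumes "A \<in> carrier_mat 2 2"
  shows "det A = A $$ (0, 0) * A $$ (Suc 0, Suc 0) - A $$ (0, Suc 0) * A $$ (Suc 0, 0)"
proof -
  have d: "mat_delete A i 0 \<in> carrier_mat 1 1" for i using assms by (simp add: mat_delete_def)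
  have "det A = (\<Sum>i<2. A $$ (i, 0) * cofactor A i 0)" by (rule laplace_expansion_column[OF assms]) simp
  then show ?thesis unfolding cofactor_def det_single[OF d] using assms by (simp add: mat_delete_def eval_nat_numeral)
qed

lemma det_dim_3:
  assumes "A \<in> carrier_mat 3 3"
  shows "det A = A $$ (0, 0) * (A $$ (1, 1) * A $$ (2, 2) - A $$ (1, 2) * A $$ (2, 1))
    - A $$ (1, 0) * (A $$ (0, 1) * A $$ (2, 2) - A $$ (0, 2) * A $$ (2, 1))
    + A $$ (2, 0) * (A $$ (0, 1) * A $$ (1, 2) - A $$ (0, 2) * A $$ (1, 1))"
proof -
  have d: "mat_delete A i 0 \<in> carrier_mat 2 2" for i using assms by (simp add: mat_delete_def)
  have "det A = (\<Sum>i<3. A $$ (i, 0) * cofactor A i 0)" by (rule laplace_expansion_column[OF assms]) simp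
  then show ?thesis unfolding cofactor_def det_dim_2[OF d] using assms by (simp add: mat_delete_def eval_nat_numeral algebra_simps)
qed

definition mat22 :: "int \<Rightarrow> int \<Rightarrow> int \<Rightarrow> int \<Rightarrow> int mat" where
  "mat22 a b c d = mat 2 2 (\<lambda>(i, j). if i = 0 then if j = 0 then a else b else if j = 0 then c else d)"

lemma mat22_carrier [simp]: "mat22 a b c d \<in> carrier_mat 2 2"
  by (simp add: mat22_def)

lemma mat22_index [simp]:
  "mat22 a b c d $$ (0, 0) = a" "mat22 a b c d $$ (0, Suc 0) = b"
  "mat22 a b c d $$ (Suc 0, 0) = c" "mat22 a b c d $$ (Suc 0, Suc 0) = d"
  by (simp_all add: mat22_def)

lemma eq_mat22: "A \<in> carrier_mat 2 2 \<Longrightarrow> A = mat22 (A $$ (0, 0)) (A $$ (0, 1)) (A $$ (1, 0)) (A $$ (1, 1))"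
  by (rule eq_matI) (auto simp: mat22_def less_2_cases_iff)

lemma mat22_mult: "mat22 a b c d * mat22 a' b' c' d' = mat22 (a * a' + b * c') (a * b' + b * d') (c * a' + d * c') (c * b' + d * d')"
  by (rule eq_matI) (auto simp: mat22_def scalar_prod_def less_2_cases_iff numeral_2_eq_2)

lemma mat22_uminus: "- mat22 a b c d = mat22 (- a) (- b) (- c) (- d)"
  by (rule eq_matI) (auto simp: mat22_def)

lemma one_mat22: "1\<^sub>m 2 = mat22 1 0 0 1"
  by (rule eq_matI) (auto simp: mat22_def)

lemma det_mat22: "det (mat22 a b c d) = a * d - b * c"
  by (simp add: det_dim_2)

definition up_to_sign :: "int mat \<Rightarrow> int mat set" where
  "up_to_sign A = {A, - A}"

lemma carrier_SL2Z: "A \<in> carrier SL2Z \<longleftrightarrow> A \<in> carrier_mat 2 2 \<and> det A = 1"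
  by (simp add: SL2Z_def)

lemma SL2Z_cases:
  assumes "A \<in> carrier SL2Z" obtains a b c d where "A = mat22 a b c d" "a * d - b * c = 1"
  using assms eq_mat22 by (metis carrier_SL2Z det_mat22)

lemma mat22_SL2Z: "mat22 a b c d \<in> carrier SL2Z \<longleftrightarrow> a * d - b * c = 1"
  by (simp add: carrier_SL2Z det_mat22)

lemma carrier_PSL2Z: "carrier PSL2Z = up_to_sign ` carrier SL2Z"
proof -
  have "{1\<^sub>m 2, - 1\<^sub>m 2} #>\<^bsub>SL2Z\<^esub> A = up_to_sign A" if "A \<in> carrier SL2Z" for A
    using that by (cases rule: SL2Z_cases)
      (auto simp: r_coset_def SL2Z_def up_to_sign_def one_mat22 mat22_uminus mat22_mult)
  then show ?thesis by (auto simp: PSL2Z_def FactGroup_def RCOSETS_def)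
qed

lemma one_PSL2Z: "\<one>\<^bsub>PSL2Z\<^esub> = up_to_sign (mat22 1 0 0 1)"
  by (simp add: PSL2Z_def FactGroup_def up_to_sign_def one_mat22)

lemma mult_PSL2Z:
  "up_to_sign (mat22 a b c d) \<otimes>\<^bsub>PSL2Z\<^esub> up_to_sign (mat22 a' b' c' d') = up_to_sign (mat22 a b c d * mat22 a' b' c' d')"
  by (auto simp: PSL2Z_def FactGroup_def set_mult_def SL2Z_def up_to_sign_def mat22_uminus mat22_mult)

lemma PSL2Z_cases:
  assumes "h \<in> carrier PSL2Z" obtains a b c d where "h = up_to_sign (mat22 a b c d)" "a * d - b * c = 1"
  using assms by (auto simp: carrier_PSL2Z elim: SL2Z_cases)

lemma up_to_sign_mem: "a * d - b * c = 1 \<Longrightarrow> up_to_sign (mat22 a b c d) \<in> carrier PSL2Z"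
  by (simp add: carrier_PSL2Z mat22_SL2Z)

lemma up_to_sign_uminus: "up_to_sign (mat22 (- a) (- b) (- c) (- d)) = up_to_sign (mat22 a b c d)"
  by (auto simp: up_to_sign_def mat22_uminus)

lemma group_PSL2Z: "group PSL2Z"
proof (rule groupI)
  show "h \<otimes>\<^bsub>PSL2Z\<^esub> g \<in> carrier PSL2Z" if hg: "h \<in> carrier PSL2Z" "g \<in> carrier PSL2Z" for h g
  proof -
    obtain a b c d where h: "h = up_to_sign (mat22 a b c d)" "a * d - b * c = 1" using hg(1) by (rule PSL2Z_cases)
    obtain a' b' c' d' where g: "g = up_to_sign (mat22 a' b' c' d')" "a' * d' - b' * c' = 1" using hg(2) by (rule PSL2Z_cases)
    have "(a * a' + b * c') * (c * b' + d * d') - (a * b' + b * d') * (c * a' + d * c') = (a * d - b * c) * (a' * d' - b' * c')"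
      by (simp add: ring_distribs)
    then show ?thesis unfolding h(1) g(1) mult_PSL2Z mat22_mult by (intro up_to_sign_mem) (simp add: h g)
  qed
  show "\<one>\<^bsub>PSL2Z\<^esub> \<in> carrier PSL2Z" by (simp add: one_PSL2Z up_to_sign_mem)
  show "\<one>\<^bsub>PSL2Z\<^esub> \<otimes>\<^bsub>PSL2Z\<^esub> h = h" if "h \<in> carrier PSL2Z" for h
    using that by (cases rule: PSL2Z_cases) (simp add: one_PSL2Z mult_PSL2Z mat22_mult)
  show "h \<otimes>\<^bsub>PSL2Z\<^esub> g \<otimes>\<^bsub>PSL2Z\<^esub> k = h \<otimes>\<^bsub>PSL2Z\<^esub> (g \<otimes>\<^bsub>PSL2Z\<^esub> k)"
    if "h \<in> carrier PSL2Z" "g \<in> carrier PSL2Z" "k \<in> carrier PSL2Z" for h g k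
    using that by (elim PSL2Z_cases) (simp add: mult_PSL2Z mat22_mult algebra_simps)
  show "\<exists>g\<in>carrier PSL2Z. g \<otimes>\<^bsub>PSL2Z\<^esub> h = \<one>\<^bsub>PSL2Z\<^esub>" if hc: "h \<in> carrier PSL2Z" for h
  proof -
    obtain a b c d where h: "h = up_to_sign (mat22 a b c d)" "a * d - b * c = 1" using hc by (rule PSL2Z_cases)
    show ?thesis
      by (rule bexI[of _ "up_to_sign (mat22 d (- b) (- c) a)"])
        (use h in \<open>simp_all add: mult_PSL2Z mat22_mult one_PSL2Z up_to_sign_mem algebra_simps\<close>)
  qed
qed

abbreviation S_PSL2Z :: "int mat set" where "S_PSL2Z \<equiv> up_to_sign (mat22 0 (- 1) 1 0)"
abbreviation U_PSL2Z :: "int mat set" where "U_PSL2Z \<equiv> up_to_sign (mat22 0 (- 1) 1 (- 1))"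

text \<open>Euclid's algorithm on the first column: \<open>U S\<close> and \<open>U U S\<close> are,
  up to sign, the two elementary shears, and subtracting or adding rows decreases
  \<open>|a| + |c|\<close> until an entry vanishes.\<close>

lemma generate_PSL2Z: "generate PSL2Z {S_PSL2Z, U_PSL2Z} = carrier PSL2Z"
proof
  interpret group PSL2Z by (rule group_PSL2Z)
  let ?K = "generate PSL2Z {S_PSL2Z, U_PSL2Z}"
  have car: "S_PSL2Z \<in> carrier PSL2Z" "U_PSL2Z \<in> carrier PSL2Z" by (simp_all add: up_to_sign_mem)
  then show "?K \<subseteq> carrier PSL2Z" by (intro generate_incl) simp
  have S: "S_PSL2Z \<in> ?K" and U: "U_PSL2Z \<in> ?K" by (auto intro: generate.incl)
  have inv: "inv\<^bsub>PSL2Z\<^esub> (up_to_sign (mat22 a b c d)) = up_to_sign (mat22 d (- b) (- c) a)"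
    if "a * d - b * c = 1" for a b c d
    using that by (intro inv_equality) (simp_all add: mult_PSL2Z mat22_mult one_PSL2Z up_to_sign_mem algebra_simps)
  have K_inv: "g \<in> ?K \<Longrightarrow> inv\<^bsub>PSL2Z\<^esub> g \<in> ?K" for g
    using car by (intro generate_m_inv_closed) auto
  have lower: "up_to_sign (mat22 1 0 1 1) \<in> ?K"
    using generate.eng[OF U S] up_to_sign_uminus[of 1 0 1 1] by (simp add: mult_PSL2Z mat22_mult)
  have upper: "up_to_sign (mat22 1 1 0 1) \<in> ?K"
    using generate.eng[OF U generate.eng[OF U S]] by (simp add: mult_PSL2Z mat22_mult)
  have lower': "up_to_sign (mat22 1 0 (- 1) 1) \<in> ?K" and upper': "up_to_sign (mat22 1 (- 1) 0 1) \<in> ?K"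
    using K_inv[OF lower] K_inv[OF upper] by (simp_all add: inv)
  have step:
    "up_to_sign (mat22 (a - c) (b - d) c d) \<in> ?K \<Longrightarrow> up_to_sign (mat22 a b c d) \<in> ?K"
    "up_to_sign (mat22 (a + c) (b + d) c d) \<in> ?K \<Longrightarrow> up_to_sign (mat22 a b c d) \<in> ?K"
    "up_to_sign (mat22 a b (c - a) (d - b)) \<in> ?K \<Longrightarrow> up_to_sign (mat22 a b c d) \<in> ?K"
    "up_to_sign (mat22 a b (c + a) (d + b)) \<in> ?K \<Longrightarrow> up_to_sign (mat22 a b c d) \<in> ?K"
    "up_to_sign (mat22 c d (- a) (- b)) \<in> ?K \<Longrightarrow> up_to_sign (mat22 a b c d) \<in> ?K" for a b c d
    using generate.eng[OF upper, of "up_to_sign (mat22 (a - c) (b - d) c d)"]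
      generate.eng[OF upper', of "up_to_sign (mat22 (a + c) (b + d) c d)"]
      generate.eng[OF lower, of "up_to_sign (mat22 a b (c - a) (d - b))"]
      generate.eng[OF lower', of "up_to_sign (mat22 a b (c + a) (d + b))"]
      generate.eng[OF S, of "up_to_sign (mat22 c d (- a) (- b))"]
    by (simp_all add: mult_PSL2Z mat22_mult)
  have shear: "up_to_sign (mat22 1 b 0 1) \<in> ?K" for b
  proof (induction b rule: int_induct[where k = 0])
    case base
    show ?case using generate.one[of PSL2Z] by (simp add: one_PSL2Z)
  next
    case (step1 i)
    then show ?case using step(1)[of 1 0 "i + 1" 1] by simp
  next
    case (step2 i)
    then show ?case using step(2)[of 1 0 "i - 1" 1] by simp
  qed
  have c0: "up_to_sign (mat22 a b 0 d) \<in> ?K" if "a * d = 1" for a b d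
  proof -
    have "a = 1 \<and> d = 1 \<or> a = - 1 \<and> d = - 1" using that by (simp add: zmult_eq_1_iff)
    then show ?thesis using shear[of b] shear[of "- b"] up_to_sign_uminus[of 1 "- b" 0 1] by auto
  qed
  have "a * d - b * c = 1 \<Longrightarrow> up_to_sign (mat22 a b c d) \<in> ?K" for a b c d
  proof (induction "nat (\<bar>a\<bar> + \<bar>c\<bar>)" arbitrary: a b c d rule: less_induct)
    case less
    have d: "(a - c) * d - (b - d) * c = 1" "(a + c) * d - (b + d) * c = 1"
      "a * (d - b) - b * (c - a) = 1" "a * (d + b) - b * (c + a) = 1"
      using less.prems by (simp_all add: algebra_simps)
    consider "c = 0" | "a = 0" | "0 < c \<and> c \<le> a \<or> a \<le> c \<and> c < 0" | "0 < a \<and> a \<le> c \<or> c \<le> a \<and> a < 0"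
      | "0 < c \<and> c \<le> - a \<or> - a \<le> c \<and> c < 0" | "0 < - a \<and> - a \<le> c \<or> c \<le> - a \<and> - a < 0"
      by linarith
    then show ?case
    proof cases
      case 1
      then show ?thesis using less.prems c0 by simp
    next
      case 2
      then have "c * - b = 1" using less.prems by (simp add: mult.commute)
      then show ?thesis using c0[of c "- b" d] step(5)[where a = a and b = b and c = c and d = d] 2 by simp
    next
      case 3
      then have "nat (\<bar>a - c\<bar> + \<bar>c\<bar>) < nat (\<bar>a\<bar> + \<bar>c\<bar>)" by arith
      then show ?thesis using d(1) by (rule step(1)[OF less.hyps])
    next
      case 4
      then have "nat (\<bar>a\<bar> + \<bar>c - a\<bar>) < nat (\<bar>a\<bar> + \<bar>c\<bar>)" by arith
      then show ?thesis using d(3) by (rule step(3)[OF less.hyps])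
    next
      case 5
      then have "nat (\<bar>a + c\<bar> + \<bar>c\<bar>) < nat (\<bar>a\<bar> + \<bar>c\<bar>)" by arith
      then show ?thesis using d(2) by (rule step(2)[OF less.hyps])
    next
      case 6
      then have "nat (\<bar>a\<bar> + \<bar>c + a\<bar>) < nat (\<bar>a\<bar> + \<bar>c\<bar>)" by arith
      then show ?thesis using d(4) by (rule step(4)[OF less.hyps])
    qed
  qed
  then show "carrier PSL2Z \<subseteq> ?K" by (auto elim: PSL2Z_cases)
qed

text \<open>Chosen such that the triple of the identity, \<open>(4, 5, 5)\<close>, is in the region \<open>basic\<close>.\<close>

definition row_form :: "int \<Rightarrow> int \<Rightarrow> real" where
  "row_form a b = of_int (2 * a * a + a * b + 2 * b * b)"

text \<open>The values of the sum of \<open>row_form\<close> over the rows at \<open>A\<close>, \<open>U\<^sup>-\<^sup>1 A\<close> and \<open>U A\<close>.\<close>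

definition mat22_triple :: "int mat \<Rightarrow> triple" where
  "mat22_triple A = (let a = A $$ (0, 0); b = A $$ (0, Suc 0); c = A $$ (Suc 0, 0); d = A $$ (Suc 0, Suc 0) in
    (row_form a b + row_form c d, row_form (c - a) (d - b) + row_form a b, row_form c d + row_form (a - c) (b - d)))"

theorem power_relators_group_iso_PSL2Z: "power_relators_group 2 3 \<cong> PSL2Z"
proof -
  interpret group PSL2Z by (rule group_PSL2Z)
  define L where "L = (\<lambda>h. mat22_triple (SOME A. A \<in> h))"
  have L: "L (up_to_sign (mat22 a b c d)) = mat22_triple (mat22 a b c d)" for a b c d
  proof -
    have "(SOME A. A \<in> up_to_sign (mat22 a b c d)) \<in> up_to_sign (mat22 a b c d)"
      by (rule someI_ex) (auto simp: up_to_sign_def)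
    then have "(SOME A. A \<in> up_to_sign (mat22 a b c d)) = mat22 a b c d \<or>
        (SOME A. A \<in> up_to_sign (mat22 a b c d)) = mat22 (- a) (- b) (- c) (- d)"
      by (simp add: up_to_sign_def mat22_uminus)
    moreover have "mat22_triple (mat22 (- a) (- b) (- c) (- d)) = mat22_triple (mat22 a b c d)"
      by (simp add: mat22_triple_def Let_def row_form_def algebra_simps)
    ultimately show ?thesis unfolding L_def by (elim disjE) (simp_all only:)
  qed
  show ?thesis
  proof (rule power_relators_group_iso_triple[where L = L and x = S_PSL2Z and y = U_PSL2Z])
    show car: "S_PSL2Z \<in> carrier PSL2Z" "U_PSL2Z \<in> carrier PSL2Z" by (simp_all add: up_to_sign_mem)
    show "S_PSL2Z [^]\<^bsub>PSL2Z\<^esub> (2::nat) = \<one>\<^bsub>PSL2Z\<^esub>"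
      using up_to_sign_uminus[of 1 0 0 1] by (simp add: small_powers car mult_PSL2Z mat22_mult one_PSL2Z)
    show "U_PSL2Z [^]\<^bsub>PSL2Z\<^esub> (3::nat) = \<one>\<^bsub>PSL2Z\<^esub>"
      by (simp add: small_powers car mult_PSL2Z mat22_mult one_PSL2Z)
    show "equal_up_to_sign (L (S_PSL2Z \<otimes>\<^bsub>PSL2Z\<^esub> h)) (x_triple 3 (L h))" if "h \<in> carrier PSL2Z" for h
      using that by (cases rule: PSL2Z_cases)
        (simp add: mult_PSL2Z mat22_mult L mat22_triple_def Let_def row_form_def equal_up_to_sign_def algebra_simps)
    show "equal_up_to_sign (L (U_PSL2Z \<otimes>\<^bsub>PSL2Z\<^esub> h)) (y_triple 3 (L h))" if "h \<in> carrier PSL2Z" for h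
      using that by (cases rule: PSL2Z_cases)
        (simp add: mult_PSL2Z mat22_mult L mat22_triple_def Let_def row_form_def equal_up_to_sign_def algebra_simps)
    \<comment> \<open>\<open>row_form\<close> is the sum of \<open>a^2 + b^2\<close> and
      \<open>a^2 + a b + b^2\<close>, which are invariant under \<open>S\<close> and
      \<open>U\<close> respectively. Each of them alone would put the identity on the boundary of
      \<open>basic 3\<close>, with triples \<open>(2, 3, 3)\<close> and
      \<open>(2, 2, 2)\<close>.\<close>
    show "basic 3 (L \<one>\<^bsub>PSL2Z\<^esub>)"
      by (simp add: one_PSL2Z L mat22_triple_def row_form_def)
  qed (simp_all add: generate_PSL2Z)
qed

corollary power_relators_group_times_C2_iso_PSL2Z:
  "power_relators_group 2 3 \<times>\<times> integer_mod_group 2 \<cong> PSL2Z \<times>\<times> integer_mod_group 2"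
  by (rule group.DirProd_iso_trans[OF _ power_relators_group_iso_PSL2Z iso_refl])
    (simp add: power_relators_group_alt group_presented_group)

section \<open>The triangular group\<close>

abbreviation det3 :: "real Matrix.vec \<Rightarrow> real Matrix.vec \<Rightarrow> real Matrix.vec \<Rightarrow> real" where
  "det3 x y z \<equiv> det (mat_of_cols 3 [x, y, z])"

lemma det3_eq:
  "det3 x y z = vec_index x 0 * (vec_index y 1 * vec_index z 2 - vec_index y 2 * vec_index z 1)
    - vec_index x 1 * (vec_index y 0 * vec_index z 2 - vec_index y 2 * vec_index z 0)
    + vec_index x 2 * (vec_index y 0 * vec_index z 1 - vec_index y 1 * vec_index z 0)"
proof -
  have "mat_of_cols 3 [x, y, z] \<in> carrier_mat 3 3"
    using mat_of_cols_carrier(1)[of 3 "[x, y, z]"] by (simp add: numeral_3_eq_3)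
  then show ?thesis by (subst det_dim_3) (simp_all add: mat_of_cols_index algebra_simps)
qed

section \<open>Lorentzian linear algebra\<close>

lemma line_normal_index:
  "vec_index (line_normal p q) 0 = vec_index p 1 * vec_index q 2 - vec_index p 2 * vec_index q 1"
  "vec_index (line_normal p q) 1 = vec_index p 2 * vec_index q 0 - vec_index p 0 * vec_index q 2"
  "vec_index (line_normal p q) 2 = vec_index p 1 * vec_index q 0 - vec_index p 0 * vec_index q 1"
  by (auto simp: line_normal_def numeral_2_eq_2)

lemma line_normal_carrier [simp]: "line_normal p q \<in> carrier_vec 3"
  unfolding line_normal_def by (rule carrier_vecI) simp

lemma lorentz_line_normal: "lorentz x (line_normal p q) = det3 x p q"
  by (simp add: lorentz_def line_normal_index[unfolded One_nat_def] line_normal_index det3_eq algebra_simps)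

lemma lorentz_line_normals:
  "lorentz (line_normal p q) (line_normal r s) = lorentz p s * lorentz q r - lorentz p r * lorentz q s"
  by (simp add: lorentz_def line_normal_index[unfolded One_nat_def] line_normal_index algebra_simps)

lemma lorentz_commute: "lorentz x y = lorentz y x"
  by (simp add: lorentz_def mult.commute)

text \<open>The right-hand side is minus the Gram determinant of the three vectors; the sign is the
  determinant of the Lorentz form.\<close>

lemma lorentz_gram:
  "(det3 x y z)\<^sup>2 = lorentz x y * (lorentz x y * lorentz z z - lorentz y z * lorentz x z)
    - lorentz x x * (lorentz y y * lorentz z z - (lorentz y z)\<^sup>2)
    - lorentz x z * (lorentz x y * lorentz y z - lorentz y y * lorentz x z)"
  unfolding det3_eq lorentz_def by (simp add: power2_eq_square algebra_simps)

lemma lorentz_add_smult: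
  assumes "x \<in> carrier_vec 3" "y \<in> carrier_vec 3" "n \<in> carrier_vec 3"
  shows "lorentz (x + c \<cdot>\<^sub>v n) (y + d \<cdot>\<^sub>v n) = lorentz x y + c * lorentz y n + d * lorentz x n + c * d * lorentz n n"
  using assms by (simp add: lorentz_def algebra_simps)

lemma lorentz_minus_smult:
  assumes "x \<in> carrier_vec 3" "n \<in> carrier_vec 3"
  shows "lorentz (x - c \<cdot>\<^sub>v n) y = lorentz x y - c * lorentz n y"
  using assms by (simp add: lorentz_def algebra_simps)

lemma hyp_planeD: "x \<in> hyp_plane \<Longrightarrow> x \<in> carrier_vec 3" "x \<in> hyp_plane \<Longrightarrow> lorentz x x = - 1"
  "x \<in> hyp_plane \<Longrightarrow> 0 < vec_index x 2" "x \<in> hyp_plane \<Longrightarrow> x \<notin> ideal_points"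
  by (auto simp: hyp_plane_def ideal_points_def)

lemma space_part_less:
  assumes "lorentz x x < 0" "lorentz y y < 0"
  shows "\<bar>vec_index x 0 * vec_index y 0 + vec_index x 1 * vec_index y 1\<bar> < \<bar>vec_index x 2 * vec_index y 2\<bar>"
proof -
  let ?x = "\<lambda>i. vec_index x i" and ?y = "\<lambda>i. vec_index y i"
  have "(?x 0 * ?y 0 + ?x 1 * ?y 1)\<^sup>2 \<le> (?x 0 * ?x 0 + ?x 1 * ?x 1) * (?y 0 * ?y 0 + ?y 1 * ?y 1)"
    using zero_le_power2[of "?x 0 * ?y 1 - ?x 1 * ?y 0"] by (simp add: power2_eq_square algebra_simps)
  also have "\<dots> < (?x 2 * ?x 2) * (?y 2 * ?y 2)"
    using assms by (intro mult_strict_mono') (auto simp: lorentz_def)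
  also have "\<dots> = (?x 2 * ?y 2)\<^sup>2" by (simp add: power2_eq_square)
  finally show ?thesis using abs_le_square_iff not_less by metis
qed

text \<open>By \<open>space_part_less\<close> the time components dominate, so the sign of the
  product tells to which sheet of the timelike cone \<open>y\<close> belongs.\<close>

lemma lorentz_neg_iff:
  assumes "x \<in> hyp_plane" "lorentz y y < 0"
  shows "lorentz x y < 0 \<longleftrightarrow> 0 < vec_index y 2"
proof -
  have "\<bar>vec_index x 0 * vec_index y 0 + vec_index x 1 * vec_index y 1\<bar> < vec_index x 2 * \<bar>vec_index y 2\<bar>"
    using space_part_less[of x y] hyp_planeD[OF assms(1)] assms(2) by (simp add: abs_mult)
  moreover have "vec_index x 2 * \<bar>vec_index y 2\<bar> = (if 0 < vec_index y 2 then 1 else - 1) * (vec_index x 2 * vec_index y 2)"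
    by (auto simp: abs_if)
  ultimately show ?thesis by (auto simp: lorentz_def split: if_splits)
qed

text \<open>By \<open>lorentz_gram\<close> the square lengths of the two tangent vectors have
  product \<open>s^2 + D^2\<close>, where \<open>D\<close> is the determinant. The cosine therefore
  has modulus below 1, which excludes the angle 0 at a vertex inside the plane.\<close>

lemma cos_hyp_angle:
  assumes v: "v \<in> hyp_plane" and pq: "p \<in> carrier_vec 3" "q \<in> carrier_vec 3" and D: "det3 v p q \<noteq> 0"
  defines "s \<equiv> lorentz p q + lorentz p v * lorentz q v"
  shows "cos (hyp_angle v p q) = s / sqrt (s\<^sup>2 + (det3 v p q)\<^sup>2)" "hyp_angle v p q \<noteq> 0"
proof -
  note vD = hyp_planeD[OF v]
  define a b where "a = p + lorentz p v \<cdot>\<^sub>v v" and "b = q + lorentz q v \<cdot>\<^sub>v v"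
  have prod: "lorentz (x + lorentz x v \<cdot>\<^sub>v v) (y + lorentz y v \<cdot>\<^sub>v v) = lorentz x y + lorentz x v * lorentz y v"
    if "x \<in> carrier_vec 3" "y \<in> carrier_vec 3" for x y
    using that vD by (simp add: lorentz_add_smult)
  have ab: "lorentz a b = s" "lorentz a a = lorentz p p + (lorentz p v)\<^sup>2" "lorentz b b = lorentz q q + (lorentz q v)\<^sup>2"
    using prod[OF pq] prod[OF pq(1) pq(1)] prod[OF pq(2) pq(2)] by (simp_all add: a_def b_def s_def power2_eq_square)
  have gram: "lorentz a a * lorentz b b = s\<^sup>2 + (det3 v p q)\<^sup>2"
    unfolding ab lorentz_gram[of v p q] s_def vD(2) lorentz_commute[of p v] lorentz_commute[of q v]
    by (simp add: power2_eq_square algebra_simps)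
  have angle: "hyp_angle v p q = arccos (s / sqrt (s\<^sup>2 + (det3 v p q)\<^sup>2))"
    using vD(4) by (simp add: hyp_angle_def Let_def a_def[symmetric] b_def[symmetric] ab(1) gram real_sqrt_mult[symmetric])
  have "sqrt (s\<^sup>2) < sqrt (s\<^sup>2 + (det3 v p q)\<^sup>2)" using D by (intro real_sqrt_less_mono) simp
  then have "\<bar>s\<bar> < sqrt (s\<^sup>2 + (det3 v p q)\<^sup>2)" by simp
  moreover have "0 < s\<^sup>2 + (det3 v p q)\<^sup>2" using D by (intro add_nonneg_pos) simp_all
  ultimately have "\<bar>s / sqrt (s\<^sup>2 + (det3 v p q)\<^sup>2)\<bar> < 1" by (simp add: abs_divide divide_less_eq)
  then have t: "\<bar>s / sqrt (s\<^sup>2 + (det3 v p q)\<^sup>2)\<bar> < 1" (is "\<bar>?t\<bar> < 1") .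
  then have c: "cos (arccos ?t) = ?t" by (intro cos_arccos_abs less_imp_le)
  then show "cos (hyp_angle v p q) = ?t" unfolding angle .
  have "cos (arccos ?t) \<noteq> cos 0" unfolding c cos_zero using t by linarith
  then show "hyp_angle v p q \<noteq> 0" unfolding angle by metis
qed

definition reflect :: "real Matrix.vec \<Rightarrow> real Matrix.vec \<Rightarrow> real Matrix.vec" where
  "reflect n v = v - (2 * lorentz v n / lorentz n n) \<cdot>\<^sub>v n"

lemma hyp_reflection_eq: "hyp_reflection p q = restrict (reflect (line_normal p q)) hyp_plane"
  by (auto simp: hyp_reflection_def reflect_def Let_def restrict_def)

lemma reflect_carrier [simp]: "v \<in> carrier_vec 3 \<Longrightarrow> n \<in> carrier_vec 3 \<Longrightarrow> reflect n v \<in> carrier_vec 3"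
  by (simp add: reflect_def)

lemma lorentz_reflect:
  "v \<in> carrier_vec 3 \<Longrightarrow> n \<in> carrier_vec 3 \<Longrightarrow> lorentz (reflect n v) y = lorentz v y - 2 * lorentz v n / lorentz n n * lorentz n y"
  by (simp add: reflect_def lorentz_minus_smult)

lemma reflect_hyp_plane:
  assumes v: "v \<in> hyp_plane" and n: "n \<in> carrier_vec 3" "0 < lorentz n n"
  shows "reflect n v \<in> hyp_plane"
proof -
  note vD = hyp_planeD[OF v]
  have v_image: "lorentz v (reflect n v) = - 1 - 2 * (lorentz v n)\<^sup>2 / lorentz n n"
    unfolding lorentz_commute[of v "reflect n v"] using vD n by (simp add: lorentz_reflect lorentz_commute[of n v] power2_eq_square)
  have "lorentz n (reflect n v) = - lorentz v n"
    unfolding lorentz_commute[of n "reflect n v"] using vD n by (simp add: lorentz_reflect)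
  then have self: "lorentz (reflect n v) (reflect n v) = - 1"
    using vD n by (simp add: lorentz_reflect v_image power2_eq_square)
  have "0 \<le> 2 * (lorentz v n)\<^sup>2 / lorentz n n" using n(2) by simp
  then have "lorentz v (reflect n v) < 0" unfolding v_image by linarith
  then show ?thesis using lorentz_neg_iff[OF v, of "reflect n v"] self vD n by (simp add: hyp_plane_def)
qed

text \<open>Cramer's expansion of \<open>n\<close> in terms of \<open>x\<close>, \<open>y\<close>,
  \<open>z\<close>, paired with \<open>n\<close>. It is used to see that a reflection reverses the
  sign of every determinant.\<close>

lemma cramer:
  "det3 x y z * lorentz n n = lorentz x n * det3 n y z + lorentz y n * det3 x n z + lorentz z n * det3 x y n"
  unfolding det3_eq lorentz_def by (simp add: power2_eq_square algebra_simps)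

lemma det3_reflect:
  assumes "x \<in> carrier_vec 3" "y \<in> carrier_vec 3" "z \<in> carrier_vec 3" "n \<in> carrier_vec 3" "0 < lorentz n n"
  shows "det3 (reflect n x) (reflect n y) (reflect n z) = - det3 x y z"
proof -
  have m: "det3 (x - a \<cdot>\<^sub>v n) (y - b \<cdot>\<^sub>v n) (z - c \<cdot>\<^sub>v n) = det3 x y z - (a * det3 n y z + b * det3 x n z + c * det3 x y n)" for a b c
    using assms by (simp add: det3_eq algebra_simps)
  show ?thesis
    unfolding reflect_def m using cramer[of x y z n] assms(5) by (simp add: field_simps)
qed


section \<open>Reflections as elements of the group of bijections\<close>

lemma compose_BijGroup:
  assumes "f \<in> carrier (BijGroup S)" "g \<in> carrier (BijGroup S)" "v \<in> S"
  shows "(f \<otimes>\<^bsub>BijGroup S\<^esub> g) v = f (g v)"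
  using assms by (simp add: BijGroup_def compose_def)

lemma BijGroup_maps: "f \<in> carrier (BijGroup S) \<Longrightarrow> v \<in> S \<Longrightarrow> f v \<in> S"
  by (auto simp: BijGroup_def Bij_def bij_betw_def)

lemma BijGroup_eqI:
  assumes "f \<in> carrier (BijGroup S)" "g \<in> carrier (BijGroup S)" "\<And>v. v \<in> S \<Longrightarrow> f v = g v"
  shows "f = g"
  using assms by (auto simp: BijGroup_def Bij_def intro: extensionalityI)

lemma one_BijGroup: "v \<in> S \<Longrightarrow> \<one>\<^bsub>BijGroup S\<^esub> v = v"
  by (simp add: BijGroup_def)

text \<open>Inverses of involutions add nothing new, so stability under left multiplication by the
  generators passes to the whole group and may be applied to the identity.\<close>

lemma generate_involutions_subset:
  assumes "group G" and stable: "\<And>s z. s \<in> S \<Longrightarrow> z \<in> Z \<Longrightarrow> s \<otimes>\<^bsub>G\<^esub> z \<in> Z"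
    and S: "S \<subseteq> carrier G" "\<And>s. s \<in> S \<Longrightarrow> s \<otimes>\<^bsub>G\<^esub> s = \<one>\<^bsub>G\<^esub>" and Z: "Z \<subseteq> carrier G" "\<one>\<^bsub>G\<^esub> \<in> Z"
  shows "generate G S \<subseteq> Z"
proof
  interpret group G by fact
  fix g assume g: "g \<in> generate G S"
  then have "\<forall>z\<in>Z. g \<otimes>\<^bsub>G\<^esub> z \<in> Z"
  proof (induction rule: generate.induct)
    case (inv h)
    then have "inv\<^bsub>G\<^esub> h = h" using S by (intro inv_equality) auto
    then show ?case using inv stable by simp
  next
    case (eng a b)
    have "a \<in> carrier G" "b \<in> carrier G" using eng(1,2) generate_in_carrier[OF S(1)] by auto
    then show ?case using eng Z(1) by (auto simp: m_assoc subset_iff)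
  qed (use stable Z(1) in auto)
  then have "g \<otimes>\<^bsub>G\<^esub> \<one>\<^bsub>G\<^esub> \<in> Z" using Z(2) by blast
  then show "g \<in> Z" using generate_in_carrier[OF S(1) g] by simp
qed

lemma reflect_reflect:
  assumes "v \<in> carrier_vec 3" "n \<in> carrier_vec 3" "0 < lorentz n n"
  shows "reflect n (reflect n v) = v"
proof -
  have "lorentz (reflect n v) n = - lorentz v n" using assms by (simp add: lorentz_reflect)
  then show ?thesis using assms(1,2) by (simp add: reflect_def) (rule eq_vecI, auto)
qed

lemma hyp_reflection_BijGroup:
  assumes "0 < lorentz (line_normal p q) (line_normal p q)"
  shows "hyp_reflection p q \<in> carrier (BijGroup hyp_plane)"
proof -
  let ?f = "reflect (line_normal p q)"
  have "bij_betw ?f hyp_plane hyp_plane"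
    by (rule bij_betw_byWitness[where f' = ?f])
      (use assms hyp_planeD(1) in \<open>auto simp: reflect_reflect reflect_hyp_plane\<close>)
  then show ?thesis
    by (simp add: BijGroup_def Bij_def hyp_reflection_eq bij_betw_cong[of hyp_plane "restrict ?f hyp_plane" ?f])
qed

lemma hyp_reflection_involution:
  assumes "0 < lorentz (line_normal p q) (line_normal p q)"
  shows "hyp_reflection p q \<otimes>\<^bsub>BijGroup hyp_plane\<^esub> hyp_reflection p q = \<one>\<^bsub>BijGroup hyp_plane\<^esub>"
proof (rule BijGroup_eqI)
  interpret group "BijGroup hyp_plane" by (rule group_BijGroup)
  note c = hyp_reflection_BijGroup[OF assms]
  show "hyp_reflection p q \<otimes>\<^bsub>BijGroup hyp_plane\<^esub> hyp_reflection p q \<in> carrier (BijGroup hyp_plane)"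
    "\<one>\<^bsub>BijGroup hyp_plane\<^esub> \<in> carrier (BijGroup hyp_plane)"
    using c by simp_all
  show "(hyp_reflection p q \<otimes>\<^bsub>BijGroup hyp_plane\<^esub> hyp_reflection p q) v = \<one>\<^bsub>BijGroup hyp_plane\<^esub> v" if "v \<in> hyp_plane" for v
    using that hyp_planeD(1)[OF that] reflect_hyp_plane[OF that line_normal_carrier assms] assms
    unfolding compose_BijGroup[OF c c that] by (simp add: one_BijGroup hyp_reflection_eq reflect_reflect)
qed

lemma eq_abs_of_cos_45:
  fixes s d :: real
  assumes "sqrt 2 / 2 = s / sqrt (s\<^sup>2 + d\<^sup>2)" "d \<noteq> 0"
  shows "s = \<bar>d\<bar>"
proof -
  have pos: "0 < sqrt (s\<^sup>2 + d\<^sup>2)" using assms(2) by (simp add: add_nonneg_pos)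
  then have e: "s = sqrt 2 / 2 * sqrt (s\<^sup>2 + d\<^sup>2)" using assms(1) by (simp add: field_simps)
  have "0 \<le> s" by (subst e) simp
  have "s\<^sup>2 = (sqrt 2 / 2 * sqrt (s\<^sup>2 + d\<^sup>2))\<^sup>2" using e by (rule arg_cong)
  also have "\<dots> = (s\<^sup>2 + d\<^sup>2) / 2" by (simp add: power_mult_distrib power_divide)
  finally have "s\<^sup>2 = d\<^sup>2" by simp
  then have "\<bar>s\<bar> = \<bar>d\<bar>" by (simp add: power2_eq_iff abs_eq_iff)
  with \<open>0 \<le> s\<close> show ?thesis by simp
qed

text \<open>
  The reflections in coordinates with respect to normal vectors \<open>n\<^sub>1, n\<^sub>2, n\<^sub>3\<close> of the sides that are
  scaled so that their Gram matrix is a multiple of the one with rows \<open>(1, - 1, 0)\<close>, \<open>(- 1, 2, - 2)\<close>,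
  \<open>(0, - 2, 2)\<close>.
\<close>

fun flip1 :: "triple \<Rightarrow> triple" where "flip1 (a, b, c) = (- a, b + 2 * a, c)"
fun flip2 :: "triple \<Rightarrow> triple" where "flip2 (a, b, c) = (a + b, - b, c + 2 * b)"
fun flip3 :: "triple \<Rightarrow> triple" where "flip3 (a, b, c) = (a, b + 2 * c, - c)"

section \<open>The triangle with angles \<open>pi/2\<close>, \<open>pi/4\<close>, 0 and its rotation
  group\<close>

context
  fixes A B C :: "real Matrix.vec"
  assumes tri: "hyp_triangle_with_angles A B C (pi / 2) (pi / 4) 0"
begin

text \<open>Three equations determine the products \<open>p\<close>, \<open>q\<close>,
  \<open>r\<close> of the vertices: the right angle gives \<open>r = - p q\<close>, the angle
  \<open>pi/4\<close> gives \<open>q + p r = m\<close>, and the Gram determinant gives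
  \<open>m^2\<close>. They force \<open>p^2 = 2\<close> and leave free only \<open>m\<close>, the
  scale of the ideal vertex.\<close>

lemma vertex_products:
  "A \<in> hyp_plane" "B \<in> hyp_plane" "C \<in> ideal_points" "det3 A B C \<noteq> 0"
  "lorentz A B = - sqrt 2" "lorentz A C = - \<bar>det3 A B C\<bar>" "lorentz B C = - (sqrt 2 * \<bar>det3 A B C\<bar>)"
proof -
  have T: "A \<in> hyp_plane \<union> ideal_points" "B \<in> hyp_plane \<union> ideal_points" "C \<in> hyp_plane \<union> ideal_points"
    and D: "det3 A B C \<noteq> 0"
    and angles: "hyp_angle A B C = pi / 2" "hyp_angle B C A = pi / 4" "hyp_angle C A B = 0"
    using tri by (auto simp: hyp_triangle_with_angles_def hyp_triangle_def)
  have c: "A \<in> carrier_vec 3" "B \<in> carrier_vec 3" "C \<in> carrier_vec 3"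
    using T by (auto simp: hyp_plane_def ideal_points_def)
  have rot: "det3 B C A = det3 A B C" "det3 C A B = det3 A B C" by (simp_all add: det3_eq algebra_simps)
  show A: "A \<in> hyp_plane" using T(1) angles(1) by (auto simp: hyp_angle_def)
  show B: "B \<in> hyp_plane" using T(2) angles(2) by (auto simp: hyp_angle_def)
  \<comment> \<open>Vertices inside the plane have nonzero angles, so the angle 0 makes
    \<open>C\<close> ideal; conversely the nonzero angles placed \<open>A\<close> and
    \<open>B\<close> inside the plane.\<close>
  have "C \<notin> hyp_plane" using cos_hyp_angle(2)[of C A B] c D angles(3) rot by auto
  then show C: "C \<in> ideal_points" using T(3) by simp
  then have CC: "lorentz C C = 0" and C2: "0 < vec_index C 2" by (auto simp: ideal_points_def)
  note AA = hyp_planeD(2)[OF A] and BB = hyp_planeD(2)[OF B]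
  show D: "det3 A B C \<noteq> 0" by (rule D)
  define m where "m = \<bar>det3 A B C\<bar>"
  define p q r where "p = lorentz A B" and "q = lorentz A C" and "r = lorentz B C"
  have m: "0 < m" using D by (simp add: m_def)
  have sym: "lorentz B A = p" "lorentz C A = q" "lorentz C B = r"
    by (simp_all add: p_def q_def r_def lorentz_commute)
  have "r + p * q = 0"
  proof -
    have pos: "0 < (lorentz B C + lorentz B A * lorentz C A)\<^sup>2 + (det3 A B C)\<^sup>2"
      using D by (intro add_nonneg_pos) simp_all
    have "(lorentz B C + lorentz B A * lorentz C A) / sqrt ((lorentz B C + lorentz B A * lorentz C A)\<^sup>2 + (det3 A B C)\<^sup>2) = 0"
      using cos_hyp_angle(1)[OF A c(2,3) D] unfolding angles by simp
    then show ?thesis using pos by (auto simp: sym r_def[symmetric])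
  qed
  then have r: "r = - (p * q)" by simp
  have m2: "m\<^sup>2 = - (r\<^sup>2 + 2 * p * q * r + q\<^sup>2)"
    unfolding m_def power2_abs lorentz_gram[of A B C] AA BB CC p_def[symmetric] q_def[symmetric] r_def[symmetric]
    by (simp add: power2_eq_square algebra_simps)
  have DB: "det3 B C A \<noteq> 0" using D rot by simp
  have "lorentz C A + lorentz C B * lorentz A B = \<bar>det3 A B C\<bar>"
    using cos_hyp_angle(1)[OF B c(3,1) DB, unfolded rot angles cos_45] D by (intro eq_abs_of_cos_45)
  then have qm: "q + p * r = m" by (simp add: sym p_def m_def mult.commute)
  have q1: "q * (1 - p\<^sup>2) = m" using qm by (simp add: r power2_eq_square algebra_simps)
  have "m\<^sup>2 = q\<^sup>2 * (p\<^sup>2 - 1)" unfolding m2 r by (simp add: power2_eq_square algebra_simps)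
  then have "q\<^sup>2 * (p\<^sup>2 - 1) = q\<^sup>2 * ((1 - p\<^sup>2) * (1 - p\<^sup>2))"
    unfolding q1[symmetric] by (simp add: power2_eq_square algebra_simps)
  moreover have "q \<noteq> 0" using q1 m by auto
  ultimately have "p\<^sup>2 - 1 = (1 - p\<^sup>2) * (1 - p\<^sup>2)" by simp
  then have "(1 - p\<^sup>2) * (2 - p\<^sup>2) = 0" by (simp add: algebra_simps)
  moreover have "1 - p\<^sup>2 \<noteq> 0" using q1 m by auto
  ultimately have p2: "p\<^sup>2 = 2" by simp
  have "p < 0" using lorentz_neg_iff[OF A, of B] hyp_planeD[OF B] by (simp add: p_def)
  then have "p = - sqrt 2" using real_sqrt_abs[of p] unfolding p2 by linarith
  then show p: "lorentz A B = - sqrt 2" by (simp add: p_def)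
  have qm': "q = - m" using q1 by (simp add: p2)
  then show "lorentz A C = - \<bar>det3 A B C\<bar>" by (simp add: q_def m_def)
  show "lorentz B C = - (sqrt 2 * \<bar>det3 A B C\<bar>)"
    using r by (simp add: qm' p_def p r_def m_def)
qed

lemma vertex_carriers: "A \<in> carrier_vec 3" "B \<in> carrier_vec 3" "C \<in> carrier_vec 3" "0 < vec_index C 2"
    "lorentz A A = - 1" "lorentz B B = - 1" "lorentz C C = 0"
  using vertex_products(1-3) by (auto simp: hyp_plane_def ideal_points_def)

lemma normal_products:
  defines "m \<equiv> \<bar>det3 A B C\<bar>"
  shows "lorentz (line_normal A B) (line_normal A B) = 1" "lorentz (line_normal B C) (line_normal B C) = 2 * m\<^sup>2"
    "lorentz (line_normal C A) (line_normal C A) = m\<^sup>2"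
    "lorentz (line_normal A B) (line_normal B C) = - m" "lorentz (line_normal B C) (line_normal A B) = - m"
    "lorentz (line_normal B C) (line_normal C A) = - (sqrt 2 * m\<^sup>2)" "lorentz (line_normal C A) (line_normal B C) = - (sqrt 2 * m\<^sup>2)"
    "lorentz (line_normal A B) (line_normal C A) = 0" "lorentz (line_normal C A) (line_normal A B) = 0"
  unfolding lorentz_line_normals lorentz_commute[of B A] lorentz_commute[of C A] lorentz_commute[of C B]
  by (simp_all add: vertex_products vertex_carriers m_def[symmetric] power2_eq_square)

text \<open>Division by the signed determinant makes the coordinates of interior points positive for
  either orientation of the triangle; \<open>|D|\<close> and \<open>sqrt 2\<close> are the scalings
  that make the reflections integral.\<close>

definition line_coordinates :: "real Matrix.vec \<Rightarrow> triple" where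
  "line_coordinates v = (let D = det3 A B C in
    (lorentz v (line_normal A B) / D, lorentz v (line_normal B C) / (D * \<bar>D\<bar>), sqrt 2 * lorentz v (line_normal C A) / (D * \<bar>D\<bar>)))"

lemma line_coordinates_reflect:
  assumes "v \<in> carrier_vec 3"
  shows "line_coordinates (reflect (line_normal A B) v) = flip1 (line_coordinates v)"
    "line_coordinates (reflect (line_normal B C) v) = flip2 (line_coordinates v)"
    "line_coordinates (reflect (line_normal C A) v) = flip3 (line_coordinates v)"
proof -
  define D m where "D = det3 A B C" and "m = \<bar>D\<bar>"
  have "D \<noteq> 0" "m \<noteq> 0" using vertex_products(4) by (simp_all add: D_def m_def)
  then show "line_coordinates (reflect (line_normal A B) v) = flip1 (line_coordinates v)"
    "line_coordinates (reflect (line_normal B C) v) = flip2 (line_coordinates v)"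
    "line_coordinates (reflect (line_normal C A) v) = flip3 (line_coordinates v)"
    using assms unfolding line_coordinates_def Let_def lorentz_reflect[OF assms line_normal_carrier] normal_products
      D_def[symmetric] m_def[symmetric]
    by (simp_all add: field_simps power2_eq_square)
qed

lemma line_coordinates_inj:
  assumes "v \<in> carrier_vec 3" "w \<in> carrier_vec 3" "line_coordinates v = line_coordinates w"
  shows "v = w"
proof -
  have eq: "det3 v A B = det3 w A B" "det3 v B C = det3 w B C" "det3 v C A = det3 w C A"
    using assms(3) vertex_products(4) by (simp_all add: line_coordinates_def Let_def lorentz_line_normal)
  have expand: "det3 A B C * vec_index u i = det3 u B C * vec_index A i + det3 u C A * vec_index B i + det3 u A B * vec_index C i"
    if "i < 3" for u i
    using that unfolding det3_eq by (auto simp: eval_nat_numeral less_Suc_eq algebra_simps)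
  have "vec_index v i = vec_index w i" if "i < 3" for i
    by (rule mult_left_cancel[THEN iffD1, OF vertex_products(4)]) (simp only: expand[OF that] eq)
  then show ?thesis using assms(1,2) by (intro eq_vecI) auto
qed

text \<open>The sum of the vertices, rescaled to the hyperboloid. The sum is timelike because the
  mutual products of the vertices are negative, and it has equal determinants with the three
  sides.\<close>

lemma interior_point:
  obtains P r where "P \<in> hyp_plane" "det3 A B P \<noteq> 0" "0 < r"
    "line_coordinates P = (r * \<bar>det3 A B C\<bar>, r, sqrt 2 * r)"
proof -
  define m where "m = \<bar>det3 A B C\<bar>"
  have m: "0 < m" using vertex_products(4) by (simp add: m_def)
  define S where "S = A + B + C"
  note cA = vertex_carriers
  have S: "S \<in> carrier_vec 3" using cA by (simp add: S_def)
  have SS: "lorentz S S = - (2 + 2 * (sqrt 2 + m + sqrt 2 * m))"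
  proof -
    have "lorentz S S = lorentz A A + lorentz B B + lorentz C C + 2 * (lorentz A B + lorentz A C + lorentz B C)"
      using cA(1-3) by (simp add: S_def lorentz_def algebra_simps)
    then show ?thesis by (simp add: cA vertex_products m_def)
  qed
  define t where "t = 1 / sqrt (- lorentz S S)"
  have "0 < 2 + 2 * (sqrt 2 + m + sqrt 2 * m)" using m by (simp add: add_pos_pos)
  then have SS_neg: "0 < - lorentz S S" by (simp add: SS)
  then have t: "0 < t" "t\<^sup>2 * lorentz S S = - 1" by (simp_all add: t_def power_divide real_sqrt_pow2)
  define P where "P = t \<cdot>\<^sub>v S"
  have index: "vec_index P i = t * (vec_index A i + vec_index B i + vec_index C i)" if "i < 3" for i
    using cA(1-3) that by (simp add: P_def S_def)
  have P: "P \<in> hyp_plane"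
  proof -
    have "lorentz P P = t\<^sup>2 * lorentz S S" using S by (simp add: P_def lorentz_def power2_eq_square algebra_simps)
    moreover have "0 < vec_index P 2"
      using index[of 2] t hyp_planeD(3)[OF vertex_products(1)] hyp_planeD(3)[OF vertex_products(2)] cA(4) by simp
    ultimately show ?thesis using t S by (simp add: hyp_plane_def P_def)
  qed
  have dets: "det3 P A B = t * det3 A B C" "det3 P B C = t * det3 A B C" "det3 P C A = t * det3 A B C" "det3 A B P = t * det3 A B C"
    unfolding det3_eq by (simp_all add: index[unfolded One_nat_def] index algebra_simps)
  show ?thesis
  proof (rule that[of P "t / m"])
    show "det3 A B P \<noteq> 0" using dets t vertex_products(4) by simp
    show "line_coordinates P = (t / m * \<bar>det3 A B C\<bar>, t / m, sqrt 2 * (t / m))"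
      using m vertex_products(4) by (simp add: line_coordinates_def Let_def lorentz_line_normal dets m_def)
  qed (use P t m in simp_all)
qed

text \<open>A product of reflections in two sides is a rotation about their common vertex:
  \<open>x\<close> is the half-turn about \<open>A\<close>, and \<open>y\<close> is a rotation of
  order 4 about \<open>B\<close>.\<close>

theorem power_relators_group_iso_oriented_triangle_group:
  "power_relators_group 2 4 \<cong> oriented_triangle_group A B C"
proof -
  let ?B = "BijGroup hyp_plane"
  let ?O = "oriented_triangle_group A B C"
  interpret B: group ?B by (rule group_BijGroup)
  define s1 s2 s3 where "s1 = hyp_reflection A B" and "s2 = hyp_reflection B C" and "s3 = hyp_reflection C A"
  have D: "det3 A B C \<noteq> 0" by (rule vertex_products)
  have pos: "0 < lorentz (line_normal A B) (line_normal A B)" "0 < lorentz (line_normal B C) (line_normal B C)"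
    "0 < lorentz (line_normal C A) (line_normal C A)"
    using D by (simp_all add: normal_products)
  have s: "s1 \<in> carrier ?B" "s2 \<in> carrier ?B" "s3 \<in> carrier ?B"
    unfolding s1_def s2_def s3_def by (rule hyp_reflection_BijGroup[OF pos(1)] hyp_reflection_BijGroup[OF pos(2)] hyp_reflection_BijGroup[OF pos(3)])+
  have s_eq: "s1 v = reflect (line_normal A B) v" "s2 v = reflect (line_normal B C) v" "s3 v = reflect (line_normal C A) v"
    if "v \<in> hyp_plane" for v
    using that by (simp_all add: s1_def s2_def s3_def hyp_reflection_eq)
  have coord_s: "line_coordinates (s1 v) = flip1 (line_coordinates v)" "line_coordinates (s2 v) = flip2 (line_coordinates v)"
    "line_coordinates (s3 v) = flip3 (line_coordinates v)" if "v \<in> hyp_plane" for v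
    using that hyp_planeD(1)[OF that] by (simp_all add: s_eq line_coordinates_reflect)
  note comp = compose_BijGroup BijGroup_maps s B.m_closed
  have eqI: "f = g" if "f \<in> carrier ?B" "g \<in> carrier ?B" "\<And>v. v \<in> hyp_plane \<Longrightarrow> line_coordinates (f v) = line_coordinates (g v)" for f g
  proof (rule BijGroup_eqI[OF that(1,2)])
    fix v assume v: "v \<in> hyp_plane"
    show "f v = g v"
      by (rule line_coordinates_inj) (use v that(3)[OF v] BijGroup_maps[OF that(1) v] BijGroup_maps[OF that(2) v] hyp_planeD(1) in auto)
  qed
  have invol: "s1 \<otimes>\<^bsub>?B\<^esub> s1 = \<one>\<^bsub>?B\<^esub>" "s2 \<otimes>\<^bsub>?B\<^esub> s2 = \<one>\<^bsub>?B\<^esub>" "s3 \<otimes>\<^bsub>?B\<^esub> s3 = \<one>\<^bsub>?B\<^esub>"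
    unfolding s1_def s2_def s3_def using pos by (simp_all only: hyp_reflection_involution)
  define x y where "x = s1 \<otimes>\<^bsub>?B\<^esub> s3" and "y = s2 \<otimes>\<^bsub>?B\<^esub> s1"
  have xy: "x \<in> carrier ?B" "y \<in> carrier ?B" by (simp_all add: x_def y_def s)
  have coord_x: "line_coordinates (x v) = flip1 (flip3 (line_coordinates v))"
    and coord_y: "line_coordinates (y v) = flip2 (flip1 (line_coordinates v))" if "v \<in> hyp_plane" for v
    using that by (simp_all add: x_def y_def comp coord_s)
  have x2: "x \<otimes>\<^bsub>?B\<^esub> x = \<one>\<^bsub>?B\<^esub>"
  proof (rule eqI)
    fix v assume "v \<in> hyp_plane"
    then show "line_coordinates ((x \<otimes>\<^bsub>?B\<^esub> x) v) = line_coordinates (\<one>\<^bsub>?B\<^esub> v)"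
      by (cases "line_coordinates v") (simp add: comp xy coord_x one_BijGroup)
  qed (use xy in simp_all)
  have y4: "(y \<otimes>\<^bsub>?B\<^esub> y) \<otimes>\<^bsub>?B\<^esub> (y \<otimes>\<^bsub>?B\<^esub> y) = \<one>\<^bsub>?B\<^esub>"
  proof (rule eqI)
    fix v assume "v \<in> hyp_plane"
    then show "line_coordinates (((y \<otimes>\<^bsub>?B\<^esub> y) \<otimes>\<^bsub>?B\<^esub> (y \<otimes>\<^bsub>?B\<^esub> y)) v) = line_coordinates (\<one>\<^bsub>?B\<^esub> v)"
      by (cases "line_coordinates v") (simp add: comp xy coord_y one_BijGroup)
  qed (use xy in simp_all)
  define E where "E = generate ?B {x, y}"
  define K where "K = generate ?B {s1, s2, s3}"
  have subE: "subgroup E ?B" unfolding E_def using xy by (intro B.generate_is_subgroup) auto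
  have subK: "subgroup K ?B" unfolding K_def using s by (intro B.generate_is_subgroup) auto
  have xyE: "x \<in> E" "y \<in> E" by (auto simp: E_def intro: generate.incl)
  have invE: "inv\<^bsub>?B\<^esub> y \<in> E" using subE xyE by (simp add: subgroup.m_inv_closed)
  have cancel: "a \<otimes>\<^bsub>?B\<^esub> (a \<otimes>\<^bsub>?B\<^esub> b) = b" if "a \<otimes>\<^bsub>?B\<^esub> a = \<one>\<^bsub>?B\<^esub>" "a \<in> carrier ?B" "b \<in> carrier ?B" for a b
    using that by (simp add: B.m_assoc[symmetric])
  have inv_y: "inv\<^bsub>?B\<^esub> y = s1 \<otimes>\<^bsub>?B\<^esub> s2"
    using s invol by (intro B.inv_equality) (simp_all add: y_def B.m_assoc cancel)
  have E_car: "e \<in> carrier ?B" if "e \<in> E" for e using subE that by (rule subgroup.mem_carrier)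
  have E_mult: "f \<otimes>\<^bsub>?B\<^esub> g \<in> E" if "f \<in> E" "g \<in> E" for f g using subE that by (rule subgroup.m_closed)
  \<comment> \<open>The rotations and their coset under \<open>s1\<close>; left multiplication by
    any of the three reflections exchanges the two.\<close>
  define Z where "Z = E \<union> (\<lambda>e. s1 \<otimes>\<^bsub>?B\<^esub> e) ` E"
  have K_Z: "K \<subseteq> Z"
    unfolding K_def
  proof (rule generate_involutions_subset[OF B.is_group])
    fix t z assume t: "t \<in> {s1, s2, s3}" and "z \<in> Z"
    then obtain e where e: "e \<in> E" and z: "z = e \<or> z = s1 \<otimes>\<^bsub>?B\<^esub> e" by (auto simp: Z_def)
    have ec: "e \<in> carrier ?B" using e by (rule E_car)
    have "s2 \<otimes>\<^bsub>?B\<^esub> e = s1 \<otimes>\<^bsub>?B\<^esub> (inv\<^bsub>?B\<^esub> y \<otimes>\<^bsub>?B\<^esub> e)" "s3 \<otimes>\<^bsub>?B\<^esub> e = s1 \<otimes>\<^bsub>?B\<^esub> (x \<otimes>\<^bsub>?B\<^esub> e)"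
      unfolding inv_y x_def using s ec by (simp_all add: B.m_assoc cancel invol)
    moreover have "s2 \<otimes>\<^bsub>?B\<^esub> (s1 \<otimes>\<^bsub>?B\<^esub> e) = y \<otimes>\<^bsub>?B\<^esub> e"
      unfolding y_def using s ec by (simp add: B.m_assoc)
    moreover have "s3 \<otimes>\<^bsub>?B\<^esub> (s1 \<otimes>\<^bsub>?B\<^esub> e) = x \<otimes>\<^bsub>?B\<^esub> e"
    proof -
      have "x = inv\<^bsub>?B\<^esub> x" using x2 xy by (simp add: B.inv_equality)
      also have "\<dots> = s3 \<otimes>\<^bsub>?B\<^esub> s1"
        using s invol by (intro B.inv_equality) (simp_all add: x_def B.m_assoc cancel)
      finally show ?thesis using s ec by (simp add: B.m_assoc)
    qed
    moreover have "s1 \<otimes>\<^bsub>?B\<^esub> (s1 \<otimes>\<^bsub>?B\<^esub> e) = e" using s ec invol by (simp add: cancel)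
    ultimately show "t \<otimes>\<^bsub>?B\<^esub> z \<in> Z"
      using t z e E_mult[OF xyE(1) e] E_mult[OF xyE(2) e] E_mult[OF invE e] by (auto simp: Z_def)
  next
    show "Z \<subseteq> carrier ?B" using E_car s by (auto simp: Z_def)
    show "\<one>\<^bsub>?B\<^esub> \<in> Z" using subE by (simp add: Z_def subgroup.one_closed)
  qed (use s invol in auto)
  have E_K: "E \<subseteq> K"
    unfolding E_def using subK
  proof (rule B.generate_subgroup_incl[rotated])
    show "{x, y} \<subseteq> K" unfolding x_def y_def K_def by (auto intro!: generate.eng intro: generate.incl)
  qed
  \<comment> \<open>A reflection has factor \<open>- 1\<close> and so records the parity of a word:
    elements of \<open>E\<close> have factor 1, and those of the other coset are seen to reverse the
    orientation of \<open>A\<close>, \<open>B\<close>, \<open>P\<close>.\<close>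
  define det_factor where "det_factor = (\<lambda>f c. \<forall>u\<in>hyp_plane. \<forall>v\<in>hyp_plane. \<forall>w\<in>hyp_plane. det3 (f u) (f v) (f w) = c * det3 u v w)"
  have factor_mult: "det_factor (f \<otimes>\<^bsub>?B\<^esub> g) (c * d)" if "det_factor f c" "det_factor g d" "f \<in> carrier ?B" "g \<in> carrier ?B" for f g c d
    using that unfolding det_factor_def by (simp add: comp)
  have factor_s: "det_factor s1 (- 1)" "det_factor s2 (- 1)" "det_factor s3 (- 1)"
    unfolding det_factor_def using hyp_planeD(1) pos by (simp_all add: s_eq det3_reflect)
  have factor_E: "det_factor e 1" if "e \<in> E" for e
    using that unfolding E_def
  proof (induction rule: generate.induct)
    case one
    then show ?case by (simp add: det_factor_def one_BijGroup)
  next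
    case (incl h)
    then show ?case using factor_mult[OF factor_s(1,3)] factor_mult[OF factor_s(2,1)] s by (auto simp: x_def y_def)
  next
    case (inv h)
    have "inv\<^bsub>?B\<^esub> x = x" using x2 xy by (simp add: B.inv_equality)
    then show ?case
      using inv factor_mult[OF factor_s(1,3)] factor_mult[OF factor_s(1,2)] s by (auto simp: inv_y) (simp add: x_def)
  next
    case (eng a b)
    then show ?case using factor_mult[of a 1 b 1] E_car by (simp add: E_def)
  qed
  obtain P r where P: "P \<in> hyp_plane" "det3 A B P \<noteq> 0" and r: "0 < r" and coord_P: "line_coordinates P = (r * \<bar>det3 A B C\<bar>, r, sqrt 2 * r)"
    by (rule interior_point)
  note AB = vertex_products(1,2)
  have "{f \<in> K. orientation_preserving f} = E"
  proof (intro equalityI subsetI)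
    fix f assume "f \<in> E"
    then show "f \<in> {f \<in> K. orientation_preserving f}"
      using factor_E[of f] E_K by (auto simp: det_factor_def orientation_preserving_def)
  next
    fix f assume f: "f \<in> {f \<in> K. orientation_preserving f}"
    show "f \<in> E"
    proof (rule ccontr)
      assume "f \<notin> E"
      then obtain e where e: "e \<in> E" "f = s1 \<otimes>\<^bsub>?B\<^esub> e" using f K_Z by (auto simp: Z_def)
      then have "det_factor f (- 1 * 1)" using factor_mult[OF factor_s(1) factor_E[OF e(1)] s(1) E_car[OF e(1)]] by simp
      then have "det3 (f A) (f B) (f P) = - det3 A B P" using AB P(1) by (simp add: det_factor_def)
      moreover have "sgn (det3 (f A) (f B) (f P)) = sgn (det3 A B P)"
        using f AB P(1) by (simp add: orientation_preserving_def)
      ultimately show False using P(2) by (auto simp: sgn_if split: if_splits)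
    qed
  qed
  then have O: "?O = ?B\<lparr>carrier := E\<rparr>"
    by (simp add: oriented_triangle_group_def triangle_group_def K_def s1_def s2_def s3_def)
  have grpO: "group ?O" unfolding O using subE by (rule B.subgroup_imp_group)
  interpret O: group ?O by (rule grpO)
  have opO: "carrier ?O = E" "monoid.mult ?O = monoid.mult ?B" "monoid.one ?O = monoid.one ?B" by (simp_all add: O)
  \<comment> \<open>Up to a scalar \<open>a + b + c\<close> is the Lorentz product with
    \<open>A\<close>, the linear function fixed by the half-turn \<open>x\<close>; the other two
    entries are this function after \<open>y\<^sup>-\<^sup>1\<close> and after
    \<open>y\<close>.\<close>
  define L where "L = (\<lambda>h. case line_coordinates (h P) of (a, b, c) \<Rightarrow> (a + b + c, a + 2 * b + c, 3 * a + 2 * b + c))"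
  show ?thesis
  proof (rule O.power_relators_group_iso_triple[where L = L and x = x and y = y])
    show xyO: "x \<in> carrier ?O" "y \<in> carrier ?O" using xyE by (simp_all add: opO)
    show "x [^]\<^bsub>?O\<^esub> (2::nat) = \<one>\<^bsub>?O\<^esub>"
      unfolding O.small_powers(1)[OF xyO(1)] using x2 by (simp only: opO(2,3))
    show "y [^]\<^bsub>?O\<^esub> (4::nat) = \<one>\<^bsub>?O\<^esub>"
      unfolding O.small_powers(3)[OF xyO(2)] using y4 by (simp only: opO(2,3))
    show "equal_up_to_sign (L (x \<otimes>\<^bsub>?O\<^esub> h)) (x_triple 4 (L h))" if "h \<in> carrier ?O" for h
    proof -
      have "h \<in> carrier ?B" using that E_car by (simp add: opO)
      then have "line_coordinates ((x \<otimes>\<^bsub>?O\<^esub> h) P) = flip1 (flip3 (line_coordinates (h P)))"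
        using xy P(1) by (simp add: opO comp coord_x)
      then show ?thesis by (cases "line_coordinates (h P)") (simp add: L_def equal_up_to_sign_def)
    qed
    show "equal_up_to_sign (L (y \<otimes>\<^bsub>?O\<^esub> h)) (y_triple 4 (L h))" if "h \<in> carrier ?O" for h
    proof -
      have "h \<in> carrier ?B" using that E_car by (simp add: opO)
      then have "line_coordinates ((y \<otimes>\<^bsub>?O\<^esub> h) P) = flip2 (flip1 (line_coordinates (h P)))"
        using xy P(1) by (simp add: opO comp coord_y)
      then show ?thesis by (cases "line_coordinates (h P)") (simp add: L_def equal_up_to_sign_def)
    qed
    \<comment> \<open>In line coordinates \<open>basic 4\<close> amounts to \<open>b > 0\<close>,
      \<open>c > 0\<close> and \<open>2 a + b > 0\<close>, which describes the triangle together
      with its mirror image in the side through \<open>A\<close> and \<open>B\<close>. The point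
      \<open>P\<close> has positive coordinates.\<close>
    have "0 < r * \<bar>det3 A B C\<bar>" "0 < sqrt 2 * r" using r D by simp_all
    then show "basic 4 (L \<one>\<^bsub>?O\<^esub>)" using r P(1) by (simp add: L_def opO one_BijGroup coord_P)
    show "generate ?O {x, y} = carrier ?O"
      unfolding O using B.generate_consistent[OF _ subE, of "{x, y}"] xyE by (simp add: E_def)
  qed simp
qed

end

theorem theorem3:
  shows "(monodromy_group 3 \<cong> power_relators_group 2 3 \<times>\<times> integer_mod_group 2 \<and>
      power_relators_group 2 3 \<times>\<times> integer_mod_group 2 \<cong> PSL2Z \<times>\<times> integer_mod_group 2) \<and>
    (monodromy_group 4 \<cong> power_relators_group 2 4 \<and>
      (\<forall>A B C. hyp_triangle_with_angles A B C (pi / 2) (pi / 4) 0 \<longrightarrow>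
        power_relators_group 2 4 \<cong> oriented_triangle_group A B C))"
  using monodromy_group_3 power_relators_group_times_C2_iso_PSL2Z monodromy_group_4
    power_relators_group_iso_oriented_triangle_group by simp

end
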